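(* Let $\mathcal P$ be the set of minimal non-separable patterns, i.e. the set (up to isomorphism) of pairs $(u,\Psi)$, with $\Psi$ a finite root system and $u\in W(\Psi)$, such that $(u,\Psi)$ is not separable but every pattern contained in $(u,\Psi)$ via a proper subsystem of $\Psi$ is separable. Then $\mathcal P$ consists exactly of: (i) the two elements of $W(A_3)=S_4$ given by the permutations $3142$ and $2413$; (ii) the two elements of length two in the Weyl group of type $B_2$, namely those with inversion sets $\{\alpha_1,\alpha_1+\alpha_2\}$ and $\{\alpha_2,\alpha_1+2\alpha_2\}$, where $\alpha_1,\alpha_2$ are the simple roots with positive roots $\alpha_1,\alpha_2,\alpha_1+\alpha_2,\alpha_1+2\alpha_2$; (iii) the six elements of lengths two, three, and four in the Weyl group of type $G_2$. Consequently, an element $w$ of any finite Weyl group $W(\Phi)$ is separable if and only if it avoids all of these patterns. In particular, if $\Phi$ is simply laced, then $w\in W(\Phi)$ is separable if and only if $w$ avoids the type $A_3$ patterns $3142$ and $2413$.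
   Context: Let $\Phi$ be a finite root system in a real vector space $V$ with positive roots $\Phi^+$, simple roots $\Delta$, Weyl group $W(\Phi)$. For $w\in W(\Phi)$, $I_\Phi(w)=\{\alpha\in\Phi^+:w\alpha\in-\Phi^+\}$. A subsystem of $\Phi$ is $\Phi\cap U$ for a linear subspace $U\subseteq V$; it is a root system with positive roots $\Phi^+\cap U$ (and the corresponding simple roots). The element $w|_{\Phi\cap U}\in W(\Phi\cap U)$ is the unique element with inversion set $I_\Phi(w)\cap U$. A pattern is a pair $(u,\Psi)$ where $\Psi$ is a root system with chosen positive roots and $u\in W(\Psi)$. We say $(w,\Phi)$ contains the pattern $(u,\Psi)$ if there is a subspace $U$ and an isomorphism of root systems $\Phi\cap U\to\Psi$ sending $\Phi^+\cap U$ onto $\Psi^+$ and $I_\Phi(w)\cap U$ onto $I_\Psi(u)$; otherwise $w$ avoids $(u,\Psi)$. A root system is simply laced if all its roots have the same length. In type $A_3$ with simple roots $a_1,a_2,a_3$ (i.e. $e_1-e_2,e_2-e_3,e_3-e_4$), $3142$ has inversion set $\{a_1,a_3,a_1+a_2+a_3\}$ and $2413$ has inversion set $\{a_2,a_1+a_2,a_2+a_3\}$. In type $G_2$ with simple roots $\alpha_1$ (long) and $\alpha_2$ (short), the positive roots are $\alpha_1,\alpha_2,\alpha_1+\alpha_2,\alpha_1+2\alpha_2,\alpha_1+3\alpha_2,2\alpha_1+3\alpha_2$. The root poset: $\alpha\le\beta$ iff $\beta-\alpha$ is a nonnegative combination of simple roots. For $\Delta'\subseteq\Delta$, $\Phi'$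 is the subsystem generated by $\Delta'$ with positive roots $\Phi^+\cap\Phi'$, and $w|_{\Phi'}$ is the element of $W(\Phi')$ with inversion set $I_\Phi(w)\cap\Phi'$. Separable (recursive definition): $w\in W(\Phi)$ is separable if (a) $\Phi$ is of type $A_1$; or (b) $\Phi=\bigoplus_i\Phi_i$ is reducible and each $w|_{\Phi_i}$ is separable; or (c) $\Phi$ is irreducible and there is $\alpha_i\in\Delta$ with $w|_{\Phi'}$ separable for $\Phi'$ generated by $\Delta\setminus\{\alpha_i\}$, and either $\{\beta\in\Phi^+:\beta\ge\alpha_i\}\subseteq I_\Phi(w)$ or $\{\beta\in\Phi^+:\beta\ge\alpha_i\}\cap I_\Phi(w)=\emptyset$. *)

theory Defs
  imports "HOL-Analysis.Analysis"
begin

section \<open>Root systems and Weyl groups\<close>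

definition refl_map :: "'a::euclidean_space \<Rightarrow> 'a \<Rightarrow> 'a" where
  "refl_map \<alpha> x = x - (2 * (x \<bullet> \<alpha>) / (\<alpha> \<bullet> \<alpha>)) *\<^sub>R \<alpha>"

definition cartan :: "'a::euclidean_space \<Rightarrow> 'a \<Rightarrow> real" where
  "cartan \<beta> \<alpha> = 2 * (\<beta> \<bullet> \<alpha>) / (\<alpha> \<bullet> \<alpha>)"

text \<open>Root systems are reduced and crystallographic. They need not span the ambient space,
  so that subsystems and systems of smaller rank live in the same type; in particular the
  empty set is the root system of rank 0.\<close>

definition root_system :: "'a::euclidean_space set \<Rightarrow> bool" where
  "root_system \<Phi> \<longleftrightarrow> finite \<Phi> \<and> 0 \<notin> \<Phi>
     \<and> (\<forall>\<alpha>\<in>\<Phi>. refl_map \<alpha> ` \<Phi> = \<Phi>)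
     \<and> (\<forall>\<alpha>\<in>\<Phi>. \<forall>c. c *\<^sub>R \<alpha> \<in> \<Phi> \<longrightarrow> c = 1 \<or> c = -1)
     \<and> (\<forall>\<alpha>\<in>\<Phi>. \<forall>\<beta>\<in>\<Phi>. cartan \<beta> \<alpha> \<in> \<int>)"

definition positive_system :: "'a::euclidean_space set \<Rightarrow> 'a set \<Rightarrow> bool" where
  "positive_system \<Phi> P \<longleftrightarrow> (\<exists>v. (\<forall>\<alpha>\<in>\<Phi>. v \<bullet> \<alpha> \<noteq> 0) \<and> P = {\<alpha>\<in>\<Phi>. 0 < v \<bullet> \<alpha>})"

definition simple_roots :: "'a::euclidean_space set \<Rightarrow> 'a set" where
  "simple_roots P = {\<alpha>\<in>P. \<not> (\<exists>\<beta>\<in>P. \<exists>\<gamma>\<in>P. \<alpha> = \<beta> + \<gamma>)}"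

definition root_le :: "'a::euclidean_space set \<Rightarrow> 'a \<Rightarrow> 'a \<Rightarrow> bool" where
  "root_le P \<alpha> \<beta> \<longleftrightarrow> (\<exists>c. (\<forall>\<delta>\<in>simple_roots P. 0 \<le> c \<delta>)
     \<and> \<beta> - \<alpha> = (\<Sum>\<delta>\<in>simple_roots P. c \<delta> *\<^sub>R \<delta>))"

definition refl_word :: "'a::euclidean_space list \<Rightarrow> 'a \<Rightarrow> 'a" where
  "refl_word \<alpha>s = foldr (\<lambda>\<alpha> f. refl_map \<alpha> \<circ> f) \<alpha>s id"

text \<open>Elements of the Weyl group are maps of the whole ambient space; they fix the orthogonal
  complement of the roots pointwise. Reflections are involutions, so words suffice.\<close>

definition weyl :: "'a::euclidean_space set \<Rightarrow> ('a \<Rightarrow> 'a) set" where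
  "weyl \<Phi> = refl_word ` lists \<Phi>"

definition weyl_length :: "'a::euclidean_space set \<Rightarrow> ('a \<Rightarrow> 'a) \<Rightarrow> nat" where
  "weyl_length P w = (LEAST n. \<exists>\<alpha>s\<in>lists (simple_roots P). length \<alpha>s = n \<and> w = refl_word \<alpha>s)"

definition inversions :: "'a::euclidean_space set \<Rightarrow> ('a \<Rightarrow> 'a) \<Rightarrow> 'a set" where
  "inversions P w = {\<alpha>\<in>P. w \<alpha> \<in> uminus ` P}"

text \<open>The restriction \<open>w|\<^sub>\<Psi>\<close> of \<open>w \<in> W(\<Phi>)\<close> to a subsystem \<open>\<Psi> = \<Phi> \<inter> U\<close>,
  where \<open>P\<close> is the set of positive roots of \<open>\<Phi>\<close>.\<close>

definition weyl_restrict :: "'a::euclidean_space set \<Rightarrow> ('a \<Rightarrow> 'a) \<Rightarrow> 'a set \<Rightarrow> 'a \<Rightarrow> 'a" where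
  "weyl_restrict P w \<Psi> =
     (THE v. v \<in> weyl \<Psi> \<and> inversions (P \<inter> \<Psi>) v = inversions P w \<inter> \<Psi>)"

definition irreducible_roots :: "'a::euclidean_space set \<Rightarrow> bool" where
  "irreducible_roots \<Phi> \<longleftrightarrow> \<Phi> \<noteq> {} \<and>
     \<not> (\<exists>A B. A \<noteq> {} \<and> B \<noteq> {} \<and> A \<inter> B = {} \<and> A \<union> B = \<Phi> \<and> (\<forall>\<alpha>\<in>A. \<forall>\<beta>\<in>B. \<alpha> \<bullet> \<beta> = 0))"

definition irreducible_components :: "'a::euclidean_space set \<Rightarrow> 'a set set" where
  "irreducible_components \<Phi> =
     {C. C \<subseteq> \<Phi> \<and> irreducible_roots C \<and> (\<forall>\<alpha>\<in>C. \<forall>\<beta>\<in>\<Phi> - C. \<alpha> \<bullet> \<beta> = 0)}"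

definition simply_laced :: "'a::euclidean_space set \<Rightarrow> bool" where
  "simply_laced \<Phi> \<longleftrightarrow> (\<forall>\<alpha>\<in>\<Phi>. \<forall>\<beta>\<in>\<Phi>. norm \<alpha> = norm \<beta>)"

section \<open>Patterns and separable elements\<close>

text \<open>A triple \<open>(w, \<Phi>, P)\<close>: an element of \<open>W(\<Phi>)\<close>, the roots, and the positive roots.\<close>

type_synonym 'a pattern = "('a \<Rightarrow> 'a) \<times> 'a set \<times> 'a set"

fun is_pattern :: "'a::euclidean_space pattern \<Rightarrow> bool" where
  "is_pattern (w, \<Phi>, P) \<longleftrightarrow> root_system \<Phi> \<and> positive_system \<Phi> P \<and> w \<in> weyl \<Phi>"

text \<open>Meaningful for triples satisfying \<^const>\<open>is_pattern\<close>. The empty root system is not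
  irreducible and has no components, so rule \<open>reducible\<close> makes its only element separable
  (the empty direct sum).\<close>

inductive separable :: "'a::euclidean_space pattern \<Rightarrow> bool" where
  type_A1: "\<alpha> \<noteq> 0 \<Longrightarrow> separable (w, {\<alpha>, -\<alpha>}, P)"
| reducible: "\<not> irreducible_roots \<Phi> \<Longrightarrow>
    (\<And>C. C \<in> irreducible_components \<Phi> \<Longrightarrow> separable (weyl_restrict P w C, C, P \<inter> C)) \<Longrightarrow>
    separable (w, \<Phi>, P)"
| irreducible: "irreducible_roots \<Phi> \<Longrightarrow> \<alpha> \<in> simple_roots P \<Longrightarrow>
    \<Phi>' = \<Phi> \<inter> span (simple_roots P - {\<alpha>}) \<Longrightarrow>
    separable (weyl_restrict P w \<Phi>', \<Phi>', P \<inter> \<Phi>') \<Longrightarrow>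
    {\<beta>\<in>P. root_le P \<alpha> \<beta>} \<subseteq> inversions P w \<or> {\<beta>\<in>P. root_le P \<alpha> \<beta>} \<inter> inversions P w = {} \<Longrightarrow>
    separable (w, \<Phi>, P)"

text \<open>An isomorphism is a linear isomorphism between the spans preserving Cartan integers; it
  need not be isometric. A linear map on a span always extends to the ambient space.\<close>

definition root_iso ::
    "('a::euclidean_space \<Rightarrow> 'b::euclidean_space) \<Rightarrow> 'a set \<Rightarrow> 'b set \<Rightarrow> bool" where
  "root_iso f \<Phi> \<Psi> \<longleftrightarrow> linear f \<and> inj_on f (span \<Phi>) \<and> f ` \<Phi> = \<Psi>
     \<and> (\<forall>\<alpha>\<in>\<Phi>. \<forall>\<beta>\<in>\<Phi>. cartan (f \<beta>) (f \<alpha>) = cartan \<beta> \<alpha>)"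

fun contains_via ::
    "'a::euclidean_space set \<Rightarrow> 'a pattern \<Rightarrow> 'b::euclidean_space pattern \<Rightarrow> bool" where
  "contains_via U (w, \<Phi>, P) (u, \<Psi>, Q) \<longleftrightarrow>
     (\<exists>f. root_iso f (\<Phi> \<inter> U) \<Psi> \<and> f ` (P \<inter> U) = Q \<and> f ` (inversions P w \<inter> U) = inversions Q u)"

definition contains :: "'a::euclidean_space pattern \<Rightarrow> 'b::euclidean_space pattern \<Rightarrow> bool" where
  "contains p q \<longleftrightarrow> (\<exists>U. subspace U \<and> contains_via U p q)"

definition avoids :: "'a::euclidean_space pattern \<Rightarrow> 'b::euclidean_space pattern \<Rightarrow> bool" where
  "avoids p q \<longleftrightarrow> \<not> contains p q"

definition pattern_iso :: "'a::euclidean_space pattern \<Rightarrow> 'b::euclidean_space pattern \<Rightarrow> bool" where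
  "pattern_iso p q \<longleftrightarrow> contains_via UNIV p q"

fun minimal_nonseparable :: "'a::euclidean_space pattern \<Rightarrow> bool" where
  "minimal_nonseparable (u, \<Psi>, Q) \<longleftrightarrow> is_pattern (u, \<Psi>, Q) \<and> \<not> separable (u, \<Psi>, Q)
     \<and> (\<forall>U. \<forall>p :: 'a pattern. subspace U \<and> \<Psi> \<inter> U \<noteq> \<Psi> \<and> is_pattern p
            \<and> contains_via U (u, \<Psi>, Q) p \<longrightarrow> separable p)"

section \<open>The patterns in types \<open>A\<^sub>3\<close>, \<open>B\<^sub>2\<close> and \<open>G\<^sub>2\<close>\<close>

text \<open>All three root systems are realised in \<open>\<real>\<^sup>4\<close>, so that the ten patterns form one set.
  In the index type \<open>4\<close> the numeral \<open>4\<close> equals \<open>0\<close>; the indices \<open>1, 2, 3, 4\<close> are distinct.\<close>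

abbreviation ev :: "4 \<Rightarrow> real^4" where
  "ev i \<equiv> axis i 1"

definition A3_pos :: "(real^4) set" where
  "A3_pos = {ev 1 - ev 2, ev 1 - ev 3, ev 1 - ev 4, ev 2 - ev 3, ev 2 - ev 4, ev 3 - ev 4}"

definition A3_roots :: "(real^4) set" where
  "A3_roots = A3_pos \<union> uminus ` A3_pos"

text \<open>The permutation with one-line notation \<open>abcd\<close>, and its action \<open>e\<^sub>i \<mapsto> e\<^bsub>\<sigma>(i)\<^esub>\<close>.\<close>

definition one_line :: "4 \<Rightarrow> 4 \<Rightarrow> 4 \<Rightarrow> 4 \<Rightarrow> 4 \<Rightarrow> 4" where
  "one_line a b c d i = (if i = 1 then a else if i = 2 then b else if i = 3 then c else d)"

definition perm_map :: "(4 \<Rightarrow> 4) \<Rightarrow> real^4 \<Rightarrow> real^4" where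
  "perm_map \<sigma> x = (\<chi> j. x $ inv \<sigma> j)"

definition A3_3142 :: "(real^4) pattern" where
  "A3_3142 = (perm_map (one_line 3 1 4 2), A3_roots, A3_pos)"

definition A3_2413 :: "(real^4) pattern" where
  "A3_2413 = (perm_map (one_line 2 4 1 3), A3_roots, A3_pos)"

definition b\<^sub>1 :: "real^4" where "b\<^sub>1 = ev 1 - ev 2"
definition b\<^sub>2 :: "real^4" where "b\<^sub>2 = ev 2"

definition B2_pos :: "(real^4) set" where
  "B2_pos = {b\<^sub>1, b\<^sub>2, b\<^sub>1 + b\<^sub>2, b\<^sub>1 + 2 *\<^sub>R b\<^sub>2}"

definition B2_roots :: "(real^4) set" where
  "B2_roots = B2_pos \<union> uminus ` B2_pos"

definition B2_patterns :: "(real^4) pattern set" where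
  "B2_patterns = {(u, B2_roots, B2_pos) | u. u \<in> weyl B2_roots \<and> weyl_length B2_pos u = 2}"

definition g\<^sub>1 :: "real^4" where "g\<^sub>1 = ev 2 + ev 3 - 2 *\<^sub>R ev 1"
definition g\<^sub>2 :: "real^4" where "g\<^sub>2 = ev 1 - ev 2"

definition G2_pos :: "(real^4) set" where
  "G2_pos = {g\<^sub>1, g\<^sub>2, g\<^sub>1 + g\<^sub>2, g\<^sub>1 + 2 *\<^sub>R g\<^sub>2, g\<^sub>1 + 3 *\<^sub>R g\<^sub>2, 2 *\<^sub>R g\<^sub>1 + 3 *\<^sub>R g\<^sub>2}"

definition G2_roots :: "(real^4) set" where
  "G2_roots = G2_pos \<union> uminus ` G2_pos"

definition G2_patterns :: "(real^4) pattern set" where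
  "G2_patterns =
     {(u, G2_roots, G2_pos) | u. u \<in> weyl G2_roots \<and> weyl_length G2_pos u \<in> {2, 3, 4}}"

definition min_patterns :: "(real^4) pattern set" where
  "min_patterns = {A3_3142, A3_2413} \<union> B2_patterns \<union> G2_patterns"

end

theory Submission
  imports Defs
begin

text \<open>Elements of the Weyl group are encoded by generic functionals \<open>u\<close>, the inversions being the
  positive roots on which \<open>u\<close> is negative. An element is separable iff on every irreducible
  subsystem some nonzero dominant functional \<open>\<omega>\<close> is a pivot: all positive roots with \<open>\<omega> > 0\<close> have
  the same sign under \<open>u\<close>. Hence a minimal non-separable element lives on an irreducible system
  that has no pivot although all proper irreducible subsystems have one.

  Let \<open>\<gamma>\<close> be a root that is a positive combination of positive roots spanning a proper subsystem.
  The pivot of that subsystem is positive on \<open>\<gamma>\<close>, so one of the summands dominates: every root of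
  the subsystem on which the pivot is positive has the sign of \<open>\<gamma>\<close>. In rank at least 4, with
  \<open>\<Sum>D\<close> positive for the set \<open>D\<close> of simple roots, this first yields a simple root \<open>p\<close> that lies in
  no connected set of simple roots with negative sum: otherwise two such sets cover \<open>D\<close>, and
  contracting edges of the Dynkin diagram inside the cells they cut out leads to a cycle. Then
  all roots whose support contains \<open>p\<close> are positive, so the fundamental coweight of \<open>p\<close> is a pivot,
  a contradiction. In ranks 2 and 3 the possible root systems are enumerated by the norms of
  roots of full support, and the absence of a pivot leaves only the listed inversion sets.\<close>

section \<open>Root systems and simple roots\<close>

text \<open>Rank four is the threshold for two reasons. Three vectors cannot span a space of rank
  four, so a root that is a sum of three positive roots still lies in a proper subsystem together
  with its partial sums; and two negative sets that cover at least four simple roots, each missing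
  exactly one, share two simple roots, which closes a four-cycle. The obstacle is the step from sums
  of distinct simple roots to all roots with \<open>p\<close> in their support. A root without full
  support lies in a proper subsystem together with the sum of its support and inherits its sign. A
  root of full support with a coefficient above 1 has no such companion: a smallest one with the
  wrong sign is taken apart into three positive roots, and a root-level form of the Jacobi identity
  ensures that the parts are roots. No classification of Dynkin diagrams is assumed: Cartan integers
  and positive definiteness suffice.\<close>

lemma refl_map_linear: "linear (refl_map \<alpha>)"
  unfolding refl_map_def
  by (rule linearI) (simp_all add: algebra_simps inner_add_left add_divide_distrib)

lemma refl_map_add: "refl_map \<alpha> (x + y) = refl_map \<alpha> x + refl_map \<alpha> y"
  and refl_map_diff: "refl_map \<alpha> (x - y) = refl_map \<alpha> x - refl_map \<alpha> y"
  and refl_map_neg: "refl_map \<alpha> (- x) = - refl_map \<alpha> x"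
  and refl_map_scale: "refl_map \<alpha> (c *\<^sub>R x) = c *\<^sub>R refl_map \<alpha> x"
  using refl_map_linear[of \<alpha>]
  by (auto simp: linear_add linear_diff linear_neg linear_scale)

lemma refl_map_self: "refl_map \<alpha> \<alpha> = - \<alpha>"
proof (cases "\<alpha> = 0")
  case False
  then have "refl_map \<alpha> \<alpha> = \<alpha> - 2 *\<^sub>R \<alpha>" by (simp add: refl_map_def)
  also have "\<dots> = - \<alpha>" by (simp add: scaleR_2)
  finally show ?thesis .
qed (simp add: refl_map_def)

lemma refl_map_involution [simp]: "refl_map \<alpha> (refl_map \<alpha> x) = x"
proof -
  have "refl_map \<alpha> (refl_map \<alpha> x) = refl_map \<alpha> x + (2 * (x \<bullet> \<alpha>) / (\<alpha> \<bullet> \<alpha>)) *\<^sub>R \<alpha>"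
    by (subst (2) refl_map_def) (simp add: refl_map_diff refl_map_scale refl_map_self)
  then show ?thesis by (simp add: refl_map_def)
qed

lemma refl_map_uminus [simp]: "refl_map (- \<alpha>) = refl_map \<alpha>"
  by (rule ext) (simp add: refl_map_def)

lemma refl_map_inner_swap: "refl_map \<alpha> x \<bullet> y = x \<bullet> refl_map \<alpha> y"
  by (simp add: refl_map_def inner_diff_left inner_diff_right inner_commute)

lemma refl_map_inner [simp]: "refl_map \<alpha> x \<bullet> refl_map \<alpha> y = x \<bullet> y"
  by (simp add: refl_map_inner_swap)

lemma refl_map_conj: "refl_map \<alpha> (refl_map \<beta> x) = refl_map (refl_map \<alpha> \<beta>) (refl_map \<alpha> x)"
proof -
  have "refl_map \<alpha> (refl_map \<beta> x)
      = refl_map \<alpha> x - (2 * (x \<bullet> \<beta>) / (\<beta> \<bullet> \<beta>)) *\<^sub>R refl_map \<alpha> \<beta>"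
    by (subst (2) refl_map_def) (simp add: refl_map_diff refl_map_scale)
  then show ?thesis by (subst (3) refl_map_def) simp
qed

text \<open>Equality in Cauchy-Schwarz leaves nothing of \<open>a\<close> beyond its orthogonal
  projection onto \<open>b\<close>. The scalar is explicit because reducedness of a root system
  speaks about scalars.\<close>

lemma inner_sq_eq_imp_parallel:
  fixes a b :: "'a::real_inner"
  assumes "(a \<bullet> b)\<^sup>2 = (a \<bullet> a) * (b \<bullet> b)" "b \<noteq> 0"
  shows "a = ((a \<bullet> b) / (b \<bullet> b)) *\<^sub>R b"
proof -
  define t where "t = (a \<bullet> b) / (b \<bullet> b)"
  have bb: "b \<bullet> b > 0" using assms(2) by simp
  have tb: "t * (b \<bullet> b) = a \<bullet> b" using bb by (simp add: t_def)
  have "(a - t *\<^sub>R b) \<bullet> (a - t *\<^sub>R b) = a \<bullet> a - 2 * t * (a \<bullet> b) + t * (t * (b \<bullet> b))"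
    by (simp add: inner_diff_left inner_diff_right inner_commute)
  also have "\<dots> = a \<bullet> a - t * (a \<bullet> b)" by (simp add: tb)
  also have "\<dots> = 0"
  proof -
    have "(b \<bullet> b) * (a \<bullet> a - t * (a \<bullet> b)) = (a \<bullet> a) * (b \<bullet> b) - (t * (b \<bullet> b)) * (a \<bullet> b)"
      by (simp add: algebra_simps)
    also have "\<dots> = 0" using assms(1) by (simp add: tb power2_eq_square)
    finally show ?thesis using bb by simp
  qed
  finally show ?thesis by (simp add: t_def)
qed

section \<open>Pairs of roots and their Cartan integers\<close>

locale rsys =
  fixes \<Phi> :: "'a::euclidean_space set"
  assumes rs: "root_system \<Phi>"
begin

lemma finite_roots: "finite \<Phi>" and zero_not_root: "0 \<notin> \<Phi>"
  and root_reduced: "\<alpha> \<in> \<Phi> \<Longrightarrow> c *\<^sub>R \<alpha> \<in> \<Phi> \<Longrightarrow> c = 1 \<or> c = -1"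
  and cartan_Ints: "\<alpha> \<in> \<Phi> \<Longrightarrow> \<beta> \<in> \<Phi> \<Longrightarrow> cartan \<beta> \<alpha> \<in> \<int>"
  using rs unfolding root_system_def by blast+

lemma refl_root: "\<alpha> \<in> \<Phi> \<Longrightarrow> \<beta> \<in> \<Phi> \<Longrightarrow> refl_map \<alpha> \<beta> \<in> \<Phi>"
  using rs unfolding root_system_def by blast

lemma root_nonzero: "\<alpha> \<in> \<Phi> \<Longrightarrow> \<alpha> \<noteq> 0"
  using zero_not_root by auto

lemma root_norm_pos: "\<alpha> \<in> \<Phi> \<Longrightarrow> 0 < \<alpha> \<bullet> \<alpha>"
  using root_nonzero by simp

lemma root_minus: "\<alpha> \<in> \<Phi> \<Longrightarrow> - \<alpha> \<in> \<Phi>"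
  using refl_root[of \<alpha> \<alpha>] by (simp add: refl_map_self)

lemma cartan_int:
  assumes "\<alpha> \<in> \<Phi>" "\<beta> \<in> \<Phi>"
  obtains m :: int where "cartan \<beta> \<alpha> = of_int m"
  using cartan_Ints[OF assms] by (auto elim: Ints_cases)

lemma cauchy_strict:
  assumes "\<alpha> \<in> \<Phi>" "\<beta> \<in> \<Phi>" "\<alpha> \<noteq> \<beta>" "\<alpha> \<noteq> - \<beta>"
  shows "(\<alpha> \<bullet> \<beta>)\<^sup>2 < (\<alpha> \<bullet> \<alpha>) * (\<beta> \<bullet> \<beta>)"
proof (rule ccontr)
  assume "\<not> ?thesis"
  then have "(\<alpha> \<bullet> \<beta>)\<^sup>2 = (\<alpha> \<bullet> \<alpha>) * (\<beta> \<bullet> \<beta>)"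
    using Cauchy_Schwarz_ineq[of \<alpha> \<beta>] by simp
  then have *: "\<alpha> = ((\<alpha> \<bullet> \<beta>) / (\<beta> \<bullet> \<beta>)) *\<^sub>R \<beta>"
    using inner_sq_eq_imp_parallel root_nonzero assms by blast
  then have "(\<alpha> \<bullet> \<beta>) / (\<beta> \<bullet> \<beta>) = 1 \<or> (\<alpha> \<bullet> \<beta>) / (\<beta> \<bullet> \<beta>) = -1"
    using root_reduced[OF assms(2)] assms(1) by metis
  then have "\<alpha> = \<beta> \<or> \<alpha> = - \<beta>"
  proof
    assume t: "(\<alpha> \<bullet> \<beta>) / (\<beta> \<bullet> \<beta>) = 1"
    from * show ?thesis unfolding t by simp
  next
    assume t: "(\<alpha> \<bullet> \<beta>) / (\<beta> \<bullet> \<beta>) = -1"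
    from * show ?thesis unfolding t by simp
  qed
  then show False using assms(3,4) by auto
qed

text \<open>The two Cartan integers multiply to four times the squared cosine of the angle, which is
  below 4 for roots that are not proportional.\<close>

lemma cartan_pair:
  assumes "\<alpha> \<in> \<Phi>" "\<beta> \<in> \<Phi>" "\<alpha> \<noteq> \<beta>" "\<alpha> \<noteq> - \<beta>" "\<alpha> \<bullet> \<beta> > 0"
  obtains m n :: int where "2 * (\<alpha> \<bullet> \<beta>) = of_int m * (\<beta> \<bullet> \<beta>)" "2 * (\<alpha> \<bullet> \<beta>) = of_int n * (\<alpha> \<bullet> \<alpha>)"
    "m > 0" "n > 0" "m * n < 4"
proof -
  obtain m where m: "cartan \<alpha> \<beta> = of_int m" using cartan_int assms by blast
  obtain n where n: "cartan \<beta> \<alpha> = of_int n" using cartan_int assms by blast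
  have a: "\<alpha> \<bullet> \<alpha> > 0" and b: "\<beta> \<bullet> \<beta> > 0" using root_norm_pos assms by auto
  have 1: "2 * (\<alpha> \<bullet> \<beta>) = of_int m * (\<beta> \<bullet> \<beta>)" using m b by (simp add: cartan_def field_simps)
  have 2: "2 * (\<alpha> \<bullet> \<beta>) = of_int n * (\<alpha> \<bullet> \<alpha>)"
    using n a by (simp add: cartan_def field_simps inner_commute)
  have "of_int m * (\<beta> \<bullet> \<beta>) > 0" using 1 assms(5) by simp
  then have mp: "m > 0" using b by (simp add: zero_less_mult_iff)
  have "of_int n * (\<alpha> \<bullet> \<alpha>) > 0" using 2 assms(5) by simp
  then have np: "n > 0" using a by (simp add: zero_less_mult_iff)
  have "of_int (m * n) * ((\<alpha> \<bullet> \<alpha>) * (\<beta> \<bullet> \<beta>)) = (of_int m * (\<beta> \<bullet> \<beta>)) * (of_int n * (\<alpha> \<bullet> \<alpha>))" by simp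
  also have "\<dots> = 4 * (\<alpha> \<bullet> \<beta>)\<^sup>2" by (simp add: 1[symmetric] 2[symmetric] power2_eq_square)
  also have "\<dots> < 4 * ((\<alpha> \<bullet> \<alpha>) * (\<beta> \<bullet> \<beta>))" using cauchy_strict assms by simp
  finally have "real_of_int (m * n) < 4" using a b by (simp add: mult_less_cancel_right)
  then have "m * n < 4" by linarith
  then show ?thesis using that 1 2 mp np by blast
qed

text \<open>Two positive integers with product below 4 cannot both exceed 1. When one of them is 1,
  reflecting one root in the other yields their difference up to sign.\<close>

lemma root_diff:
  assumes "\<alpha> \<in> \<Phi>" "\<beta> \<in> \<Phi>" "\<alpha> \<noteq> \<beta>" "\<alpha> \<bullet> \<beta> > 0"
  shows "\<alpha> - \<beta> \<in> \<Phi>"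
proof -
  have "\<alpha> \<noteq> - \<beta>"
  proof
    assume "\<alpha> = - \<beta>"
    then have "\<alpha> \<bullet> \<beta> = - (\<beta> \<bullet> \<beta>)" by simp
    then show False using assms root_norm_pos[of \<beta>] by linarith
  qed
  then obtain m n :: int where mn: "2 * (\<alpha> \<bullet> \<beta>) = of_int m * (\<beta> \<bullet> \<beta>)"
    "2 * (\<alpha> \<bullet> \<beta>) = of_int n * (\<alpha> \<bullet> \<alpha>)" "m > 0" "n > 0" "m * n < 4"
    using cartan_pair assms by metis
  have "m = 1 \<or> n = 1"
  proof (rule ccontr)
    assume "\<not> ?thesis"
    then have "m \<ge> 2" "n \<ge> 2" using mn by auto
    then have "m * n \<ge> 2 * 2" by (intro mult_mono) auto
    then show False using mn by simp
  qed
  then show ?thesis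
  proof
    assume "m = 1"
    then have "refl_map \<beta> \<alpha> = \<alpha> - \<beta>" using mn(1) root_norm_pos[OF assms(2)] by (simp add: refl_map_def)
    then show ?thesis using refl_root assms by metis
  next
    assume "n = 1"
    then have "refl_map \<alpha> \<beta> = \<beta> - \<alpha>"
      using mn(2) root_norm_pos[OF assms(1)] by (simp add: refl_map_def inner_commute)
    then have "\<beta> - \<alpha> \<in> \<Phi>" using refl_root assms by metis
    then show ?thesis using root_minus by fastforce
  qed
qed

lemma root_sum:
  assumes "\<alpha> \<in> \<Phi>" "\<beta> \<in> \<Phi>" "\<alpha> \<noteq> - \<beta>" "\<alpha> \<bullet> \<beta> < 0"
  shows "\<alpha> + \<beta> \<in> \<Phi>"
  using root_diff[of \<alpha> "- \<beta>"] assms root_minus[of \<beta>] by simp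

lemma root_system_Int_subspace:
  assumes "subspace U"
  shows "root_system (\<Phi> \<inter> U)"
proof -
  have refl: "refl_map \<alpha> \<beta> \<in> \<Phi> \<inter> U" if "\<alpha> \<in> \<Phi> \<inter> U" "\<beta> \<in> \<Phi> \<inter> U" for \<alpha> \<beta>
    using that refl_root assms by (auto simp: refl_map_def intro: subspace_diff subspace_scale)
  have "refl_map \<alpha> ` (\<Phi> \<inter> U) = \<Phi> \<inter> U" if "\<alpha> \<in> \<Phi> \<inter> U" for \<alpha>
  proof
    show "refl_map \<alpha> ` (\<Phi> \<inter> U) \<subseteq> \<Phi> \<inter> U" using refl that by blast
    show "\<Phi> \<inter> U \<subseteq> refl_map \<alpha> ` (\<Phi> \<inter> U)"
    proof
      fix \<beta> assume "\<beta> \<in> \<Phi> \<inter> U"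
      then have "refl_map \<alpha> \<beta> \<in> \<Phi> \<inter> U" using refl that by blast
      then show "\<beta> \<in> refl_map \<alpha> ` (\<Phi> \<inter> U)" by (metis refl_map_involution image_eqI)
    qed
  qed
  then show ?thesis unfolding root_system_def
    using finite_roots zero_not_root root_reduced cartan_Ints by (intro conjI ballI allI impI) blast+
qed

end

section \<open>Positive systems, simple roots and coweights\<close>

locale chamber = rsys \<Phi> for \<Phi> :: "'a::euclidean_space set" +
  fixes P :: "'a set" and v :: 'a
  assumes generic: "\<alpha> \<in> \<Phi> \<Longrightarrow> v \<bullet> \<alpha> \<noteq> 0"
    and P_eq: "P = {\<alpha>\<in>\<Phi>. 0 < v \<bullet> \<alpha>}"
begin

abbreviation D :: "'a set" where "D \<equiv> simple_roots P"

lemma P_root: "\<alpha> \<in> P \<Longrightarrow> \<alpha> \<in> \<Phi>" and P_pos: "\<alpha> \<in> P \<Longrightarrow> 0 < v \<bullet> \<alpha>"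
  and PI: "\<alpha> \<in> \<Phi> \<Longrightarrow> 0 < v \<bullet> \<alpha> \<Longrightarrow> \<alpha> \<in> P"
  using P_eq by auto

lemma P_cases: "\<alpha> \<in> \<Phi> \<Longrightarrow> \<alpha> \<in> P \<or> - \<alpha> \<in> P"
proof -
  assume a: "\<alpha> \<in> \<Phi>"
  show ?thesis
  proof (cases "0 < v \<bullet> \<alpha>")
    case False
    then have "0 < v \<bullet> (- \<alpha>)" using generic[OF a] by simp
    then show ?thesis using PI[OF root_minus[OF a]] by blast
  qed (use PI a in blast)
qed

lemma P_not_minus: "\<alpha> \<in> P \<Longrightarrow> - \<alpha> \<notin> P"
  using P_pos[of \<alpha>] P_pos[of "- \<alpha>"] by auto

lemma P_nonzero: "\<alpha> \<in> P \<Longrightarrow> \<alpha> \<noteq> 0"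
  using P_root root_nonzero by blast

lemma roots_eq: "\<Phi> = P \<union> uminus ` P"
proof -
  have "\<alpha> \<in> P \<union> uminus ` P" if "\<alpha> \<in> \<Phi>" for \<alpha>
    using P_cases[OF that] by (metis UnI1 UnI2 image_eqI minus_minus)
  then show ?thesis using P_root root_minus by blast
qed

lemma finite_P: "finite P"
  by (rule finite_subset[OF _ finite_roots]) (use P_root in blast)

lemma P_sum: "\<alpha> \<in> P \<Longrightarrow> \<beta> \<in> P \<Longrightarrow> \<alpha> + \<beta> \<in> \<Phi> \<Longrightarrow> \<alpha> + \<beta> \<in> P"
  using PI[of "\<alpha> + \<beta>"] P_pos[of \<alpha>] P_pos[of \<beta>] by (simp add: inner_add_right)

lemma D_P: "\<alpha> \<in> D \<Longrightarrow> \<alpha> \<in> P" and D_indec: "\<alpha> \<in> D \<Longrightarrow> \<beta> \<in> P \<Longrightarrow> \<gamma> \<in> P \<Longrightarrow> \<alpha> \<noteq> \<beta> + \<gamma>"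
  by (auto simp: simple_roots_def)

lemma finite_D: "finite D" using finite_P D_P by (meson finite_subset subsetI)

text \<open>\<open>v\<close> acts as the height: it takes finitely many values on \<open>P\<close>,
  so strict decrease terminates. The usual height presupposes that roots are integral combinations
  of simple roots, which is itself proved by this induction.\<close>

lemma P_induct [consumes 1, case_names less]:
  assumes "\<beta> \<in> P"
    and "\<And>\<beta>. \<beta> \<in> P \<Longrightarrow> (\<And>\<beta>'. \<beta>' \<in> P \<Longrightarrow> v \<bullet> \<beta>' < v \<bullet> \<beta> \<Longrightarrow> Q \<beta>') \<Longrightarrow> Q \<beta>"
  shows "Q \<beta>"
  using assms(1)
proof (induction "card {\<beta>'\<in>P. v \<bullet> \<beta>' < v \<bullet> \<beta>}" arbitrary: \<beta> rule: less_induct)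
  case less
  have "Q \<beta>'" if "\<beta>' \<in> P" "v \<bullet> \<beta>' < v \<bullet> \<beta>" for \<beta>'
  proof (rule less.hyps)
    have "{x\<in>P. v \<bullet> x < v \<bullet> \<beta>'} \<subset> {x\<in>P. v \<bullet> x < v \<bullet> \<beta>}" using that by auto
    then show "card {x\<in>P. v \<bullet> x < v \<bullet> \<beta>'} < card {x\<in>P. v \<bullet> x < v \<bullet> \<beta>}"
      using finite_P by (simp add: psubset_card_mono)
  qed (use that in auto)
  then show ?case using assms(2) less.prems by blast
qed

text \<open>Otherwise \<alpha> - \<beta> would be positive and \<alpha> the sum of \<beta> and
  \<alpha> - \<beta>, although simple roots are indecomposable.\<close>

lemma P_diff_simple:
  assumes "\<beta> \<in> P" "\<alpha> \<in> D" "\<beta> - \<alpha> \<in> \<Phi>"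
  shows "\<beta> - \<alpha> \<in> P"
proof (rule ccontr)
  assume "\<beta> - \<alpha> \<notin> P"
  then have "- (\<beta> - \<alpha>) \<in> P" using P_cases assms by blast
  then show False using D_indec[of \<alpha> \<beta> "- (\<beta> - \<alpha>)"] assms by simp
qed

lemma P_sub_simple: "\<beta> \<in> P \<Longrightarrow> \<alpha> \<in> D \<Longrightarrow> \<beta> \<noteq> \<alpha> \<Longrightarrow> \<beta> \<bullet> \<alpha> > 0 \<Longrightarrow> \<beta> - \<alpha> \<in> P"
  using P_diff_simple[of \<beta> \<alpha>] root_diff[of \<beta> \<alpha>] P_root D_P by blast

lemma P_add: "\<beta> \<in> P \<Longrightarrow> \<alpha> \<in> P \<Longrightarrow> \<beta> \<bullet> \<alpha> < 0 \<Longrightarrow> \<beta> + \<alpha> \<in> P"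
proof (rule P_sum)
  assume *: "\<beta> \<in> P" "\<alpha> \<in> P" "\<beta> \<bullet> \<alpha> < 0"
  then have "\<beta> \<noteq> - \<alpha>" using P_not_minus[of \<alpha>] by blast
  then show "\<beta> + \<alpha> \<in> \<Phi>" using root_sum[of \<beta> \<alpha>] P_root * by blast
qed auto

lemma D_obtuse:
  assumes "\<alpha> \<in> D" "\<beta> \<in> D" "\<alpha> \<noteq> \<beta>"
  shows "\<alpha> \<bullet> \<beta> \<le> 0"
proof (rule ccontr)
  assume "\<not> ?thesis"
  then have *: "\<alpha> - \<beta> \<in> P" using P_sub_simple[of \<alpha> \<beta>] assms D_P by force
  show False using D_indec[of \<alpha> "\<alpha> - \<beta>" \<beta>] assms * D_P[of \<beta>] by simp
qed

text \<open>In a linear relation, the terms with positive coefficients and the negated rest give the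
  same vector \<open>y\<close>. Obtuseness makes \<open>y \<bullet> y\<close> nonpositive, so
  \<open>y\<close> is zero, and pairing it with \<open>v\<close>, which is positive on all simple
  roots, kills every coefficient.\<close>

lemma D_independent: "independent D"
proof
  assume "dependent D"
  then obtain c where c: "\<exists>x\<in>D. c x \<noteq> 0" "(\<Sum>x\<in>D. c x *\<^sub>R x) = 0"
    using finite_D by (auto simp: dependent_finite)
  define A where "A = {x\<in>D. c x > 0}"
  define B where "B = {x\<in>D. c x \<le> 0}"
  define y where "y = (\<Sum>x\<in>A. c x *\<^sub>R x)"
  have fin: "finite A" "finite B" using finite_D by (auto simp: A_def B_def)
  have "(\<Sum>x\<in>D. c x *\<^sub>R x) = y + (\<Sum>x\<in>B. c x *\<^sub>R x)"
    unfolding y_def using fin by (subst sum.union_disjoint[symmetric])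
      (auto simp: A_def B_def intro!: sum.cong)
  then have y2: "y = (\<Sum>x\<in>B. (- c x) *\<^sub>R x)"
    using c(2) by (simp add: sum_negf eq_neg_iff_add_eq_0)
  have yy: "y \<bullet> y = (\<Sum>x\<in>B. \<Sum>z\<in>A. (c z * - c x) * (z \<bullet> x))"
    by (subst (2) y2, subst y_def)
      (simp add: inner_sum_left inner_sum_right sum_distrib_left sum_negf mult.assoc mult.left_commute)
  have "(c z * - c x) * (z \<bullet> x) \<le> 0" if "x \<in> B" "z \<in> A" for x z
  proof -
    have "z \<noteq> x" "c z * - c x \<ge> 0" "z \<in> D" "x \<in> D" using that by (auto simp: A_def B_def mult_nonneg_nonpos)
    then show ?thesis using D_obtuse by (metis mult_nonneg_nonpos)
  qed
  then have "y \<bullet> y \<le> 0" unfolding yy by (simp add: sum_nonpos)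
  then have y0: "y = 0" by (metis inner_eq_zero_iff inner_ge_zero order_antisym)
  have "v \<bullet> y = (\<Sum>x\<in>A. c x * (v \<bullet> x))" by (simp add: y_def inner_sum_right)
  then have vA: "(\<Sum>x\<in>A. c x * (v \<bullet> x)) = 0" using y0 by simp
  have "v \<bullet> y = (\<Sum>x\<in>B. - c x * (v \<bullet> x))" using y2 by (simp add: inner_sum_right)
  then have vB: "(\<Sum>x\<in>B. - c x * (v \<bullet> x)) = 0" using y0 by simp
  have A0: "A = {}"
  proof (rule ccontr)
    assume "A \<noteq> {}"
    then have "0 < (\<Sum>x\<in>A. c x * (v \<bullet> x))"
      by (intro sum_pos fin) (auto simp: A_def dest!: D_P P_pos)
    then show False using vA by simp
  qed
  have B0: "c x = 0" if "x \<in> B" for x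
  proof (rule ccontr)
    assume "c x \<noteq> 0"
    then have "0 < - c x * (v \<bullet> x)" using that P_pos[OF D_P] by (auto simp: B_def mult_less_0_iff)
    also have "\<dots> \<le> (\<Sum>x\<in>B. - c x * (v \<bullet> x))"
      using that fin by (intro member_le_sum) (auto simp: B_def mult_nonpos_nonneg less_imp_le P_pos D_P)
    finally show False using vB by simp
  qed
  have "c x = 0" if "x \<in> D" for x using that A0 B0[of x] by (auto simp: A_def B_def not_less)
  then show False using c(1) by auto
qed

lemma P_nat_comb: "\<beta> \<in> P \<Longrightarrow> \<exists>c::'a \<Rightarrow> nat. \<beta> = (\<Sum>\<delta>\<in>D. real (c \<delta>) *\<^sub>R \<delta>)"
proof (induction \<beta> rule: P_induct)
  case (less \<beta>)
  show ?case
  proof (cases "\<beta> \<in> D")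
    case True
    have "\<beta> = (\<Sum>\<delta>\<in>D. real (if \<delta> = \<beta> then 1 else 0) *\<^sub>R \<delta>)"
      using True finite_D by (simp add: if_distrib[of real] if_distrib[of "\<lambda>t. t *\<^sub>R _"] sum.delta cong: if_cong)
    then show ?thesis by (rule exI[of _ "\<lambda>\<delta>. if \<delta> = \<beta> then 1 else 0"])
  next
    case False
    then obtain s t where st: "s \<in> P" "t \<in> P" "\<beta> = s + t"
      using less.hyps unfolding simple_roots_def by blast
    have "v \<bullet> s < v \<bullet> \<beta>" "v \<bullet> t < v \<bullet> \<beta>" using st P_pos by (auto simp: inner_add_right)
    then obtain c d :: "'a \<Rightarrow> nat" where "s = (\<Sum>\<delta>\<in>D. real (c \<delta>) *\<^sub>R \<delta>)" "t = (\<Sum>\<delta>\<in>D. real (d \<delta>) *\<^sub>R \<delta>)"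
      using less.IH st by metis
    then have "\<beta> = (\<Sum>\<delta>\<in>D. real (c \<delta> + d \<delta>) *\<^sub>R \<delta>)"
      using st by (simp add: scaleR_add_left sum.distrib)
    then show ?thesis by (rule exI[of _ "\<lambda>\<delta>. c \<delta> + d \<delta>"])
  qed
qed

text \<open>Fundamental coweights. Only their restriction to the span of \<open>\<Phi>\<close> is determined.\<close>

definition cw :: "'a \<Rightarrow> 'a" where
  "cw \<delta> = (SOME \<omega>. \<forall>\<epsilon>\<in>D. \<omega> \<bullet> \<epsilon> = (if \<epsilon> = \<delta> then 1 else 0))"

lemma cw: "\<epsilon> \<in> D \<Longrightarrow> cw \<delta> \<bullet> \<epsilon> = (if \<epsilon> = \<delta> then 1 else 0)"
proof -
  obtain g :: "'a \<Rightarrow> real" where g: "linear g" "\<forall>x\<in>D. g x = (if x = \<delta> then 1 else 0)"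
    using linear_independent_extend[OF D_independent, of "\<lambda>x. if x = \<delta> then 1 else 0"] by blast
  \<comment> \<open>The adjoint of a real functional sends 1 to the vector that represents it under
    the inner product.\<close>
  have "adjoint g 1 \<bullet> x = g x" for x
    using adjoint_works[OF g(1), of x 1] by (simp add: inner_commute)
  then have "\<exists>\<omega>. \<forall>\<epsilon>\<in>D. \<omega> \<bullet> \<epsilon> = (if \<epsilon> = \<delta> then 1 else 0)" using g(2) by metis
  from someI_ex[OF this] show "\<epsilon> \<in> D \<Longrightarrow> cw \<delta> \<bullet> \<epsilon> = (if \<epsilon> = \<delta> then 1 else 0)"
    unfolding cw_def by blast
qed

lemma cw_sum: "\<delta> \<in> D \<Longrightarrow> cw \<delta> \<bullet> (\<Sum>\<epsilon>\<in>D. c \<epsilon> *\<^sub>R \<epsilon>) = c \<delta>"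
proof -
  assume d: "\<delta> \<in> D"
  have "cw \<delta> \<bullet> (\<Sum>\<epsilon>\<in>D. c \<epsilon> *\<^sub>R \<epsilon>) = (\<Sum>\<epsilon>\<in>D. c \<epsilon> * (if \<epsilon> = \<delta> then 1 else 0))"
    by (simp add: inner_sum_right cw cong: sum.cong)
  also have "\<dots> = c \<delta>" using d finite_D by (simp add: if_distrib[of "\<lambda>t. c _ * t"] cong: if_cong)
  finally show ?thesis .
qed

lemma P_cw_nat: "\<beta> \<in> P \<Longrightarrow> \<delta> \<in> D \<Longrightarrow> \<exists>n::nat. cw \<delta> \<bullet> \<beta> = real n"
  using P_nat_comb[of \<beta>] cw_sum by metis

lemma P_cw_nonneg: "\<beta> \<in> P \<Longrightarrow> \<delta> \<in> D \<Longrightarrow> 0 \<le> cw \<delta> \<bullet> \<beta>"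
  using P_cw_nat by fastforce

lemma P_cw_ge1: "\<beta> \<in> P \<Longrightarrow> \<delta> \<in> D \<Longrightarrow> 0 < cw \<delta> \<bullet> \<beta> \<Longrightarrow> 1 \<le> cw \<delta> \<bullet> \<beta>"
  using P_cw_nat by fastforce

lemma P_expand: "\<beta> \<in> P \<Longrightarrow> \<beta> = (\<Sum>\<delta>\<in>D. (cw \<delta> \<bullet> \<beta>) *\<^sub>R \<delta>)"
proof -
  assume "\<beta> \<in> P"
  then obtain c :: "'a \<Rightarrow> nat" where c: "\<beta> = (\<Sum>\<delta>\<in>D. real (c \<delta>) *\<^sub>R \<delta>)" using P_nat_comb by blast
  then have "cw \<delta> \<bullet> \<beta> = real (c \<delta>)" if "\<delta> \<in> D" for \<delta> using cw_sum that by metis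
  then show ?thesis using c by (simp cong: sum.cong)
qed

lemma P_inner_expand: "\<beta> \<in> P \<Longrightarrow> \<beta> \<bullet> x = (\<Sum>\<delta>\<in>D. (cw \<delta> \<bullet> \<beta>) * (\<delta> \<bullet> x))"
proof -
  assume "\<beta> \<in> P"
  then have "\<beta> \<bullet> x = (\<Sum>\<delta>\<in>D. (cw \<delta> \<bullet> \<beta>) *\<^sub>R \<delta>) \<bullet> x" using P_expand by presburger
  also have "\<dots> = (\<Sum>\<delta>\<in>D. (cw \<delta> \<bullet> \<beta>) * (\<delta> \<bullet> x))"
    by (simp only: inner_sum_left inner_scaleR_left)
  finally show ?thesis .
qed

text \<open>Coefficients in the simple roots are nonnegative, so a positive value needs a positive
  term. It is applied with \<open>x\<close> a root, to find a simple root to subtract or reflect in;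
  with \<open>x\<close> the negative of a functional, to find a simple inversion; and with
  \<open>x\<close> a pivot.\<close>

lemma P_simple_pos:
  assumes "\<beta> \<in> P" "x \<bullet> \<beta> > 0"
  shows "\<exists>\<delta>\<in>D. x \<bullet> \<delta> > 0 \<and> cw \<delta> \<bullet> \<beta> > 0"
proof (rule ccontr)
  assume n: "\<not> ?thesis"
  have "x \<bullet> \<beta> = (\<Sum>\<delta>\<in>D. (cw \<delta> \<bullet> \<beta>) * (\<delta> \<bullet> x))"
    using P_inner_expand[OF assms(1), of x] by (simp only: inner_commute[of x \<beta>])
  also have "\<dots> \<le> 0"
  proof (rule sum_nonpos)
    fix \<delta> assume d: "\<delta> \<in> D"
    then have "cw \<delta> \<bullet> \<beta> = 0 \<or> \<delta> \<bullet> x \<le> 0" using n P_cw_nonneg[OF assms(1) d]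
      by (metis inner_commute linorder_not_less order_le_less)
    then show "(cw \<delta> \<bullet> \<beta>) * (\<delta> \<bullet> x) \<le> 0" using P_cw_nonneg[OF assms(1) d]
      by (auto intro: mult_nonneg_nonpos)
  qed
  finally show False using assms by simp
qed

lemma span_D: "span D = span \<Phi>"
proof -
  have 1: "\<beta> \<in> span D" if "\<beta> \<in> P" for \<beta>
    by (subst P_expand[OF that]) (intro span_sum span_scale span_base)
  then have "\<beta> \<in> span D" if "\<beta> \<in> \<Phi>" for \<beta>
    using 1 P_cases[OF that] by (metis minus_minus span_neg)
  then have "span \<Phi> \<subseteq> span D" using span_minimal subspace_span by blast
  then show ?thesis using span_mono[of D \<Phi>] D_P P_root by blast
qed

text \<open>A positive root other than \<alpha> has a positive coefficient at a second simple root,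
  since the system is reduced. The reflection changes only the coefficient at \<alpha>, and one
  positive coefficient makes a root positive.\<close>

lemma simple_refl_P:
  assumes "\<alpha> \<in> D" "\<beta> \<in> P" "\<beta> \<noteq> \<alpha>"
  shows "refl_map \<alpha> \<beta> \<in> P"
proof -
  have r: "refl_map \<alpha> \<beta> \<in> \<Phi>" using refl_root assms D_P P_root by blast
  have "\<exists>\<delta>\<in>D. \<delta> \<noteq> \<alpha> \<and> cw \<delta> \<bullet> \<beta> > 0"
  proof (rule ccontr)
    assume "\<not> ?thesis"
    then have "cw \<delta> \<bullet> \<beta> = 0" if "\<delta> \<in> D - {\<alpha>}" for \<delta> using P_cw_nonneg[OF assms(2)] that by force
    then have "\<beta> = (cw \<alpha> \<bullet> \<beta>) *\<^sub>R \<alpha>"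
      using P_expand[OF assms(2)] assms(1) finite_D by (simp add: sum.remove[of D \<alpha>])
    then have "\<beta> = \<alpha> \<or> \<beta> = - \<alpha>" using root_reduced[of \<alpha> "cw \<alpha> \<bullet> \<beta>"] assms P_root D_P
      by (metis scaleR_minus1_left scaleR_one)
    then show False using assms D_P P_not_minus[of \<alpha>] by blast
  qed
  then obtain \<delta> where d: "\<delta> \<in> D" "\<delta> \<noteq> \<alpha>" "cw \<delta> \<bullet> \<beta> > 0" by blast
  then have c: "cw \<delta> \<bullet> refl_map \<alpha> \<beta> > 0" using assms(1) cw by (simp add: refl_map_def inner_diff_right)
  show ?thesis
  proof (rule ccontr)
    assume "refl_map \<alpha> \<beta> \<notin> P"
    then have "- refl_map \<alpha> \<beta> \<in> P" using P_cases r by blast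
    then show False using P_cw_nonneg[of "- refl_map \<alpha> \<beta>" \<delta>] d c by simp
  qed
qed

lemma chamber_Int_subspace: "subspace U \<Longrightarrow> chamber (\<Phi> \<inter> U) (P \<inter> U) v"
  by (intro chamber.intro rsys.intro chamber_axioms.intro root_system_Int_subspace)
    (use generic P_eq in auto)

lemma positive_systemI: "positive_system \<Phi> P"
  unfolding positive_system_def using generic P_eq by blast

lemma root_le_iff:
  assumes "\<alpha> \<in> D" "\<beta> \<in> P"
  shows "root_le P \<alpha> \<beta> \<longleftrightarrow> 0 < cw \<alpha> \<bullet> \<beta>"
proof
  assume "root_le P \<alpha> \<beta>"
  then obtain c where c: "\<forall>\<delta>\<in>D. 0 \<le> c \<delta>" "\<beta> - \<alpha> = (\<Sum>\<delta>\<in>D. c \<delta> *\<^sub>R \<delta>)"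
    unfolding root_le_def by blast
  then have "cw \<alpha> \<bullet> (\<beta> - \<alpha>) = c \<alpha>" using cw_sum assms by metis
  then have "cw \<alpha> \<bullet> \<beta> = c \<alpha> + 1" using cw[of \<alpha> \<alpha>] assms by (simp add: inner_diff_right)
  then show "0 < cw \<alpha> \<bullet> \<beta>" using c assms by auto
next
  assume pos: "0 < cw \<alpha> \<bullet> \<beta>"
  define c where "c \<delta> = cw \<delta> \<bullet> \<beta> - (if \<delta> = \<alpha> then 1 else 0)" for \<delta>
  have "(\<Sum>\<delta>\<in>D. (if \<delta> = \<alpha> then 1 else 0::real) *\<^sub>R \<delta>) = \<alpha>"
    using assms finite_D by (simp add: if_distrib[of "\<lambda>t. t *\<^sub>R _"] sum.delta cong: if_cong)
  then have "\<beta> - \<alpha> = (\<Sum>\<delta>\<in>D. c \<delta> *\<^sub>R \<delta>)"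
    using P_expand[OF assms(2)] by (simp add: c_def scaleR_diff_left sum_subtractf)
  moreover have "\<forall>\<delta>\<in>D. 0 \<le> c \<delta>"
    using P_cw_nonneg[OF assms(2)] P_cw_ge1[OF assms(2,1) pos] by (auto simp: c_def)
  ultimately show "root_le P \<alpha> \<beta>" unfolding root_le_def by blast
qed

end

lemma chamberE:
  assumes "root_system \<Phi>" "positive_system \<Phi> P"
  obtains v where "chamber \<Phi> P v"
  using assms unfolding positive_system_def
  by (metis chamber.intro chamber_axioms.intro rsys.intro)

section \<open>Inversion sets of Weyl group elements\<close>

lemma refl_word_Nil [simp]: "refl_word [] = id"
  and refl_word_Cons [simp]: "refl_word (a # as) = refl_map a \<circ> refl_word as"
  by (simp_all add: refl_word_def)

lemma refl_word_append [simp]: "refl_word (as @ bs) = refl_word as \<circ> refl_word bs"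
  by (induction as) (simp_all add: comp_assoc)

lemma refl_word_linear: "linear (refl_word as)"
proof (induction as)
  case Nil
  show ?case unfolding refl_word_Nil by (rule linear_id)
next
  case (Cons a as)
  then show ?case unfolding refl_word_Cons by (rule linear_compose[OF _ refl_map_linear])
qed

lemma refl_word_neg: "refl_word as (- x) = - refl_word as x"
  using refl_word_linear linear_neg by blast

lemma refl_word_rev [simp]: "refl_word as (refl_word (rev as) x) = x"
  by (induction as arbitrary: x) simp_all

lemma refl_word_rev' [simp]: "refl_word (rev as) (refl_word as x) = x"
  using refl_word_rev[of "rev as" x] by simp

lemma refl_word_inner_swap: "refl_word as x \<bullet> y = x \<bullet> refl_word (rev as) y"
  by (induction as arbitrary: x y) (simp_all add: refl_map_inner_swap)

lemma (in rsys) refl_word_root: "as \<in> lists \<Phi> \<Longrightarrow> \<beta> \<in> \<Phi> \<Longrightarrow> refl_word as \<beta> \<in> \<Phi>"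
  by (induction as) (auto intro: refl_root)

context chamber
begin

lemma lists_D: "as \<in> lists D \<Longrightarrow> as \<in> lists \<Phi>"
  by (auto intro: P_root D_P)

lemma refl_word_D_root: "as \<in> lists D \<Longrightarrow> \<beta> \<in> \<Phi> \<Longrightarrow> refl_word as \<beta> \<in> \<Phi>"
  using refl_word_root lists_D by blast

lemma minus_P_iff: "\<beta> \<in> \<Phi> \<Longrightarrow> \<beta> \<in> uminus ` P \<longleftrightarrow> v \<bullet> \<beta> < 0"
proof -
  assume b: "\<beta> \<in> \<Phi>"
  have "\<beta> \<in> uminus ` P \<longleftrightarrow> - \<beta> \<in> P" by (metis image_iff minus_minus)
  then show ?thesis using PI[OF root_minus[OF b]] P_pos[of "- \<beta>"] by auto
qed

lemma inversions_word:
  assumes "as \<in> lists \<Phi>"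
  shows "inversions P (refl_word as) = {\<beta>\<in>P. v \<bullet> refl_word as \<beta> < 0}"
  unfolding inversions_def using minus_P_iff[OF refl_word_root[OF assms P_root]] by blast

text \<open>Take \<open>u\<close> to be the inverse of \<open>w\<close> applied to \<open>v\<close>:
  the reversed word is both the inverse and the adjoint of the word, so \<open>u\<close> has on
  \<beta> the sign of \<open>v\<close> on \<open>w\<close> \<beta>.\<close>

lemma weyl_functional:
  assumes "w \<in> weyl \<Phi>"
  obtains u where "\<And>\<beta>. \<beta> \<in> \<Phi> \<Longrightarrow> u \<bullet> \<beta> \<noteq> 0" "inversions P w = {\<beta>\<in>P. u \<bullet> \<beta> < 0}"
proof -
  obtain as where as: "as \<in> lists \<Phi>" "w = refl_word as" using assms by (auto simp: weyl_def)
  have eq: "refl_word (rev as) v \<bullet> \<beta> = v \<bullet> w \<beta>" for \<beta>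
    using refl_word_inner_swap[of "rev as" v \<beta>] as by simp
  show thesis
  proof (rule that)
    show "refl_word (rev as) v \<bullet> \<beta> \<noteq> 0" if "\<beta> \<in> \<Phi>" for \<beta>
      using generic refl_word_root[OF as(1) that] as(2) by (simp add: eq)
    show "inversions P w = {\<beta>\<in>P. refl_word (rev as) v \<bullet> \<beta> < 0}"
      using inversions_word[OF as(1)] as(2) by (simp add: eq)
  qed
qed

text \<open>Induction on the number of inverted roots. A functional with an inversion is negative on
  some simple \<alpha>. Reflecting it in \<alpha> removes that inversion and carries the remaining
  ones to those of the new functional, since the reflection permutes the positive roots other than
  \<alpha>.\<close>

lemma word_of_functional:
  assumes "\<And>\<beta>. \<beta> \<in> \<Phi> \<Longrightarrow> u \<bullet> \<beta> \<noteq> 0"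
  shows "\<exists>as\<in>lists D. length as = card {\<beta>\<in>P. u \<bullet> \<beta> < 0}
    \<and> (\<forall>\<beta>\<in>\<Phi>. v \<bullet> refl_word as \<beta> < 0 \<longleftrightarrow> u \<bullet> \<beta> < 0)"
  using assms
proof (induction "card {\<beta>\<in>P. u \<bullet> \<beta> < 0}" arbitrary: u)
  case 0
  then have e: "{\<beta>\<in>P. u \<bullet> \<beta> < 0} = {}" using finite_P by simp
  have "v \<bullet> \<beta> < 0 \<longleftrightarrow> u \<bullet> \<beta> < 0" if b: "\<beta> \<in> \<Phi>" for \<beta>
  proof (cases "\<beta> \<in> P")
    case True
    then show ?thesis using e P_pos by force
  next
    case False
    then have m: "- \<beta> \<in> P" using P_cases b by blast
    then have "\<not> u \<bullet> (- \<beta>) < 0" using e by blast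
    then show ?thesis using P_pos[OF m] 0(2)[OF b] by auto
  qed
  then show ?case unfolding e by (intro bexI[of _ "[]"]) simp_all
next
  case (Suc n)
  then have "{\<beta>\<in>P. u \<bullet> \<beta> < 0} \<noteq> {}" by (metis card.empty nat.distinct(1))
  then obtain \<beta> where "\<beta> \<in> P" "(- u) \<bullet> \<beta> > 0" by auto
  then obtain \<alpha> where a: "\<alpha> \<in> D" "u \<bullet> \<alpha> < 0" using P_simple_pos[of \<beta> "- u"] by auto
  have aP: "\<alpha> \<in> P" "\<alpha> \<in> \<Phi>" using a D_P P_root by blast+
  define u' where "u' = refl_map \<alpha> u"
  have u': "u' \<bullet> \<beta> = u \<bullet> refl_map \<alpha> \<beta>" for \<beta> by (simp add: u'_def refl_map_inner_swap)
  have u'a: "u' \<bullet> \<alpha> > 0" using a by (simp add: u' refl_map_self)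
  have "{\<beta>\<in>P. u' \<bullet> \<beta> < 0} = refl_map \<alpha> ` ({\<beta>\<in>P. u \<bullet> \<beta> < 0} - {\<alpha>})" (is "?L = ?R")
  proof
    show "?L \<subseteq> ?R"
    proof
      fix \<beta> assume b: "\<beta> \<in> ?L"
      then have "\<beta> \<noteq> \<alpha>" using u'a by auto
      moreover from b have "refl_map \<alpha> \<beta> \<in> P" using simple_refl_P[OF a(1)] calculation by blast
      moreover have "refl_map \<alpha> \<beta> \<noteq> \<alpha>"
        by (metis P_not_minus b calculation(2) mem_Collect_eq refl_map_involution refl_map_self)
      ultimately show "\<beta> \<in> ?R" using b by (intro image_eqI[of _ _ "refl_map \<alpha> \<beta>"]) (auto simp: u')
    qed
    show "?R \<subseteq> ?L" using simple_refl_P[OF a(1)] by (auto simp: u')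
  qed
  moreover have "inj_on (refl_map \<alpha>) A" for A by (metis inj_onI refl_map_involution)
  ultimately have "card {\<beta>\<in>P. u' \<bullet> \<beta> < 0} = card ({\<beta>\<in>P. u \<bullet> \<beta> < 0} - {\<alpha>})" by (simp add: card_image)
  also have "\<dots> = n" using Suc(2) a aP finite_P by (subst card_Diff_singleton) auto
  finally have n: "n = card {\<beta>\<in>P. u' \<bullet> \<beta> < 0}" ..
  have g: "u' \<bullet> \<beta> \<noteq> 0" if "\<beta> \<in> \<Phi>" for \<beta> using Suc(3)[OF refl_root[OF aP(2) that]] by (simp add: u')
  from Suc(1)[OF n g] obtain as where as: "as \<in> lists D" "length as = n"
    "\<forall>\<beta>\<in>\<Phi>. v \<bullet> refl_word as \<beta> < 0 \<longleftrightarrow> u' \<bullet> \<beta> < 0" using n by blast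
  have "v \<bullet> refl_word (as @ [\<alpha>]) \<beta> < 0 \<longleftrightarrow> u \<bullet> \<beta> < 0" if "\<beta> \<in> \<Phi>" for \<beta>
    using as(3) refl_root[OF aP(2) that] by (simp add: u')
  then show ?case using as a(1) Suc(2) by (intro bexI[of _ "as @ [\<alpha>]"]) auto
qed

text \<open>A nonsimple positive root has positive product with some simple \<alpha>, and reflecting
  it in \<alpha> lowers \<open>v\<close>. The reflection in the original root is a conjugate, by
  that of \<alpha>, of the reflection in the lower one.\<close>

lemma refl_map_simple_word: "\<beta> \<in> P \<Longrightarrow> \<exists>as\<in>lists D. refl_word as = refl_map \<beta>"
proof (induction \<beta> rule: P_induct)
  case (less \<beta>)
  show ?case
  proof (cases "\<beta> \<in> D")
    case True
    then show ?thesis by (intro bexI[of _ "[\<beta>]"]) auto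
  next
    case False
    obtain \<alpha> where a: "\<alpha> \<in> D" "\<beta> \<bullet> \<alpha> > 0"
      using P_simple_pos[OF less.hyps, of \<beta>] P_nonzero less.hyps by auto
    have s: "refl_map \<alpha> \<beta> \<in> P" using simple_refl_P a less.hyps False by blast
    have "\<alpha> \<bullet> \<alpha> > 0" "v \<bullet> \<alpha> > 0" using P_nonzero P_pos D_P[OF a(1)] by auto
    then have "v \<bullet> refl_map \<alpha> \<beta> < v \<bullet> \<beta>" using a by (simp add: refl_map_def inner_diff_right)
    then obtain as where as: "as \<in> lists D" "refl_word as = refl_map (refl_map \<alpha> \<beta>)"
      using less.IH s by blast
    have "refl_word (\<alpha> # as @ [\<alpha>]) = refl_map \<beta>"
    proof
      fix x
      show "refl_word (\<alpha> # as @ [\<alpha>]) x = refl_map \<beta> x"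
        using refl_map_conj[of \<alpha> "refl_map \<alpha> \<beta>" "refl_map \<alpha> x"] by (simp add: as)
    qed
    then show ?thesis using as a by (intro bexI[of _ "\<alpha> # as @ [\<alpha>]"]) auto
  qed
qed

lemma weyl_simple_word: "w \<in> weyl \<Phi> \<Longrightarrow> \<exists>as\<in>lists D. w = refl_word as"
proof -
  assume "w \<in> weyl \<Phi>"
  then obtain bs where "bs \<in> lists \<Phi>" "w = refl_word bs" by (auto simp: weyl_def)
  then show ?thesis
  proof (induction bs arbitrary: w)
    case Nil
    then show ?case by (intro bexI[of _ "[]"]) auto
  next
    case (Cons b bs)
    then obtain as where as: "as \<in> lists D" "refl_word bs = refl_word as" by auto
    have "\<exists>cs\<in>lists D. refl_word cs = refl_map b"
    proof (cases "b \<in> P")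
      case False
      then have "- b \<in> P" using P_cases[of b] Cons.hyps by simp
      then show ?thesis using refl_map_simple_word[of "- b"] by simp
    qed (rule refl_map_simple_word)
    then obtain cs where "cs \<in> lists D" "refl_word cs = refl_map b" by blast
    then show ?case using as Cons.prems by (intro bexI[of _ "cs @ as"]) auto
  qed
qed

text \<open>Letters are stripped from the left while \<beta> is reflected along. A simple reflection
  makes no positive root negative except its own, and the stripping would end at the negative root
  \<gamma>, so some letter equals the current image of \<beta>; that letter is deleted.\<close>

lemma exchange:
  assumes "bs \<in> lists D" "\<beta> \<in> P" "- \<gamma> \<in> P" "refl_word bs \<gamma> = \<beta>"
  shows "\<exists>cs\<in>lists D. Suc (length cs) = length bs \<and> refl_word cs = refl_map \<beta> \<circ> refl_word bs"
  using assms
proof (induction bs arbitrary: \<beta> rule: list.induct)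
  case Nil
  then show ?case using P_not_minus by auto
next
  case (Cons b bs)
  show ?case
  proof (cases "\<beta> = b")
    case True
    then have "refl_map \<beta> \<circ> refl_word (b # bs) = refl_word bs" by (simp add: fun_eq_iff)
    then show ?thesis using Cons.prems(1) by (intro bexI[of _ bs] conjI) (simp_all del: refl_word_Cons)
  next
    case False
    have w: "refl_word bs \<gamma> = refl_map b \<beta>" using Cons.prems(4) by force
    have "refl_map b \<beta> \<in> P" using simple_refl_P Cons.prems False by auto
    moreover have "bs \<in> lists D" using Cons.prems(1) by simp
    ultimately obtain cs where cs: "cs \<in> lists D" "Suc (length cs) = length bs"
      "refl_word cs = refl_map (refl_map b \<beta>) \<circ> refl_word bs"
      using Cons.IH[OF _ _ Cons.prems(3) w] by blast
    have "refl_word (b # cs) = refl_map \<beta> \<circ> refl_word (b # bs)"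
      using refl_map_conj[of b "refl_map b \<beta>"] by (simp add: cs fun_eq_iff)
    then show ?thesis using cs Cons.prems by (intro bexI[of _ "b # cs"]) auto
  qed
qed

text \<open>The reflection in \<open>a\<close> changes the sign of no root but \<open>a\<close> and
  \<open>- a\<close>, so prepending it can alter the inversion set only at the root that the word
  sends to \<open>a\<close>, or at its negative.\<close>

lemma inversions_step:
  assumes "a \<in> D" "bs \<in> lists D" "\<gamma> = refl_word (rev bs) a"
  shows "\<gamma> \<in> P \<Longrightarrow> inversions P (refl_word (a # bs)) = insert \<gamma> (inversions P (refl_word bs))
      \<and> \<gamma> \<notin> inversions P (refl_word bs)"
    and "- \<gamma> \<in> P \<Longrightarrow> inversions P (refl_word (a # bs)) = inversions P (refl_word bs) - {- \<gamma>}
      \<and> - \<gamma> \<in> inversions P (refl_word bs)"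
proof -
  define w where "w = refl_word bs"
  have wg: "w \<gamma> = a" by (simp add: w_def assms(3))
  have wroot: "w \<beta> \<in> \<Phi>" if "\<beta> \<in> \<Phi>" for \<beta> using refl_word_D_root assms(2) that w_def by blast
  have wneg: "w (- x) = - w x" for x by (simp add: w_def refl_word_neg)
  have winj: "x = y" if "w x = w y" for x y using that refl_word_rev' w_def by metis
  have aP: "a \<in> P" "v \<bullet> a > 0" using assms(1) D_P P_pos by blast+
  have I: "inversions P w = {\<beta>\<in>P. v \<bullet> w \<beta> < 0}"
    unfolding w_def by (rule inversions_word) (use assms lists_D in auto)
  have I': "inversions P (refl_word (a # bs)) = {\<beta>\<in>P. v \<bullet> refl_map a (w \<beta>) < 0}"
    using inversions_word[of "a # bs"] lists_D[of "a # bs"] assms by (simp add: w_def)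
  have sgn: "v \<bullet> refl_map a (w \<beta>) < 0 \<longleftrightarrow> v \<bullet> w \<beta> < 0"
    if b: "\<beta> \<in> P" "\<beta> \<noteq> \<gamma>" "\<beta> \<noteq> - \<gamma>" for \<beta>
  proof -
    have r: "w \<beta> \<in> \<Phi>" using wroot P_root b by blast
    have "w \<beta> \<noteq> a" using b winj wg by metis
    moreover have "- w \<beta> \<noteq> a" using b winj[of "- \<beta>" \<gamma>] wg by (metis minus_minus wneg)
    ultimately have "w \<beta> \<in> P \<Longrightarrow> refl_map a (w \<beta>) \<in> P" "- w \<beta> \<in> P \<Longrightarrow> refl_map a (- w \<beta>) \<in> P"
      using simple_refl_P assms(1) by blast+
    then show ?thesis using P_cases[OF r] P_pos by (force simp: refl_map_neg)
  qed
  show "inversions P (refl_word (a # bs)) = insert \<gamma> (inversions P (refl_word bs))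
      \<and> \<gamma> \<notin> inversions P (refl_word bs)" if g: "\<gamma> \<in> P"
  proof -
    have "\<beta> \<noteq> - \<gamma>" if "\<beta> \<in> P" for \<beta> using that P_not_minus[OF g] by auto
    moreover have "v \<bullet> refl_map a (w \<gamma>) < 0" "\<not> v \<bullet> w \<gamma> < 0" using wg aP by (auto simp: refl_map_self)
    ultimately show ?thesis using sgn g unfolding I' w_def[symmetric] I by blast
  qed
  show "inversions P (refl_word (a # bs)) = inversions P (refl_word bs) - {- \<gamma>}
      \<and> - \<gamma> \<in> inversions P (refl_word bs)" if g: "- \<gamma> \<in> P"
  proof -
    have "\<beta> \<noteq> \<gamma>" if "\<beta> \<in> P" for \<beta> using that P_not_minus[OF g] by auto
    moreover have "\<not> v \<bullet> refl_map a (w (- \<gamma>)) < 0" "v \<bullet> w (- \<gamma>) < 0"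
      using wg aP by (auto simp: refl_map_self wneg refl_map_neg)
    ultimately show ?thesis using sgn g unfolding I' w_def[symmetric] I by blast
  qed
qed

lemma finite_inversions: "finite (inversions P w)"
  by (rule finite_subset[OF _ finite_P]) (auto simp: inversions_def)

text \<open>A word with as many letters as inversions is carried along. A letter that creates an
  inversion is prepended to it; one that removes an inversion is absorbed by
  \<open>exchange\<close>, which shortens the word by one.\<close>

lemma reduced_word:
  "as \<in> lists D \<Longrightarrow> card (inversions P (refl_word as)) \<le> length as
    \<and> (\<exists>bs\<in>lists D. refl_word bs = refl_word as \<and> length bs = card (inversions P (refl_word as)))"
proof (induction as)
  case Nil
  have "inversions P (refl_word []) = {}" using inversions_word[of "[]"] P_pos by force
  then have "card (inversions P (refl_word [])) = 0" by (simp only: card.empty)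
  then show ?case by (simp only: list.size) (intro conjI bexI[of _ "[]"], auto)
next
  case (Cons a as)
  have ad: "a \<in> D" "as \<in> lists D" using Cons.prems by auto
  then obtain bs where bs: "bs \<in> lists D" "refl_word bs = refl_word as"
    "length bs = card (inversions P (refl_word as))" and le: "card (inversions P (refl_word as)) \<le> length as"
    using Cons.IH by auto
  define \<gamma> where "\<gamma> = refl_word (rev bs) a"
  have "rev bs \<in> lists D" using bs by auto
  then have "\<gamma> \<in> \<Phi>" unfolding \<gamma>_def using refl_word_D_root P_root D_P ad(1) by blast
  then consider "\<gamma> \<in> P" | "- \<gamma> \<in> P" using P_cases by blast
  then show ?case
  proof cases
    case 1
    note st = inversions_step(1)[OF ad(1) bs(1) \<gamma>_def 1]
    have e: "refl_word (a # bs) = refl_word (a # as)" using bs by simp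
    have c: "card (inversions P (refl_word (a # as))) = Suc (length bs)"
      using st bs finite_inversions unfolding e by (simp add: card_insert_if)
    have "a # bs \<in> lists D" using ad bs by simp
    then show ?thesis using e c le bs(3) by (intro conjI bexI[of _ "a # bs"]) (simp_all del: refl_word_Cons)
  next
    case 2
    note st = inversions_step(2)[OF ad(1) bs(1) \<gamma>_def 2]
    have e: "refl_word (a # bs) = refl_word (a # as)" using bs by simp
    have c: "card (inversions P (refl_word (a # as))) = length bs - 1"
      using st bs finite_inversions unfolding e by (simp add: card_Diff_singleton_if)
    have "refl_word bs \<gamma> = a" by (simp add: \<gamma>_def)
    from exchange[OF bs(1) D_P[OF ad(1)] 2 this] obtain cs
      where "cs \<in> lists D" "Suc (length cs) = length bs" "refl_word cs = refl_map a \<circ> refl_word bs"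
      by blast
    then have "cs \<in> lists D" "length cs = length bs - 1" "refl_word cs = refl_word (a # as)"
      using bs by auto
    then show ?thesis using le bs c by (intro conjI bexI[of _ cs]) (simp_all del: refl_word_Cons)
  qed
qed

lemma weyl_length_eq:
  assumes "w \<in> weyl \<Phi>"
  shows "weyl_length P w = card (inversions P w)"
proof -
  obtain as where as: "as \<in> lists D" "w = refl_word as" using weyl_simple_word assms by blast
  show ?thesis unfolding weyl_length_def
  proof (rule Least_equality)
    show "\<exists>\<alpha>s\<in>lists D. length \<alpha>s = card (inversions P w) \<and> w = refl_word \<alpha>s"
      using reduced_word[OF as(1)] as(2) by metis
    show "\<And>n. \<exists>\<alpha>s\<in>lists D. length \<alpha>s = n \<and> w = refl_word \<alpha>s \<Longrightarrow> card (inversions P w) \<le> n"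
      using reduced_word by blast
  qed
qed

text \<open>Equal inversion sets mean that \<open>w\<close> composed with the inverse of
  \<open>w'\<close> inverts no positive root; its reduced word is then empty.\<close>

lemma weyl_unique:
  assumes "w \<in> weyl \<Phi>" "w' \<in> weyl \<Phi>" "inversions P w = inversions P w'"
  shows "w = w'"
proof -
  obtain as where as: "as \<in> lists D" "w = refl_word as" using weyl_simple_word assms by blast
  obtain bs where bs: "bs \<in> lists D" "w' = refl_word bs" using weyl_simple_word assms by blast
  have pos: "v \<bullet> w \<beta> < 0 \<longleftrightarrow> v \<bullet> w' \<beta> < 0" if "\<beta> \<in> P" for \<beta>
    using assms(3) inversions_word[OF lists_D[OF as(1)]] inversions_word[OF lists_D[OF bs(1)]] as bs that
    by blast
  have "\<not> v \<bullet> w (refl_word (rev bs) \<beta>) < 0" if b: "\<beta> \<in> P" for \<beta>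
  proof -
    define \<gamma> where "\<gamma> = refl_word (rev bs) \<beta>"
    have "rev bs \<in> lists D" using bs by auto
    then have g: "\<gamma> \<in> \<Phi>" unfolding \<gamma>_def using refl_word_D_root P_root b by blast
    have w'g: "w' \<gamma> = \<beta>" by (simp add: \<gamma>_def bs)
    have gw: "v \<bullet> w \<gamma> \<noteq> 0" using generic refl_word_D_root[OF as(1) g] as(2) by simp
    from P_cases[OF g] show ?thesis
    proof
      assume "\<gamma> \<in> P"
      then show ?thesis using pos w'g P_pos[OF b] \<gamma>_def by force
    next
      assume m: "- \<gamma> \<in> P"
      have "v \<bullet> w' (- \<gamma>) < 0" using P_pos[OF b] w'g by (simp add: bs refl_word_neg)
      then have "v \<bullet> w (- \<gamma>) < 0" using pos m by blast
      then show ?thesis by (simp add: as refl_word_neg \<gamma>_def)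
    qed
  qed
  moreover have ab: "as @ rev bs \<in> lists D" using as bs by auto
  ultimately have "inversions P (refl_word (as @ rev bs)) = {}"
    using inversions_word[OF lists_D[OF ab]] as(2) by simp
  then have "card (inversions P (refl_word (as @ rev bs))) = 0" by (simp only: card.empty)
  then obtain cs where "refl_word cs = refl_word (as @ rev bs)" "length cs = 0"
    using reduced_word[OF ab] by metis
  then have "refl_word as (refl_word (rev bs) x) = x" for x by (simp add: fun_eq_iff)
  then have "w (refl_word (rev bs) x) = x" for x by (simp add: as)
  then show ?thesis using bs by (metis ext refl_word_rev')
qed

text \<open>Together with \<open>weyl_functional\<close> this turns statements about Weyl group
  elements into statements about signs of generic functionals. It also settles the definite
  description in \<open>weyl_restrict\<close>, as a generic functional stays generic on a
  subsystem.\<close>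

lemma weyl_exists:
  assumes "\<And>\<beta>. \<beta> \<in> \<Phi> \<Longrightarrow> u \<bullet> \<beta> \<noteq> 0"
  shows "\<exists>!w. w \<in> weyl \<Phi> \<and> inversions P w = {\<beta>\<in>P. u \<bullet> \<beta> < 0}"
proof -
  obtain as where as: "as \<in> lists D" "\<forall>\<beta>\<in>\<Phi>. v \<bullet> refl_word as \<beta> < 0 \<longleftrightarrow> u \<bullet> \<beta> < 0"
    using word_of_functional[of u] assms by blast
  have "refl_word as \<in> weyl \<Phi>" unfolding weyl_def using lists_D[OF as(1)] by (rule imageI)
  moreover have "inversions P (refl_word as) = {\<beta>\<in>P. u \<bullet> \<beta> < 0}"
    using inversions_word[OF lists_D[OF as(1)]] as(2) P_root by auto
  ultimately show ?thesis using weyl_unique by metis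
qed

lemma weyl_restrict_subspace:
  assumes "w \<in> weyl \<Phi>" "subspace U"
  shows "weyl_restrict P w (\<Phi> \<inter> U) \<in> weyl (\<Phi> \<inter> U)"
    and "inversions (P \<inter> U) (weyl_restrict P w (\<Phi> \<inter> U)) = inversions P w \<inter> U"
proof -
  obtain u where u: "\<And>\<beta>. \<beta> \<in> \<Phi> \<Longrightarrow> u \<bullet> \<beta> \<noteq> 0" "inversions P w = {\<beta>\<in>P. u \<bullet> \<beta> < 0}"
    using weyl_functional[OF assms(1)] by blast
  interpret U: chamber "\<Phi> \<inter> U" "P \<inter> U" v by (rule chamber_Int_subspace[OF assms(2)])
  have "\<exists>!x. x \<in> weyl (\<Phi> \<inter> U) \<and> inversions (P \<inter> U) x = {\<beta>\<in>P \<inter> U. u \<bullet> \<beta> < 0}"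
    by (rule U.weyl_exists) (use u in auto)
  moreover have "{\<beta>\<in>P \<inter> U. u \<bullet> \<beta> < 0} = inversions P w \<inter> (\<Phi> \<inter> U)"
    using u(2) P_root by auto
  moreover have PU: "P \<inter> (\<Phi> \<inter> U) = P \<inter> U" using P_root by auto
  ultimately have ex: "\<exists>!x. x \<in> weyl (\<Phi> \<inter> U)
      \<and> inversions (P \<inter> (\<Phi> \<inter> U)) x = inversions P w \<inter> (\<Phi> \<inter> U)" by simp
  note r = theI'[OF ex, folded weyl_restrict_def]
  show "weyl_restrict P w (\<Phi> \<inter> U) \<in> weyl (\<Phi> \<inter> U)" using r by blast
  show "inversions (P \<inter> U) (weyl_restrict P w (\<Phi> \<inter> U)) = inversions P w \<inter> U"
    using r PU by (auto simp: inversions_def P_root)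
qed

end

section \<open>Pivots and separability\<close>

text \<open>For irreducible \<open>\<Phi>\<close> this is the pivot condition of rule \<open>irreducible\<close> of \<^const>\<open>separable\<close>, with the
  fundamental coweight relaxed to any nonzero dominant functional. In contrast to a choice of
  simple root, a functional restricts to subsystems.\<close>

definition pivotal :: "'a::euclidean_space set \<Rightarrow> 'a set \<Rightarrow> bool" where
  "pivotal Q J \<longleftrightarrow> (\<exists>\<omega>. (\<forall>\<beta>\<in>Q. 0 \<le> \<omega> \<bullet> \<beta>) \<and> (\<exists>\<beta>\<in>Q. 0 < \<omega> \<bullet> \<beta>)
     \<and> ({\<beta>\<in>Q. 0 < \<omega> \<bullet> \<beta>} \<subseteq> J \<or> {\<beta>\<in>Q. 0 < \<omega> \<bullet> \<beta>} \<inter> J = {}))"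

definition all_pivotal :: "'a::euclidean_space set \<Rightarrow> 'a set \<Rightarrow> 'a set \<Rightarrow> bool" where
  "all_pivotal \<Phi> P J \<longleftrightarrow>
     (\<forall>U. subspace U \<and> irreducible_roots (\<Phi> \<inter> U) \<longrightarrow> pivotal (P \<inter> U) (J \<inter> U))"

definition minimal_nonpivotal :: "'a::euclidean_space set \<Rightarrow> 'a set \<Rightarrow> 'a set \<Rightarrow> bool" where
  "minimal_nonpivotal \<Phi> P J \<longleftrightarrow> irreducible_roots \<Phi> \<and> \<not> pivotal P J
     \<and> (\<forall>U. subspace U \<and> \<Phi> \<inter> U \<noteq> \<Phi> \<and> irreducible_roots (\<Phi> \<inter> U) \<longrightarrow> pivotal (P \<inter> U) (J \<inter> U))"

lemma pivotal_singleton: "\<gamma> \<noteq> 0 \<Longrightarrow> pivotal {\<gamma>} J"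
  unfolding pivotal_def by (rule exI[of _ \<gamma>]) auto

section \<open>Irreducibility and components\<close>

lemma irreducible_roots_no_split:
  assumes "irreducible_roots C" "A \<noteq> {}" "B \<noteq> {}" "A \<inter> B = {}" "A \<union> B = C" "\<forall>\<alpha>\<in>A. \<forall>\<beta>\<in>B. \<alpha> \<bullet> \<beta> = 0"
  shows False
proof -
  have "\<exists>A B. A \<noteq> {} \<and> B \<noteq> {} \<and> A \<inter> B = {} \<and> A \<union> B = C \<and> (\<forall>\<alpha>\<in>A. \<forall>\<beta>\<in>B. \<alpha> \<bullet> \<beta> = 0)"
    by (intro exI[of _ A] exI[of _ B] conjI assms(2-6))
  then show False using assms(1) unfolding irreducible_roots_def by (rule notE[OF conjunct2, rotated])
qed

lemma irreducible_rootsD: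
  assumes "irreducible_roots C" "0 \<notin> C" "C \<subseteq> A \<union> B" "\<forall>\<alpha>\<in>A. \<forall>\<beta>\<in>B. \<alpha> \<bullet> \<beta> = 0"
  shows "C \<subseteq> A \<or> C \<subseteq> B"
proof (rule ccontr)
  assume n: "\<not> ?thesis"
  have "x = 0" if "x \<in> A" "x \<in> B" for x using assms(4) that by (metis inner_eq_zero_iff)
  then have "(C \<inter> A) \<inter> (C \<inter> B) = {}" using assms(2) by blast
  moreover have "C \<inter> A \<noteq> {}" "C \<inter> B \<noteq> {}" "(C \<inter> A) \<union> (C \<inter> B) = C" using n assms(3) by blast+
  ultimately show False using assms(1,4) unfolding irreducible_roots_def by (metis IntD2)
qed

lemma irreducible_rootsI:
  assumes "C \<noteq> {}" "\<And>A B. A \<noteq> {} \<Longrightarrow> B \<noteq> {} \<Longrightarrow> A \<inter> B = {} \<Longrightarrow> A \<union> B = C \<Longrightarrow>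
    \<forall>\<alpha>\<in>A. \<forall>\<beta>\<in>B. \<alpha> \<bullet> \<beta> = 0 \<Longrightarrow> False"
  shows "irreducible_roots C"
  using assms unfolding irreducible_roots_def by blast

lemma inner_span_zero:
  assumes "\<And>a. a \<in> A \<Longrightarrow> y \<bullet> a = 0" "x \<in> span A"
  shows "y \<bullet> x = 0"
  using assms(2) by (induction rule: span_induct_alt) (auto simp: inner_add_right assms(1))

text \<open>A smallest set that contains \<beta> and is orthogonal to the rest of \<Phi> is
  irreducible: in a splitting, the half with \<beta> would be a smaller such set.\<close>

lemma component_exists:
  assumes "finite \<Phi>" "\<beta> \<in> \<Phi>"
  obtains C where "C \<in> irreducible_components \<Phi>" "\<beta> \<in> C"
proof -
  define T where "T = {C. C \<subseteq> \<Phi> \<and> \<beta> \<in> C \<and> (\<forall>\<alpha>\<in>C. \<forall>\<gamma>\<in>\<Phi> - C. \<alpha> \<bullet> \<gamma> = 0)}"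
  have "\<Phi> \<in> T" using assms by (auto simp: T_def)
  then obtain C where C: "C \<in> T" and minC: "\<And>C'. C' \<in> T \<Longrightarrow> card C \<le> card C'"
    using ex_has_least_nat[of "\<lambda>C. C \<in> T" \<Phi> card] by blast
  have "irreducible_roots C"
  proof (rule irreducible_rootsI)
    show "C \<noteq> {}" using C by (auto simp: T_def)
    fix A B assume AB: "A \<noteq> {}" "B \<noteq> {}" "A \<inter> B = {}" "A \<union> B = C" "\<forall>\<alpha>\<in>A. \<forall>\<beta>\<in>B. \<alpha> \<bullet> \<beta> = 0"
    have fin: "finite C" using C assms(1) finite_subset by (auto simp: T_def)
    have C': "C \<subseteq> \<Phi>" "\<beta> \<in> C" "\<And>\<alpha> \<gamma>. \<alpha> \<in> C \<Longrightarrow> \<gamma> \<in> \<Phi> - C \<Longrightarrow> \<alpha> \<bullet> \<gamma> = 0"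
      using C by (auto simp: T_def)
    have BA: "\<forall>\<alpha>\<in>B. \<forall>\<beta>\<in>A. \<alpha> \<bullet> \<beta> = 0" using AB(5) by (metis inner_commute)
    have "X \<in> T" if X: "\<beta> \<in> X" "X \<union> Y = C" "\<forall>\<alpha>\<in>X. \<forall>\<beta>\<in>Y. \<alpha> \<bullet> \<beta> = 0" for X Y
    proof -
      have "\<alpha> \<bullet> \<gamma> = 0" if "\<alpha> \<in> X" "\<gamma> \<in> \<Phi> - X" for \<alpha> \<gamma>
        using that X C'(3)[of \<alpha> \<gamma>] by blast
      then show ?thesis using X C' by (auto simp: T_def)
    qed
    from this[of A B] this[of B A] have "A \<in> T \<or> B \<in> T" using C'(2) AB BA by blast
    moreover have "card A < card C" "card B < card C" using AB fin by (auto intro!: psubset_card_mono)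
    ultimately show False using minC by fastforce
  qed
  then show thesis using that[of C] C by (auto simp: T_def irreducible_components_def)
qed

text \<open>A root in the span of \<open>C\<close> but outside \<open>C\<close> would be orthogonal
  to \<open>C\<close>, hence to itself. Thereby rule \<open>reducible\<close> too restricts to
  sections by linear subspaces.\<close>

lemma component_eq_span:
  assumes "C \<in> irreducible_components \<Phi>" "0 \<notin> \<Phi>"
  shows "C = \<Phi> \<inter> span C"
proof
  show "C \<subseteq> \<Phi> \<inter> span C" using assms span_base by (auto simp: irreducible_components_def)
  show "\<Phi> \<inter> span C \<subseteq> C"
  proof (rule ccontr)
    assume "\<not> ?thesis"
    then obtain x where x: "x \<in> \<Phi>" "x \<in> span C" "x \<notin> C" by blast
    then have "x \<bullet> a = 0" if "a \<in> C" for a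
      using assms that by (auto simp: irreducible_components_def inner_commute)
    then have "x \<bullet> x = 0" using inner_span_zero x(2) by blast
    then show False using x assms by simp
  qed
qed

section \<open>Separability as a pivot condition\<close>

lemma is_pattern_chamber:
  assumes "is_pattern (w, \<Phi>, P)"
  obtains v where "chamber \<Phi> P v"
  using assms chamberE by auto

lemma is_pattern_restrict:
  assumes "is_pattern (w, \<Phi>, P)" "subspace U"
  shows "is_pattern (weyl_restrict P w (\<Phi> \<inter> U), \<Phi> \<inter> U, P \<inter> U)"
    and "inversions (P \<inter> U) (weyl_restrict P w (\<Phi> \<inter> U)) = inversions P w \<inter> U"
proof -
  obtain v where "chamber \<Phi> P v" using is_pattern_chamber assms by blast
  then interpret chamber \<Phi> P v .
  interpret U: chamber "\<Phi> \<inter> U" "P \<inter> U" v by (rule chamber_Int_subspace[OF assms(2)])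
  show "is_pattern (weyl_restrict P w (\<Phi> \<inter> U), \<Phi> \<inter> U, P \<inter> U)"
    "inversions (P \<inter> U) (weyl_restrict P w (\<Phi> \<inter> U)) = inversions P w \<inter> U"
    using weyl_restrict_subspace[of w U] assms U.rs U.positive_systemI by auto
qed

lemma is_pattern_subset: "is_pattern (w, \<Phi>, P) \<Longrightarrow> P \<subseteq> \<Phi>"
  by (auto simp: positive_system_def)

lemma is_pattern_zero: "is_pattern (w, \<Phi>, P) \<Longrightarrow> 0 \<notin> \<Phi>"
  by (auto simp: root_system_def)

text \<open>An irreducible subsystem of a reducible system lies in one component. For rule
  \<open>irreducible\<close>, the coweight of \<alpha> is either a pivot of the subsystem or zero on
  all of it, and in the second case the subsystem lies in the one spanned by the other simple
  roots.\<close>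

lemma separable_imp_all_pivotal:
  "separable p \<Longrightarrow> p = (w, \<Phi>, P) \<Longrightarrow> is_pattern p \<Longrightarrow> all_pivotal \<Phi> P (inversions P w)"
proof (induction arbitrary: w \<Phi> P rule: separable.induct)
  case (type_A1 \<alpha> w' P')
  then have e: "\<Phi> = {\<alpha>, - \<alpha>}" and p: "is_pattern (w, {\<alpha>, - \<alpha>}, P)" by auto
  obtain v where "chamber {\<alpha>, - \<alpha>} P v" using is_pattern_chamber[OF p] by blast
  then interpret chamber "{\<alpha>, - \<alpha>}" P v .
  have "P = {\<alpha>} \<or> P = {- \<alpha>}"
    using P_cases[of \<alpha>] P_not_minus[of \<alpha>] P_not_minus[of "- \<alpha>"] P_root by auto
  then obtain \<gamma> where g: "P = {\<gamma>}" "\<gamma> \<noteq> 0" using type_A1 by force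
  show ?case unfolding all_pivotal_def e
  proof (intro allI impI)
    fix U assume U: "subspace U \<and> irreducible_roots ({\<alpha>, - \<alpha>} \<inter> U)"
    then have "\<alpha> \<in> U \<or> - \<alpha> \<in> U" using type_A1 by (auto simp: irreducible_roots_def)
    then have "\<alpha> \<in> U" "- \<alpha> \<in> U" using U subspace_neg[of U] by fastforce+
    then have "P \<inter> U = {\<gamma>}" using g P_root by auto
    then show "pivotal (P \<inter> U) (inversions P w \<inter> U)" using pivotal_singleton g by metis
  qed
next
  case (reducible \<Phi>' P' w')
  then have e: "\<Phi>' = \<Phi>" "P' = P" "w' = w" and p: "is_pattern (w, \<Phi>, P)" by auto
  have z: "0 \<notin> \<Phi>" using p is_pattern_zero by blast
  show ?case unfolding all_pivotal_def
  proof (intro allI impI)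
    fix U assume U: "subspace U \<and> irreducible_roots (\<Phi> \<inter> U)"
    then obtain \<beta> where b: "\<beta> \<in> \<Phi> \<inter> U" by (auto simp: irreducible_roots_def)
    have "finite \<Phi>" using p by (auto simp: root_system_def)
    then obtain C where C: "C \<in> irreducible_components \<Phi>" "\<beta> \<in> C" using component_exists b by blast
    have "\<Phi> \<inter> U \<subseteq> C \<or> \<Phi> \<inter> U \<subseteq> \<Phi> - C"
      using irreducible_rootsD[of "\<Phi> \<inter> U" C "\<Phi> - C"] U z C by (auto simp: irreducible_components_def)
    then have sub: "\<Phi> \<inter> U \<subseteq> C" using b C by blast
    have Ceq: "C = \<Phi> \<inter> span C" using component_eq_span C z by blast
    note r = is_pattern_restrict[OF p subspace_span[of C], folded Ceq]
    have PC: "P \<inter> span C = P \<inter> C" using Ceq is_pattern_subset[OF p] by blast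
    have ap: "all_pivotal C (P \<inter> C) (inversions (P \<inter> C) (weyl_restrict P w C))"
      using reducible.IH[of C] r C unfolding e PC by blast
    have IP: "inversions P w \<subseteq> P" by (auto simp: inversions_def)
    have s: "C \<inter> U = \<Phi> \<inter> U" "P \<inter> C \<inter> U = P \<inter> U" "inversions P w \<inter> span C \<inter> U = inversions P w \<inter> U"
      using sub Ceq is_pattern_subset[OF p] IP by blast+
    have "pivotal (P \<inter> C \<inter> U) (inversions (P \<inter> C) (weyl_restrict P w C) \<inter> U)"
      using ap[unfolded all_pivotal_def, rule_format, of U] U s(1) by simp
    then show "pivotal (P \<inter> U) (inversions P w \<inter> U)"
      using s r(2) PC by simp
  qed
next
  case (irreducible \<Phi>1 \<alpha> P1 \<Phi>' w1)
  then have e: "\<Phi>1 = \<Phi>" "P1 = P" "w1 = w" and p: "is_pattern (w, \<Phi>, P)" by auto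
  obtain v where "chamber \<Phi> P v" using is_pattern_chamber p by blast
  then interpret chamber \<Phi> P v .
  define S where "S = span (D - {\<alpha>})"
  have a: "\<alpha> \<in> D" using irreducible e by simp
  note r = is_pattern_restrict[OF p, of S]
  have S: "subspace S" by (simp add: S_def)
  have \<Phi>': "\<Phi>' = \<Phi> \<inter> S" using irreducible e by (simp add: S_def)
  have PS: "P \<inter> (\<Phi> \<inter> S) = P \<inter> S" using P_root by auto
  have ap: "all_pivotal (\<Phi> \<inter> S) (P \<inter> S) (inversions P w \<inter> S)"
    using irreducible.IH[unfolded e \<Phi>' PS, OF refl r(1)[OF S]] r(2)[OF S] by simp
  have piv: "{\<beta>\<in>P. 0 < cw \<alpha> \<bullet> \<beta>} \<subseteq> inversions P w \<or> {\<beta>\<in>P. 0 < cw \<alpha> \<bullet> \<beta>} \<inter> inversions P w = {}"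
    using irreducible.hyps(5) root_le_iff[OF a] unfolding e by (auto simp: subset_iff disjoint_iff)
  show ?case unfolding all_pivotal_def
  proof (intro allI impI)
    fix U assume U: "subspace U \<and> irreducible_roots (\<Phi> \<inter> U)"
    show "pivotal (P \<inter> U) (inversions P w \<inter> U)"
    proof (cases "\<exists>\<beta>\<in>P \<inter> U. 0 < cw \<alpha> \<bullet> \<beta>")
      case True
      then show ?thesis unfolding pivotal_def using piv P_cw_nonneg a by (intro exI[of _ "cw \<alpha>"]) blast
    next
      case False
      have "\<beta> \<in> S" if "\<beta> \<in> P \<inter> U" for \<beta>
      proof -
        have "cw \<alpha> \<bullet> \<beta> = 0" using False that P_cw_nonneg[of \<beta> \<alpha>] a by force
        then have "\<beta> = (\<Sum>\<delta>\<in>D - {\<alpha>}. (cw \<delta> \<bullet> \<beta>) *\<^sub>R \<delta>)"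
          using P_expand[of \<beta>] that a finite_D by (simp add: sum.remove)
        also have "\<dots> \<in> S" unfolding S_def by (intro span_sum span_scale span_base) auto
        finally show ?thesis .
      qed
      then have PU: "P \<inter> U \<subseteq> S" by blast
      have "\<beta> \<in> S" if "\<beta> \<in> \<Phi> \<inter> U" for \<beta>
      proof -
        have "\<beta> \<in> P \<inter> U \<or> - \<beta> \<in> P \<inter> U" using P_cases[of \<beta>] that subspace_neg[of U \<beta>] U by blast
        then show ?thesis using PU subspace_neg[OF S, of "- \<beta>"] by auto
      qed
      then have s: "\<Phi> \<inter> S \<inter> U = \<Phi> \<inter> U" "P \<inter> S \<inter> U = P \<inter> U" "inversions P w \<inter> S \<inter> U = inversions P w \<inter> U"
        using PU by (auto simp: inversions_def)
      show ?thesis using ap[unfolded all_pivotal_def, rule_format, of U] U s by simp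
    qed
  qed
qed

text \<open>A pivot is positive on some simple root \<alpha>, hence on every root above \<alpha>, so
  \<alpha> meets the condition of rule \<open>irreducible\<close>. The induction goes through
  because sections of a section are again sections of \<Phi>.\<close>

lemma all_pivotal_imp_separable:
  "is_pattern (w, \<Phi>, P) \<Longrightarrow> all_pivotal \<Phi> P (inversions P w) \<Longrightarrow> separable (w, \<Phi>, P)"
proof (induction "card \<Phi>" arbitrary: w \<Phi> P rule: less_induct)
  case less
  obtain v where "chamber \<Phi> P v" using is_pattern_chamber less.prems by blast
  then interpret chamber \<Phi> P v .
  have sub: "separable (weyl_restrict P w (\<Phi> \<inter> S), \<Phi> \<inter> S, P \<inter> S)"
    if S: "subspace S" "\<Phi> \<inter> S \<noteq> \<Phi>" for S
  proof (rule less.hyps)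
    show "card (\<Phi> \<inter> S) < card \<Phi>" using S finite_roots by (intro psubset_card_mono) auto
    note r = is_pattern_restrict[OF less.prems(1) S(1)]
    show "is_pattern (weyl_restrict P w (\<Phi> \<inter> S), \<Phi> \<inter> S, P \<inter> S)" by (rule r)
    show "all_pivotal (\<Phi> \<inter> S) (P \<inter> S) (inversions (P \<inter> S) (weyl_restrict P w (\<Phi> \<inter> S)))"
      unfolding all_pivotal_def r(2)
    proof (intro allI impI)
      fix U assume "subspace U \<and> irreducible_roots (\<Phi> \<inter> S \<inter> U)"
      then show "pivotal (P \<inter> S \<inter> U) (inversions P w \<inter> S \<inter> U)"
        using less.prems(2)[unfolded all_pivotal_def, rule_format, of "S \<inter> U"] S
        by (simp add: subspace_inter Int_assoc)
    qed
  qed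
  show ?case
  proof (cases "irreducible_roots \<Phi>")
    case False
    show ?thesis
    proof (rule separable.reducible[OF False])
      fix C assume C: "C \<in> irreducible_components \<Phi>"
      then have Ceq: "C = \<Phi> \<inter> span C" using component_eq_span zero_not_root by blast
      moreover have "C \<noteq> \<Phi>" using C False by (auto simp: irreducible_components_def)
      moreover have "P \<inter> span C = P \<inter> C" using Ceq P_root by blast
      ultimately show "separable (weyl_restrict P w C, C, P \<inter> C)" using sub[of "span C"] by simp
    qed
  next
    case True
    then have "pivotal (P \<inter> UNIV) (inversions P w \<inter> UNIV)"
      using less.prems(2)[unfolded all_pivotal_def, rule_format, of UNIV] by simp
    then obtain \<omega> where w: "\<forall>\<beta>\<in>P. 0 \<le> \<omega> \<bullet> \<beta>" "\<exists>\<beta>\<in>P. 0 < \<omega> \<bullet> \<beta>"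
      "{\<beta>\<in>P. 0 < \<omega> \<bullet> \<beta>} \<subseteq> inversions P w \<or> {\<beta>\<in>P. 0 < \<omega> \<bullet> \<beta>} \<inter> inversions P w = {}"
      by (auto simp: pivotal_def)
    then obtain \<alpha> where a: "\<alpha> \<in> D" "0 < \<omega> \<bullet> \<alpha>" using P_simple_pos by blast
    have up: "0 < \<omega> \<bullet> \<beta>" if "\<beta> \<in> P" "root_le P \<alpha> \<beta>" for \<beta>
    proof -
      have "0 < (cw \<alpha> \<bullet> \<beta>) * (\<alpha> \<bullet> \<omega>)" using that root_le_iff a by (simp add: inner_commute)
      also have "\<dots> \<le> (\<Sum>\<delta>\<in>D. (cw \<delta> \<bullet> \<beta>) * (\<delta> \<bullet> \<omega>))"
        using a finite_D w(1) that P_cw_nonneg D_P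
        by (intro member_le_sum) (auto simp: inner_commute[of _ \<omega>])
      also have "\<dots> = \<omega> \<bullet> \<beta>" using P_inner_expand[OF that(1), of \<omega>] by (simp only: inner_commute[of \<omega> \<beta>])
      finally show ?thesis .
    qed
    have nm: "\<alpha> \<notin> span (D - {\<alpha>})" using D_independent a unfolding dependent_def by blast
    have ne: "\<Phi> \<inter> span (D - {\<alpha>}) \<noteq> \<Phi>" using nm a D_P P_root by blast
    have "P \<inter> (\<Phi> \<inter> span (D - {\<alpha>})) = P \<inter> span (D - {\<alpha>})" using P_root by blast
    then show ?thesis using sub[OF subspace_span ne] up w(3)
      by (intro separable.irreducible[OF True a(1) refl]) auto
  qed
qed

lemma separable_iff: "is_pattern (w, \<Phi>, P) \<Longrightarrow> separable (w, \<Phi>, P) \<longleftrightarrow> all_pivotal \<Phi> P (inversions P w)"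
  using separable_imp_all_pivotal all_pivotal_imp_separable by blast

section \<open>Transport along isomorphisms of root systems\<close>

lemma root_iso_inverse:
  assumes "root_iso f \<Phi> \<Psi>"
  obtains g where "root_iso g \<Psi> \<Phi>" "\<And>x. x \<in> span \<Phi> \<Longrightarrow> g (f x) = x"
proof -
  have f: "linear f" "inj_on f (span \<Phi>)" "f ` \<Phi> = \<Psi>"
    "\<And>\<alpha> \<beta>. \<alpha> \<in> \<Phi> \<Longrightarrow> \<beta> \<in> \<Phi> \<Longrightarrow> cartan (f \<beta>) (f \<alpha>) = cartan \<beta> \<alpha>"
    using assms by (auto simp: root_iso_def)
  obtain g where g: "linear g" "\<And>x. x \<in> span \<Phi> \<Longrightarrow> g (f x) = x"
    using linear_inj_on_left_inverse[OF f(1,2)] by blast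
  have gf: "g (f x) = x" if "x \<in> \<Phi>" for x using g(2) span_base that by blast
  have "span \<Psi> = f ` span \<Phi>" using f(1,3) linear_span_image by metis
  then have "inj_on g (span \<Psi>)" using g(2) by (auto intro!: inj_onI)
  moreover have "g ` \<Psi> = \<Phi>" unfolding f(3)[symmetric] using gf by force
  moreover have "cartan (g \<beta>) (g \<alpha>) = cartan \<beta> \<alpha>" if "\<alpha> \<in> \<Psi>" "\<beta> \<in> \<Psi>" for \<alpha> \<beta>
    using that f(3,4) gf by auto
  ultimately show thesis using that g unfolding root_iso_def by blast
qed

lemma pattern_iso_sym:
  assumes "is_pattern p" "pattern_iso p q"
  shows "pattern_iso q p"
proof -
  obtain w \<Phi> P u \<Psi> Q where pq: "p = (w, \<Phi>, P)" "q = (u, \<Psi>, Q)" by (cases p, cases q) auto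
  obtain f where f: "root_iso f \<Phi> \<Psi>" "f ` P = Q" "f ` inversions P w = inversions Q u"
    using assms(2) by (auto simp: pattern_iso_def pq)
  obtain g where g: "root_iso g \<Psi> \<Phi>" "\<And>x. x \<in> span \<Phi> \<Longrightarrow> g (f x) = x" using root_iso_inverse f(1) by blast
  have "P \<subseteq> \<Phi>" using is_pattern_subset assms(1) pq by blast
  then have "g (f x) = x" if "x \<in> P" for x using that g(2) span_base by blast
  then have im: "g ` f ` A = A" if "A \<subseteq> P" for A using that by force
  have "inversions P w \<subseteq> P" by (auto simp: inversions_def)
  then have "g ` Q = P" "g ` inversions Q u = inversions P w"
    using im[of P] im[of "inversions P w"] by (simp_all add: f(2,3))
  then show ?thesis using g(1) by (auto simp: pattern_iso_def pq)
qed

text \<open>\<open>U\<close> is the preimage of \<open>U'\<close> inside \<open>V\<close>, and a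
  pivot is carried over by the adjoint of a left inverse of \<open>f\<close>. Irreducibility
  transfers although \<open>f\<close> need not be an isometry, because Cartan integers detect
  orthogonality. The inclusion in \<open>V\<close> and the image of \<open>\<Phi> \<inter> U\<close>
  are recorded so that properness can be compared on both sides.\<close>

lemma root_iso_pivotal:
  assumes "root_iso f (\<Phi> \<inter> V) \<Psi>" "f ` (P \<inter> V) = Q" "f ` (J \<inter> V) = J'" "subspace V" "0 \<notin> \<Phi>"
    "P \<subseteq> \<Phi>" "J \<subseteq> P" "subspace U'" "irreducible_roots (\<Psi> \<inter> U')"
  obtains U where "subspace U" "U \<subseteq> V" "irreducible_roots (\<Phi> \<inter> U)" "f ` (\<Phi> \<inter> U) = \<Psi> \<inter> U'"
    "pivotal (P \<inter> U) (J \<inter> U) \<longrightarrow> pivotal (Q \<inter> U') (J' \<inter> U')"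
proof -
  have f: "linear f" "inj_on f (span (\<Phi> \<inter> V))" "f ` (\<Phi> \<inter> V) = \<Psi>"
    "\<And>\<alpha> \<beta>. \<alpha> \<in> \<Phi> \<inter> V \<Longrightarrow> \<beta> \<in> \<Phi> \<inter> V \<Longrightarrow> cartan (f \<beta>) (f \<alpha>) = cartan \<beta> \<alpha>"
    using assms(1) by (auto simp: root_iso_def)
  define U where "U = V \<inter> f -` U'"
  have U: "subspace U" unfolding U_def
    by (intro subspace_inter assms linear_subspace_vimage f)
  have im: "f ` (\<Phi> \<inter> U) = \<Psi> \<inter> U'" "f ` (P \<inter> U) = Q \<inter> U'" "f ` (J \<inter> U) = J' \<inter> U'"
    using f(3) assms(2,3) by (auto simp: U_def)
  obtain g where g: "linear g" "\<And>x. x \<in> span (\<Phi> \<inter> V) \<Longrightarrow> g (f x) = x"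
    using linear_inj_on_left_inverse[OF f(1,2)] by blast
  have gf: "g (f x) = x" if "x \<in> \<Phi> \<inter> V" for x using g(2) span_base that by blast
  have inj: "inj_on f (\<Phi> \<inter> V)" using gf by (rule inj_on_inverseI)
  have disj: "f ` X \<inter> f ` Y = {}" if "X \<inter> Y = {}" "X \<subseteq> \<Phi> \<inter> V" "Y \<subseteq> \<Phi> \<inter> V" for X Y
    using inj_on_image_Int[OF inj that(2,3)] that(1) by simp
  have orth: "f x \<bullet> f y = 0" if "x \<in> \<Phi> \<inter> V" "y \<in> \<Phi> \<inter> V" "x \<bullet> y = 0" for x y
  proof -
    have "cartan (f x) (f y) = 0" using f(4) that by (simp add: cartan_def)
    moreover have "f y \<noteq> 0" using gf[OF that(2)] assms(5) that(2) linear_0[OF g(1)] by force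
    ultimately show ?thesis by (simp add: cartan_def)
  qed
  have "irreducible_roots (\<Phi> \<inter> U)"
  proof (rule irreducible_rootsI)
    show "\<Phi> \<inter> U \<noteq> {}" using assms(9) im(1) by (auto simp: irreducible_roots_def)
    fix A B assume AB: "A \<noteq> {}" "B \<noteq> {}" "A \<inter> B = {}" "A \<union> B = \<Phi> \<inter> U" "\<forall>\<alpha>\<in>A. \<forall>\<beta>\<in>B. \<alpha> \<bullet> \<beta> = 0"
    have sub: "A \<subseteq> \<Phi> \<inter> V" "B \<subseteq> \<Phi> \<inter> V" using AB by (auto simp: U_def)
    have "f ` A \<inter> f ` B = {}" using disj AB(3) sub by blast
    moreover have "f ` A \<union> f ` B = \<Psi> \<inter> U'" using arg_cong[OF AB(4), of "image f"] im(1) by (simp add: image_Un)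
    moreover have "\<forall>\<alpha>\<in>f ` A. \<forall>\<beta>\<in>f ` B. \<alpha> \<bullet> \<beta> = 0" using orth AB(5) sub by blast
    moreover have "f ` A \<noteq> {}" "f ` B \<noteq> {}" using AB by auto
    ultimately show False by (intro irreducible_roots_no_split[OF assms(9)])
  qed
  moreover have "pivotal (Q \<inter> U') (J' \<inter> U')" if piv: "pivotal (P \<inter> U) (J \<inter> U)"
  proof -
    obtain \<omega> where w: "\<forall>\<beta>\<in>P \<inter> U. 0 \<le> \<omega> \<bullet> \<beta>" "\<exists>\<beta>\<in>P \<inter> U. 0 < \<omega> \<bullet> \<beta>"
      "{\<beta>\<in>P \<inter> U. 0 < \<omega> \<bullet> \<beta>} \<subseteq> J \<inter> U \<or> {\<beta>\<in>P \<inter> U. 0 < \<omega> \<bullet> \<beta>} \<inter> (J \<inter> U) = {}"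
      using piv by (auto simp: pivotal_def)
    define \<omega>' where "\<omega>' = adjoint g \<omega>"
    have w': "\<omega>' \<bullet> f x = \<omega> \<bullet> x" if "x \<in> P \<inter> U" for x
      using adjoint_works[OF g(1), of "f x" \<omega>] gf[of x] that assms(6)
      by (auto simp: \<omega>'_def inner_commute U_def)
    have imw: "{\<beta>\<in>Q \<inter> U'. 0 < \<omega>' \<bullet> \<beta>} = f ` {\<beta>\<in>P \<inter> U. 0 < \<omega> \<bullet> \<beta>}"
      unfolding im(2)[symmetric] using w' by auto
    have sV: "{\<beta>\<in>P \<inter> U. 0 < \<omega> \<bullet> \<beta>} \<subseteq> \<Phi> \<inter> V" "J \<inter> U \<subseteq> \<Phi> \<inter> V"
      using assms(6,7) by (auto simp: U_def)
    have "{\<beta>\<in>Q \<inter> U'. 0 < \<omega>' \<bullet> \<beta>} \<subseteq> J' \<inter> U' \<or> {\<beta>\<in>Q \<inter> U'. 0 < \<omega>' \<bullet> \<beta>} \<inter> (J' \<inter> U') = {}"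
      using w(3)
    proof
      assume "{\<beta>\<in>P \<inter> U. 0 < \<omega> \<bullet> \<beta>} \<subseteq> J \<inter> U"
      then show ?thesis unfolding imw im(3)[symmetric] by (intro disjI1 image_mono)
    next
      assume "{\<beta>\<in>P \<inter> U. 0 < \<omega> \<bullet> \<beta>} \<inter> (J \<inter> U) = {}"
      then show ?thesis unfolding imw im(3)[symmetric] using disj[OF _ sV] by (intro disjI2)
    qed
    moreover have "\<forall>\<beta>\<in>Q \<inter> U'. 0 \<le> \<omega>' \<bullet> \<beta>" "\<exists>\<beta>\<in>Q \<inter> U'. 0 < \<omega>' \<bullet> \<beta>"
      unfolding im(2)[symmetric] using w(1,2) w' by auto
    ultimately show ?thesis unfolding pivotal_def by blast
  qed
  ultimately show thesis using that[of U] U im(1) by (auto simp: U_def)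
qed

lemma all_pivotal_contains_via:
  assumes "is_pattern (w, \<Phi>, P)" "contains_via V (w, \<Phi>, P) (u, \<Psi>, Q)" "subspace V"
    "\<And>U. subspace U \<Longrightarrow> U \<subseteq> V \<Longrightarrow> irreducible_roots (\<Phi> \<inter> U) \<Longrightarrow> pivotal (P \<inter> U) (inversions P w \<inter> U)"
  shows "all_pivotal \<Psi> Q (inversions Q u)"
proof -
  obtain f where f: "root_iso f (\<Phi> \<inter> V) \<Psi>" "f ` (P \<inter> V) = Q" "f ` (inversions P w \<inter> V) = inversions Q u"
    using assms(2) by auto
  have sub: "P \<subseteq> \<Phi>" "0 \<notin> \<Phi>" "inversions P w \<subseteq> P"
    using is_pattern_subset[OF assms(1)] is_pattern_zero[OF assms(1)] by (auto simp: inversions_def)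
  show ?thesis unfolding all_pivotal_def
  proof (intro allI impI)
    fix U' assume U': "subspace U' \<and> irreducible_roots (\<Psi> \<inter> U')"
    show "pivotal (Q \<inter> U') (inversions Q u \<inter> U')"
      using root_iso_pivotal[OF f assms(3) sub(2,1,3) conjunct1[OF U'] conjunct2[OF U']] assms(4) by metis
  qed
qed

lemma separable_contains:
  assumes "is_pattern p" "is_pattern q" "separable p" "contains p q"
  shows "separable q"
proof -
  obtain w \<Phi> P u \<Psi> Q where pq: "p = (w, \<Phi>, P)" "q = (u, \<Psi>, Q)" by (cases p, cases q) auto
  obtain V where V: "subspace V" "contains_via V (w, \<Phi>, P) (u, \<Psi>, Q)"
    using assms(4) unfolding contains_def pq by blast
  have "all_pivotal \<Psi> Q (inversions Q u)"
    using all_pivotal_contains_via[OF _ V(2,1)] assms(1,3) separable_iff pq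
    unfolding all_pivotal_def by blast
  then show ?thesis using separable_iff assms(2) pq by blast
qed

lemma contains_via_restrict:
  assumes "is_pattern (w, \<Phi>, P)" "subspace U"
  shows "contains_via U (w, \<Phi>, P) (weyl_restrict P w (\<Phi> \<inter> U), \<Phi> \<inter> U, P \<inter> U)"
proof -
  have "root_iso id (\<Phi> \<inter> U) (\<Phi> \<inter> U)" by (auto simp: root_iso_def linear_id)
  then show ?thesis unfolding contains_via.simps using is_pattern_restrict(2)[OF assms]
    by (intro exI[of _ id] conjI) simp_all
qed

text \<open>In one direction it suffices to test the restrictions themselves, which are contained
  via the identity; in the other, pivots transport to every isomorphic copy of a proper
  subsystem.\<close>

lemma minimal_nonseparable_iff:
  assumes p: "is_pattern (u, \<Psi>, Q)"
  shows "minimal_nonseparable (u, \<Psi>, Q) \<longleftrightarrow> minimal_nonpivotal \<Psi> Q (inversions Q u)"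
proof
  have sub: "Q \<subseteq> \<Psi>" "inversions Q u \<subseteq> Q" using is_pattern_subset[OF p] by (auto simp: inversions_def)
  assume m: "minimal_nonseparable (u, \<Psi>, Q)"
  have proper: "pivotal (Q \<inter> U) (inversions Q u \<inter> U)"
    if U: "subspace U" "\<Psi> \<inter> U \<noteq> \<Psi>" "irreducible_roots (\<Psi> \<inter> U)" for U
  proof -
    note r = is_pattern_restrict[OF p U(1)]
    have "separable (weyl_restrict Q u (\<Psi> \<inter> U), \<Psi> \<inter> U, Q \<inter> U)"
      using m U r contains_via_restrict[OF p U(1)] by auto
    then have "all_pivotal (\<Psi> \<inter> U) (Q \<inter> U) (inversions Q u \<inter> U)"
      using separable_iff[OF r(1)] r(2) by simp
    then show ?thesis unfolding all_pivotal_def using U(3) by (metis Int_UNIV_right subspace_UNIV)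
  qed
  have "\<not> all_pivotal \<Psi> Q (inversions Q u)" using m separable_iff[OF p] by simp
  then obtain U where U: "subspace U" "irreducible_roots (\<Psi> \<inter> U)" "\<not> pivotal (Q \<inter> U) (inversions Q u \<inter> U)"
    by (auto simp: all_pivotal_def)
  then have "\<Psi> \<inter> U = \<Psi>" using proper by blast
  then have "Q \<inter> U = Q" "inversions Q u \<inter> U = inversions Q u" using sub by blast+
  then show "minimal_nonpivotal \<Psi> Q (inversions Q u)"
    unfolding minimal_nonpivotal_def using U proper \<open>\<Psi> \<inter> U = \<Psi>\<close> by simp
next
  assume m: "minimal_nonpivotal \<Psi> Q (inversions Q u)"
  then have "\<not> all_pivotal \<Psi> Q (inversions Q u)"
    unfolding all_pivotal_def minimal_nonpivotal_def by (metis Int_UNIV_right subspace_UNIV)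
  then have ns: "\<not> separable (u, \<Psi>, Q)" using separable_iff[OF p] by simp
  have "separable p'" if U: "subspace U" "\<Psi> \<inter> U \<noteq> \<Psi>" "is_pattern p'" "contains_via U (u, \<Psi>, Q) p'" for U p'
  proof -
    obtain w' \<Phi>' P' where p': "p' = (w', \<Phi>', P')" by (cases p')
    have "all_pivotal \<Phi>' P' (inversions P' w')"
    proof (rule all_pivotal_contains_via[OF p U(4)[unfolded p'] U(1)])
      fix U' assume "subspace U'" "U' \<subseteq> U" "irreducible_roots (\<Psi> \<inter> U')"
      moreover have "\<Psi> \<inter> U' \<noteq> \<Psi>" using U(2) \<open>U' \<subseteq> U\<close> by blast
      ultimately show "pivotal (Q \<inter> U') (inversions Q u \<inter> U')" using m by (auto simp: minimal_nonpivotal_def)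
    qed
    then show ?thesis using separable_iff U(3) p' by blast
  qed
  then show "minimal_nonseparable (u, \<Psi>, Q)" using ns p unfolding minimal_nonseparable.simps by blast
qed

text \<open>Pivots of proper subsystems are transported along \<open>f\<close>. For the whole system
  \<open>root_iso_pivotal\<close>, applied to the inverse, yields only some subspace without a
  pivot; by the first part such a section cannot be proper.\<close>

lemma minimal_nonseparable_iso:
  assumes "is_pattern p" "is_pattern q" "pattern_iso p q" "minimal_nonseparable p"
  shows "minimal_nonseparable q"
proof -
  obtain w \<Phi> P u \<Psi> Q where pq: "p = (w, \<Phi>, P)" "q = (u, \<Psi>, Q)" by (cases p, cases q) auto
  have m: "minimal_nonpivotal \<Phi> P (inversions P w)" using assms minimal_nonseparable_iff pq by blast
  obtain f where f: "root_iso f (\<Phi> \<inter> UNIV) \<Psi>" "f ` (P \<inter> UNIV) = Q" "f ` (inversions P w \<inter> UNIV) = inversions Q u"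
    using assms(3) by (auto simp: pattern_iso_def pq)
  have sub: "P \<subseteq> \<Phi>" "0 \<notin> \<Phi>" "inversions P w \<subseteq> P"
    using is_pattern_subset[OF assms(1)[unfolded pq]] is_pattern_zero[OF assms(1)[unfolded pq]]
    by (auto simp: inversions_def)
  have "pattern_iso q p" using pattern_iso_sym assms by blast
  then obtain g where g: "root_iso g (\<Psi> \<inter> UNIV) \<Phi>" "g ` (Q \<inter> UNIV) = P"
    "g ` (inversions Q u \<inter> UNIV) = inversions P w"
    by (auto simp: pattern_iso_def pq)
  have sub': "Q \<subseteq> \<Psi>" "0 \<notin> \<Psi>" "inversions Q u \<subseteq> Q"
    using is_pattern_subset[OF assms(2)[unfolded pq]] is_pattern_zero[OF assms(2)[unfolded pq]]
    by (auto simp: inversions_def)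
  have proper: "pivotal (Q \<inter> U') (inversions Q u \<inter> U')"
    if U': "subspace U'" "\<Psi> \<inter> U' \<noteq> \<Psi>" "irreducible_roots (\<Psi> \<inter> U')" for U'
  proof -
    obtain U where U: "subspace U" "U \<subseteq> UNIV" "irreducible_roots (\<Phi> \<inter> U)" "f ` (\<Phi> \<inter> U) = \<Psi> \<inter> U'"
      "pivotal (P \<inter> U) (inversions P w \<inter> U) \<longrightarrow> pivotal (Q \<inter> U') (inversions Q u \<inter> U')"
      by (rule root_iso_pivotal[OF f subspace_UNIV sub(2,1,3) U'(1,3)]) blast
    have "\<Phi> \<inter> U \<noteq> \<Phi>" using U(4) U'(2) f(1) by (auto simp: root_iso_def)
    then have "pivotal (P \<inter> U) (inversions P w \<inter> U)" using m U(1,3) unfolding minimal_nonpivotal_def by blast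
    then show ?thesis using U(5) by blast
  qed
  have irr: "irreducible_roots (\<Phi> \<inter> UNIV)" using m by (simp add: minimal_nonpivotal_def)
  obtain U where U: "subspace U" "U \<subseteq> UNIV" "irreducible_roots (\<Psi> \<inter> U)" "g ` (\<Psi> \<inter> U) = \<Phi> \<inter> UNIV"
    "pivotal (Q \<inter> U) (inversions Q u \<inter> U) \<longrightarrow> pivotal (P \<inter> UNIV) (inversions P w \<inter> UNIV)"
    by (rule root_iso_pivotal[OF g subspace_UNIV sub'(2,1,3) subspace_UNIV irr]) blast
  have np: "\<not> pivotal (Q \<inter> U) (inversions Q u \<inter> U)" using U(5) m by (auto simp: minimal_nonpivotal_def)
  then have "\<Psi> \<inter> U = \<Psi>" using proper[of U] U(1,3) by blast
  moreover then have "Q \<inter> U = Q" "inversions Q u \<inter> U = inversions Q u" using sub' by blast+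
  ultimately have "minimal_nonpivotal \<Psi> Q (inversions Q u)"
    unfolding minimal_nonpivotal_def using U(3) np proper by simp
  then show ?thesis using minimal_nonseparable_iff assms(2) pq by blast
qed

text \<open>Among the subspaces whose section is irreducible without a pivot, one with the fewest
  roots is minimal.\<close>

lemma nonseparable_contains_minimal:
  assumes p: "is_pattern (w, \<Phi>, P)" and "\<not> separable (w, \<Phi>, P)"
  obtains U where "subspace U"
    "minimal_nonseparable (weyl_restrict P w (\<Phi> \<inter> U), \<Phi> \<inter> U, P \<inter> U)"
proof -
  define T where "T U \<longleftrightarrow> subspace U \<and> irreducible_roots (\<Phi> \<inter> U)
    \<and> \<not> pivotal (P \<inter> U) (inversions P w \<inter> U)" for U
  have "\<exists>U. T U" using assms separable_iff unfolding all_pivotal_def T_def by blast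
  then obtain U where U: "T U" and mn: "\<And>U'. T U' \<Longrightarrow> card (\<Phi> \<inter> U) \<le> card (\<Phi> \<inter> U')"
    using ex_has_least_nat[of T _ "\<lambda>U. card (\<Phi> \<inter> U)"] by blast
  have sU: "subspace U" using U by (simp add: T_def)
  note r = is_pattern_restrict[OF p sU]
  have "minimal_nonpivotal (\<Phi> \<inter> U) (P \<inter> U) (inversions P w \<inter> U)"
    unfolding minimal_nonpivotal_def
  proof (intro conjI allI impI)
    fix U' assume U': "subspace U' \<and> \<Phi> \<inter> U \<inter> U' \<noteq> \<Phi> \<inter> U \<and> irreducible_roots (\<Phi> \<inter> U \<inter> U')"
    have "finite \<Phi>" using p by (auto simp: root_system_def)
    then have "card (\<Phi> \<inter> (U \<inter> U')) < card (\<Phi> \<inter> U)" using U' by (intro psubset_card_mono) auto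
    then have "\<not> T (U \<inter> U')" using mn by fastforce
    then show "pivotal (P \<inter> U \<inter> U') (inversions P w \<inter> U \<inter> U')"
      using U' sU by (simp add: T_def subspace_inter Int_assoc)
  qed (use U in \<open>auto simp: T_def\<close>)
  then have "minimal_nonseparable (weyl_restrict P w (\<Phi> \<inter> U), \<Phi> \<inter> U, P \<inter> U)"
    unfolding minimal_nonseparable_iff[OF r(1)] r(2) .
  then show thesis by (rule that[OF sU])
qed

section \<open>Minimal patterns have rank at most three\<close>

lemma irreducible_roots_singleton: "irreducible_roots {x}"
proof (rule irreducible_rootsI)
  fix A B assume "A \<noteq> {}" "B \<noteq> {}" "A \<inter> B = {}" "A \<union> B = {x}"
  then show False by (auto simp: Un_singleton_iff)
qed simp

text \<open>Irreducibility is connectedness of the graph that joins nonorthogonal vectors. This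
  lemma and \<open>irreducible_roots_link\<close> are the two rules through which connected pieces
  of the Dynkin diagram are handled.\<close>

lemma irreducible_roots_union:
  assumes "irreducible_roots M" "irreducible_roots N" "x \<in> M" "y \<in> N" "x \<bullet> y \<noteq> 0" "0 \<notin> M \<union> N"
  shows "irreducible_roots (M \<union> N)"
proof (rule irreducible_rootsI)
  show "M \<union> N \<noteq> {}" using assms(3) by auto
  fix A B assume AB: "A \<noteq> {}" "B \<noteq> {}" "A \<inter> B = {}" "A \<union> B = M \<union> N" "\<forall>\<alpha>\<in>A. \<forall>\<beta>\<in>B. \<alpha> \<bullet> \<beta> = 0"
  have "M \<subseteq> A \<or> M \<subseteq> B" "N \<subseteq> A \<or> N \<subseteq> B"
    using irreducible_rootsD[OF assms(1) _ _ AB(5)] irreducible_rootsD[OF assms(2) _ _ AB(5)] assms(6) AB(4) by auto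
  then consider "M \<union> N \<subseteq> A" | "M \<union> N \<subseteq> B" | "M \<subseteq> A" "N \<subseteq> B" | "M \<subseteq> B" "N \<subseteq> A" by auto
  then show False
  proof cases
    case 3
    then show False using AB(5) assms(3-5) by blast
  next
    case 4
    then have "y \<bullet> x = 0" using AB(5) assms(3-5) by blast
    then show False using assms(5) by (simp add: inner_commute)
  qed (use AB in blast)+
qed

lemma irreducible_roots_link:
  assumes "irreducible_roots C" "0 \<notin> C" "A \<subset> C" "A \<noteq> {}"
  obtains a b where "a \<in> A" "b \<in> C - A" "a \<bullet> b \<noteq> 0"
proof -
  have "\<not> (C \<subseteq> A \<or> C \<subseteq> C - A)" using assms(3,4) by blast
  then have "\<not> (\<forall>\<alpha>\<in>A. \<forall>\<beta>\<in>C - A. \<alpha> \<bullet> \<beta> = 0)" using irreducible_rootsD[OF assms(1,2), of A "C - A"] by blast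
  then show thesis using that by blast
qed

lemma inner_sum_pos:
  fixes \<omega> :: "'a::real_inner"
  assumes "finite A" "\<And>x. x \<in> A \<Longrightarrow> 0 \<le> \<omega> \<bullet> x" "\<And>x. x \<in> A \<Longrightarrow> (0::real) \<le> k x" "y \<in> A" "0 < \<omega> \<bullet> y" "0 < k y"
  shows "0 < \<omega> \<bullet> (\<Sum>x\<in>A. k x *\<^sub>R x)"
proof -
  have "0 < k y * (\<omega> \<bullet> y)" using assms by simp
  also have "\<dots> \<le> (\<Sum>x\<in>A. k x * (\<omega> \<bullet> x))" using assms by (intro member_le_sum) auto
  finally show ?thesis by (simp add: inner_sum_right)
qed

context chamber
begin

lemma zero_notin_D: "S \<subseteq> D \<Longrightarrow> 0 \<notin> S"
  using P_nonzero D_P by blast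

text \<open>The root-level shadow of the Jacobi identity: an iterated bracket of \<open>a\<close>,
  \<open>e\<close> and \<open>b\<close> that survives must survive with \<open>b\<close> bracketed
  first with \<open>a\<close> or with \<open>e\<close>. If the sum \<open>g\<close> has positive
  product with neither \<open>a\<close> nor \<open>e\<close>, and \<open>b\<close> has negative
  product with neither, then \<open>g - b\<close> has squared norm at most zero.\<close>

lemma root_jacobi:
  assumes "a \<in> P" "e \<in> P" "b \<in> P" "a + e \<in> \<Phi>" "a + e + b \<in> \<Phi>"
  shows "a + b \<in> P \<or> e + b \<in> P"
proof -
  define g where "g = a + e + b"
  have gP: "g \<in> \<Phi>" using assms by (simp add: g_def)
  have vp: "0 < v \<bullet> a" "0 < v \<bullet> e" "0 < v \<bullet> b" using assms P_pos by auto
  have ne: "g \<noteq> a" "g \<noteq> e" "g \<noteq> b" using vp by (auto simp: g_def inner_add_right dest: arg_cong[of _ _ "\<lambda>x. v \<bullet> x"])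
  consider "g \<bullet> a > 0" | "g \<bullet> e > 0" | "g \<bullet> a \<le> 0" "g \<bullet> e \<le> 0" by linarith
  then show ?thesis
  proof cases
    case 1
    then have "g - a \<in> \<Phi>" using root_diff gP P_root assms(1) ne by blast
    then show ?thesis using P_sum[of e b] assms by (simp add: g_def)
  next
    case 2
    then have "g - e \<in> \<Phi>" using root_diff gP P_root assms(2) ne by blast
    then show ?thesis using P_sum[of a b] assms by (simp add: g_def algebra_simps)
  next
    case 3
    have gg: "g \<bullet> g = g \<bullet> a + g \<bullet> e + g \<bullet> b" by (subst (2) g_def) (simp add: inner_add_right)
    have gb: "g \<bullet> b = a \<bullet> b + e \<bullet> b + b \<bullet> b" by (simp add: g_def inner_add_left)
    have "a \<bullet> b < 0 \<or> e \<bullet> b < 0"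
    proof (rule ccontr)
      assume "\<not> ?thesis"
      then have "(g - b) \<bullet> (g - b) \<le> 0"
        using 3 gg gb by (simp add: inner_diff_left inner_diff_right inner_commute)
      then show False using ne by (metis eq_iff_diff_eq_0 inner_eq_zero_iff inner_ge_zero order_antisym)
    qed
    then show ?thesis using P_add assms by blast
  qed
qed

text \<open>The nilradical of a maximal parabolic is generated in degree one.\<close>

lemma split_coefficient:
  "\<beta> \<in> P \<Longrightarrow> j \<in> D \<Longrightarrow> 2 \<le> cw j \<bullet> \<beta> \<Longrightarrow> \<exists>s\<in>P. \<exists>t\<in>P. \<beta> = s + t \<and> 0 < cw j \<bullet> s \<and> 0 < cw j \<bullet> t"
proof (induction \<beta> rule: P_induct)
  case (less \<beta>)
  have bb: "0 < \<beta> \<bullet> \<beta>" using P_nonzero less.hyps by simp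
  have nj: "\<beta> \<noteq> \<delta>" if "\<delta> \<in> D" for \<delta> using cw[OF that, of j] less.prems by (auto split: if_splits)
  show ?case
  proof (cases "\<exists>\<alpha>\<in>D. \<alpha> \<noteq> j \<and> 0 < \<beta> \<bullet> \<alpha>")
    case True
    then obtain \<alpha> where a: "\<alpha> \<in> D" "\<alpha> \<noteq> j" "0 < \<beta> \<bullet> \<alpha>" by blast
    have b': "\<beta> - \<alpha> \<in> P" using P_sub_simple less.hyps a nj by blast
    moreover have "v \<bullet> (\<beta> - \<alpha>) < v \<bullet> \<beta>" using P_pos D_P a by (simp add: inner_diff_right)
    moreover have "cw j \<bullet> (\<beta> - \<alpha>) = cw j \<bullet> \<beta>" using cw[OF a(1), of j] a by (simp add: inner_diff_right)
    ultimately obtain s t where st: "s \<in> P" "t \<in> P" "\<beta> - \<alpha> = s + t" "0 < cw j \<bullet> s" "0 < cw j \<bullet> t"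
      using less.IH[OF b'] less.prems by metis
    have "\<beta> = s + t + \<alpha>" using st(3) by (simp add: algebra_simps)
    moreover have "s + t \<in> \<Phi>" using st(3) b' P_root by simp
    \<comment> \<open>The subtracted simple root is given back to one of the two summands. Its
      coefficient at \<open>j\<close> is zero, so both parts keep a positive one.\<close>
    ultimately have "s + \<alpha> \<in> P \<or> t + \<alpha> \<in> P"
      using root_jacobi[OF st(1,2) D_P[OF a(1)]] less.hyps P_root by simp
    moreover have c0: "cw j \<bullet> \<alpha> = 0" using cw[OF a(1), of j] a by simp
    moreover have "\<beta> = (s + \<alpha>) + t" "\<beta> = s + (t + \<alpha>)" using \<open>\<beta> = s + t + \<alpha>\<close> by (simp_all add: algebra_simps)
    moreover have "0 < cw j \<bullet> (s + \<alpha>)" "0 < cw j \<bullet> (t + \<alpha>)" using st c0 by (simp_all add: inner_add_right)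
    ultimately show ?thesis using st(1,2,4,5) by blast
  next
    case False
    \<comment> \<open>Now \<open>j\<close> is the only simple root with positive product, so
      \<open>j\<close> itself can be split off, and the rest keeps a coefficient of at least 1
      there.\<close>
    obtain \<alpha> where "\<alpha> \<in> D" "0 < \<beta> \<bullet> \<alpha>" using P_simple_pos[OF less.hyps bb] by blast
    then have "0 < \<beta> \<bullet> j" using False by metis
    then have "\<beta> - j \<in> P" using P_sub_simple less.hyps less.prems(1) nj by blast
    moreover have "cw j \<bullet> j = 1" using cw[of j j] less.prems(1) by simp
    moreover then have "0 < cw j \<bullet> (\<beta> - j)" using less.prems(2) by (simp add: inner_diff_right)
    ultimately show ?thesis using D_P[OF less.prems(1)] by (intro bexI[of _ j] bexI[of _ "\<beta> - j"]) auto
  qed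
qed

section \<open>Supports of roots and the Dynkin diagram\<close>

definition supp :: "'a \<Rightarrow> 'a set" where
  "supp \<beta> = {\<delta>\<in>D. 0 < cw \<delta> \<bullet> \<beta>}"

lemma supp_subset: "supp \<beta> \<subseteq> D"
  by (auto simp: supp_def)

lemma supp_expand: "\<beta> \<in> P \<Longrightarrow> \<beta> = (\<Sum>\<delta>\<in>supp \<beta>. (cw \<delta> \<bullet> \<beta>) *\<^sub>R \<delta>)"
proof -
  assume b: "\<beta> \<in> P"
  have "(\<Sum>\<delta>\<in>supp \<beta>. (cw \<delta> \<bullet> \<beta>) *\<^sub>R \<delta>) = (\<Sum>\<delta>\<in>D. (cw \<delta> \<bullet> \<beta>) *\<^sub>R \<delta>)"
    using P_cw_nonneg[OF b] by (intro sum.mono_neutral_left finite_D supp_subset) (force simp: supp_def)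
  then show ?thesis using P_expand[OF b] by simp
qed

text \<open>A largest partial sum that is a root is the whole sum: a simple root of \<open>S\<close>
  linked to it from outside has negative product with it and can be added.\<close>

lemma sum_subset_D_in_P:
  assumes "S \<subseteq> D" "irreducible_roots S"
  shows "\<Sum>S \<in> P"
proof -
  define T where "T X \<longleftrightarrow> X \<subseteq> S \<and> X \<noteq> {} \<and> \<Sum>X \<in> P" for X
  have fS: "finite S" using assms finite_D finite_subset by blast
  obtain s where s: "s \<in> S" using assms by (auto simp: irreducible_roots_def)
  have "T {s}" using s assms D_P by (auto simp: T_def)
  moreover have "\<forall>X. T X \<longrightarrow> card X < Suc (card S)" using fS by (auto simp: T_def less_Suc_eq_le card_mono)
  ultimately obtain X where X: "T X" and mx: "\<And>Y. T Y \<Longrightarrow> card Y \<le> card X"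
    using ex_has_greatest_nat[of T "{s}" card "Suc (card S)"] by blast
  have Xs: "X \<subseteq> S" "X \<noteq> {}" "\<Sum>X \<in> P" using X by (auto simp: T_def)
  have fX: "finite X" using Xs fS finite_subset by blast
  have "X = S"
  proof (rule ccontr)
    assume "X \<noteq> S"
    then obtain a b where ab: "a \<in> X" "b \<in> S - X" "a \<bullet> b \<noteq> 0"
      using irreducible_roots_link[OF assms(2) zero_notin_D[OF assms(1)], of X] Xs by blast
    have np: "x \<bullet> b \<le> 0" if "x \<in> X" for x using D_obtuse[of x b] that ab Xs assms by blast
    have "a \<bullet> b < 0" using np[OF ab(1)] ab(3) by simp
    then have "(\<Sum>x\<in>X. x \<bullet> b) < (\<Sum>x\<in>X. 0)" using np ab(1) fX by (intro sum_strict_mono_ex1) auto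
    then have "\<Sum>X \<bullet> b < 0" by (simp add: inner_sum_left)
    then have "\<Sum>X + b \<in> P" using P_add Xs ab assms D_P by blast
    then have "T (insert b X)" using ab Xs fX by (auto simp: T_def add.commute)
    then show False using mx[of "insert b X"] fX ab by simp
  qed
  then show ?thesis using Xs by simp
qed

text \<open>Induction by subtracting a simple \<alpha> with positive product. If \<alpha> were new
  and orthogonal to the support of \<beta> - \<alpha>, reflecting \<beta> in \<alpha> would give
  \<beta> - 2 \<alpha>, whose coefficient at \<alpha> is negative.\<close>

lemma irreducible_supp: "\<beta> \<in> P \<Longrightarrow> irreducible_roots (supp \<beta>)"
proof (induction \<beta> rule: P_induct)
  case (less \<beta>)
  show ?case
  proof (cases "\<beta> \<in> D")
    case True
    then have "supp \<beta> = {\<beta>}" using cw[OF True] by (auto simp: supp_def)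
    then show ?thesis using irreducible_roots_singleton by simp
  next
    case False
    obtain \<alpha> where a: "\<alpha> \<in> D" "0 < \<beta> \<bullet> \<alpha>" using P_simple_pos[OF less.hyps, of \<beta>] P_nonzero less.hyps by auto
    have b': "\<beta> - \<alpha> \<in> P" using P_sub_simple less.hyps a False by blast
    have "v \<bullet> (\<beta> - \<alpha>) < v \<bullet> \<beta>" using P_pos D_P a by (simp add: inner_diff_right)
    then have irr: "irreducible_roots (supp (\<beta> - \<alpha>))" using less.IH b' by blast
    have cwd: "cw \<delta> \<bullet> \<beta> = cw \<delta> \<bullet> (\<beta> - \<alpha>) + (if \<delta> = \<alpha> then 1 else 0)" for \<delta>
      using cw[OF a(1), of \<delta>] by (auto simp: inner_diff_right)
    have eq: "supp \<beta> = {\<alpha>} \<union> supp (\<beta> - \<alpha>)"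
      using a(1) P_cw_nonneg[OF b' a(1)] by (auto simp: supp_def cwd)
    show ?thesis
    proof (cases "\<alpha> \<in> supp (\<beta> - \<alpha>)")
      case True
      then show ?thesis using irr eq by (simp add: insert_absorb)
    next
      case al: False
      have "\<exists>y\<in>supp (\<beta> - \<alpha>). \<alpha> \<bullet> y \<noteq> 0"
      proof (rule ccontr)
        assume n: "\<not> ?thesis"
        have "(\<beta> - \<alpha>) \<bullet> \<alpha> = (\<Sum>\<delta>\<in>supp (\<beta> - \<alpha>). (cw \<delta> \<bullet> (\<beta> - \<alpha>)) *\<^sub>R \<delta>) \<bullet> \<alpha>"
          using supp_expand[OF b'] by simp
        also have "\<dots> = (\<Sum>\<delta>\<in>supp (\<beta> - \<alpha>). (cw \<delta> \<bullet> (\<beta> - \<alpha>)) * (\<delta> \<bullet> \<alpha>))"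
          by (simp only: inner_sum_left inner_scaleR_left)
        also have "\<dots> = 0" using n by (intro sum.neutral) (auto simp: inner_commute)
        finally have "refl_map \<alpha> (\<beta> - \<alpha>) = \<beta> - \<alpha>" by (simp add: refl_map_def)
        then have r: "refl_map \<alpha> \<beta> = \<beta> - 2 *\<^sub>R \<alpha>"
          by (simp add: refl_map_diff refl_map_self scaleR_2 algebra_simps)
        have "refl_map \<alpha> \<beta> \<in> P" using simple_refl_P a(1) less.hyps False by blast
        then have "0 \<le> cw \<alpha> \<bullet> (\<beta> - 2 *\<^sub>R \<alpha>)" using P_cw_nonneg a(1) r by metis
        moreover have "cw \<alpha> \<bullet> (\<beta> - \<alpha>) \<le> 0" using al a(1) by (auto simp: supp_def)
        moreover have "cw \<alpha> \<bullet> \<alpha> = 1" using cw[OF a(1), of \<alpha>] by simp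
        ultimately show False by (simp add: inner_diff_right)
      qed
      then obtain y where "y \<in> supp (\<beta> - \<alpha>)" "\<alpha> \<bullet> y \<noteq> 0" by blast
      then show ?thesis unfolding eq using irreducible_roots_union[OF irreducible_roots_singleton irr]
          zero_notin_D[of "{\<alpha>} \<union> supp (\<beta> - \<alpha>)"] a(1) supp_subset by blast
    qed
  qed
qed

text \<open>A splitting of the simple roots would split \<Phi>, since the support of each root,
  being connected, lies on one side.\<close>

lemma irreducible_D:
  assumes "irreducible_roots \<Phi>"
  shows "irreducible_roots D"
proof (rule irreducible_rootsI)
  have "\<Phi> \<noteq> {}" using assms by (simp add: irreducible_roots_def)
  then obtain \<beta> where "\<beta> \<in> P" using P_cases by blast
  then show "D \<noteq> {}" using P_simple_pos[of \<beta> v] P_pos by blast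
  fix A B assume AB: "A \<noteq> {}" "B \<noteq> {}" "A \<inter> B = {}" "A \<union> B = D" "\<forall>\<alpha>\<in>A. \<forall>\<beta>\<in>B. \<alpha> \<bullet> \<beta> = 0"
  have BA: "\<forall>\<alpha>\<in>B. \<forall>\<beta>\<in>A. \<alpha> \<bullet> \<beta> = 0" using AB(5) by (metis inner_commute)
  have "\<beta> \<in> span A \<or> \<beta> \<in> span B" if b: "\<beta> \<in> P" for \<beta>
  proof -
    have "supp \<beta> \<subseteq> A \<or> supp \<beta> \<subseteq> B"
      using irreducible_rootsD[OF irreducible_supp[OF b] zero_notin_D[OF supp_subset] _ AB(5)] supp_subset AB(4) by blast
    moreover have "\<beta> \<in> span (supp \<beta>)"
      by (subst supp_expand[OF b]) (intro span_sum span_scale span_base)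
    ultimately show ?thesis using span_mono by blast
  qed
  note sp = this
  have cov: "\<Phi> \<subseteq> (\<Phi> \<inter> span A) \<union> (\<Phi> \<inter> span B)"
  proof
    fix \<beta> assume b: "\<beta> \<in> \<Phi>"
    then consider "\<beta> \<in> P" | "- \<beta> \<in> P" using P_cases by blast
    then have "\<beta> \<in> span A \<or> \<beta> \<in> span B"
    proof cases
      case 2
      then show ?thesis using sp[OF 2] span_neg[of "- \<beta>" A] span_neg[of "- \<beta>" B] by auto
    qed (rule sp)
    then show "\<beta> \<in> (\<Phi> \<inter> span A) \<union> (\<Phi> \<inter> span B)" using b by blast
  qed
  have o1: "a \<bullet> y = 0" if "a \<in> A" "y \<in> span B" for a y using inner_span_zero[OF _ that(2)] AB(5) that(1) by blast
  have o2: "x \<bullet> y = 0" if x: "x \<in> span A" and y: "y \<in> span B" for x y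
  proof -
    have "y \<bullet> x = 0" by (rule inner_span_zero[OF _ x]) (use o1 y in \<open>simp add: inner_commute\<close>)
    then show ?thesis by (simp add: inner_commute)
  qed
  have "\<Phi> \<subseteq> \<Phi> \<inter> span A \<or> \<Phi> \<subseteq> \<Phi> \<inter> span B"
    by (rule irreducible_rootsD[OF assms zero_not_root cov]) (use o2 in blast)
  moreover have False if X: "\<Phi> \<subseteq> span X" "Y \<noteq> {}" "Y \<subseteq> D" "\<forall>\<alpha>\<in>Y. \<forall>\<beta>\<in>X. \<alpha> \<bullet> \<beta> = 0" for X Y
  proof -
    obtain y where y: "y \<in> Y" using X(2) by blast
    have "y \<in> span X" using y X D_P P_root by blast
    then have "y \<bullet> y = 0" using inner_span_zero[of X y y] X(4) y by blast
    then show False using P_nonzero D_P X(3) y by auto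
  qed
  moreover have "A \<subseteq> D" "B \<subseteq> D" using AB(4) by auto
  ultimately show False using AB(1,2,5) BA by (metis Int_subset_iff)
qed

text \<open>The Cartan integers of two linked simple roots have product at least 1 in absolute
  value, so the cosine of their angle is at most -1/2.\<close>

lemma simple_link_bound:
  assumes "x \<in> D" "y \<in> D" "x \<noteq> y" "x \<bullet> y \<noteq> 0"
  shows "2 * (x \<bullet> y) \<le> - (norm x * norm y)"
proof -
  have neg: "x \<bullet> y < 0" using D_obtuse[OF assms(1-3)] assms(4) by simp
  have xy: "x \<in> \<Phi>" "- y \<in> \<Phi>" using assms D_P P_root root_minus by blast+
  have "x \<noteq> - y" using P_not_minus[of y] assms D_P by blast
  then obtain m n :: int where mn: "2 * (x \<bullet> - y) = of_int m * (- y \<bullet> - y)" "2 * (x \<bullet> - y) = of_int n * (x \<bullet> x)"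
    "m > 0" "n > 0" "m * n < 4"
    using cartan_pair[OF xy] assms(3) neg by auto
  have "1 * 1 \<le> m * n" using mn by (intro mult_mono) auto
  then have "real_of_int 1 \<le> real_of_int (m * n)" by linarith
  then have "1 * ((x \<bullet> x) * (y \<bullet> y)) \<le> of_int (m * n) * ((x \<bullet> x) * (y \<bullet> y))"
    by (intro mult_right_mono) auto
  also have "\<dots> = (2 * (x \<bullet> - y)) * (2 * (x \<bullet> - y))" using mn(1,2) by (metis (no_types, opaque_lifting) inner_minus_left inner_minus_right minus_minus mult.assoc mult.left_commute of_int_mult)
  finally have "(norm x * norm y)\<^sup>2 \<le> (2 * (x \<bullet> - y))\<^sup>2"
    by (simp add: power2_eq_square mult_ac flip: power2_norm_eq_inner)
  then have "norm x * norm y \<le> 2 * (x \<bullet> - y)" by (rule power2_le_imp_le) (use neg in simp)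
  then show ?thesis by simp
qed

lemma simple_cos_bound:
  assumes "x \<in> D" "y \<in> D" "x \<noteq> y"
  shows "(x /\<^sub>R norm x) \<bullet> (y /\<^sub>R norm y) \<le> 0" "x \<bullet> y \<noteq> 0 \<Longrightarrow> (x /\<^sub>R norm x) \<bullet> (y /\<^sub>R norm y) \<le> - 1 / 2"
proof -
  have n: "0 < norm x" "0 < norm y" using P_nonzero D_P assms by auto
  have e: "(x /\<^sub>R norm x) \<bullet> (y /\<^sub>R norm y) = (x \<bullet> y) / (norm x * norm y)" using n by (simp add: field_simps)
  show "(x /\<^sub>R norm x) \<bullet> (y /\<^sub>R norm y) \<le> 0" unfolding e using D_obtuse[OF assms] n by (simp add: divide_nonpos_pos)
  show "(x /\<^sub>R norm x) \<bullet> (y /\<^sub>R norm y) \<le> - 1 / 2" if "x \<bullet> y \<noteq> 0"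
    unfolding e using simple_link_bound[OF assms that] n by (simp add: pos_divide_le_eq mult_pos_pos)
qed

lemma unit_inner_self: "x \<in> D \<Longrightarrow> (x /\<^sub>R norm x) \<bullet> (x /\<^sub>R norm x) = 1"
  using P_nonzero D_P by (simp add: power2_norm_eq_inner[symmetric] power2_eq_square)

lemma unit_v_pos: "x \<in> D \<Longrightarrow> 0 < v \<bullet> (x /\<^sub>R norm x)"
  using P_nonzero P_pos D_P by simp

text \<open>In a cycle the sum of the unit vectors would have norm at most zero.\<close>

lemma no_3_cycle:
  assumes "a \<in> D" "b \<in> D" "c \<in> D" "a \<noteq> b" "b \<noteq> c" "a \<noteq> c" "a \<bullet> b \<noteq> 0" "b \<bullet> c \<noteq> 0" "a \<bullet> c \<noteq> 0"
  shows False
proof -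
  define h where "h x = x /\<^sub>R norm x" for x :: 'a
  have n: "h a \<bullet> h b \<le> -1/2" "h b \<bullet> h c \<le> -1/2" "h a \<bullet> h c \<le> -1/2"
    using simple_cos_bound(2) assms by (auto simp: h_def)
  have s: "h a \<bullet> h a = 1" "h b \<bullet> h b = 1" "h c \<bullet> h c = 1" using unit_inner_self assms by (auto simp: h_def)
  define z where "z = h a + h b + h c"
  have "z \<bullet> z = h a \<bullet> h a + h b \<bullet> h b + h c \<bullet> h c + 2 * (h a \<bullet> h b + h b \<bullet> h c + h a \<bullet> h c)"
    by (simp add: z_def inner_add_left inner_add_right inner_commute)
  then have "z \<bullet> z \<le> 0" using n s by simp
  then have "z = 0" by (metis inner_eq_zero_iff inner_ge_zero order_antisym)
  moreover have "0 < v \<bullet> h a" "0 < v \<bullet> h b" "0 < v \<bullet> h c" using unit_v_pos assms by (auto simp: h_def)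
  then have "0 < v \<bullet> z" by (simp add: z_def inner_add_right)
  ultimately show False by simp
qed

lemma no_4_cycle:
  assumes "a \<in> D" "b \<in> D" "c \<in> D" "d \<in> D" "a \<noteq> b" "b \<noteq> c" "a \<noteq> c" "a \<noteq> d" "b \<noteq> d" "c \<noteq> d"
    "a \<bullet> b \<noteq> 0" "b \<bullet> c \<noteq> 0" "c \<bullet> d \<noteq> 0" "a \<bullet> d \<noteq> 0"
  shows False
proof -
  define h where "h x = x /\<^sub>R norm x" for x :: 'a
  have n: "h a \<bullet> h b \<le> -1/2" "h b \<bullet> h c \<le> -1/2" "h c \<bullet> h d \<le> -1/2" "h a \<bullet> h d \<le> -1/2"
    using simple_cos_bound(2) assms by (auto simp: h_def)
  \<comment> \<open>The diagonals of the cycle may be linked or not; for them nonpositivity is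
    enough.\<close>
  have n0: "h a \<bullet> h c \<le> 0" "h b \<bullet> h d \<le> 0" using simple_cos_bound(1) assms by (auto simp: h_def)
  have s: "h a \<bullet> h a = 1" "h b \<bullet> h b = 1" "h c \<bullet> h c = 1" "h d \<bullet> h d = 1"
    using unit_inner_self assms by (auto simp: h_def)
  define z where "z = h a + h b + h c + h d"
  have "z \<bullet> z = h a \<bullet> h a + h b \<bullet> h b + h c \<bullet> h c + h d \<bullet> h d
      + 2 * (h a \<bullet> h b + h b \<bullet> h c + h c \<bullet> h d + h a \<bullet> h d + h a \<bullet> h c + h b \<bullet> h d)"
    by (simp add: z_def inner_add_left inner_add_right inner_commute)
  then have "z \<bullet> z \<le> 0" using n n0 s by simp
  then have "z = 0" by (metis inner_eq_zero_iff inner_ge_zero order_antisym)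
  moreover have "0 < v \<bullet> h a" "0 < v \<bullet> h b" "0 < v \<bullet> h c" "0 < v \<bullet> h d" using unit_v_pos assms by (auto simp: h_def)
  then have "0 < v \<bullet> z" by (simp add: z_def inner_add_right)
  ultimately show False by simp
qed

end

text \<open>The functional \<open>u\<close> stands for the Weyl group element inverting the positive roots on which
  \<open>u\<close> is negative.\<close>

locale signed_chamber = chamber \<Phi> P v for \<Phi> P :: "'a::euclidean_space set" and v +
  fixes u :: 'a
  assumes u_generic: "\<beta> \<in> \<Phi> \<Longrightarrow> u \<bullet> \<beta> \<noteq> 0"

section \<open>Sign rules in a minimal system without pivot\<close>

locale min_chamber = signed_chamber +
  assumes minimal: "minimal_nonpivotal \<Phi> P {\<beta>\<in>P. u \<bullet> \<beta> < 0}"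
begin

lemma irr: "irreducible_roots \<Phi>" and not_pivotal: "\<not> pivotal P {\<beta>\<in>P. u \<bullet> \<beta> < 0}"
  and proper_pivotal: "\<And>U. subspace U \<Longrightarrow> \<Phi> \<inter> U \<noteq> \<Phi> \<Longrightarrow> irreducible_roots (\<Phi> \<inter> U)
     \<Longrightarrow> pivotal (P \<inter> U) ({\<beta>\<in>P. u \<bullet> \<beta> < 0} \<inter> U)"
  using minimal unfolding minimal_nonpivotal_def by blast+

text \<open>Negating \<open>u\<close> complements the inversion set within \<open>P\<close>, and the
  two alternatives in the definition of \<open>pivotal\<close> change places. So the sign of one
  chosen root may be fixed in advance.\<close>

lemma opposite: "min_chamber \<Phi> P v (- u)"
proof -
  have piv: "pivotal (P \<inter> U) ({\<beta>\<in>P. - u \<bullet> \<beta> < 0} \<inter> U) \<longleftrightarrow> pivotal (P \<inter> U) ({\<beta>\<in>P. u \<bullet> \<beta> < 0} \<inter> U)" for U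
  proof -
    have "{\<beta>\<in>P \<inter> U. 0 < \<omega> \<bullet> \<beta>} \<subseteq> {\<beta>\<in>P. - u \<bullet> \<beta> < 0} \<inter> U \<longleftrightarrow> {\<beta>\<in>P \<inter> U. 0 < \<omega> \<bullet> \<beta>} \<inter> ({\<beta>\<in>P. u \<bullet> \<beta> < 0} \<inter> U) = {}"
      "{\<beta>\<in>P \<inter> U. 0 < \<omega> \<bullet> \<beta>} \<subseteq> {\<beta>\<in>P. u \<bullet> \<beta> < 0} \<inter> U \<longleftrightarrow> {\<beta>\<in>P \<inter> U. 0 < \<omega> \<bullet> \<beta>} \<inter> ({\<beta>\<in>P. - u \<bullet> \<beta> < 0} \<inter> U) = {}" for \<omega>
    proof -
      have "- u \<bullet> \<beta> < 0 \<longleftrightarrow> \<not> u \<bullet> \<beta> < 0" if "\<beta> \<in> P" for \<beta>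
        using u_generic[OF P_root[OF that]] by auto
      then show "{\<beta>\<in>P \<inter> U. 0 < \<omega> \<bullet> \<beta>} \<subseteq> {\<beta>\<in>P. - u \<bullet> \<beta> < 0} \<inter> U \<longleftrightarrow> {\<beta>\<in>P \<inter> U. 0 < \<omega> \<bullet> \<beta>} \<inter> ({\<beta>\<in>P. u \<bullet> \<beta> < 0} \<inter> U) = {}"
        "{\<beta>\<in>P \<inter> U. 0 < \<omega> \<bullet> \<beta>} \<subseteq> {\<beta>\<in>P. u \<bullet> \<beta> < 0} \<inter> U \<longleftrightarrow> {\<beta>\<in>P \<inter> U. 0 < \<omega> \<bullet> \<beta>} \<inter> ({\<beta>\<in>P. - u \<bullet> \<beta> < 0} \<inter> U) = {}"
        by blast+
    qed
    then show ?thesis unfolding pivotal_def by (simp add: disj_commute)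
  qed
  have "minimal_nonpivotal \<Phi> P {\<beta>\<in>P. - u \<bullet> \<beta> < 0}"
    unfolding minimal_nonpivotal_def
  proof (intro conjI allI impI irr)
    show "\<not> pivotal P {\<beta>\<in>P. - u \<bullet> \<beta> < 0}" using not_pivotal piv[of UNIV] by simp
    show "pivotal (P \<inter> U) ({\<beta>\<in>P. - u \<bullet> \<beta> < 0} \<inter> U)"
      if "subspace U \<and> \<Phi> \<inter> U \<noteq> \<Phi> \<and> irreducible_roots (\<Phi> \<inter> U)" for U
      unfolding piv using proper_pivotal that by blast
  qed
  then show ?thesis using u_generic by unfold_locales auto
qed

lemma D_irr: "irreducible_roots D"
  by (rule irreducible_D[OF irr])

lemma u_nonzero: "\<beta> \<in> P \<Longrightarrow> u \<bullet> \<beta> \<noteq> 0"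
  using u_generic P_root by blast

text \<open>The subsystem spanned by the summands of a root is irreducible, so it has a pivot. One of the
  summands has positive pivot coefficient, and all roots with positive pivot coefficient have
  the same sign as the sum.\<close>

lemma dominating_summand:
  assumes "A \<subseteq> P" "\<And>a. a \<in> A \<Longrightarrow> 0 < k a" "\<gamma> = (\<Sum>a\<in>A. k a *\<^sub>R a)" "\<gamma> \<in> P" "card A < card D"
  obtains \<omega> where "\<And>\<beta>. \<beta> \<in> P \<Longrightarrow> \<beta> \<in> span A \<Longrightarrow> 0 \<le> \<omega> \<bullet> \<beta>" "\<exists>a\<in>A. 0 < \<omega> \<bullet> a"
    "\<And>\<beta>. \<beta> \<in> P \<Longrightarrow> \<beta> \<in> span A \<Longrightarrow> 0 < \<omega> \<bullet> \<beta> \<Longrightarrow> 0 < u \<bullet> \<beta> \<longleftrightarrow> 0 < u \<bullet> \<gamma>"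
proof -
  have fA: "finite A" using assms(1) finite_P finite_subset by blast
  have \<gamma>A: "\<gamma> \<in> span A" unfolding assms(3) by (intro span_sum span_scale span_base)
  \<comment> \<open>Fewer vectors than the rank cannot span, so minimality applies to the section by
    \<open>span A\<close>.\<close>
  have "\<Phi> \<inter> span A \<noteq> \<Phi>"
  proof
    assume "\<Phi> \<inter> span A = \<Phi>"
    then have "D \<subseteq> span A" using D_P P_root by blast
    then have "card D \<le> card A" using independent_span_bound[OF fA D_independent] by blast
    then show False using assms(5) by simp
  qed
  moreover have "irreducible_roots (\<Phi> \<inter> span A)"
  proof (rule irreducible_rootsI)
    show "\<Phi> \<inter> span A \<noteq> {}" using \<gamma>A assms(4) P_root by blast
    \<comment> \<open>The summands in \<open>Y\<close> add up to a vector \<open>y\<close> in the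
      span of \<open>X\<close>; being orthogonal to \<open>Y\<close>, it is orthogonal to itself and
      vanishes, and positivity of \<open>v\<close> leaves no summand in \<open>Y\<close>. Then
      \<open>X\<close> spans the section, and no root of it can be orthogonal to
      \<open>X\<close>.\<close>
    have main: False if X: "X \<inter> Y = {}" "X \<union> Y = \<Phi> \<inter> span A" "\<forall>\<alpha>\<in>X. \<forall>\<beta>\<in>Y. \<alpha> \<bullet> \<beta> = 0" "\<gamma> \<in> X" "Y \<noteq> {}" for X Y
    proof -
      have AXY: "A \<subseteq> X \<union> Y" using X(2) assms(1) P_root span_base by blast
      define y where "y = (\<Sum>a\<in>A \<inter> Y. k a *\<^sub>R a)"
      have "\<gamma> = (\<Sum>a\<in>A \<inter> X. k a *\<^sub>R a) + y"
        unfolding assms(3) y_def using fA AXY X(1) by (subst sum.union_disjoint[symmetric]) (auto intro!: sum.cong)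
      then have "y = \<gamma> - (\<Sum>a\<in>A \<inter> X. k a *\<^sub>R a)" by simp
      also have "\<dots> \<in> span X" using X(4) by (intro span_diff span_sum span_scale span_base) auto
      finally have yX: "y \<in> span X" .
      have "x \<bullet> b = 0" if "x \<in> span X" "b \<in> Y" for x b
        using inner_span_zero[OF _ that(1), of b] X(3) that(2) by (metis inner_commute)
      then have "b \<bullet> y = 0" if "b \<in> Y" for b using yX that by (metis inner_commute)
      then have "y \<bullet> y = 0" by (auto simp: y_def inner_sum_left)
      then have "v \<bullet> y = 0" by simp
      moreover have "0 < v \<bullet> y" if "A \<inter> Y \<noteq> {}"
        unfolding y_def inner_sum_right using fA that assms(1,2) P_pos by (intro sum_pos) auto
      ultimately have "A \<inter> Y = {}" by force
      then have "A \<subseteq> X" using AXY by blast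
      obtain b where b: "b \<in> Y" using X(5) by blast
      have "b \<in> span X" using b X(2) span_mono[OF \<open>A \<subseteq> X\<close>] by blast
      then have "b \<bullet> b = 0" using \<open>\<And>x b. x \<in> span X \<Longrightarrow> b \<in> Y \<Longrightarrow> x \<bullet> b = 0\<close> b by blast
      then show False using b X(2) root_nonzero by auto
    qed
    fix X Y assume X: "X \<noteq> {}" "Y \<noteq> {}" "X \<inter> Y = {}" "X \<union> Y = \<Phi> \<inter> span A" "\<forall>\<alpha>\<in>X. \<forall>\<beta>\<in>Y. \<alpha> \<bullet> \<beta> = 0"
    have X': "\<forall>\<alpha>\<in>Y. \<forall>\<beta>\<in>X. \<alpha> \<bullet> \<beta> = 0" using X(5) by (metis inner_commute)
    have X'': "Y \<inter> X = {}" "Y \<union> X = \<Phi> \<inter> span A" using X by blast+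
    have "\<gamma> \<in> X \<or> \<gamma> \<in> Y" using X(4) \<gamma>A assms(4) P_root by blast
    then show False using main[OF X(3,4,5) _ X(2)] main[OF X'' X' _ X(1)] by blast
  qed
  ultimately have "pivotal (P \<inter> span A) ({\<beta>\<in>P. u \<bullet> \<beta> < 0} \<inter> span A)"
    by (intro proper_pivotal) auto
  then obtain \<omega> where w: "\<forall>\<beta>\<in>P \<inter> span A. 0 \<le> \<omega> \<bullet> \<beta>" "\<exists>\<beta>\<in>P \<inter> span A. 0 < \<omega> \<bullet> \<beta>"
    "{\<beta>\<in>P \<inter> span A. 0 < \<omega> \<bullet> \<beta>} \<subseteq> {\<beta>\<in>P. u \<bullet> \<beta> < 0} \<inter> span A
      \<or> {\<beta>\<in>P \<inter> span A. 0 < \<omega> \<bullet> \<beta>} \<inter> ({\<beta>\<in>P. u \<bullet> \<beta> < 0} \<inter> span A) = {}"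
    unfolding pivotal_def by blast
  have "\<exists>a\<in>A. \<omega> \<bullet> a \<noteq> 0" using inner_span_zero[of A \<omega>] w(2) by (metis IntD2 less_irrefl)
  then obtain a where a: "a \<in> A" "0 < \<omega> \<bullet> a" using w(1) assms(1) span_base by (metis IntI order_le_less subsetD)
  have wA: "0 \<le> \<omega> \<bullet> x" if "x \<in> A" for x using w(1) assms(1) span_base that by blast
  have "0 < \<omega> \<bullet> \<gamma>" unfolding assms(3)
    using fA wA a assms(2) by (intro inner_sum_pos[of A \<omega> k a]) (auto intro: less_imp_le)
  then have "0 < u \<bullet> \<beta> \<longleftrightarrow> 0 < u \<bullet> \<gamma>" if "\<beta> \<in> P" "\<beta> \<in> span A" "0 < \<omega> \<bullet> \<beta>" for \<beta>
    using w(3) u_nonzero[OF that(1)] u_nonzero[OF assms(4)] that \<gamma>A assms(4) by fastforce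
  then show thesis using that[of \<omega>] w(1) a by blast
qed

lemma dominating_sum:
  assumes "A \<subseteq> P" "\<Sum>A \<in> P" "card A < card D"
  obtains \<omega> where "\<And>\<beta>. \<beta> \<in> P \<Longrightarrow> \<beta> \<in> span A \<Longrightarrow> 0 \<le> \<omega> \<bullet> \<beta>" "\<exists>a\<in>A. 0 < \<omega> \<bullet> a"
    "\<And>\<beta>. \<beta> \<in> P \<Longrightarrow> \<beta> \<in> span A \<Longrightarrow> 0 < \<omega> \<bullet> \<beta> \<Longrightarrow> 0 < u \<bullet> \<beta> \<longleftrightarrow> 0 < u \<bullet> \<Sum>A"
  by (rule dominating_summand[of A "\<lambda>_. 1" "\<Sum>A"]) (use assms in auto)

lemma sum_pos_of_mem:
  assumes "finite A" "\<And>x. x \<in> A \<Longrightarrow> 0 \<le> \<omega> \<bullet> x" "y \<in> A" "0 < \<omega> \<bullet> (y :: 'a)"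
  shows "0 < \<omega> \<bullet> \<Sum>A"
  using inner_sum_pos[of A \<omega> "\<lambda>_. 1" y] assms by simp

text \<open>A pivot on the span of the three summands is positive on \<open>a\<close>,
  \<open>b\<close> or \<open>c\<close>, hence on \<open>a\<close>, \<open>a + b\<close> or
  \<open>a + c\<close>, and each of these has positive sign. Rank four makes the span of three
  vectors proper.\<close>

lemma three_summands:
  assumes "a \<in> P" "b \<in> P" "c \<in> P" "a + b \<in> P" "a + c \<in> P" "a + b + c \<in> P" "4 \<le> card D"
    "0 < u \<bullet> a" "0 < u \<bullet> (a + b)" "0 < u \<bullet> (a + c)"
  shows "0 < u \<bullet> (a + b + c)"
proof -
  \<comment> \<open>Multiplicities: the three roots may coincide, and the set
    \<open>{a, b, c}\<close> forgets repetitions.\<close>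
  define k where "k x = (of_bool (x = a) + of_bool (x = b) + of_bool (x = c) :: real)" for x
  have k1: "(\<Sum>x\<in>{a,b,c}. of_bool (x = y) *\<^sub>R x) = y" if "y \<in> {a,b,c}" for y
  proof -
    have "(\<Sum>x\<in>{a,b,c}. of_bool (x = y) *\<^sub>R x) = (\<Sum>x\<in>{a,b,c}. if x = y then y else 0)"
      by (intro sum.cong) auto
    also have "\<dots> = y" using that by (subst sum.delta) auto
    finally show ?thesis .
  qed
  have sum: "a + b + c = (\<Sum>x\<in>{a,b,c}. k x *\<^sub>R x)"
    unfolding k_def scaleR_add_left sum.distrib using k1 by simp
  have cd: "card {a,b,c} < card D" using card_length[of "[a,b,c]"] assms(7) by simp
  obtain \<omega> where w: "\<And>\<beta>. \<beta> \<in> P \<Longrightarrow> \<beta> \<in> span {a,b,c} \<Longrightarrow> 0 \<le> \<omega> \<bullet> \<beta>" "\<exists>x\<in>{a,b,c}. 0 < \<omega> \<bullet> x"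
    "\<And>\<beta>. \<beta> \<in> P \<Longrightarrow> \<beta> \<in> span {a,b,c} \<Longrightarrow> 0 < \<omega> \<bullet> \<beta> \<Longrightarrow> 0 < u \<bullet> \<beta> \<longleftrightarrow> 0 < u \<bullet> (a + b + c)"
    by (rule dominating_summand[of "{a,b,c}" k "a + b + c"]) (use assms sum cd in \<open>auto simp: k_def\<close>)
  have sp: "a \<in> span {a,b,c}" "b \<in> span {a,b,c}" "c \<in> span {a,b,c}" by (auto intro: span_base)
  have w0: "0 \<le> \<omega> \<bullet> a" "0 \<le> \<omega> \<bullet> b" "0 \<le> \<omega> \<bullet> c" using w(1) assms(1-3) sp by auto
  consider "0 < \<omega> \<bullet> a" | "0 < \<omega> \<bullet> b" | "0 < \<omega> \<bullet> c" using w(2) by blast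
  then show ?thesis
  proof cases
    case 1
    then show ?thesis using w(3)[OF assms(1) sp(1)] assms(8) by simp
  next
    case 2
    then have "0 < \<omega> \<bullet> (a + b)" using w0 by (simp add: inner_add_right)
    then show ?thesis using w(3)[OF assms(4) span_add[OF sp(1,2)]] assms(9) by simp
  next
    case 3
    then have "0 < \<omega> \<bullet> (a + c)" using w0 by (simp add: inner_add_right)
    then show ?thesis using w(3)[OF assms(5) span_add[OF sp(1,3)]] assms(10) by simp
  qed
qed

text \<open>\<beta> and the sum of its support have positive coefficients at the same simple roots.
  A pivot of the section that these span is positive on one of them, hence on both vectors.\<close>

lemma sign_of_support:
  assumes "\<beta> \<in> P" "supp \<beta> \<noteq> D"
  shows "0 < u \<bullet> \<beta> \<longleftrightarrow> 0 < u \<bullet> \<Sum>(supp \<beta>)"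
proof -
  have sub: "supp \<beta> \<subseteq> P" using supp_subset D_P by blast
  have "card (supp \<beta>) < card D" using assms(2) supp_subset finite_D by (intro psubset_card_mono) auto
  then obtain \<omega> where w: "\<And>x. x \<in> P \<Longrightarrow> x \<in> span (supp \<beta>) \<Longrightarrow> 0 \<le> \<omega> \<bullet> x" "\<exists>a\<in>supp \<beta>. 0 < \<omega> \<bullet> a"
    "\<And>x. x \<in> P \<Longrightarrow> x \<in> span (supp \<beta>) \<Longrightarrow> 0 < \<omega> \<bullet> x \<Longrightarrow> 0 < u \<bullet> x \<longleftrightarrow> 0 < u \<bullet> \<Sum>(supp \<beta>)"
    using dominating_sum[OF sub sum_subset_D_in_P[OF supp_subset irreducible_supp[OF assms(1)]]] by blast
  obtain a where a: "a \<in> supp \<beta>" "0 < \<omega> \<bullet> a" using w(2) by blast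
  have fs: "finite (supp \<beta>)" using supp_subset finite_D finite_subset by blast
  have bs: "\<beta> \<in> span (supp \<beta>)"
    by (subst supp_expand[OF assms(1)]) (intro span_sum span_scale span_base)
  have "0 \<le> \<omega> \<bullet> x" if "x \<in> supp \<beta>" for x using w(1) sub span_base that by blast
  then have "0 < \<omega> \<bullet> (\<Sum>\<delta>\<in>supp \<beta>. (cw \<delta> \<bullet> \<beta>) *\<^sub>R \<delta>)"
    using a fs by (intro inner_sum_pos[of _ _ _ a]) (auto simp: supp_def)
  then have "0 < \<omega> \<bullet> \<beta>" using supp_expand[OF assms(1)] by simp
  then show ?thesis using w(3) assms(1) bs by blast
qed

text \<open>Connected sets of simple roots whose sum, which is a root, has negative sign.\<close>

definition neg :: "'a set \<Rightarrow> bool" where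
  "neg S \<longleftrightarrow> S \<subseteq> D \<and> irreducible_roots S \<and> u \<bullet> \<Sum>S < 0"

lemma neg_facts: "neg S \<Longrightarrow> S \<subseteq> D" "neg S \<Longrightarrow> irreducible_roots S" "neg S \<Longrightarrow> u \<bullet> \<Sum>S < 0"
  "neg S \<Longrightarrow> finite S" "neg S \<Longrightarrow> \<Sum>S \<in> P" "neg S \<Longrightarrow> S \<subseteq> P"
  using finite_D finite_subset sum_subset_D_in_P D_P by (auto simp: neg_def)

section \<open>How negative connected sets combine\<close>

lemma sum_in_span: "S \<subseteq> A \<Longrightarrow> \<Sum>S \<in> span A"
  by (intro span_sum span_base) auto

text \<open>The pivot on the span of the union is positive on a simple root of \<open>M\<close> or
  of \<open>N\<close>, hence on the sum over that set. This sum is negative, and the sum over the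
  union shares its sign.\<close>

lemma neg_union:
  assumes "neg M" "neg N" "x \<in> M" "y \<in> N" "x \<bullet> y \<noteq> 0" "M \<union> N \<noteq> D"
  shows "neg (M \<union> N)"
proof -
  have sub: "M \<union> N \<subseteq> D" using assms neg_facts by blast
  have irrU: "irreducible_roots (M \<union> N)"
    by (rule irreducible_roots_union[OF neg_facts(2)[OF assms(1)] neg_facts(2)[OF assms(2)] assms(3-5) zero_notin_D[OF sub]])
  have P: "\<Sum>(M \<union> N) \<in> P" by (rule sum_subset_D_in_P[OF sub irrU])
  have subP: "M \<union> N \<subseteq> P" using sub D_P by blast
  have "card (M \<union> N) < card D" using sub assms(6) finite_D by (intro psubset_card_mono) auto
  then obtain \<omega> where w: "\<And>\<beta>. \<beta> \<in> P \<Longrightarrow> \<beta> \<in> span (M \<union> N) \<Longrightarrow> 0 \<le> \<omega> \<bullet> \<beta>" "\<exists>a\<in>M \<union> N. 0 < \<omega> \<bullet> a"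
    "\<And>\<beta>. \<beta> \<in> P \<Longrightarrow> \<beta> \<in> span (M \<union> N) \<Longrightarrow> 0 < \<omega> \<bullet> \<beta> \<Longrightarrow> 0 < u \<bullet> \<beta> \<longleftrightarrow> 0 < u \<bullet> \<Sum>(M \<union> N)"
    using dominating_sum[OF subP P] by blast
  have key: "\<not> 0 < u \<bullet> \<Sum>(M \<union> N)" if S: "neg S" "S \<subseteq> M \<union> N" "a \<in> S" "0 < \<omega> \<bullet> a" for S a
  proof -
    have "0 < \<omega> \<bullet> \<Sum>S"
      using S neg_facts(4,6)[OF S(1)] w(1) span_base by (intro sum_pos_of_mem[of S \<omega> a]) blast+
    then show ?thesis using w(3)[OF neg_facts(5)[OF S(1)] sum_in_span[OF S(2)]] neg_facts(3)[OF S(1)] by simp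
  qed
  then have "\<not> 0 < u \<bullet> \<Sum>(M \<union> N)" using w(2) assms(1,2) by blast
  then show ?thesis unfolding neg_def using sub irrU u_nonzero[OF P] by auto
qed

text \<open>Contracting the edge \<open>i - j\<close> to the single root \<open>i + j\<close> gives a proper subsystem that still
  contains the sums over \<open>M\<close>, \<open>N\<close> and \<open>D\<close>.\<close>

lemma cell_orthogonal:
  assumes "neg M" "neg N" "M \<union> N = D" "0 < u \<bullet> \<Sum>D" "i \<in> D" "j \<in> D" "i \<noteq> j" "i \<in> M \<longleftrightarrow> j \<in> M" "i \<in> N \<longleftrightarrow> j \<in> N"
  shows "i \<bullet> j = 0"
proof (rule ccontr)
  assume ij: "i \<bullet> j \<noteq> 0"
  define e where "e = i + j"
  have "i \<bullet> j < 0" using D_obtuse[OF assms(5-7)] ij by simp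
  then have eP: "e \<in> P" unfolding e_def using P_add D_P assms(5,6) by blast
  have eD: "e \<notin> D" using D_indec[of e i j] D_P assms(5,6) by (auto simp: e_def)
  define A where "A = insert e (D - {i, j})"
  have AP: "A \<subseteq> P" using eP D_P by (auto simp: A_def)
  \<comment> \<open>A set with both or neither of \<open>i\<close> and \<open>j\<close> keeps its
    sum when the pair is replaced by \<open>e\<close>.\<close>
  have cont: "\<exists>B. B \<subseteq> A \<and> \<Sum>B = \<Sum>S \<and> (\<forall>x. x \<in> S - {i,j} \<longrightarrow> x \<in> B) \<and> (i \<in> S \<longrightarrow> e \<in> B)"
    if S: "S \<subseteq> D" "i \<in> S \<longleftrightarrow> j \<in> S" for S
  proof (cases "i \<in> S")
    case True
    have fS: "finite S" using S finite_D finite_subset by blast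
    have "\<Sum>S = i + (j + \<Sum>(S - {i} - {j}))"
      using True S(2) fS assms(7) by (simp add: sum.remove[of S i] sum.remove[of "S - {i}" j])
    moreover have "e \<notin> S - {i,j}" using eD S by blast
    ultimately have "\<Sum>(insert e (S - {i,j})) = \<Sum>S"
      using fS by (simp add: e_def Diff_insert2[of S i "{j}"] Diff_insert[of S i "{j}"] add.assoc)
    then show ?thesis using S by (intro exI[of _ "insert e (S - {i,j})"]) (auto simp: A_def)
  next
    case False
    then show ?thesis using S by (intro exI[of _ S]) (auto simp: A_def)
  qed
  have sumA: "\<Sum>A = \<Sum>D"
  proof -
    have "\<Sum>D = i + (j + \<Sum>(D - {i} - {j}))"
      using assms(5-7) finite_D by (simp add: sum.remove[of D i] sum.remove[of "D - {i}" j])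
    moreover have "D - {i} - {j} = D - {i,j}" by blast
    ultimately show ?thesis using eD finite_D by (simp add: A_def e_def add.assoc)
  qed
  have SD: "\<Sum>D \<in> P" using sum_subset_D_in_P D_irr by blast
  have "card A < card D"
  proof -
    have "card A = Suc (card (D - {i,j}))" using eD finite_D by (simp add: A_def)
    also have "card (D - {i,j}) = card D - 2" using assms(5-7) finite_D by (subst card_Diff_subset) auto
    also have "2 \<le> card D" using assms(5-7) finite_D card_mono[of D "{i,j}"] by simp
    ultimately show ?thesis by simp
  qed
  then obtain \<omega> where w: "\<And>\<beta>. \<beta> \<in> P \<Longrightarrow> \<beta> \<in> span A \<Longrightarrow> 0 \<le> \<omega> \<bullet> \<beta>" "\<exists>a\<in>A. 0 < \<omega> \<bullet> a"
    "\<And>\<beta>. \<beta> \<in> P \<Longrightarrow> \<beta> \<in> span A \<Longrightarrow> 0 < \<omega> \<bullet> \<beta> \<Longrightarrow> 0 < u \<bullet> \<beta> \<longleftrightarrow> 0 < u \<bullet> \<Sum>D"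
    using dominating_sum[OF AP] sumA SD by metis
  obtain a where a: "a \<in> A" "0 < \<omega> \<bullet> a" using w(2) by blast
  \<comment> \<open>The pivot is positive on some element of the contracted basis, which enters the
    sum over \<open>M\<close> or over \<open>N\<close>. That sum would then have the positive sign
    of the sum over \<open>D\<close>.\<close>
  have bad: False if S: "neg S" "i \<in> S \<longleftrightarrow> j \<in> S" "a \<in> S - {i,j} \<or> (a = e \<and> i \<in> S)" for S
  proof -
    obtain B where B: "B \<subseteq> A" "\<Sum>B = \<Sum>S" "a \<in> B" using cont[OF neg_facts(1)[OF S(1)] S(2)] S(3) by blast
    have "finite B" using B AP finite_P by (meson finite_subset)
    then have "0 < \<omega> \<bullet> \<Sum>B"
      using B a w(1) AP span_base by (intro sum_pos_of_mem[of B \<omega> a]) blast+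
    then have "0 < u \<bullet> \<Sum>S" using w(3)[of "\<Sum>S"] neg_facts(5)[OF S(1)] sum_in_span[OF B(1)] B(2) assms(4) by simp
    then show False using neg_facts(3)[OF S(1)] by simp
  qed
  have "a = e \<or> a \<in> D - {i,j}" using a(1) by (auto simp: A_def)
  then show False using bad[OF assms(1,8)] bad[OF assms(2,9)] assms(3,5) by blast
qed

text \<open>By \<open>cell_orthogonal\<close> all edges inside \<open>M\<close> run between
  \<open>M - N\<close> and \<open>M \<inter> N\<close>. If \<open>M - N\<close> had two elements,
  adding any one \<open>a\<close> of them to \<open>N\<close> would give a proper connected set, of
  positive sum by maximality of \<open>N\<close>. Then \<open>a\<close> and its edges
  \<open>a + b\<close> into \<open>M \<inter> N\<close> are positive, which leaves no place where a
  pivot of \<open>M\<close>, of negative sign, could be positive.\<close>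

lemma neg_pair_singleton:
  assumes "neg M" "neg N" "M \<union> N = D" "0 < u \<bullet> \<Sum>D"
    and mx: "\<And>N'. neg N' \<Longrightarrow> M \<union> N' = D \<Longrightarrow> card N' \<le> card N"
  obtains a where "M - N = {a}" "\<And>b. b \<in> M \<inter> N \<Longrightarrow> a \<bullet> b \<noteq> 0"
proof -
  have fin: "finite M" "finite N" using neg_facts assms by auto
  have D0: "D \<noteq> {}" using D_irr by (auto simp: irreducible_roots_def)
  have MD: "M \<noteq> D" "N \<noteq> D" using assms(1,2,4) neg_facts(3) by force+
  have ov: "M \<inter> N \<noteq> {}"
  proof
    assume "M \<inter> N = {}"
    then have "\<Sum>D = \<Sum>M + \<Sum>N" using sum.union_disjoint[OF fin] assms(3) by force
    then have "u \<bullet> \<Sum>D = u \<bullet> \<Sum>M + u \<bullet> \<Sum>N" by (simp add: inner_add_right)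
    then show False using neg_facts(3)[OF assms(1)] neg_facts(3)[OF assms(2)] assms(4) by linarith
  qed
  have DP: "x \<in> P" if "x \<in> M \<or> x \<in> N" for x using that neg_facts(6) assms(1,2) by blast
  have DD: "x \<in> D" if "x \<in> M \<or> x \<in> N" for x using that assms(3) by blast
  have ne: "M - N \<noteq> {}" using MD(2) assms(3) by blast
  have 0: "0 \<notin> M" "0 \<notin> N" using zero_notin_D neg_facts(1) assms by blast+
  have adj: "\<exists>b\<in>M \<inter> N. a \<bullet> b \<noteq> 0" if a: "a \<in> M - N" for a
  proof -
    obtain b where b: "b \<in> M - {a}" "a \<bullet> b \<noteq> 0"
      using irreducible_roots_link[OF neg_facts(2)[OF assms(1)] 0(1), of "{a}"] a ov by blast
    then have "b \<in> N" using cell_orthogonal[OF assms(1-4), of a b] a DD by blast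
    then show ?thesis using b by blast
  qed
  have adj': "\<exists>a\<in>M - N. a \<bullet> b \<noteq> 0" if b: "b \<in> M \<inter> N" for b
  proof -
    obtain a where a: "a \<in> M - {b}" "b \<bullet> a \<noteq> 0"
      using irreducible_roots_link[OF neg_facts(2)[OF assms(1)] 0(1), of "{b}"] b ne by blast
    then have "a \<notin> N" using cell_orthogonal[OF assms(1-4), of b a] b DD by blast
    then show ?thesis using a by (auto simp: inner_commute)
  qed
  have edge: "x + y \<in> P" if "x \<in> D" "y \<in> D" "x \<noteq> y" "x \<bullet> y \<noteq> 0" for x y
    using P_add[of x y] D_P D_obtuse[of x y] that by force
  have pos: "0 < u \<bullet> a \<and> (\<forall>b\<in>M \<inter> N. a \<bullet> b \<noteq> 0 \<longrightarrow> 0 < u \<bullet> (a + b))"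
    if a: "a \<in> M - N" and N': "insert a N \<noteq> D" for a
  proof -
    obtain b where b: "b \<in> M \<inter> N" "a \<bullet> b \<noteq> 0" using adj a by blast
    have sub: "{a} \<union> N \<subseteq> D" using a assms(3) by blast
    have irrN: "irreducible_roots ({a} \<union> N)"
      by (rule irreducible_roots_union[OF irreducible_roots_singleton neg_facts(2)[OF assms(2)] _ _ b(2) zero_notin_D[OF sub]])
        (use b in auto)
    have P: "\<Sum>({a} \<union> N) \<in> P" by (rule sum_subset_D_in_P[OF sub irrN])
    have "\<not> neg ({a} \<union> N)" using mx[of "{a} \<union> N"] a assms(3) fin by auto
    then have up: "0 < u \<bullet> \<Sum>({a} \<union> N)" using sub irrN u_nonzero[OF P] by (auto simp: neg_def)
    have subP: "{a} \<union> N \<subseteq> P" using sub D_P by blast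
    have "card ({a} \<union> N) < card D" using sub N' finite_D by (intro psubset_card_mono) auto
    then obtain \<omega> where w: "\<And>\<beta>. \<beta> \<in> P \<Longrightarrow> \<beta> \<in> span ({a} \<union> N) \<Longrightarrow> 0 \<le> \<omega> \<bullet> \<beta>" "\<exists>x\<in>{a} \<union> N. 0 < \<omega> \<bullet> x"
      "\<And>\<beta>. \<beta> \<in> P \<Longrightarrow> \<beta> \<in> span ({a} \<union> N) \<Longrightarrow> 0 < \<omega> \<bullet> \<beta> \<Longrightarrow> 0 < u \<bullet> \<beta> \<longleftrightarrow> 0 < u \<bullet> \<Sum>({a} \<union> N)"
      using dominating_sum[OF subP P] by blast
    have wN: "0 \<le> \<omega> \<bullet> x" if "x \<in> N" for x using w(1)[of x] subP span_base[of x "{a} \<union> N"] that by blast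
    \<comment> \<open>The pivot cannot be positive anywhere on \<open>N\<close>, whose sum has the
      wrong sign, so it is concentrated on \<open>a\<close>.\<close>
    have "\<not> 0 < \<omega> \<bullet> x" if x: "x \<in> N" for x
    proof
      assume "0 < \<omega> \<bullet> x"
      then have "0 < \<omega> \<bullet> \<Sum>N" using sum_pos_of_mem[OF fin(2) wN x] by blast
      then have "0 < u \<bullet> \<Sum>N" using w(3)[OF neg_facts(5)[OF assms(2)] sum_in_span] up by blast
      then show False using neg_facts(3)[OF assms(2)] by simp
    qed
    then have wa: "0 < \<omega> \<bullet> a" using w(2) by blast
    have "0 < u \<bullet> a" using w(3)[of a] wa up subP span_base[of a "{a} \<union> N"] by blast
    moreover have "0 < u \<bullet> (a + b')" if b': "b' \<in> M \<inter> N" "a \<bullet> b' \<noteq> 0" for b'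
    proof -
      have "a + b' \<in> P" using edge[of a b'] a b' DD by blast
      moreover have "a + b' \<in> span ({a} \<union> N)" using b' by (intro span_add span_base) auto
      moreover have "0 < \<omega> \<bullet> (a + b')" using wa wN b' by (simp add: inner_add_right add_pos_nonneg)
      ultimately show ?thesis using w(3) up by blast
    qed
    ultimately show ?thesis by blast
  qed
  have "\<exists>a. M - N = {a}"
  proof (rule ccontr)
    assume ns: "\<not> ?thesis"
    have N': "insert a N \<noteq> D" if "a \<in> M - N" for a using ns that assms(3) by blast
    have "card M < card D" using MD neg_facts(1)[OF assms(1)] finite_D by (intro psubset_card_mono) auto
    then obtain \<omega> where w: "\<And>\<beta>. \<beta> \<in> P \<Longrightarrow> \<beta> \<in> span M \<Longrightarrow> 0 \<le> \<omega> \<bullet> \<beta>" "\<exists>x\<in>M. 0 < \<omega> \<bullet> x"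
      "\<And>\<beta>. \<beta> \<in> P \<Longrightarrow> \<beta> \<in> span M \<Longrightarrow> 0 < \<omega> \<bullet> \<beta> \<Longrightarrow> 0 < u \<bullet> \<beta> \<longleftrightarrow> 0 < u \<bullet> \<Sum>M"
      using dominating_sum[OF neg_facts(6)[OF assms(1)] neg_facts(5)[OF assms(1)]] by blast
    obtain x where x: "x \<in> M" "0 < \<omega> \<bullet> x" using w(2) by blast
    have nM: "\<not> 0 < u \<bullet> \<Sum>M" using neg_facts(3)[OF assms(1)] by simp
    show False
    proof (cases "x \<in> N")
      case False
      then show False using w(3)[of x] x nM pos[of x] N'[of x] DP span_base[of x M] by blast
    next
      case True
      \<comment> \<open>From a simple root \<open>x\<close> in \<open>M \<inter> N\<close> one
        passes to the edge \<open>a + x\<close>: the pivot of \<open>M\<close> is positive there as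
        well, but the sign of \<open>a + x\<close> is positive.\<close>
      then obtain a where a: "a \<in> M - N" "a \<bullet> x \<noteq> 0" using adj'[of x] x by blast
      have "0 < u \<bullet> (a + x)" using pos[OF a(1) N'[OF a(1)]] a x True by blast
      moreover have "a + x \<in> P" using edge[of a x] a x True DD by blast
      moreover have "a + x \<in> span M" using a x by (intro span_add span_base) auto
      moreover have "0 < \<omega> \<bullet> (a + x)"
        using x w(1)[of a] a DP span_base[of a M] by (simp add: inner_add_right add_nonneg_pos)
      ultimately show False using w(3) nM by blast
    qed
  qed
  then obtain a where a: "M - N = {a}" by blast
  have "a \<bullet> b \<noteq> 0" if "b \<in> M \<inter> N" for b using adj'[OF that] unfolding a by simp
  then show thesis by (rule that[OF a])
qed

text \<open>Otherwise the negative sets cover \<open>D\<close>. A largest one and a second one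
  through a neighbour outside already cover it, since else their union would be a larger negative
  set. For a covering pair of largest total size, \<open>neg_pair_singleton\<close> applies on both
  sides and gives \<open>a\<close> and \<open>c\<close>, each linked to all of
  \<open>M \<inter> N\<close>. Rank four leaves at least two roots there, and a four-cycle
  results.\<close>

lemma pivot_for_sums:
  assumes "0 < u \<bullet> \<Sum>D" "4 \<le> card D"
  shows "\<exists>p\<in>D. \<forall>S. neg S \<longrightarrow> p \<notin> S"
proof (rule ccontr)
  assume "\<not> ?thesis"
  then have all: "\<exists>S. neg S \<and> p \<in> S" if "p \<in> D" for p using that by blast
  have bound: "\<forall>S. neg S \<longrightarrow> card S < Suc (card D)"
    using neg_facts(1) finite_D by (auto simp: less_Suc_eq_le intro: card_mono)
  obtain d where "d \<in> D" using D_irr by (auto simp: irreducible_roots_def)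
  then obtain S0 where "neg S0" using all by blast
  then obtain M0 where M0: "neg M0" "\<And>S. neg S \<Longrightarrow> card S \<le> card M0"
    using ex_has_greatest_nat[of neg S0 card "Suc (card D)"] bound by blast
  have "M0 \<subset> D" using neg_facts(1,3)[OF M0(1)] assms(1) by force
  moreover have "M0 \<noteq> {}" using neg_facts(2)[OF M0(1)] by (auto simp: irreducible_roots_def)
  ultimately obtain x t where xt: "x \<in> M0" "t \<in> D - M0" "x \<bullet> t \<noteq> 0"
    using irreducible_roots_link[OF D_irr zero_notin_D[OF subset_refl]] by blast
  obtain N0 where N0: "neg N0" "t \<in> N0" using all xt by blast
  have U0: "M0 \<union> N0 = D"
  proof (rule ccontr)
    assume "M0 \<union> N0 \<noteq> D"
    then have "neg (M0 \<union> N0)" using neg_union M0 N0 xt by blast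
    moreover have "card M0 < card (M0 \<union> N0)"
      using xt N0 neg_facts(4)[OF M0(1)] neg_facts(4)[OF N0(1)] by (intro psubset_card_mono) auto
    ultimately show False using M0(2) by fastforce
  qed
  \<comment> \<open>Maximising the total size makes each member largest for the other, as
    \<open>neg_pair_singleton\<close> demands in both directions.\<close>
  define Q where "Q = (\<lambda>(M, N). neg M \<and> neg N \<and> M \<union> N = D)"
  have "Q (M0, N0)" using M0 N0 U0 by (simp add: Q_def)
  moreover have "\<forall>z. Q z \<longrightarrow> card (fst z) + card (snd z) < 2 * card D + 1"
  proof (intro allI impI)
    fix z assume "Q z"
    then have "card (fst z) < Suc (card D)" "card (snd z) < Suc (card D)" using bound by (auto simp: Q_def)
    then show "card (fst z) + card (snd z) < 2 * card D + 1" by simp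
  qed
  ultimately obtain z where z: "Q z" "\<And>z'. Q z' \<Longrightarrow> card (fst z') + card (snd z') \<le> card (fst z) + card (snd z)"
    using ex_has_greatest_nat[of Q "(M0, N0)" "\<lambda>z. card (fst z) + card (snd z)" "2 * card D + 1"] by blast
  obtain M N where zMN: "z = (M, N)" by (cases z)
  have MN: "neg M" "neg N" "M \<union> N = D" "N \<union> M = D" using z(1) by (auto simp: Q_def zMN)
  have mx: "card N' \<le> card N" if "neg N'" "M \<union> N' = D" for N'
    using z(2)[of "(M, N')"] that MN by (simp add: Q_def zMN)
  have mx': "card M' \<le> card M" if "neg M'" "N \<union> M' = D" for M'
    using z(2)[of "(M', N)"] that MN by (simp add: Q_def zMN Un_commute)
  obtain a where a: "M - N = {a}" "\<And>b. b \<in> M \<inter> N \<Longrightarrow> a \<bullet> b \<noteq> 0"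
    using neg_pair_singleton[OF MN(1-3) assms(1) mx] by blast
  obtain c where c: "N - M = {c}" "\<And>b. b \<in> N \<inter> M \<Longrightarrow> c \<bullet> b \<noteq> 0"
    using neg_pair_singleton[OF MN(2,1,4) assms(1) mx'] by blast
  have ac: "a \<in> D" "c \<in> D" "a \<noteq> c" "a \<notin> N" "c \<notin> M" using a(1) c(1) MN by blast+
  have Deq: "D = (M \<inter> N) \<union> {a, c}" using a(1) c(1) MN(3) by blast
  have "card D \<le> card (M \<inter> N) + card {a, c}" by (subst Deq) (rule card_Un_le)
  then have "2 \<le> card (M \<inter> N)" using assms(2) ac(3) by simp
  then obtain b b' where b: "b \<in> M \<inter> N" "b' \<in> M \<inter> N" "b \<noteq> b'"
    by (metis card_2_iff' ex_card subsetD)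
  have "b \<in> D" "b' \<in> D" "a \<noteq> b" "b \<noteq> c" "a \<noteq> b'" "c \<noteq> b'" using b ac(4,5) MN(3) by auto
  moreover have "a \<bullet> b \<noteq> 0" "a \<bullet> b' \<noteq> 0" "c \<bullet> b' \<noteq> 0" "c \<bullet> b \<noteq> 0" using a(2) c(2) b(1,2) by blast+
  moreover have "b \<bullet> c \<noteq> 0" using \<open>c \<bullet> b \<noteq> 0\<close> by (simp add: inner_commute)
  ultimately show False using no_4_cycle[of a b c b'] ac(1-3) b(3) by blast
qed

text \<open>The coweight of \<open>p\<close> is no pivot, so some root with \<open>p\<close> in its
  support is negative; let \<gamma> be one with least \<open>v\<close>. The proof writes \<gamma> as
  \<open>x + s + t\<close>, with \<open>x\<close> a sum of distinct simple roots including
  \<open>p\<close>, such that \<open>x + s\<close> and \<open>x + t\<close> are roots too. These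
  three lie below \<gamma>, so they are positive, and \<open>three_summands\<close> makes \<gamma>
  positive.\<close>

theorem rank_less_4_aux:
  assumes "0 < u \<bullet> \<Sum>D"
  shows "card D < 4"
proof (rule ccontr)
  assume "\<not> card D < 4"
  then have four: "4 \<le> card D" by simp
  obtain p where p: "p \<in> D" "\<And>S. neg S \<Longrightarrow> p \<notin> S" using pivot_for_sums[OF assms four] by blast
  have pP: "p \<in> P" by (rule D_P[OF p(1)])
  \<comment> \<open>Without full support the sign is that of the support sum, and no negative set
    contains \<open>p\<close>.\<close>
  have nonfull: "0 < u \<bullet> \<beta>" if b: "\<beta> \<in> P" "0 < cw p \<bullet> \<beta>" "supp \<beta> \<noteq> D" for \<beta>
  proof -
    have "\<not> neg (supp \<beta>)" using p b by (auto simp: supp_def)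
    moreover have "\<Sum>(supp \<beta>) \<in> P" by (rule sum_subset_D_in_P[OF supp_subset irreducible_supp[OF b(1)]])
    ultimately have "0 < u \<bullet> \<Sum>(supp \<beta>)"
      using supp_subset irreducible_supp[OF b(1)] u_nonzero by (fastforce simp: neg_def)
    then show ?thesis using sign_of_support[OF b(1,3)] by simp
  qed
  have "\<exists>\<gamma>\<in>P. 0 < cw p \<bullet> \<gamma> \<and> u \<bullet> \<gamma> < 0"
  proof (rule ccontr)
    assume "\<not> ?thesis"
    then have "pivotal P {\<beta>\<in>P. u \<bullet> \<beta> < 0}" unfolding pivotal_def
      using P_cw_nonneg p(1) pP cw[OF p(1), of p] by (intro exI[of _ "cw p"]) force
    then show False using not_pivotal by simp
  qed
  then have "\<exists>\<gamma>. (\<gamma> \<in> P \<and> 0 < cw p \<bullet> \<gamma> \<and> u \<bullet> \<gamma> < 0)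
      \<and> (\<forall>\<beta>\<in>P. 0 < cw p \<bullet> \<beta> \<longrightarrow> v \<bullet> \<beta> < v \<bullet> \<gamma> \<longrightarrow> 0 < u \<bullet> \<beta>)"
  proof -
    assume "\<exists>\<gamma>\<in>P. 0 < cw p \<bullet> \<gamma> \<and> u \<bullet> \<gamma> < 0"
    then obtain \<gamma> where "\<gamma> \<in> P" "0 < cw p \<bullet> \<gamma> \<and> u \<bullet> \<gamma> < 0" by blast
    then show ?thesis
    proof (induction \<gamma> rule: P_induct)
      case (less \<gamma>)
      show ?case
      proof (cases "\<exists>\<beta>\<in>P. 0 < cw p \<bullet> \<beta> \<and> v \<bullet> \<beta> < v \<bullet> \<gamma> \<and> \<not> 0 < u \<bullet> \<beta>")
        case True
        then obtain \<beta> where "\<beta> \<in> P" "0 < cw p \<bullet> \<beta>" "v \<bullet> \<beta> < v \<bullet> \<gamma>" "u \<bullet> \<beta> < 0"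
          using u_nonzero by (metis not_less_iff_gr_or_eq)
        then show ?thesis using less.IH by blast
      next
        case False
        then show ?thesis using less.hyps less.prems by (intro exI[of _ \<gamma>]) blast
      qed
    qed
  qed
  then obtain \<gamma> where g: "\<gamma> \<in> P" "0 < cw p \<bullet> \<gamma>" "u \<bullet> \<gamma> < 0"
    and mn: "\<And>\<beta>. \<beta> \<in> P \<Longrightarrow> 0 < cw p \<bullet> \<beta> \<Longrightarrow> v \<bullet> \<beta> < v \<bullet> \<gamma> \<Longrightarrow> 0 < u \<bullet> \<beta>" by blast
  have full: "supp \<gamma> = D" using nonfull[OF g(1,2)] g(3) by force
  then have gpos: "1 \<le> cw i \<bullet> \<gamma>" if "i \<in> D" for i using P_cw_ge1[OF g(1) that] that by (auto simp: supp_def)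
  have lt: "v \<bullet> s < v \<bullet> (s + t)" "v \<bullet> t < v \<bullet> (s + t)" if "s \<in> P" "t \<in> P" for s t
    using P_pos that by (simp_all add: inner_add_right)
  \<comment> \<open>A larger coefficient at \<open>p\<close> would split \<gamma> into two smaller
    roots with \<open>p\<close> in their supports, both positive.\<close>
  have cp1: "cw p \<bullet> \<gamma> = 1"
  proof (rule ccontr)
    assume "cw p \<bullet> \<gamma> \<noteq> 1"
    then have "2 \<le> cw p \<bullet> \<gamma>" using gpos[OF p(1)] P_cw_nat[OF g(1) p(1)] by force
    then obtain s t where st: "s \<in> P" "t \<in> P" "\<gamma> = s + t" "0 < cw p \<bullet> s" "0 < cw p \<bullet> t"
      using split_coefficient[OF g(1) p(1)] by blast
    then have "0 < u \<bullet> s" "0 < u \<bullet> t" using mn lt by auto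
    then show False using g(3) st(3) by (simp add: inner_add_right)
  qed
  \<comment> \<open>\<open>R\<close> will be a largest connected set around \<open>p\<close> on
    which \<gamma> has coefficient 1. It is not all of \<open>D\<close>, because the sum over
    \<open>D\<close> is positive, and maximality forces a coefficient of at least 2 at a neighbour
    \<open>j\<close>.\<close>
  define C where "C R \<longleftrightarrow> R \<subseteq> D \<and> irreducible_roots R \<and> p \<in> R \<and> (\<forall>i\<in>R. cw i \<bullet> \<gamma> = 1)" for R
  have "C {p}" using p(1) cp1 irreducible_roots_singleton by (simp add: C_def)
  moreover have "\<forall>R. C R \<longrightarrow> card R < Suc (card D)" using finite_D by (auto simp: C_def less_Suc_eq_le intro: card_mono)
  ultimately obtain R where R: "C R" and mxR: "\<And>R'. C R' \<Longrightarrow> card R' \<le> card R"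
    using ex_has_greatest_nat[of C "{p}" card "Suc (card D)"] by blast
  have R': "R \<subseteq> D" "irreducible_roots R" "p \<in> R" "\<And>i. i \<in> R \<Longrightarrow> cw i \<bullet> \<gamma> = 1" using R by (auto simp: C_def)
  have fR: "finite R" using R' finite_D finite_subset by blast
  have RD: "R \<noteq> D"
  proof
    assume "R = D"
    then have "\<gamma> = \<Sum>D" using P_expand[OF g(1)] R'(4) by simp
    then show False using assms g(3) by simp
  qed
  obtain r j where rj: "r \<in> R" "j \<in> D - R" "r \<bullet> j \<noteq> 0"
    using irreducible_roots_link[OF D_irr zero_notin_D[OF subset_refl], of R] R' RD by blast
  have cj: "2 \<le> cw j \<bullet> \<gamma>"
  proof (rule ccontr)
    assume "\<not> ?thesis"
    then have "cw j \<bullet> \<gamma> = 1" using gpos[of j] P_cw_nat[OF g(1), of j] rj by force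
    moreover have "irreducible_roots (R \<union> {j})"
      using irreducible_roots_union[OF R'(2) irreducible_roots_singleton rj(1) _ rj(3)] zero_notin_D[of "R \<union> {j}"] R'(1) rj(2)
      by blast
    ultimately have "C (R \<union> {j})" using R' rj by (auto simp: C_def)
    then show False using mxR[of "R \<union> {j}"] fR rj by simp
  qed
  define x where "x = \<Sum>R"
  have xP: "x \<in> P" unfolding x_def by (rule sum_subset_D_in_P[OF R'(1,2)])
  have cwx: "cw i \<bullet> x = (if i \<in> R then 1 else 0)" if "i \<in> D" for i
  proof -
    have "cw i \<bullet> x = (\<Sum>y\<in>R. if y = i then 1 else 0)"
      unfolding x_def inner_sum_right using cw R'(1) by (intro sum.cong) auto
    then show ?thesis using fR by (simp add: sum.delta)
  qed
  \<comment> \<open>Stages of a descent from \<gamma> to \<open>x\<close>: the coefficients on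
    \<open>R\<close> stay 1 and the part removed is a root. The disjunct \<open>y = \<gamma>\<close>
    covers the start, where nothing has been removed.\<close>
  define Y where "Y y \<longleftrightarrow> y \<in> P \<and> (\<forall>i\<in>R. cw i \<bullet> y = 1) \<and> (y = \<gamma> \<or> \<gamma> - y \<in> P)" for y
  have Yg: "Y \<gamma>" using g R' by (simp add: Y_def)
  have descend: "\<exists>y'. Y y' \<and> v \<bullet> y' < v \<bullet> y" if y: "Y y" "y \<noteq> x" for y
  proof -
    have yP: "y \<in> P" and yR: "\<And>i. i \<in> R \<Longrightarrow> cw i \<bullet> y = 1" and yg: "y = \<gamma> \<or> \<gamma> - y \<in> P" using y by (auto simp: Y_def)
    \<comment> \<open>One step removes a simple root outside \<open>R\<close> that has positive
      product with \<open>y\<close> or, if there is none, all of \<open>y - x\<close> at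
      once.\<close>
    have "\<exists>e\<in>P. y - e \<in> P \<and> (\<forall>i\<in>R. cw i \<bullet> e = 0)"
    proof (cases "\<exists>\<alpha>\<in>D - R. 0 < y \<bullet> \<alpha>")
      case True
      then obtain \<alpha> where a: "\<alpha> \<in> D" "\<alpha> \<notin> R" "0 < y \<bullet> \<alpha>" by blast
      have "cw p \<bullet> \<alpha> = 0" using cw[OF a(1), of p] a R' by auto
      then have "y \<noteq> \<alpha>" using yR R' by force
      then have "y - \<alpha> \<in> P" using P_sub_simple yP a by blast
      moreover have "\<forall>i\<in>R. cw i \<bullet> \<alpha> = 0" using cw[OF a(1)] a by auto
      ultimately show ?thesis using D_P a by blast
    next
      case False
      \<comment> \<open>With no positive products outside \<open>R\<close>, also
        \<open>z \<bullet> y\<close> is nonpositive; hence \<open>y \<bullet> x\<close> is positive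
        and the difference \<open>z\<close> is a root.\<close>
      define z where "z = y - x"
      have z: "z = (\<Sum>\<delta>\<in>D - R. (cw \<delta> \<bullet> y) *\<^sub>R \<delta>)"
      proof -
        have "y = (\<Sum>\<delta>\<in>D - R. (cw \<delta> \<bullet> y) *\<^sub>R \<delta>) + (\<Sum>\<delta>\<in>R. (cw \<delta> \<bullet> y) *\<^sub>R \<delta>)"
          using P_expand[OF yP] sum.subset_diff[OF R'(1) finite_D, of "\<lambda>\<delta>. (cw \<delta> \<bullet> y) *\<^sub>R \<delta>"] by simp
        also have "(\<Sum>\<delta>\<in>R. (cw \<delta> \<bullet> y) *\<^sub>R \<delta>) = x" unfolding x_def using yR by (intro sum.cong) auto
        finally have "y = (\<Sum>\<delta>\<in>D - R. (cw \<delta> \<bullet> y) *\<^sub>R \<delta>) + x" .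
        then show ?thesis unfolding z_def by (metis add_diff_cancel_right')
      qed
      have "z \<bullet> y = (\<Sum>\<delta>\<in>D - R. (cw \<delta> \<bullet> y) * (\<delta> \<bullet> y))" by (subst z) (simp add: inner_sum_left)
      also have "\<dots> \<le> 0"
      proof (rule sum_nonpos)
        fix \<delta> assume "\<delta> \<in> D - R"
        then have "0 \<le> cw \<delta> \<bullet> y" "\<delta> \<bullet> y \<le> 0" using P_cw_nonneg[OF yP] False by (auto simp: inner_commute not_less)
        then show "(cw \<delta> \<bullet> y) * (\<delta> \<bullet> y) \<le> 0" by (rule mult_nonneg_nonpos)
      qed
      finally have "z \<bullet> y \<le> 0" .
      moreover have "0 < y \<bullet> y" using P_nonzero[OF yP] by simp
      moreover have "z \<bullet> y = y \<bullet> y - y \<bullet> x" by (simp add: z_def inner_diff_left inner_commute[of x y])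
      ultimately have "0 < y \<bullet> x" by linarith
      then have zr: "z \<in> \<Phi>" unfolding z_def using root_diff P_root yP xP y(2) by blast
      have "v \<bullet> z = (\<Sum>\<delta>\<in>D - R. (cw \<delta> \<bullet> y) * (v \<bullet> \<delta>))" by (subst z) (simp add: inner_sum_right)
      also have "\<dots> \<ge> 0" using P_cw_nonneg[OF yP] P_pos D_P
        by (intro sum_nonneg mult_nonneg_nonneg) (auto intro: less_imp_le)
      finally have "0 < v \<bullet> z" using generic[OF zr] by simp
      then have "z \<in> P" using PI zr by blast
      moreover have "y - z \<in> P" using xP by (simp add: z_def)
      moreover have "\<forall>i\<in>R. cw i \<bullet> z = 0" using yR cwx R'(1) by (auto simp: z_def inner_diff_right)
      ultimately show ?thesis by blast
    qed
    then obtain e where e: "e \<in> P" "y - e \<in> P" "\<And>i. i \<in> R \<Longrightarrow> cw i \<bullet> e = 0" by blast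
    define y' where "y' = y - e"
    have y': "y' \<in> P" "y = y' + e" "\<And>i. i \<in> R \<Longrightarrow> cw i \<bullet> y' = 1" using e yR by (auto simp: y'_def inner_diff_right)
    have less: "v \<bullet> y' < v \<bullet> y" using lt[OF y'(1) e(1)] y'(2) by simp
    have "Y y'"
    proof (cases "y = \<gamma>")
      case True
      then have "\<gamma> - y' = e" using y'(2) by (metis add_diff_cancel_left')
      then show ?thesis using y' e(1) by (simp add: Y_def)
    next
      case False
      define b where "b = \<gamma> - y"
      have b: "b \<in> P" "\<gamma> = y' + e + b" using False yg y' by (auto simp: b_def)
      \<comment> \<open>If \<open>y' + b\<close> were a root, \<open>three_summands\<close> with
        core \<open>y'\<close> would make \<gamma> positive. So the newly removed \<open>e\<close>
        and the earlier \<open>b\<close> join to one root.\<close>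
      have "y' + b \<in> P \<or> e + b \<in> P"
        using root_jacobi[OF y'(1) e(1) b(1)] y'(2) b(2) yP g(1) P_root by metis
      moreover have "y' + b \<notin> P"
      proof
        assume yb: "y' + b \<in> P"
        have cb: "cw p \<bullet> b = 0" using yR[OF R'(3)] cp1 by (simp add: b_def inner_diff_right)
        have "v \<bullet> y < v \<bullet> \<gamma>" using lt[of y b] yP b y'(2) by simp
        then have s1: "0 < u \<bullet> y'" "0 < u \<bullet> y" using mn y' yP yR R'(3) less by auto
        have "v \<bullet> (y' + b) < v \<bullet> \<gamma>" using P_pos[OF e(1)] b(2) by (simp add: inner_add_right)
        then have s2: "0 < u \<bullet> (y' + b)" using mn[OF yb] cb y'(3)[OF R'(3)] by (simp add: inner_add_right)
        have "0 < u \<bullet> \<gamma>"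
          using three_summands[OF y'(1) e(1) b(1)] y'(2) yP yb b(2) g(1) four s1 s2 by simp
        then show False using g(3) by simp
      qed
      ultimately have "e + b \<in> P" by blast
      moreover have "\<gamma> - y' = e + b" using b(2) by simp
      ultimately show ?thesis using y' by (simp add: Y_def)
    qed
    then show ?thesis using less by blast
  qed
  have "Y x"
  proof -
    have "Y y \<Longrightarrow> Y x" if "y \<in> P" for y
      using that by (induction y rule: P_induct) (metis Y_def descend)
    then show ?thesis using Yg g(1) by blast
  qed
  moreover have "x \<noteq> \<gamma>" using cwx[of j] rj cj by auto
  ultimately have bP: "\<gamma> - x \<in> P" by (simp add: Y_def)
  have "2 \<le> cw j \<bullet> (\<gamma> - x)" using cwx[of j] rj cj by (simp add: inner_diff_right)
  \<comment> \<open>Both parts avoid \<open>R\<close> but contain its neighbour \<open>j\<close>, so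
    each has negative product with \<open>x\<close> and can be added to it.\<close>
  then obtain s t where st: "s \<in> P" "t \<in> P" "\<gamma> - x = s + t" "0 < cw j \<bullet> s" "0 < cw j \<bullet> t"
    using split_coefficient[OF bP] rj by blast
  have cR: "cw i \<bullet> s = 0 \<and> cw i \<bullet> t = 0" if i: "i \<in> R" for i
  proof -
    have iD: "i \<in> D" using i R' by blast
    have "cw i \<bullet> (s + t) = 0" using R'(4)[OF i] cwx[OF iD] i st(3)[symmetric] by (simp add: inner_diff_right)
    then show ?thesis using P_cw_nonneg[OF st(1) iD] P_cw_nonneg[OF st(2) iD] by (simp add: inner_add_right)
  qed
  have xi: "i \<bullet> x \<le> 0" if "i \<in> D - R" for i
    unfolding x_def inner_sum_right using D_obtuse that R'(1) by (intro sum_nonpos) blast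
  have xj: "j \<bullet> x < 0"
  proof -
    have "j \<bullet> r < 0" using D_obtuse[of j r] rj R'(1) by (auto simp: inner_commute less_le)
    then have "(\<Sum>y\<in>R. j \<bullet> y) < (\<Sum>y\<in>R. 0)"
      using D_obtuse rj R'(1) fR by (intro sum_strict_mono_ex1) (blast+)
    then show ?thesis by (simp add: x_def inner_sum_right)
  qed
  have neg_prod: "q \<bullet> x < 0" if q: "q \<in> P" "\<And>i. i \<in> R \<Longrightarrow> cw i \<bullet> q = 0" "0 < cw j \<bullet> q" for q
  proof -
    have "(\<Sum>\<delta>\<in>D. (cw \<delta> \<bullet> q) * (\<delta> \<bullet> x)) < (\<Sum>\<delta>\<in>D. 0)"
    proof (rule sum_strict_mono_ex1)
      show "\<forall>\<delta>\<in>D. (cw \<delta> \<bullet> q) * (\<delta> \<bullet> x) \<le> 0"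
      proof
        fix \<delta> assume d: "\<delta> \<in> D"
        show "(cw \<delta> \<bullet> q) * (\<delta> \<bullet> x) \<le> 0"
          by (cases "\<delta> \<in> R") (use q(2) xi[of \<delta>] P_cw_nonneg[OF q(1) d] d in \<open>auto intro: mult_nonneg_nonpos\<close>)
      qed
      show "\<exists>\<delta>\<in>D. (cw \<delta> \<bullet> q) * (\<delta> \<bullet> x) < 0" using rj xj q(3) by (intro bexI[of _ j]) (auto simp: mult_pos_neg)
    qed (rule finite_D)
    then show ?thesis using P_inner_expand[OF q(1), of x] by simp
  qed
  have "s \<bullet> x < 0" "t \<bullet> x < 0" using neg_prod st cR by blast+
  then have xs: "x + s \<in> P" "x + t \<in> P" using P_add[of s x] P_add[of t x] st xP by (simp_all add: add.commute)
  have gst: "\<gamma> = x + s + t" using st(3) by (simp add: algebra_simps)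
  have pD: "cw p \<bullet> x = 1" "cw p \<bullet> s = 0" "cw p \<bullet> t = 0" using cwx[OF p(1)] R'(3) cR by auto
  have vl: "v \<bullet> x < v \<bullet> \<gamma>" "v \<bullet> (x + s) < v \<bullet> \<gamma>" "v \<bullet> (x + t) < v \<bullet> \<gamma>"
    using P_pos[OF st(1)] P_pos[OF st(2)] gst by (simp_all add: inner_add_right)
  have "0 < u \<bullet> x" "0 < u \<bullet> (x + s)" "0 < u \<bullet> (x + t)"
    using mn[OF xP _ vl(1)] mn[OF xs(1) _ vl(2)] mn[OF xs(2) _ vl(3)] pD by (simp_all add: inner_add_right)
  then have "0 < u \<bullet> \<gamma>" using three_summands[OF xP st(1,2) xs] gst g(1) four by simp
  then show False using g(3) by simp
qed

lemma rank_less_4: "card D < 4"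
proof (cases "0 < u \<bullet> \<Sum>D")
  case True
  then show ?thesis by (rule rank_less_4_aux)
next
  case False
  interpret opp: min_chamber \<Phi> P v "- u" by (rule opposite)
  have "\<Sum>D \<in> P" using sum_subset_D_in_P D_irr by blast
  then have "0 < - u \<bullet> \<Sum>D" using False u_nonzero by force
  then show ?thesis by (rule opp.rank_less_4_aux)
qed

end

section \<open>Minimal patterns of rank two and three\<close>

context chamber
begin

text \<open>Reflecting a root down to a simple root keeps its norm. In small rank this leaves few
  values for a positive definite quadratic form in the coefficients, so that the roots can be
  listed.\<close>

lemma norm_of_simple: "\<beta> \<in> P \<Longrightarrow> \<exists>\<delta>\<in>D. \<beta> \<bullet> \<beta> = \<delta> \<bullet> \<delta>"
proof (induction \<beta> rule: P_induct)
  case (less \<beta>)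
  show ?case
  proof (cases "\<beta> \<in> D")
    case False
    obtain \<alpha> where a: "\<alpha> \<in> D" "\<beta> \<bullet> \<alpha> > 0"
      using P_simple_pos[OF less.hyps, of \<beta>] P_nonzero less.hyps by auto
    have s: "refl_map \<alpha> \<beta> \<in> P" using simple_refl_P a less.hyps False by blast
    have "\<alpha> \<bullet> \<alpha> > 0" "v \<bullet> \<alpha> > 0" using P_nonzero P_pos D_P[OF a(1)] by auto
    then have "v \<bullet> refl_map \<alpha> \<beta> < v \<bullet> \<beta>" using a by (simp add: refl_map_def inner_diff_right)
    then show ?thesis using less.IH[OF s] by simp
  qed blast
qed

lemma refl_P:
  assumes "\<alpha> \<in> P" "\<beta> \<in> P" "refl_map \<alpha> \<beta> = \<gamma>" "0 < v \<bullet> \<gamma>"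
  shows "\<gamma> \<in> P"
  using assms refl_root[of \<alpha> \<beta>] P_root PI by blast

lemma expand2:
  assumes "D = {a, b}" "a \<noteq> b" "\<beta> \<in> P"
  obtains m n :: nat where "\<beta> = real m *\<^sub>R a + real n *\<^sub>R b" "cw a \<bullet> \<beta> = m" "cw b \<bullet> \<beta> = n"
proof -
  obtain m n :: nat where mn: "cw a \<bullet> \<beta> = m" "cw b \<bullet> \<beta> = n"
    using P_cw_nat[OF assms(3)] assms(1) by (metis insertCI)
  have "\<beta> = real m *\<^sub>R a + real n *\<^sub>R b" using P_expand[OF assms(3)] assms(1,2) mn by simp
  then show thesis using that mn by blast
qed

lemma expand3:
  assumes "D = {a, b, c}" "a \<noteq> b" "b \<noteq> c" "a \<noteq> c" "\<beta> \<in> P"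
  obtains i j k :: nat where "\<beta> = real i *\<^sub>R a + real j *\<^sub>R b + real k *\<^sub>R c"
    "cw a \<bullet> \<beta> = i" "cw b \<bullet> \<beta> = j" "cw c \<bullet> \<beta> = k"
proof -
  obtain i j k :: nat where ijk: "cw a \<bullet> \<beta> = i" "cw b \<bullet> \<beta> = j" "cw c \<bullet> \<beta> = k"
    using P_cw_nat[OF assms(5)] assms(1) by (metis insertCI)
  have "\<beta> = real i *\<^sub>R a + real j *\<^sub>R b + real k *\<^sub>R c" using P_expand[OF assms(5)] assms(1-4) ijk by (simp add: add.assoc)
  then show thesis using that ijk by blast
qed

lemma simple_pair:
  assumes "a \<in> D" "b \<in> D" "a \<noteq> b" "a \<bullet> b \<noteq> 0"
  obtains m n :: nat where "2 * (a \<bullet> b) = - (real m * (b \<bullet> b))" "2 * (a \<bullet> b) = - (real n * (a \<bullet> a))"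
    "m * n \<in> {1, 2, 3}"
proof -
  have neg: "0 < a \<bullet> - b" using D_obtuse[OF assms(1-3)] assms(4) by simp
  have xy: "a \<in> \<Phi>" "- b \<in> \<Phi>" using assms D_P P_root root_minus by blast+
  have "a \<noteq> - b" using P_not_minus[of b] assms D_P by blast
  then obtain m n :: int where mn: "2 * (a \<bullet> - b) = of_int m * (- b \<bullet> - b)" "2 * (a \<bullet> - b) = of_int n * (a \<bullet> a)"
    "m > 0" "n > 0" "m * n < 4"
    using cartan_pair[OF xy _ _ neg] assms(3) by auto
  have "0 < m * n" using mn by simp
  then have "m * n \<in> {1,2,3}" using mn(5) by auto
  moreover have "nat m * nat n = nat (m * n)" using mn by (simp add: nat_mult_distrib)
  ultimately have "nat m * nat n \<in> {1,2,3}" by (elim insertE) simp_all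
  then show thesis using that[of "nat m" "nat n"] mn by simp
qed

end

lemma nat_mult_small:
  fixes m n :: nat
  assumes "m * n \<in> {1, 2, 3}"
  shows "(m = 1 \<or> n = 1) \<and> m \<in> {1,2,3} \<and> n \<in> {1,2,3}"
proof -
  have "m * n = 1 \<or> m * n = 2 \<or> m * n = 3" using assms by blast
  then have p: "0 < m * n" "m * n < 4" by linarith+
  have mn: "0 < m" "0 < n" using p(1) by (simp_all only: nat_0_less_mult_iff)
  have "m * 1 \<le> m * n" "1 * n \<le> m * n" using mn by (intro mult_mono; simp)+
  then have b: "m < 4" "n < 4" using p(2) by linarith+
  have "\<not> (2 \<le> m \<and> 2 \<le> n)"
  proof
    assume "2 \<le> m \<and> 2 \<le> n"
    then have "2 * 2 \<le> m * n" by (intro mult_mono) auto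
    then show False using p(2) by simp
  qed
  then show ?thesis using mn b by auto
qed

lemma int_square_less:
  fixes x n :: int
  assumes "x\<^sup>2 < n * n" "0 \<le> n"
  shows "- n < x \<and> x < n"
proof -
  have "\<bar>x\<bar> < n"
  proof (rule ccontr)
    assume "\<not> ?thesis"
    then have "n * n \<le> \<bar>x\<bar> * \<bar>x\<bar>" using assms(2) by (intro mult_mono) auto
    then show False using assms(1) by (simp add: power2_eq_square)
  qed
  then show ?thesis by linarith
qed

context min_chamber
begin

text \<open>No coweight is a pivot, so both signs occur above every simple root. In ranks two and
  three the absence of a pivot is used in this form.\<close>

lemma mixed:
  assumes "\<delta> \<in> D"
  shows "\<exists>\<beta>\<in>P. 0 < cw \<delta> \<bullet> \<beta> \<and> 0 < u \<bullet> \<beta>" "\<exists>\<beta>\<in>P. 0 < cw \<delta> \<bullet> \<beta> \<and> u \<bullet> \<beta> < 0"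
proof -
  have e: "\<exists>\<beta>\<in>P. 0 < cw \<delta> \<bullet> \<beta>" using D_P[OF assms] cw[OF assms, of \<delta>] by force
  show "\<exists>\<beta>\<in>P. 0 < cw \<delta> \<bullet> \<beta> \<and> 0 < u \<bullet> \<beta>"
  proof (rule ccontr)
    assume "\<not> ?thesis"
    then have "{\<beta>\<in>P. 0 < cw \<delta> \<bullet> \<beta>} \<subseteq> {\<beta>\<in>P. u \<bullet> \<beta> < 0}" using u_nonzero by (force simp: not_less)
    then have "pivotal P {\<beta>\<in>P. u \<bullet> \<beta> < 0}" unfolding pivotal_def
      using P_cw_nonneg assms e by (intro exI[of _ "cw \<delta>"]) blast
    then show False using not_pivotal by simp
  qed
  show "\<exists>\<beta>\<in>P. 0 < cw \<delta> \<bullet> \<beta> \<and> u \<bullet> \<beta> < 0"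
  proof (rule ccontr)
    assume "\<not> ?thesis"
    then have "{\<beta>\<in>P. 0 < cw \<delta> \<bullet> \<beta>} \<inter> {\<beta>\<in>P. u \<bullet> \<beta> < 0} = {}" by blast
    then have "pivotal P {\<beta>\<in>P. u \<bullet> \<beta> < 0}" unfolding pivotal_def
      using P_cw_nonneg assms e by (intro exI[of _ "cw \<delta>"]) blast
    then show False using not_pivotal by simp
  qed
qed

lemma rank_not_1: "card D \<noteq> 1"
proof
  assume "card D = 1"
  then obtain a where a: "D = {a}" by (rule card_1_singletonE)
  have "\<beta> = a" if b: "\<beta> \<in> P" for \<beta>
  proof -
    have e: "\<beta> = (cw a \<bullet> \<beta>) *\<^sub>R a" using P_expand[OF b] a by simp
    then have "cw a \<bullet> \<beta> = 1 \<or> cw a \<bullet> \<beta> = -1"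
      using root_reduced[of a "cw a \<bullet> \<beta>"] P_root b D_P[of a] a by auto
    then show ?thesis using e P_cw_nonneg[OF b, of a] a by auto
  qed
  moreover have "a \<in> P" using D_P a by blast
  ultimately have "P = {a}" "a \<noteq> 0" using P_nonzero by blast+
  then show False using not_pivotal pivotal_singleton by metis
qed

lemma rank_2_or_3: "card D = 2 \<or> card D = 3"
proof -
  have "card D \<noteq> 0" using D_irr finite_D by (auto simp: irreducible_roots_def)
  then show ?thesis using rank_not_1 rank_less_4 by linarith
qed

text \<open>In rank three two roots span a proper subsystem. Its pivot is positive on
  \<open>s\<close> or on \<open>t\<close>, hence on every combination with positive coefficients, so
  the roots among these share one sign.\<close>

lemma two_summands:
  assumes "s \<in> P" "t \<in> P" "s \<noteq> t" "s + t \<in> P" "3 \<le> card D" "\<beta> \<in> P" "\<beta> = m *\<^sub>R s + n *\<^sub>R t" "0 < m" "0 < n"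
  shows "0 < u \<bullet> \<beta> \<longleftrightarrow> 0 < u \<bullet> (s + t)"
proof -
  have S: "\<Sum>{s, t} = s + t" using assms(3) by simp
  have A: "{s, t} \<subseteq> P" "\<Sum>{s, t} \<in> P" "card {s, t} < card D" using assms(1-5) by simp_all
  obtain \<omega> where w: "\<And>\<beta>. \<beta> \<in> P \<Longrightarrow> \<beta> \<in> span {s,t} \<Longrightarrow> 0 \<le> \<omega> \<bullet> \<beta>" "\<exists>x\<in>{s,t}. 0 < \<omega> \<bullet> x"
    "\<And>\<beta>. \<beta> \<in> P \<Longrightarrow> \<beta> \<in> span {s,t} \<Longrightarrow> 0 < \<omega> \<bullet> \<beta> \<Longrightarrow> 0 < u \<bullet> \<beta> \<longleftrightarrow> 0 < u \<bullet> (s + t)"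
    using dominating_sum[OF A] unfolding S by blast
  have sp: "s \<in> span {s,t}" "t \<in> span {s,t}" by (auto intro: span_base)
  have "0 \<le> \<omega> \<bullet> s" "0 \<le> \<omega> \<bullet> t" "0 < \<omega> \<bullet> s \<or> 0 < \<omega> \<bullet> t" using w(1,2) assms(1,2) sp by auto
  then have "0 < m * (\<omega> \<bullet> s) + n * (\<omega> \<bullet> t)"
    using assms(8,9) by (metis add_nonneg_pos add_pos_nonneg mult_nonneg_nonneg mult_pos_pos order_less_imp_le)
  then have "0 < \<omega> \<bullet> \<beta>" by (simp add: assms(7) inner_add_right)
  moreover have "\<beta> \<in> span {s,t}" unfolding assms(7) by (intro span_add span_scale sp)
  ultimately show ?thesis using w(3) assms(6) by blast
qed

text \<open>\<open>k\<close> is the ratio of the squared lengths of \<open>a\<close> and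
  \<open>b\<close>. In units of \<open>b \<bullet> b\<close> the norm form takes only the values 1
  and \<open>k\<close> on roots, and completing squares bounds the coefficients. Ratio 1 is type A2,
  where one simple root always has the sign of the sum and yields a pivot.\<close>

lemma rank_2:
  assumes "card D = 2"
  obtains a b where "D = {a, b}" "a \<noteq> b" "a \<bullet> a = 2 * (b \<bullet> b)" "a \<bullet> b = - (b \<bullet> b)"
      "P = {a, b, a + b, a + 2 *\<^sub>R b}"
    | a b where "D = {a, b}" "a \<noteq> b" "a \<bullet> a = 3 * (b \<bullet> b)" "2 * (a \<bullet> b) = - 3 * (b \<bullet> b)"
      "P = {a, b, a + b, a + 2 *\<^sub>R b, a + 3 *\<^sub>R b, 2 *\<^sub>R a + 3 *\<^sub>R b}"
proof -
  obtain x y where xy: "D = {x, y}" "x \<noteq> y" using assms by (meson card_2_iff)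
  have xD: "{x} \<subset> D" using xy by auto
  obtain p q where "p \<in> {x}" "q \<in> D - {x}" "p \<bullet> q \<noteq> 0"
    using irreducible_roots_link[OF D_irr zero_notin_D[OF subset_refl] xD] by blast
  then have link: "x \<bullet> y \<noteq> 0" using xy by auto
  obtain m n where mn: "2 * (x \<bullet> y) = - (real m * (y \<bullet> y))" "2 * (x \<bullet> y) = - (real n * (x \<bullet> x))"
    "m * n \<in> {1, 2, 3}" using simple_pair[of x y] xy link by blast
  have "\<exists>a b. \<exists>k::nat. D = {a, b} \<and> a \<noteq> b \<and> a \<bullet> a = real k * (b \<bullet> b) \<and> 2 * (a \<bullet> b) = - (real k * (b \<bullet> b)) \<and> k \<in> {1,2,3}"
  proof (cases "n = 1")
    case True
    then have "x \<bullet> x = real m * (y \<bullet> y)" using mn(1,2) by simp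
    then show ?thesis using xy mn(1) nat_mult_small[OF mn(3)] by (intro exI[of _ x] exI[of _ y] exI[of _ m]) simp
  next
    case False
    then have "m = 1" using nat_mult_small[OF mn(3)] by auto
    then have "y \<bullet> y = real n * (x \<bullet> x)" using mn(1,2) by simp
    moreover have "D = {y, x}" using xy(1) by auto
    moreover have "2 * (y \<bullet> x) = - (real n * (x \<bullet> x))" using mn(2) by (simp add: inner_commute)
    ultimately show ?thesis using xy(2) nat_mult_small[OF mn(3)]
      by (intro exI[of _ y] exI[of _ x] exI[of _ n]) simp
  qed
  then obtain a b and k :: nat where ab: "D = {a, b}" "a \<noteq> b" "a \<bullet> a = real k * (b \<bullet> b)"
    "2 * (a \<bullet> b) = - (real k * (b \<bullet> b))" "k \<in> {1,2,3}" by blast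
  have abP: "a \<in> P" "b \<in> P" using D_P ab(1) by auto
  have bb: "0 < b \<bullet> b" using P_nonzero abP by simp
  have kpos: "0 < k" using ab(5) by auto
  have aa: "0 < a \<bullet> a" using P_nonzero abP by simp
  have vab: "0 < v \<bullet> a" "0 < v \<bullet> b" using P_pos abP by auto
  have sum: "a + b \<in> P"
  proof (rule P_add[OF abP])
    have "0 < real k * (b \<bullet> b)" using kpos bb by simp
    then show "a \<bullet> b < 0" using ab(4) by linarith
  qed
  have form: "int k * int m * int m + int n * int n - int k * int m * int n \<in> {1, int k}"
    if b: "\<beta> \<in> P" "\<beta> = real m *\<^sub>R a + real n *\<^sub>R b" for \<beta> m n
  proof -
    have "\<beta> \<bullet> \<beta> = real m * real m * (a \<bullet> a) + real n * real n * (b \<bullet> b) + real m * real n * (2 * (a \<bullet> b))"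
      unfolding b(2) by (simp add: inner_add_left inner_add_right inner_commute algebra_simps)
    also have "\<dots> = (real k * real m * real m + real n * real n - real k * real m * real n) * (b \<bullet> b)"
      unfolding ab(3,4) by (simp add: algebra_simps)
    finally have e: "\<beta> \<bullet> \<beta> = real_of_int (int k * int m * int m + int n * int n - int k * int m * int n) * (b \<bullet> b)" by simp
    have "\<beta> \<bullet> \<beta> = 1 * (b \<bullet> b) \<or> \<beta> \<bullet> \<beta> = real_of_int (int k) * (b \<bullet> b)" using norm_of_simple[OF b(1)] ab(1,3) by auto
    then have "real_of_int (int k * int m * int m + int n * int n - int k * int m * int n) = real_of_int 1
      \<or> real_of_int (int k * int m * int m + int n * int n - int k * int m * int n) = real_of_int (int k)"
      using e bb by auto
    then show ?thesis by (metis insertCI of_int_eq_iff)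
  qed
  have sb: "refl_map b a = a + real k *\<^sub>R b" using ab(4) bb by (simp add: refl_map_def)
  have "2 * (b \<bullet> a) = - (a \<bullet> a)" using ab(3,4) by (simp add: inner_commute)
  then have sa: "refl_map a b = a + b" using aa by (simp add: refl_map_def)
  have akb: "a + real k *\<^sub>R b \<in> P" by (rule refl_P[OF abP(2,1) sb]) (use vab in \<open>simp add: inner_add_right add_pos_nonneg\<close>)
  consider "k = 1" | "k = 2" | "k = 3" using ab(5) by blast
  then show thesis
  proof cases
    case 1
    have "\<beta> \<in> {a, b, a + b}" if b: "\<beta> \<in> P" for \<beta>
    proof -
      obtain m n :: nat where mn: "\<beta> = real m *\<^sub>R a + real n *\<^sub>R b" using expand2[OF ab(1,2) b] by blast
      have "int m * int m + int n * int n - int m * int n = 1" using form[OF b mn] 1 by simp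
      then have f: "(int m - int n)^2 + int m^2 + int n^2 = 2" by (simp add: power2_eq_square algebra_simps)
      have "int m ^ 2 < 2 * 2" "int n ^ 2 < 2 * 2"
        using f zero_le_power2[of "int m - int n"] zero_le_power2[of "int m"] zero_le_power2[of "int n"] by linarith+
      from int_square_less[OF this(1)] int_square_less[OF this(2)] have "m < 2" "n < 2" by linarith+
      then have "m = 0 \<or> m = 1" "n = 0 \<or> n = 1" by auto
      then show ?thesis using f mn by auto
    qed
    then have P3: "P = {a, b, a + b}" using abP sum by blast
    have 0: "cw a \<bullet> b = 0" "cw b \<bullet> a = 0" using cw[of b a] cw[of a b] ab(1,2) by auto
    have "(0 < u \<bullet> a \<or> 0 < u \<bullet> a + u \<bullet> b) \<and> (u \<bullet> a < 0 \<or> u \<bullet> a + u \<bullet> b < 0)"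
      "(0 < u \<bullet> b \<or> 0 < u \<bullet> a + u \<bullet> b) \<and> (u \<bullet> b < 0 \<or> u \<bullet> a + u \<bullet> b < 0)"
      using mixed[of a] mixed[of b] ab(1) 0 unfolding P3 by (auto simp: inner_add_right)
    then show thesis by linarith
  next
    case 2
    have "\<beta> \<in> {a, b, a + b, a + 2 *\<^sub>R b}" if b: "\<beta> \<in> P" for \<beta>
    proof -
      obtain m n :: nat where mn: "\<beta> = real m *\<^sub>R a + real n *\<^sub>R b" using expand2[OF ab(1,2) b] by blast
      have "2 * int m * int m + int n * int n - 2 * int m * int n \<in> {1, 2}" using form[OF b mn] 2 by simp
      then have f: "int m^2 + (int m - int n)^2 \<in> {1, 2}" by (simp add: power2_eq_square algebra_simps)
      then have "int m^2 + (int m - int n)^2 \<le> 2" by auto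
      then have "int m ^ 2 < 2 * 2" "(int m - int n) ^ 2 < 2 * 2"
        using zero_le_power2[of "int m - int n"] zero_le_power2[of "int m"] by linarith+
      from int_square_less[OF this(1)] int_square_less[OF this(2)]
      have "(m = 0 \<and> n = 0) \<or> (m = 0 \<and> n = 1) \<or> (m = 1 \<and> n = 0) \<or> (m = 1 \<and> n = 1) \<or> (m = 1 \<and> n = 2)" by presburger
      then show ?thesis using f mn by auto
    qed
    then have "P = {a, b, a + b, a + 2 *\<^sub>R b}" using abP sum akb 2 by auto
    then show thesis using that(1)[OF ab(1,2)] ab(3,4) 2 by simp
  next
    case 3
    have "\<beta> \<in> {a, b, a + b, a + 2 *\<^sub>R b, a + 3 *\<^sub>R b, 2 *\<^sub>R a + 3 *\<^sub>R b}" if b: "\<beta> \<in> P" for \<beta>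
    proof -
      obtain m n :: nat where mn: "\<beta> = real m *\<^sub>R a + real n *\<^sub>R b" using expand2[OF ab(1,2) b] by blast
      have "3 * int m * int m + int n * int n - 3 * int m * int n \<in> {1, 3}" using form[OF b mn] 3 by simp
      then have f: "3 * int m^2 + (2 * int n - 3 * int m)^2 \<in> {4, 12}" by (auto simp: power2_eq_square algebra_simps)
      then have "3 * int m^2 + (2 * int n - 3 * int m)^2 \<le> 12" by auto
      then have "int m ^ 2 < 3 * 3" "(2 * int n - 3 * int m) ^ 2 < 4 * 4"
        using zero_le_power2[of "2 * int n - 3 * int m"] zero_le_power2[of "int m"] by linarith+
      from int_square_less[OF this(1)] int_square_less[OF this(2)]
      have "(m = 0 \<and> n = 0) \<or> (m = 0 \<and> n = 1) \<or> (m = 1 \<and> n = 0) \<or> (m = 1 \<and> n = 1) \<or> (m = 1 \<and> n = 2) \<or> (m = 1 \<and> n = 3)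
        \<or> (m = 2 \<and> n = 2) \<or> (m = 2 \<and> n = 3) \<or> (m = 2 \<and> n = 4)" by presburger
      then show ?thesis using f mn by (auto simp: scaleR_2)
    qed
    moreover have a2: "a + 2 *\<^sub>R b \<in> P"
    proof (rule refl_P[OF abP(2) sum])
      have "refl_map b (a + b) = a + 3 *\<^sub>R b - b" using sb 3 by (simp add: refl_map_add refl_map_self)
      also have "\<dots> = a + (3 *\<^sub>R b - 1 *\<^sub>R b)" by simp
      also have "\<dots> = a + 2 *\<^sub>R b" unfolding scaleR_diff_left[symmetric] by simp
      finally show "refl_map b (a + b) = a + 2 *\<^sub>R b" .
    qed (use vab in \<open>simp add: inner_add_right\<close>)
    moreover have a3: "a + 3 *\<^sub>R b \<in> P" using akb 3 by simp
    moreover have "2 *\<^sub>R a + 3 *\<^sub>R b \<in> P"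
    proof (rule refl_P[OF abP(1) a3])
      have "refl_map a (a + 3 *\<^sub>R b) = - a + 3 *\<^sub>R (a + b)"
        by (simp add: refl_map_add refl_map_self refl_map_scale sa)
      also have "\<dots> = (3 *\<^sub>R a - 1 *\<^sub>R a) + 3 *\<^sub>R b" by (simp add: scaleR_add_right)
      also have "\<dots> = 2 *\<^sub>R a + 3 *\<^sub>R b" unfolding scaleR_diff_left[symmetric] by simp
      finally show "refl_map a (a + 3 *\<^sub>R b) = 2 *\<^sub>R a + 3 *\<^sub>R b" .
    qed (use vab in \<open>simp add: inner_add_right\<close>)
    ultimately have "P = {a, b, a + b, a + 2 *\<^sub>R b, a + 3 *\<^sub>R b, 2 *\<^sub>R a + 3 *\<^sub>R b}" using abP sum by auto
    then show thesis using that(2)[OF ab(1,2)] ab(3,4) 3 by simp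
  qed
qed

end

lemma subset_of_three:
  assumes "S \<subseteq> {a, b, c}"
  shows "S = {} \<or> S = {a} \<or> S = {b} \<or> S = {c} \<or> S = {a, b} \<or> S = {b, c} \<or> S = {a, c} \<or> S = {a, b, c}"
proof -
  obtain x y z where xyz: "x = (a \<in> S)" "y = (b \<in> S)" "z = (c \<in> S)" by blast
  have S: "S = (if x then {a} else {}) \<union> (if y then {b} else {}) \<union> (if z then {c} else {})"
    unfolding xyz using assms by auto
  show ?thesis unfolding S by (cases x; cases y; cases z) auto
qed

context min_chamber
begin

text \<open>The last three hypotheses say that no fundamental coweight is a pivot when every root of
  full support has positive sign.\<close>

lemma path_signs:
  fixes x y z :: real
  assumes "0 < x + y + z" "x < 0 \<or> x + y < 0" "y < 0 \<or> x + y < 0 \<or> y + z < 0" "z < 0 \<or> y + z < 0"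
  shows "0 < x \<and> y < 0 \<and> 0 < z \<and> x + y < 0 \<and> y + z < 0"
  using assms by linarith

text \<open>The diagram is a path with middle \<open>b\<close> and at least one simple edge. In each
  of the three cases (one length, end \<open>c\<close> short, end \<open>c\<close> long) all roots
  of full support share a sign \<tau>, whence \<open>path_signs\<close> fixes the signs of the
  simple roots and of the two edges. With two lengths, some root of full support is a sum of two
  roots of sign opposite to \<tau>, a contradiction. With one length, the two values of \<tau> give
  the two patterns.\<close>

lemma rank_3:
  assumes "card D = 3"
  obtains a b c where "D = {a, b, c}" "a \<noteq> b" "b \<noteq> c" "a \<noteq> c" "a \<bullet> c = 0"
    "a \<bullet> a = b \<bullet> b" "c \<bullet> c = b \<bullet> b" "2 * (a \<bullet> b) = - (b \<bullet> b)" "2 * (b \<bullet> c) = - (b \<bullet> b)"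
    "P = {a, b, c, a + b, b + c, a + b + c}"
    "{\<beta>\<in>P. u \<bullet> \<beta> < 0} \<in> {{a, c, a + b + c}, {b, a + b, b + c}}"
proof -
  obtain x y z where xyz: "D = {x, y, z}" "x \<noteq> y" "y \<noteq> z" "x \<noteq> z" using assms by (auto simp: card_3_iff)
  have link: "\<exists>q\<in>D. q \<noteq> p \<and> p \<bullet> q \<noteq> 0" if p: "p \<in> D" for p
  proof -
    have "{p} \<subset> D" using p xyz by auto
    then obtain p' q where "p' \<in> {p}" "q \<in> D - {p}" "p' \<bullet> q \<noteq> 0"
      using irreducible_roots_link[OF D_irr zero_notin_D[OF subset_refl]] by blast
    then show ?thesis by blast
  qed
  have "\<exists>a b c. D = {a,b,c} \<and> a \<noteq> b \<and> b \<noteq> c \<and> a \<noteq> c \<and> a \<bullet> c = 0"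
  proof -
    have "x \<bullet> y = 0 \<or> y \<bullet> z = 0 \<or> x \<bullet> z = 0" using no_3_cycle[of x y z] xyz by auto
    moreover have "D = {x,z,y}" "D = {y,x,z}" using xyz by auto
    ultimately show ?thesis using xyz by metis
  qed
  then obtain a1 b c1 where abc1: "D = {a1,b,c1}" "a1 \<noteq> b" "b \<noteq> c1" "a1 \<noteq> c1" "a1 \<bullet> c1 = 0" by blast
  have ab1: "a1 \<bullet> b \<noteq> 0" using link[of a1] abc1 by auto
  have cb1: "c1 \<bullet> b \<noteq> 0" using link[of c1] abc1 by (auto simp: inner_commute)
  have inD: "a1 \<in> D" "b \<in> D" "c1 \<in> D" using abc1 by auto
  obtain m n where mn: "2 * (a1 \<bullet> b) = - (real m * (b \<bullet> b))" "2 * (a1 \<bullet> b) = - (real n * (a1 \<bullet> a1))" "m * n \<in> {1,2,3}"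
    using simple_pair[OF inD(1,2) abc1(2) ab1] by blast
  obtain k l where kl: "2 * (c1 \<bullet> b) = - (real k * (b \<bullet> b))" "2 * (c1 \<bullet> b) = - (real l * (c1 \<bullet> c1))" "k * l \<in> {1,2,3}"
    using simple_pair[OF inD(3,2) _ cb1] abc1(3) by blast
  have pos1: "0 < a1 \<bullet> a1" "0 < b \<bullet> b" "0 < c1 \<bullet> c1" using P_nonzero D_P inD by auto
  \<comment> \<open>\<open>r\<close> is the part of \<open>b\<close> orthogonal to both ends. It is
    nonzero by independence, and its squared norm is that of \<open>b\<close> times
    \<open>1 - m * n / 4 - k * l / 4\<close>.\<close>
  have small: "m * n + k * l < 4"
  proof -
    define s where "s = (a1 \<bullet> b) / (a1 \<bullet> a1)"
    define t where "t = (c1 \<bullet> b) / (c1 \<bullet> c1)"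
    define r where "r = b - s *\<^sub>R a1 - t *\<^sub>R c1"
    have s: "s * (a1 \<bullet> a1) = a1 \<bullet> b" "t * (c1 \<bullet> c1) = c1 \<bullet> b" using pos1 by (auto simp: s_def t_def)
    have "cw b \<bullet> r = 1" using cw[of a1 b] cw[of b b] cw[of c1 b] inD abc1 by (simp add: r_def inner_diff_right)
    then have "r \<noteq> 0" by auto
    then have "0 < r \<bullet> r" by simp
    also have "r \<bullet> r = b \<bullet> b - 2 * s * (a1 \<bullet> b) - 2 * t * (c1 \<bullet> b) + s * (s * (a1 \<bullet> a1)) + t * (t * (c1 \<bullet> c1)) + 2 * s * t * (a1 \<bullet> c1)"
      by (simp add: r_def inner_diff_left inner_diff_right inner_commute algebra_simps)
    also have "\<dots> = b \<bullet> b - s * (a1 \<bullet> b) - t * (c1 \<bullet> b)" unfolding s abc1(5) by simp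
    also have "s * (a1 \<bullet> b) = real (m * n) * (b \<bullet> b) / 4"
    proof -
      have "s = - real n / 2" using mn(2) pos1 by (simp add: s_def field_simps)
      moreover have "a1 \<bullet> b = - (real m * (b \<bullet> b)) / 2" using mn(1) by simp
      ultimately show ?thesis by simp
    qed
    also have "t * (c1 \<bullet> b) = real (k * l) * (b \<bullet> b) / 4"
    proof -
      have "t = - real l / 2" using kl(2) pos1 by (simp add: t_def field_simps)
      moreover have "c1 \<bullet> b = - (real k * (b \<bullet> b)) / 2" using kl(1) by simp
      ultimately show ?thesis by simp
    qed
    finally have "0 < (b \<bullet> b) * (1 - real (m * n) / 4 - real (k * l) / 4)" by (simp add: algebra_simps)
    then have "0 < 1 - real (m * n) / 4 - real (k * l) / 4" using pos1 by (simp add: zero_less_mult_iff)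
    then have "real (m * n + k * l) < 4" by simp
    then show ?thesis by linarith
  qed
  \<comment> \<open>The ends are named so that the edge between \<open>a\<close> and
    \<open>b\<close> is simple; \<open>k\<close> and \<open>l\<close> are the Cartan integers, up to
    sign, of the other edge.\<close>
  have "\<exists>a c. \<exists>k l::nat. D = {a,b,c} \<and> a \<noteq> b \<and> b \<noteq> c \<and> a \<noteq> c \<and> a \<bullet> c = 0 \<and> a \<bullet> a = b \<bullet> b
     \<and> 2 * (a \<bullet> b) = - (b \<bullet> b) \<and> 2 * (c \<bullet> b) = - (real k * (b \<bullet> b)) \<and> 2 * (c \<bullet> b) = - (real l * (c \<bullet> c)) \<and> k * l \<in> {1,2}"
  proof -
    have one: "p = 1 \<and> q = 1" if "p * q = 1" for p q :: nat using that by auto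
    have "m * n \<ge> 1" "k * l \<ge> 1" using mn(3) kl(3) by (metis insertE one_le_numeral order_refl singletonD)+
    then consider "m * n = 1" "k * l \<in> {1,2}" | "k * l = 1" "m * n \<in> {1,2}" using small mn(3) kl(3) by force
    then show ?thesis
    proof cases
      case 1
      have "m = 1" "n = 1" using one[OF 1(1)] by auto
      then have "a1 \<bullet> a1 = b \<bullet> b" "2 * (a1 \<bullet> b) = - (b \<bullet> b)" using mn(1,2) by auto
      then show ?thesis using abc1 kl(1,2) 1(2) by (intro exI[of _ a1] exI[of _ c1] exI[of _ k] exI[of _ l]) simp
    next
      case 2
      have "k = 1" "l = 1" using one[OF 2(1)] by auto
      then have "c1 \<bullet> c1 = b \<bullet> b" "2 * (c1 \<bullet> b) = - (b \<bullet> b)" using kl(1,2) by auto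
      moreover have "D = {c1, b, a1}" using abc1(1) by auto
      moreover have "c1 \<bullet> a1 = 0" using abc1(5) by (simp add: inner_commute)
      ultimately show ?thesis using abc1(2-4) mn(1,2) 2(2)
        by (intro exI[of _ c1] exI[of _ a1] exI[of _ m] exI[of _ n]) auto
    qed
  qed
  then obtain a c k l where D: "D = {a,b,c}" "a \<noteq> b" "b \<noteq> c" "a \<noteq> c" and ac: "a \<bullet> c = 0" and aa: "a \<bullet> a = b \<bullet> b"
    and ab: "2 * (a \<bullet> b) = - (b \<bullet> b)" and kl: "2 * (c \<bullet> b) = - (real k * (b \<bullet> b))" "2 * (c \<bullet> b) = - (real l * (c \<bullet> c))" "k * l \<in> {1,2}"
    by (metis (no_types, lifting))
  have P: "a \<in> P" "b \<in> P" "c \<in> P" using D_P D by auto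
  have bb: "0 < b \<bullet> b" using pos1 by simp
  have cc: "0 < c \<bullet> c" using P_nonzero P by simp
  have vp: "0 < v \<bullet> a" "0 < v \<bullet> b" "0 < v \<bullet> c" using P_pos P by auto
  have kl0: "0 < k" "0 < l" using kl(3) by (cases k; cases l; simp)+
  have cb: "c \<bullet> b < 0"
  proof -
    have "0 < real k * (b \<bullet> b)" using kl0 bb by simp
    then show ?thesis using kl(1) by linarith
  qed
  have abP: "a + b \<in> P" using P_add[OF P(1,2)] ab bb by linarith
  have bcP: "b + c \<in> P" using P_add[OF P(2,3)] cb by (simp add: inner_commute)
  have "(a + b) \<bullet> c = c \<bullet> b" by (simp add: inner_add_left ac inner_commute[of b c])
  then have abcP: "a + b + c \<in> P" using P_add[OF abP P(3)] cb by simp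
  have cwd: "cw a \<bullet> a = 1" "cw a \<bullet> b = 0" "cw a \<bullet> c = 0" "cw b \<bullet> a = 0" "cw b \<bullet> b = 1" "cw b \<bullet> c = 0"
    "cw c \<bullet> a = 0" "cw c \<bullet> b = 0" "cw c \<bullet> c = 1"
    using cw[of a] cw[of b] cw[of c] D by auto
  have norm_form: "\<beta> \<bullet> \<beta> = (real i * real i + real j * real j - real i * real j) * (b \<bullet> b) + real h * real h * (c \<bullet> c) + real j * real h * (2 * (c \<bullet> b))"
    if "\<beta> = real i *\<^sub>R a + real j *\<^sub>R b + real h *\<^sub>R c" for \<beta> i j h
  proof -
    have "\<beta> \<bullet> \<beta> = real i * real i * (a \<bullet> a) + real j * real j * (b \<bullet> b) + real h * real h * (c \<bullet> c)
        + real i * real j * (2 * (a \<bullet> b)) + real j * real h * (2 * (c \<bullet> b)) + 2 * real i * real h * (a \<bullet> c)"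
      unfolding that by (simp add: inner_add_left inner_add_right inner_commute algebra_simps)
    then show ?thesis unfolding aa ab ac by (simp add: algebra_simps)
  qed
  have norm_val: "\<beta> \<bullet> \<beta> = b \<bullet> b \<or> \<beta> \<bullet> \<beta> = c \<bullet> c" if "\<beta> \<in> P" for \<beta>
    using norm_of_simple[OF that] D(1) aa by auto
  define X where "X = u \<bullet> a" define Y where "Y = u \<bullet> b" define Z where "Z = u \<bullet> c"
  \<comment> \<open>Supports are connected, which rules out the two ends alone.\<close>
  have nf: "supp \<beta> = {a} \<or> supp \<beta> = {b} \<or> supp \<beta> = {c} \<or> supp \<beta> = {a,b} \<or> supp \<beta> = {b,c} \<or> supp \<beta> = D" if b: "\<beta> \<in> P" for \<beta>
  proof -
    have "supp \<beta> \<subseteq> {a,b,c}" using supp_subset D by auto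
    moreover have "supp \<beta> \<noteq> {}" using irreducible_supp[OF b] by (auto simp: irreducible_roots_def)
    moreover have "supp \<beta> \<noteq> {a,c}"
    proof
      assume e: "supp \<beta> = {a,c}"
      have sub: "{a} \<subset> supp \<beta>" using e D by auto
      obtain p q where "p \<in> {a}" "q \<in> supp \<beta> - {a}" "p \<bullet> q \<noteq> 0"
        using irreducible_roots_link[OF irreducible_supp[OF b] zero_notin_D[OF supp_subset] sub] by blast
      then show False using e ac by auto
    qed
    ultimately show ?thesis unfolding D(1) using subset_of_three by metis
  qed
  have sgn: "0 < u \<bullet> \<beta> \<longleftrightarrow> 0 < u \<bullet> \<Sum>(supp \<beta>)" if "\<beta> \<in> P" "supp \<beta> \<noteq> D" for \<beta>
    using sign_of_support that by blast
  \<comment> \<open>The factor \<tau> treats both signs at once. Above each simple root there is a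
    root of sign opposite to \<tau>; it lacks full support, so the sum of its support has the same
    sign and can replace it.\<close>
  have signs: "(0 < \<tau> * X \<and> \<tau> * Y < 0 \<and> 0 < \<tau> * Z \<and> \<tau> * (X + Y) < 0 \<and> \<tau> * (Y + Z) < 0)"
    if full: "\<And>\<beta>. \<beta> \<in> P \<Longrightarrow> supp \<beta> = D \<Longrightarrow> 0 < \<tau> * (u \<bullet> \<beta>)" and tau: "\<tau> = 1 \<or> \<tau> = -1" for \<tau> :: real
  proof -
    have ex: "\<exists>S. \<delta> \<in> S \<and> S \<in> {{a},{b},{c},{a,b},{b,c}} \<and> \<tau> * (u \<bullet> \<Sum>S) < 0" if d: "\<delta> \<in> D" for \<delta>
    proof -
      have "\<exists>\<beta>\<in>P. 0 < cw \<delta> \<bullet> \<beta> \<and> \<tau> * (u \<bullet> \<beta>) < 0" using mixed[OF d] tau by auto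
      then obtain \<beta> where \<beta>: "\<beta> \<in> P" "0 < cw \<delta> \<bullet> \<beta>" "\<tau> * (u \<bullet> \<beta>) < 0" by blast
      have ns: "supp \<beta> \<noteq> D" using full[OF \<beta>(1)] \<beta>(3) by force
      have "\<delta> \<in> supp \<beta>" using d \<beta>(2) by (simp add: supp_def)
      moreover have "supp \<beta> \<in> {{a},{b},{c},{a,b},{b,c}}" using nf[OF \<beta>(1)] ns by blast
      moreover have "\<tau> * (u \<bullet> \<Sum>(supp \<beta>)) < 0"
      proof -
        have "\<Sum>(supp \<beta>) \<in> P" by (rule sum_subset_D_in_P[OF supp_subset irreducible_supp[OF \<beta>(1)]])
        then have "u \<bullet> \<Sum>(supp \<beta>) \<noteq> 0" by (rule u_nonzero)
        then show ?thesis using sgn[OF \<beta>(1) ns] \<beta>(3) tau by auto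
      qed
      ultimately show ?thesis by blast
    qed
    have "supp (a + b + c) = D" using cwd D by (auto simp: supp_def inner_add_right)
    then have "0 < \<tau> * X + \<tau> * Y + \<tau> * Z" using full[OF abcP] by (simp add: X_def Y_def Z_def inner_add_right algebra_simps)
    moreover have "\<tau> * X < 0 \<or> \<tau> * X + \<tau> * Y < 0" using ex[of a] D by (auto simp: X_def Y_def inner_add_right algebra_simps)
    moreover have "\<tau> * Y < 0 \<or> \<tau> * X + \<tau> * Y < 0 \<or> \<tau> * Y + \<tau> * Z < 0" using ex[of b] D by (auto simp: X_def Y_def Z_def inner_add_right algebra_simps)
    moreover have "\<tau> * Z < 0 \<or> \<tau> * Y + \<tau> * Z < 0" using ex[of c] D by (auto simp: Y_def Z_def inner_add_right algebra_simps)
    ultimately show ?thesis using path_signs[of "\<tau> * X" "\<tau> * Y" "\<tau> * Z"] by (simp add: algebra_simps)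
  qed
  have three: "3 \<le> card D" using assms by simp
  define \<tau> where "\<tau> = (if 0 < u \<bullet> (a + b + c) then 1 else - 1 :: real)"
  have tau: "\<tau> = 1 \<or> \<tau> = -1" "0 < \<tau> * (u \<bullet> (a + b + c))" using u_nonzero[OF abcP] by (auto simp: \<tau>_def)
  have same: "0 < \<tau> * (u \<bullet> \<beta>)" if "\<beta> \<in> P" "0 < u \<bullet> \<beta> \<longleftrightarrow> 0 < u \<bullet> (a + b + c)" for \<beta>
    using that u_nonzero[OF that(1)] by (auto simp: \<tau>_def)
  have fullc: "1 \<le> i \<and> 1 \<le> j \<and> 1 \<le> h" if "supp \<beta> = D" "\<beta> = real i *\<^sub>R a + real j *\<^sub>R b + real h *\<^sub>R c" for \<beta> i j h
  proof -
    have "0 < cw a \<bullet> \<beta>" "0 < cw b \<bullet> \<beta>" "0 < cw c \<bullet> \<beta>" using that(1) D(1) by (auto simp: supp_def)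
    then show ?thesis unfolding that(2) using cwd by (simp add: inner_add_right)
  qed
  have klcases: "(k = 1 \<and> l = 1) \<or> (k = 1 \<and> l = 2) \<or> (k = 2 \<and> l = 1)"
  proof -
    have "m = 1 \<and> n = 1 \<or> m = 1 \<and> n = 2 \<or> m = 2 \<and> n = 1" if "m * n \<in> {1,2}" for m n :: nat
      using nat_mult_small[of m n] that by auto
    then show ?thesis using kl(3) by blast
  qed
  then consider (A) "k = 1" "l = 1" | (B) "k = 1" "l = 2" | (C) "k = 2" "l = 1" by blast
  then show thesis
  proof cases
    case B
    then have cb2: "2 * (c \<bullet> b) = - (b \<bullet> b)" and cc2: "2 * (c \<bullet> c) = b \<bullet> b" using kl(1,2) by auto
    have "2 * (b \<bullet> c) = - 2 * (c \<bullet> c)" using cb2 cc2 by (simp add: inner_commute)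
    then have "refl_map c b = b + 2 *\<^sub>R c" using cc by (simp add: refl_map_def)
    then have b2c: "b + 2 *\<^sub>R c \<in> P" by (rule refl_P[OF P(3,2)]) (use vp in \<open>simp add: inner_add_right\<close>)
    have "(b + c) \<bullet> (b + c) = c \<bullet> c" using cb2 cc2 by (simp add: inner_add_left inner_add_right inner_commute)
    moreover have "2 * (a \<bullet> (b + c)) = - 2 * (c \<bullet> c)" using ab ac cc2 by (simp add: inner_add_right)
    ultimately have "2 * (a \<bullet> (b + c)) / ((b + c) \<bullet> (b + c)) = - 2" using cc by simp
    then have "refl_map (b + c) a = a + 2 *\<^sub>R (b + c)" by (simp only: refl_map_def) simp
    then have a2b2c: "a + 2 *\<^sub>R (b + c) \<in> P" by (rule refl_P[OF bcP P(1)]) (use vp in \<open>simp add: inner_add_right\<close>)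
    have full: "0 < \<tau> * (u \<bullet> \<beta>)" if \<beta>: "\<beta> \<in> P" "supp \<beta> = D" for \<beta>
    proof -
      obtain i j h :: nat where ijh: "\<beta> = real i *\<^sub>R a + real j *\<^sub>R b + real h *\<^sub>R c" using expand3[OF D \<beta>(1)] by blast
      have "2 * (\<beta> \<bullet> \<beta>) = real_of_int (2 * int i * int i + 2 * int j * int j - 2 * int i * int j + int h * int h - 2 * int j * int h) * (b \<bullet> b)"
        unfolding norm_form[OF ijh] cb2 using cc2 by (simp add: algebra_simps)
      moreover have "2 * (\<beta> \<bullet> \<beta>) = real_of_int 2 * (b \<bullet> b) \<or> 2 * (\<beta> \<bullet> \<beta>) = real_of_int 1 * (b \<bullet> b)" using norm_val[OF \<beta>(1)] cc2 by auto
      ultimately have "real_of_int (2 * int i * int i + 2 * int j * int j - 2 * int i * int j + int h * int h - 2 * int j * int h) = real_of_int 2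
        \<or> real_of_int (2 * int i * int i + 2 * int j * int j - 2 * int i * int j + int h * int h - 2 * int j * int h) = real_of_int 1"
        using bb by auto
      then have "2 * int i * int i + 2 * int j * int j - 2 * int i * int j + int h * int h - 2 * int j * int h \<in> {1,2}"
        unfolding of_int_eq_iff by blast
      then have f: "int i^2 + (int i - int j)^2 + (int j - int h)^2 \<in> {1, 2}" by (simp add: power2_eq_square algebra_simps)
      then have "int i^2 + (int i - int j)^2 + (int j - int h)^2 \<le> 2" by auto
      then have "int i^2 < 2 * 2" "(int i - int j)^2 < 2 * 2" "(int j - int h)^2 < 2 * 2"
        using zero_le_power2[of "int i"] zero_le_power2[of "int i - int j"] zero_le_power2[of "int j - int h"] by linarith+
      from int_square_less[OF this(1)] int_square_less[OF this(2)] int_square_less[OF this(3)] fullc[OF \<beta>(2) ijh]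
      have "i = 1 \<and> ((j = 1 \<and> h = 1) \<or> (j = 1 \<and> h = 2) \<or> (j = 2 \<and> h = 1) \<or> (j = 2 \<and> h = 2) \<or> (j = 2 \<and> h = 3))" by presburger
      \<comment> \<open>The second is \<open>a + b\<close> plus twice \<open>c\<close>, the third
        \<open>a\<close> plus twice \<open>b + c\<close>, so \<open>two_summands\<close> compares
        each with \<open>a + b + c\<close>.\<close>
      then consider "\<beta> = a + b + c" | "\<beta> = a + b + 2 *\<^sub>R c" | "\<beta> = a + 2 *\<^sub>R b + 2 *\<^sub>R c" using f ijh by auto
      then show ?thesis
      proof cases
        case 1
        then show ?thesis using tau by simp
      next
        case 2
        have "a + b \<noteq> c" using D_indec[of c a b] D P by auto
        then have "0 < u \<bullet> \<beta> \<longleftrightarrow> 0 < u \<bullet> (a + b + c)"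
          using two_summands[OF abP P(3) _ abcP three \<beta>(1), of 1 2] 2 by simp
        then show ?thesis using same \<beta>(1) by blast
      next
        case 3
        have "a \<noteq> b + c" using D_indec[of a b c] D P by auto
        then have "0 < u \<bullet> \<beta> \<longleftrightarrow> 0 < u \<bullet> (a + (b + c))"
          using two_summands[OF P(1) bcP _ _ three \<beta>(1), of 1 2] abcP 3 by (simp add: add.assoc scaleR_add_right)
        then show ?thesis using same \<beta>(1) by (simp add: add.assoc)
      qed
    qed
    note s = signs[OF full tau(1)]
    have "supp (b + 2 *\<^sub>R c) = {b, c}" using cwd D by (auto simp: supp_def inner_add_right)
    moreover have "{b, c} \<noteq> D" using D by auto
    ultimately have "0 < u \<bullet> (b + 2 *\<^sub>R c) \<longleftrightarrow> 0 < Y + Z" using sgn[OF b2c] D by (simp add: Y_def Z_def inner_add_right)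
    then have "\<tau> * (u \<bullet> (b + 2 *\<^sub>R c)) < 0" using s tau(1) u_nonzero[OF b2c] by auto
    moreover have "supp (a + 2 *\<^sub>R (b + c)) = D" using cwd D by (auto simp: supp_def inner_add_right)
    then have "0 < \<tau> * (u \<bullet> (a + 2 *\<^sub>R (b + c)))" using full a2b2c by blast
    \<comment> \<open>The contradiction: a root of full support becomes a sum of two roots whose
      sign is opposite to \<tau>.\<close>
    moreover have "a + 2 *\<^sub>R (b + c) = (a + b) + (b + 2 *\<^sub>R c)" by (simp add: scaleR_add_right scaleR_2)
    then have "\<tau> * (u \<bullet> (a + 2 *\<^sub>R (b + c))) = \<tau> * (X + Y) + \<tau> * (u \<bullet> (b + 2 *\<^sub>R c))"
      by (simp only:) (simp add: X_def Y_def inner_add_right algebra_simps)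
    ultimately show thesis using s by linarith
  next
    case C
    then have cb2: "c \<bullet> b = - (b \<bullet> b)" and cc2: "c \<bullet> c = 2 * (b \<bullet> b)" using kl(1,2) by auto
    have "2 * (c \<bullet> b) / (b \<bullet> b) = - 2" using cb2 bb by simp
    then have "refl_map b c = 2 *\<^sub>R b + c" by (simp add: refl_map_def add.commute)
    then have bbc: "2 *\<^sub>R b + c \<in> P" by (rule refl_P[OF P(2,3)]) (use vp in \<open>simp add: inner_add_right\<close>)
    have "2 * ((a + b + c) \<bullet> b) = - (b \<bullet> b)" using ab cb2 by (simp add: inner_add_left)
    then have "refl_map b (a + b + c) = a + b + c + b" using bb by (simp add: refl_map_def)
    then have r: "refl_map b (a + b + c) = a + (2 *\<^sub>R b + c)" by (simp add: scaleR_2 algebra_simps)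
    have abbc: "a + (2 *\<^sub>R b + c) \<in> P" by (rule refl_P[OF P(2) abcP r]) (use vp in \<open>simp add: inner_add_right\<close>)
    have full: "0 < \<tau> * (u \<bullet> \<beta>)" if \<beta>: "\<beta> \<in> P" "supp \<beta> = D" for \<beta>
    proof -
      have ne: "a \<noteq> 2 *\<^sub>R b + c" using cwd by (metis add_0 inner_add_right inner_scaleR_right mult_zero_right zero_neq_one)
      have ne': "a + b \<noteq> c" using D_indec[of c a b] D P by auto
      \<comment> \<open>The root \<open>2 a + 2 b + c\<close> mediates: it combines
        \<open>a + b\<close> with \<open>c\<close>, and also \<open>a\<close> with
        \<open>2 b + c\<close>, so the sign of \<open>a + b + c\<close> is passed on to
        \<open>a + 2 b + c\<close>.\<close>
      have e1: "0 < u \<bullet> (2 *\<^sub>R a + 2 *\<^sub>R b + c) \<longleftrightarrow> 0 < u \<bullet> (a + b + c)" if "2 *\<^sub>R a + 2 *\<^sub>R b + c \<in> P"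
        using two_summands[OF abP P(3) ne' abcP three that, of 2 1] by (simp add: scaleR_add_right)
      have aabbcc: "2 *\<^sub>R a + 2 *\<^sub>R b + c \<in> P"
      proof -
        have "(a + b) \<bullet> (a + b) = b \<bullet> b" using ab aa by (simp add: inner_add_left inner_add_right inner_commute)
        moreover have "2 * (c \<bullet> (a + b)) = - 2 * (b \<bullet> b)" using cb2 ac by (simp add: inner_add_right inner_commute)
        ultimately have "2 * (c \<bullet> (a + b)) / ((a + b) \<bullet> (a + b)) = - 2" using bb by simp
        then have "refl_map (a + b) c = 2 *\<^sub>R a + 2 *\<^sub>R b + c" by (simp add: refl_map_def scaleR_add_right add.commute)
        then show ?thesis by (rule refl_P[OF abP P(3)]) (use vp in \<open>simp add: inner_add_right\<close>)
      qed
      have e2: "0 < u \<bullet> (2 *\<^sub>R a + 2 *\<^sub>R b + c) \<longleftrightarrow> 0 < u \<bullet> (a + (2 *\<^sub>R b + c))"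
        using two_summands[OF P(1) bbc ne abbc three aabbcc, of 2 1] by (simp add: add.assoc)
      obtain i j h :: nat where ijh: "\<beta> = real i *\<^sub>R a + real j *\<^sub>R b + real h *\<^sub>R c" using expand3[OF D \<beta>(1)] by blast
      have "\<beta> \<bullet> \<beta> = real_of_int (int i * int i + int j * int j - int i * int j + 2 * int h * int h - 2 * int j * int h) * (b \<bullet> b)"
        unfolding norm_form[OF ijh] cb2 cc2 by (simp add: algebra_simps)
      moreover have "\<beta> \<bullet> \<beta> = real_of_int 1 * (b \<bullet> b) \<or> \<beta> \<bullet> \<beta> = real_of_int 2 * (b \<bullet> b)" using norm_val[OF \<beta>(1)] cc2 by auto
      ultimately have "real_of_int (int i * int i + int j * int j - int i * int j + 2 * int h * int h - 2 * int j * int h) = real_of_int 1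
        \<or> real_of_int (int i * int i + int j * int j - int i * int j + 2 * int h * int h - 2 * int j * int h) = real_of_int 2"
        using bb by auto
      then have "int i * int i + int j * int j - int i * int j + 2 * int h * int h - 2 * int j * int h \<in> {1,2}"
        unfolding of_int_eq_iff by blast
      then have f: "int i^2 + (int i - int j)^2 + (2 * int h - int j)^2 \<in> {2, 4}" by (auto simp: power2_eq_square algebra_simps)
      then have "int i^2 + (int i - int j)^2 + (2 * int h - int j)^2 \<le> 4" by auto
      then have "int i^2 < 3 * 3" "(int i - int j)^2 < 3 * 3" "(2 * int h - int j)^2 < 3 * 3"
        using zero_le_power2[of "int i"] zero_le_power2[of "int i - int j"] zero_le_power2[of "2 * int h - int j"] by linarith+
      from int_square_less[OF this(1)] int_square_less[OF this(2)] int_square_less[OF this(3)] fullc[OF \<beta>(2) ijh]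
      have "(i = 1 \<or> i = 2) \<and> (j = 1 \<or> j = 2 \<or> j = 3 \<or> j = 4) \<and> (h = 1 \<or> h = 2 \<or> h = 3)" by presburger
      then consider "\<beta> = a + b + c" | "\<beta> = a + (2 *\<^sub>R b + c)" | "\<beta> = 2 *\<^sub>R a + 2 *\<^sub>R b + c" using f ijh
        by (elim conjE disjE) (simp_all add: add.assoc)
      then show ?thesis
      proof cases
        case 1
        then show ?thesis using tau by simp
      next
        case 2
        then show ?thesis using same \<beta>(1) e1[OF aabbcc] e2 by blast
      next
        case 3
        then show ?thesis using same \<beta>(1) e1[OF aabbcc] by blast
      qed
    qed
    note s = signs[OF full tau(1)]
    have "supp (a + (2 *\<^sub>R b + c)) = D" using cwd D by (auto simp: supp_def inner_add_right)
    then have "0 < \<tau> * (u \<bullet> (a + (2 *\<^sub>R b + c)))" using full abbc by blast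
    moreover have "\<tau> * (u \<bullet> (a + (2 *\<^sub>R b + c))) = \<tau> * (X + Y) + \<tau> * (Y + Z)"
      by (simp add: X_def Y_def Z_def inner_add_right algebra_simps)
    ultimately show thesis using s by linarith
  next
    case A
    then have cb2: "2 * (c \<bullet> b) = - (b \<bullet> b)" and cc2: "c \<bullet> c = b \<bullet> b" using kl(1,2) by auto
    have list: "\<beta> \<in> {a, b, c, a + b, b + c, a + b + c}" if \<beta>: "\<beta> \<in> P" for \<beta>
    proof -
      obtain i j h :: nat where ijh: "\<beta> = real i *\<^sub>R a + real j *\<^sub>R b + real h *\<^sub>R c" using expand3[OF D \<beta>] by blast
      have "\<beta> \<bullet> \<beta> = real_of_int (int i * int i + int j * int j - int i * int j + int h * int h - int j * int h) * (b \<bullet> b)"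
        unfolding norm_form[OF ijh] cb2 cc2 by (simp add: algebra_simps)
      moreover have "\<beta> \<bullet> \<beta> = real_of_int 1 * (b \<bullet> b)" using norm_val[OF \<beta>] cc2 by auto
      ultimately have "real_of_int (int i * int i + int j * int j - int i * int j + int h * int h - int j * int h) = real_of_int 1"
        using bb by auto
      then have "int i * int i + int j * int j - int i * int j + int h * int h - int j * int h = 1"
        unfolding of_int_eq_iff .
      \<comment> \<open>Twice the norm form of type A3, as squares of the differences along the path
        with both ends attached to zero.\<close>
      then have f: "int i^2 + (int i - int j)^2 + (int j - int h)^2 + int h^2 = 2" by (simp add: power2_eq_square algebra_simps)
      then have "int i^2 < 2 * 2" "(int i - int j)^2 < 2 * 2" "(int j - int h)^2 < 2 * 2" "int h ^2 < 2 * 2"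
        using zero_le_power2[of "int i"] zero_le_power2[of "int i - int j"] zero_le_power2[of "int j - int h"] zero_le_power2[of "int h"] by linarith+
      from int_square_less[OF this(1)] int_square_less[OF this(2)] int_square_less[OF this(3)] int_square_less[OF this(4)]
      have "(i = 0 \<or> i = 1) \<and> (j = 0 \<or> j = 1 \<or> j = 2) \<and> (h = 0 \<or> h = 1)" by presburger
      then show ?thesis using f ijh by (elim conjE disjE) simp_all
    qed
    then have Peq: "P = {a, b, c, a + b, b + c, a + b + c}" using P abP bcP abcP by blast
    have full: "0 < \<tau> * (u \<bullet> \<beta>)" if \<beta>: "\<beta> \<in> P" "supp \<beta> = D" for \<beta>
    proof -
      have "0 < cw a \<bullet> \<beta>" "0 < cw c \<bullet> \<beta>" using \<beta>(2) D(1) by (auto simp: supp_def)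
      then have "\<beta> = a + b + c" using list[OF \<beta>(1)] cwd by (auto simp: inner_add_right)
      then show ?thesis using tau by simp
    qed
    note s = signs[OF full tau(1)]
    have dist: "a \<noteq> b" "b \<noteq> c" "a \<noteq> c" by (rule D)+
    have ux: "u \<bullet> a = X" "u \<bullet> b = Y" "u \<bullet> c = Z" by (simp_all add: X_def Y_def Z_def)
    have t2: "0 < \<tau> * (X + Y + Z)" using tau(2) by (simp add: inner_add_right ux)
    have "{\<beta>\<in>P. u \<bullet> \<beta> < 0} = {b, a + b, b + c} \<or> {\<beta>\<in>P. u \<bullet> \<beta> < 0} = {a, c, a + b + c}"
    proof (cases "\<tau> = 1")
      case True
      have "u \<bullet> a > 0" "u \<bullet> b < 0" "u \<bullet> c > 0" "u \<bullet> (a + b) < 0" "u \<bullet> (b + c) < 0" "u \<bullet> (a + b + c) > 0"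
        using s t2 True by (simp_all add: ux inner_add_right)
      then have "{\<beta>\<in>P. u \<bullet> \<beta> < 0} = {b, a + b, b + c}" unfolding Peq by (auto simp del: inner_add_right)
      then show ?thesis ..
    next
      case False
      then have "\<tau> = -1" using tau(1) by blast
      then have "u \<bullet> a < 0" "u \<bullet> b > 0" "u \<bullet> c < 0" "u \<bullet> (a + b) > 0" "u \<bullet> (b + c) > 0" "u \<bullet> (a + b + c) < 0"
        using s t2 by (simp_all add: ux inner_add_right)
      then have "{\<beta>\<in>P. u \<bullet> \<beta> < 0} = {a, c, a + b + c}" unfolding Peq by (auto simp del: inner_add_right)
      then show ?thesis ..
    qed
    then have J: "{\<beta>\<in>P. u \<bullet> \<beta> < 0} \<in> {{a, c, a + b + c}, {b, a + b, b + c}}" by blast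
    have "2 * (b \<bullet> c) = - (b \<bullet> b)" using cb2 by (simp add: inner_commute)
    then show thesis using that[OF D ac aa cc2 ab _ Peq J] by blast
  qed
qed

end

section \<open>Recognising and transporting minimal patterns\<close>

text \<open>A nonzero vector in the span of one side of a splitting cannot be orthogonal to that
  side. Irreducibility of a concrete system thus reduces to that of its simple roots.\<close>

lemma irreducible_roots_of_spanning:
  assumes "irreducible_roots S" "S \<subseteq> \<Phi>" "\<Phi> \<subseteq> span S" "0 \<notin> \<Phi>"
  shows "irreducible_roots \<Phi>"
proof (rule irreducible_rootsI)
  show "\<Phi> \<noteq> {}" using assms(1,2) by (auto simp: irreducible_roots_def)
  have main: False if m: "B \<noteq> {}" "A \<union> B = \<Phi>" "\<forall>\<alpha>\<in>A. \<forall>\<beta>\<in>B. \<alpha> \<bullet> \<beta> = 0" "S \<subseteq> A" for A B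
  proof -
    obtain b where b: "b \<in> B" using m(1) by blast
    have "b \<in> span S" using b m(2) assms(3) by blast
    then have "b \<in> span A" using span_mono[OF m(4)] by blast
    moreover have "b \<bullet> a = 0" if "a \<in> A" for a
    proof -
      have "a \<bullet> b = 0" using m(3) b that by blast
      then show ?thesis by (simp add: inner_commute)
    qed
    ultimately have "b \<bullet> b = 0" using inner_span_zero[of A b b] by blast
    then show False using b m(2) assms(4) by auto
  qed
  fix A B assume AB: "A \<noteq> {}" "B \<noteq> {}" "A \<inter> B = {}" "A \<union> B = \<Phi>" "\<forall>\<alpha>\<in>A. \<forall>\<beta>\<in>B. \<alpha> \<bullet> \<beta> = 0"
  have BA: "\<forall>\<alpha>\<in>B. \<forall>\<beta>\<in>A. \<alpha> \<bullet> \<beta> = 0" using AB(5) by (metis inner_commute)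
  have "S \<subseteq> A \<union> B" "0 \<notin> S" using assms(2,4) AB(4) by auto
  then have "S \<subseteq> A \<or> S \<subseteq> B" using irreducible_rootsD[OF assms(1) _ _ AB(5)] by blast
  then show False using main[OF AB(2,4,5)] main[OF AB(1) _ BA] AB(4) by (metis Un_commute)
qed

context chamber
begin

lemma dim_roots: "dim \<Phi> = card D"
proof -
  have "dim \<Phi> = dim (span D)" using span_D by (metis dim_span)
  then show ?thesis using D_independent by (simp add: dim_span dim_eq_card_independent)
qed

text \<open>As \<open>v\<close> is at least 1 on \<open>P\<close>, a sum of two positive roots has
  value at least 2, so roots of value 1 are indecomposable.\<close>

lemma simple_rootsI:
  assumes "T \<subseteq> P" "\<And>t. t \<in> T \<Longrightarrow> v \<bullet> t = 1" "\<And>\<beta>. \<beta> \<in> P \<Longrightarrow> 1 \<le> v \<bullet> \<beta>"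
    "\<And>\<beta>. \<beta> \<in> P - T \<Longrightarrow> \<exists>x\<in>P. \<exists>y\<in>P. \<beta> = x + y"
  shows "D = T"
proof
  show "D \<subseteq> T" using assms(4) by (auto simp: simple_roots_def)
  show "T \<subseteq> D"
  proof
    fix t assume t: "t \<in> T"
    have "t \<noteq> x + y" if "x \<in> P" "y \<in> P" for x y
      using assms(2)[OF t] assms(3)[OF that(1)] assms(3)[OF that(2)] by (auto simp: inner_add_right)
    then show "t \<in> D" using t assms(1) by (auto simp: simple_roots_def)
  qed
qed

text \<open>Gram matrices of the simple roots that agree up to a factor make \<open>f\<close> a
  similarity on the span. The factor absorbs the scale of the root system, which Cartan integers do
  not see.\<close>

lemma root_iso_of_gram:
  assumes "linear f" "0 < k" "\<And>d e. d \<in> D \<Longrightarrow> e \<in> D \<Longrightarrow> f d \<bullet> f e = k * (d \<bullet> e)"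
    "f ` P = Q" "\<Psi> = Q \<union> uminus ` Q"
  shows "root_iso f \<Phi> \<Psi>"
proof -
  have 1: "f d \<bullet> f y = k * (d \<bullet> y)" if d: "d \<in> D" and y: "y \<in> span D" for d y
    using y by (induction rule: span_induct_alt)
      (auto simp: linear_0[OF assms(1)] linear_add[OF assms(1)] linear_scale[OF assms(1)] inner_add_right assms(3) d algebra_simps)
  have gram: "f x \<bullet> f y = k * (x \<bullet> y)" if x: "x \<in> span D" and y: "y \<in> span D" for x y
    using x by (induction rule: span_induct_alt)
      (auto simp: linear_0[OF assms(1)] linear_add[OF assms(1)] linear_scale[OF assms(1)] inner_add_left 1 y algebra_simps)
  have "inj_on f (span \<Phi>)"
  proof (rule inj_onI)
    fix x y assume xy: "x \<in> span \<Phi>" "y \<in> span \<Phi>" "f x = f y"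
    have "x - y \<in> span D" using xy span_D span_diff by metis
    then have "f (x - y) \<bullet> f (x - y) = k * ((x - y) \<bullet> (x - y))" using gram by blast
    moreover have "f (x - y) = 0" using xy(3) linear_diff[OF assms(1), of x y] by simp
    ultimately have "(x - y) \<bullet> (x - y) = 0" using assms(2) by simp
    then show "x = y" by simp
  qed
  moreover have "f ` \<Phi> = \<Psi>"
  proof -
    have "f ` \<Phi> = f ` P \<union> f ` uminus ` P" by (subst roots_eq) (rule image_Un)
    also have "f ` uminus ` P = uminus ` f ` P" by (simp add: image_image linear_neg[OF assms(1)])
    finally show ?thesis using assms(4,5) by simp
  qed
  moreover have "cartan (f \<beta>) (f \<alpha>) = cartan \<beta> \<alpha>" if "\<alpha> \<in> \<Phi>" "\<beta> \<in> \<Phi>" for \<alpha> \<beta>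
  proof -
    have "\<alpha> \<in> span D" "\<beta> \<in> span D" using that span_D span_base by blast+
    then show ?thesis using assms(2) by (simp add: cartan_def gram)
  qed
  ultimately show ?thesis using assms(1) by (simp add: root_iso_def)
qed

end

text \<open>Conjugation of \<open>w\<close> by \<open>f\<close> is avoided: the functional that
  represents \<open>w\<close> is carried over, and \<open>weyl_exists\<close> turns it back into an
  element of the Weyl group.\<close>

lemma root_iso_transport:
  assumes "is_pattern (w, \<Phi>, P)" "chamber \<Psi> Q v'" "root_iso f \<Phi> \<Psi>" "f ` P = Q"
  obtains w' where "w' \<in> weyl \<Psi>" "inversions Q w' = f ` inversions P w" "pattern_iso (w, \<Phi>, P) (w', \<Psi>, Q)"
    "is_pattern (w', \<Psi>, Q)"
proof -
  obtain v where "chamber \<Phi> P v" using is_pattern_chamber assms(1) by blast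
  then interpret chamber \<Phi> P v .
  interpret Q: chamber \<Psi> Q v' by (rule assms(2))
  have w: "w \<in> weyl \<Phi>" using assms(1) by simp
  obtain u where u: "\<And>\<beta>. \<beta> \<in> \<Phi> \<Longrightarrow> u \<bullet> \<beta> \<noteq> 0" "inversions P w = {\<beta>\<in>P. u \<bullet> \<beta> < 0}"
    using weyl_functional[OF w] by blast
  have f: "linear f" "inj_on f (span \<Phi>)" "f ` \<Phi> = \<Psi>" using assms(3) by (auto simp: root_iso_def)
  obtain g where g: "linear g" "\<And>x. x \<in> span \<Phi> \<Longrightarrow> g (f x) = x"
    using linear_inj_on_left_inverse[OF f(1,2)] by blast
  have ug: "adjoint g u \<bullet> f x = u \<bullet> x" if "x \<in> \<Phi>" for x
    using adjoint_works[OF g(1), of "f x" u] g(2) that span_base by (metis inner_commute)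
  have "adjoint g u \<bullet> \<beta> \<noteq> 0" if "\<beta> \<in> \<Psi>" for \<beta>
    using that ug u(1) unfolding f(3)[symmetric] by auto
  then obtain w' where w': "w' \<in> weyl \<Psi>" "inversions Q w' = {\<beta>\<in>Q. adjoint g u \<bullet> \<beta> < 0}"
    using Q.weyl_exists by blast
  have "{\<beta>\<in>Q. adjoint g u \<bullet> \<beta> < 0} = f ` {\<beta>\<in>P. u \<bullet> \<beta> < 0}"
    unfolding assms(4)[symmetric] using ug P_root by auto
  then have i: "inversions Q w' = f ` inversions P w" using w'(2) u(2) by simp
  have "pattern_iso (w, \<Phi>, P) (w', \<Psi>, Q)" unfolding pattern_iso_def contains_via.simps
    using assms(3,4) i by (intro exI[of _ f]) simp
  moreover have "is_pattern (w', \<Psi>, Q)" using w'(1) Q.rs Q.positive_systemI by simp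
  ultimately show thesis using that w'(1) i by blast
qed

text \<open>A minimal pattern contained in the given one has rank two or three, and in rank two it
  needs roots of two lengths. So under the rank hypothesis its rank is that of \<Psi>, and the
  subspace cuts out all of \<Psi>.\<close>

lemma minimal_by_rank:
  assumes p: "is_pattern (w, \<Psi>, Q)" and irr: "irreducible_roots \<Psi>" and np: "\<not> pivotal Q (inversions Q w)"
    and rank: "dim \<Psi> = 2 \<or> (dim \<Psi> = 3 \<and> simply_laced \<Psi>)"
  shows "minimal_nonseparable (w, \<Psi>, Q)"
proof -
  obtain v where "chamber \<Psi> Q v" using is_pattern_chamber p by blast
  then interpret chamber \<Psi> Q v .
  have w: "w \<in> weyl \<Psi>" using p by simp
  obtain u where u: "\<And>\<beta>. \<beta> \<in> \<Psi> \<Longrightarrow> u \<bullet> \<beta> \<noteq> 0" "inversions Q w = {\<beta>\<in>Q. u \<bullet> \<beta> < 0}"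
    using weyl_functional[OF w] by blast
  have "\<not> all_pivotal \<Psi> Q (inversions Q w)"
    using irr np unfolding all_pivotal_def by (metis Int_UNIV_right subspace_UNIV)
  then have "\<not> separable (w, \<Psi>, Q)" using separable_iff[OF p] by simp
  then obtain U where U: "subspace U" "minimal_nonseparable (weyl_restrict Q w (\<Psi> \<inter> U), \<Psi> \<inter> U, Q \<inter> U)"
    by (rule nonseparable_contains_minimal[OF p])
  note r = is_pattern_restrict[OF p U(1)]
  have m: "minimal_nonpivotal (\<Psi> \<inter> U) (Q \<inter> U) (inversions Q w \<inter> U)"
    using U(2) unfolding minimal_nonseparable_iff[OF r(1)] r(2) .
  have iu: "inversions Q w \<inter> U = {\<beta>\<in>Q \<inter> U. u \<bullet> \<beta> < 0}" using u(2) by blast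
  interpret U: chamber "\<Psi> \<inter> U" "Q \<inter> U" v by (rule chamber_Int_subspace[OF U(1)])
  interpret U: min_chamber "\<Psi> \<inter> U" "Q \<inter> U" v u
    by unfold_locales (use u(1) m iu in auto)
  have dU: "dim (\<Psi> \<inter> U) = 2 \<or> dim (\<Psi> \<inter> U) = 3" using U.rank_2_or_3 U.dim_roots by simp
  have le: "dim (\<Psi> \<inter> U) \<le> dim \<Psi>" by (rule dim_subset) auto
  have "dim (\<Psi> \<inter> U) = dim \<Psi>"
  proof (cases "dim \<Psi> = 2")
    case True
    then show ?thesis using dU le by auto
  next
    case False
    then have d3: "dim \<Psi> = 3" "simply_laced \<Psi>" using rank by auto
    have "dim (\<Psi> \<inter> U) \<noteq> 2"
    proof
      assume "dim (\<Psi> \<inter> U) = 2"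
      then have c: "card U.D = 2" using U.dim_roots by simp
      have eqn: "x \<bullet> x = y \<bullet> y" if "x \<in> U.D" "y \<in> U.D" for x y
      proof -
        have "x \<in> \<Psi>" "y \<in> \<Psi>" using that U.D_P U.P_root by blast+
        then have "norm x = norm y" using d3(2) unfolding simply_laced_def by blast
        then show ?thesis by (simp add: dot_square_norm)
      qed
      have pos: "0 < y \<bullet> y" if "y \<in> U.D" for y using that U.D_P U.P_nonzero by simp
      show False
      proof (rule U.rank_2[OF c])
        fix a b assume "U.D = {a, b}" "a \<bullet> a = 2 * (b \<bullet> b)"
        then show False using eqn[of a b] pos[of b] by simp
      next
        fix a b assume "U.D = {a, b}" "a \<bullet> a = 3 * (b \<bullet> b)"
        then show False using eqn[of a b] pos[of b] by simp
      qed
    qed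
    then show ?thesis using dU d3 by simp
  qed
  then have "span (\<Psi> \<inter> U) = span \<Psi>"
    by (intro subspace_dim_equal subspace_span span_mono) (simp_all add: dim_span)
  then have "\<Psi> \<subseteq> span U" using span_base span_mono[of "\<Psi> \<inter> U" U] by blast
  then have e: "\<Psi> \<inter> U = \<Psi>" using span_eq_iff U(1) by blast
  then have "Q \<inter> U = Q" "inversions Q w \<inter> U = inversions Q w" using P_root by (auto simp: inversions_def)
  then have "minimal_nonpivotal \<Psi> Q (inversions Q w)" using m e by simp
  then show ?thesis unfolding minimal_nonseparable_iff[OF p] .
qed

context min_chamber
begin

lemma rank_2_B2_inversions:
  assumes D: "D = {a, b}" "a \<noteq> b" and P: "P = {a, b, a + b, a + 2 *\<^sub>R b}"
  shows "{\<beta>\<in>P. u \<bullet> \<beta> < 0} \<in> {{a, a + b}, {b, a + 2 *\<^sub>R b}}"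
proof -
  have ab: "cw a \<bullet> a = 1" "cw a \<bullet> b = 0" "cw b \<bullet> a = 0" "cw b \<bullet> b = 1" using cw[of a] cw[of b] D by auto
  define x where "x = u \<bullet> a" define y where "y = u \<bullet> b"
  have ux: "u \<bullet> a = x" "u \<bullet> b = y" "u \<bullet> (a + b) = x + y" "u \<bullet> (a + 2 *\<^sub>R b) = x + 2 * y"
    by (simp_all add: x_def y_def inner_add_right)
  have "0 < x \<or> 0 < x + y \<or> 0 < x + 2 * y" "x < 0 \<or> x + y < 0 \<or> x + 2 * y < 0"
    "0 < y \<or> 0 < x + y \<or> 0 < x + 2 * y" "y < 0 \<or> x + y < 0 \<or> x + 2 * y < 0"
    using mixed[of a] mixed[of b] D(1) ab unfolding P by (auto simp: ux inner_add_right)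
  moreover have "x \<noteq> 0" "y \<noteq> 0" "x + y \<noteq> 0" "x + 2 * y \<noteq> 0"
    using u_nonzero[of a] u_nonzero[of b] u_nonzero[of "a + b"] u_nonzero[of "a + 2 *\<^sub>R b"] P ux by auto
  ultimately have "(x < 0 \<and> 0 < y \<and> x + y < 0 \<and> 0 < x + 2 * y) \<or> (0 < x \<and> y < 0 \<and> 0 < x + y \<and> x + 2 * y < 0)"
    by linarith
  then show ?thesis
  proof
    assume s: "x < 0 \<and> 0 < y \<and> x + y < 0 \<and> 0 < x + 2 * y"
    have "{\<beta>\<in>P. u \<bullet> \<beta> < 0} = {a, a + b}"
      unfolding P using s ux by (auto simp del: inner_add_right)
    then show ?thesis by blast
  next
    assume s: "0 < x \<and> y < 0 \<and> 0 < x + y \<and> x + 2 * y < 0"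
    have "{\<beta>\<in>P. u \<bullet> \<beta> < 0} = {b, a + 2 *\<^sub>R b}"
      unfolding P using s ux by (auto simp del: inner_add_right)
    then show ?thesis by blast
  qed
qed

text \<open>In the slope order \<open>a\<close>, \<open>a + b\<close>, \<open>2 a + 3 b\<close>,
  \<open>a + 2 b\<close>, \<open>a + 3 b\<close>, \<open>b\<close> a functional changes sign at most
  once. Both signs above each simple root force the change between the second and the fifth root:
  three places, two orientations.\<close>

lemma rank_2_G2_inversions:
  assumes D: "D = {a, b}" "a \<noteq> b" and P: "P = {a, b, a + b, a + 2 *\<^sub>R b, a + 3 *\<^sub>R b, 2 *\<^sub>R a + 3 *\<^sub>R b}"
  shows "{\<beta>\<in>P. u \<bullet> \<beta> < 0} \<in> {{a, a + b}, {a, a + b, 2 *\<^sub>R a + 3 *\<^sub>R b},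
    {a, a + b, 2 *\<^sub>R a + 3 *\<^sub>R b, a + 2 *\<^sub>R b}, {b, a + 3 *\<^sub>R b}, {b, a + 3 *\<^sub>R b, a + 2 *\<^sub>R b},
    {b, a + 3 *\<^sub>R b, a + 2 *\<^sub>R b, 2 *\<^sub>R a + 3 *\<^sub>R b}}"
proof -
  have ab: "cw a \<bullet> a = 1" "cw a \<bullet> b = 0" "cw b \<bullet> a = 0" "cw b \<bullet> b = 1" using cw[of a] cw[of b] D by auto
  define x where "x = u \<bullet> a" define y where "y = u \<bullet> b"
  have ux: "u \<bullet> a = x" "u \<bullet> b = y" "u \<bullet> (a + b) = x + y" "u \<bullet> (a + 2 *\<^sub>R b) = x + 2 * y"
    "u \<bullet> (a + 3 *\<^sub>R b) = x + 3 * y" "u \<bullet> (2 *\<^sub>R a + 3 *\<^sub>R b) = 2 * x + 3 * y"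
    by (simp_all add: x_def y_def inner_add_right)
  have inD: "a \<in> D" "b \<in> D" using D by auto
  have 1: "0 < x \<or> 0 < x + y \<or> 0 < x + 2 * y \<or> 0 < x + 3 * y \<or> 0 < 2 * x + 3 * y"
    using mixed(1)[OF inD(1)] ab unfolding P by (auto simp: ux inner_add_right)
  have 2: "x < 0 \<or> x + y < 0 \<or> x + 2 * y < 0 \<or> x + 3 * y < 0 \<or> 2 * x + 3 * y < 0"
    using mixed(2)[OF inD(1)] ab unfolding P by (auto simp: ux inner_add_right)
  have 3: "0 < y \<or> 0 < x + y \<or> 0 < x + 2 * y \<or> 0 < x + 3 * y \<or> 0 < 2 * x + 3 * y"
    using mixed(1)[OF inD(2)] ab unfolding P by (auto simp: ux inner_add_right)
  have 4: "y < 0 \<or> x + y < 0 \<or> x + 2 * y < 0 \<or> x + 3 * y < 0 \<or> 2 * x + 3 * y < 0"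
    using mixed(2)[OF inD(2)] ab unfolding P by (auto simp: ux inner_add_right)
  have nz': "x \<noteq> 0" "y \<noteq> 0" "x + y \<noteq> 0" "x + 3 * y \<noteq> 0"
    using u_nonzero[of a] u_nonzero[of b] u_nonzero[of "a + b"] u_nonzero[of "a + 3 *\<^sub>R b"] P ux by auto
  have nz'': "2 * x + 3 * y \<noteq> 0" "x + 2 * y \<noteq> 0"
    using u_nonzero[of "2 *\<^sub>R a + 3 *\<^sub>R b"] u_nonzero[of "a + 2 *\<^sub>R b"] P ux by auto
  have xy: "(x < 0 \<and> 0 < y) \<or> (0 < x \<and> y < 0)" using 1 2 nz'(1,2) by linarith
  have "(x < 0 \<and> 0 < y \<and> x + y < 0 \<and> 0 < x + 3 * y) \<or> (0 < x \<and> y < 0 \<and> 0 < x + y \<and> x + 3 * y < 0)"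
    using xy
  proof
    assume h: "x < 0 \<and> 0 < y"
    then have "x + y < 0" using 4 nz'(3) by linarith
    moreover have "0 < x + 3 * y" using 1 h nz'(4) by linarith
    ultimately show ?thesis using h by blast
  next
    assume h: "0 < x \<and> y < 0"
    then have "0 < x + y" using 3 nz'(3) by linarith
    moreover have "x + 3 * y < 0" using 2 h nz'(4) by linarith
    ultimately show ?thesis using h by blast
  qed
  then have "(x < 0 \<and> 0 < y \<and> x + y < 0 \<and> 0 < x + 3 * y \<and> 0 < 2 * x + 3 * y \<and> 0 < x + 2 * y)
    \<or> (x < 0 \<and> 0 < y \<and> x + y < 0 \<and> 0 < x + 3 * y \<and> 2 * x + 3 * y < 0 \<and> 0 < x + 2 * y)
    \<or> (x < 0 \<and> 0 < y \<and> x + y < 0 \<and> 0 < x + 3 * y \<and> 2 * x + 3 * y < 0 \<and> x + 2 * y < 0)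
    \<or> (0 < x \<and> y < 0 \<and> 0 < x + y \<and> x + 3 * y < 0 \<and> 0 < 2 * x + 3 * y \<and> 0 < x + 2 * y)
    \<or> (0 < x \<and> y < 0 \<and> 0 < x + y \<and> x + 3 * y < 0 \<and> 0 < 2 * x + 3 * y \<and> x + 2 * y < 0)
    \<or> (0 < x \<and> y < 0 \<and> 0 < x + y \<and> x + 3 * y < 0 \<and> 2 * x + 3 * y < 0 \<and> x + 2 * y < 0)"
    using nz'' by linarith
  then consider "{\<beta>\<in>P. u \<bullet> \<beta> < 0} = {a, a + b}"
    | "{\<beta>\<in>P. u \<bullet> \<beta> < 0} = {a, a + b, 2 *\<^sub>R a + 3 *\<^sub>R b}"
    | "{\<beta>\<in>P. u \<bullet> \<beta> < 0} = {a, a + b, 2 *\<^sub>R a + 3 *\<^sub>R b, a + 2 *\<^sub>R b}"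
    | "{\<beta>\<in>P. u \<bullet> \<beta> < 0} = {b, a + 3 *\<^sub>R b}"
    | "{\<beta>\<in>P. u \<bullet> \<beta> < 0} = {b, a + 3 *\<^sub>R b, a + 2 *\<^sub>R b}"
    | "{\<beta>\<in>P. u \<bullet> \<beta> < 0} = {b, a + 3 *\<^sub>R b, a + 2 *\<^sub>R b, 2 *\<^sub>R a + 3 *\<^sub>R b}"
  proof (elim disjE)
    assume "x < 0 \<and> 0 < y \<and> x + y < 0 \<and> 0 < x + 3 * y \<and> 0 < 2 * x + 3 * y \<and> 0 < x + 2 * y"
    then show ?thesis using ux by (intro that(1)) (auto simp: P simp del: inner_add_right)
  next
    assume "x < 0 \<and> 0 < y \<and> x + y < 0 \<and> 0 < x + 3 * y \<and> 2 * x + 3 * y < 0 \<and> 0 < x + 2 * y"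
    then show ?thesis using ux by (intro that(2)) (auto simp: P simp del: inner_add_right)
  next
    assume "x < 0 \<and> 0 < y \<and> x + y < 0 \<and> 0 < x + 3 * y \<and> 2 * x + 3 * y < 0 \<and> x + 2 * y < 0"
    then show ?thesis using ux by (intro that(3)) (auto simp: P simp del: inner_add_right)
  next
    assume "0 < x \<and> y < 0 \<and> 0 < x + y \<and> x + 3 * y < 0 \<and> 0 < 2 * x + 3 * y \<and> 0 < x + 2 * y"
    then show ?thesis using ux by (intro that(4)) (auto simp: P simp del: inner_add_right)
  next
    assume "0 < x \<and> y < 0 \<and> 0 < x + y \<and> x + 3 * y < 0 \<and> 0 < 2 * x + 3 * y \<and> x + 2 * y < 0"
    then show ?thesis using ux by (intro that(5)) (auto simp: P simp del: inner_add_right)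
  next
    assume "0 < x \<and> y < 0 \<and> 0 < x + y \<and> x + 3 * y < 0 \<and> 2 * x + 3 * y < 0 \<and> x + 2 * y < 0"
    then show ?thesis using ux by (intro that(6)) (auto simp: P simp del: inner_add_right)
  qed
  then show ?thesis by cases blast+
qed

end

text \<open>Reduces the axioms to a finite check on the coordinates of positive roots. Signs are
  carried as factors 1 and -1, which affect neither the reflection nor integrality.\<close>

lemma root_system_image:
  fixes c :: "real \<times> real \<times> real \<Rightarrow> 'b::euclidean_space"
  assumes c: "linear c" "inj c" and fin: "finite S" and z: "0 \<notin> S"
    and refl: "\<And>s t. s \<in> S \<Longrightarrow> t \<in> S \<Longrightarrow> t - (2 * (c t \<bullet> c s) / (c s \<bullet> c s)) *\<^sub>R s \<in> S \<union> uminus ` S"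
    and red: "\<And>s t k. s \<in> S \<Longrightarrow> t \<in> S \<Longrightarrow> k *\<^sub>R s = t \<Longrightarrow> k = 1 \<or> k = -1"
    and int: "\<And>s t. s \<in> S \<Longrightarrow> t \<in> S \<Longrightarrow> 2 * (c t \<bullet> c s) / (c s \<bullet> c s) \<in> \<int>"
  shows "root_system (c ` S \<union> uminus ` c ` S)" (is "root_system ?R")
proof -
  have mem: "\<exists>e s. (e = 1 \<or> e = (-1::real)) \<and> s \<in> S \<and> \<alpha> = e *\<^sub>R c s" if "\<alpha> \<in> ?R" for \<alpha>
    using that
  proof
    assume "\<alpha> \<in> c ` S"
    then obtain s where "s \<in> S" "\<alpha> = 1 *\<^sub>R c s" by auto
    then show ?thesis by blast
  next
    assume "\<alpha> \<in> uminus ` c ` S"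
    then obtain s where "s \<in> S" "\<alpha> = - 1 *\<^sub>R c s" by auto
    then show ?thesis by blast
  qed
  have memI: "e *\<^sub>R c s \<in> ?R" if "e = 1 \<or> e = (-1::real)" "s \<in> S \<union> uminus ` S" for e s
    using that(1)
  proof
    assume "e = 1"
    then show ?thesis using that(2) linear_neg[OF c(1)] by auto
  next
    assume "e = -1"
    then show ?thesis using that(2) linear_neg[OF c(1)] by auto
  qed
  have crefl: "refl_map (e *\<^sub>R c s) x = refl_map (c s) x" if "e = 1 \<or> e = (-1::real)" for e s x
    using that refl_map_uminus[of "c s"] by auto
  have closed: "refl_map \<alpha> \<beta> \<in> ?R" if ab: "\<alpha> \<in> ?R" "\<beta> \<in> ?R" for \<alpha> \<beta>
  proof -
    obtain e s where es: "e = 1 \<or> e = -1" "s \<in> S" "\<alpha> = e *\<^sub>R c s" using mem[OF ab(1)] by blast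
    obtain e' t where et: "e' = 1 \<or> e' = -1" "t \<in> S" "\<beta> = e' *\<^sub>R c t" using mem[OF ab(2)] by blast
    have "refl_map \<alpha> \<beta> = e' *\<^sub>R c (t - (2 * (c t \<bullet> c s) / (c s \<bullet> c s)) *\<^sub>R s)"
      unfolding es(3) et(3) crefl[OF es(1)] refl_map_scale
      by (simp add: refl_map_def linear_diff[OF c(1)] linear_scale[OF c(1)])
    then show ?thesis using memI[OF et(1) refl[OF es(2) et(2)]] by simp
  qed
  have "finite ?R" using fin by simp
  moreover have "0 \<notin> ?R"
  proof
    assume "0 \<in> ?R"
    then obtain e s where "e = 1 \<or> e = (-1::real)" "s \<in> S" "0 = e *\<^sub>R c s" using mem by blast
    then have s: "s \<in> S" "c s = 0" by auto
    then have "c s = c 0" using linear_0[OF c(1)] by simp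
    then have "s = 0" by (rule injD[OF c(2)])
    then show False using s z by simp
  qed
  moreover have "refl_map \<alpha> ` ?R = ?R" if a: "\<alpha> \<in> ?R" for \<alpha>
  proof
    show "refl_map \<alpha> ` ?R \<subseteq> ?R" using closed[OF a] by (rule image_subsetI)
    show "?R \<subseteq> refl_map \<alpha> ` ?R"
    proof
      fix \<beta> assume "\<beta> \<in> ?R"
      then have "refl_map \<alpha> \<beta> \<in> ?R" by (rule closed[OF a])
      then show "\<beta> \<in> refl_map \<alpha> ` ?R" by (intro image_eqI[of _ _ "refl_map \<alpha> \<beta>"]) simp_all
    qed
  qed
  moreover have "k = 1 \<or> k = -1" if a: "\<alpha> \<in> ?R" "k *\<^sub>R \<alpha> \<in> ?R" for \<alpha> k
  proof -
    obtain e s where es: "e = 1 \<or> e = -1" "s \<in> S" "\<alpha> = e *\<^sub>R c s" using mem[OF a(1)] by blast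
    obtain e' t where et: "e' = 1 \<or> e' = -1" "t \<in> S" "k *\<^sub>R \<alpha> = e' *\<^sub>R c t" using mem[OF a(2)] by blast
    have "c ((e' * k * e) *\<^sub>R s) = e' *\<^sub>R (k *\<^sub>R \<alpha>)" using es(3) by (simp add: linear_scale[OF c(1)])
    also have "\<dots> = c t" using et(1) unfolding et(3) by auto
    finally have "(e' * k * e) *\<^sub>R s = t" by (rule injD[OF c(2)])
    then have "e' * k * e = 1 \<or> e' * k * e = -1" by (rule red[OF es(2) et(2)])
    then show ?thesis using es(1) et(1) by auto
  qed
  moreover have "cartan \<beta> \<alpha> \<in> \<int>" if ab: "\<alpha> \<in> ?R" "\<beta> \<in> ?R" for \<alpha> \<beta>
  proof -
    obtain e s where es: "e = 1 \<or> e = -1" "s \<in> S" "\<alpha> = e *\<^sub>R c s" using mem[OF ab(1)] by blast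
    obtain e' t where et: "e' = 1 \<or> e' = -1" "t \<in> S" "\<beta> = e' *\<^sub>R c t" using mem[OF ab(2)] by blast
    have "cartan \<beta> \<alpha> = (e' * e) * (2 * (c t \<bullet> c s) / (c s \<bullet> c s))"
      unfolding es(3) et(3) cartan_def using es(1) by auto
    moreover have "e' * e \<in> \<int>" using es(1) et(1) by auto
    ultimately show ?thesis using int[OF es(2) et(2)] by (simp only: Ints_mult)
  qed
  ultimately show ?thesis unfolding root_system_def by (intro conjI ballI allI impI)
qed

lemma chamber_image:
  fixes c :: "real \<times> real \<times> real \<Rightarrow> 'b::euclidean_space"
  assumes "root_system (c ` S \<union> uminus ` c ` S)" "\<And>s. s \<in> S \<Longrightarrow> 0 < v \<bullet> c s"
  shows "chamber (c ` S \<union> uminus ` c ` S) (c ` S) v"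
proof (intro chamber.intro rsys.intro chamber_axioms.intro assms(1))
  show "v \<bullet> \<alpha> \<noteq> 0" if "\<alpha> \<in> c ` S \<union> uminus ` c ` S" for \<alpha>
    using that assms(2) by force
  show "c ` S = {\<alpha> \<in> c ` S \<union> uminus ` c ` S. 0 < v \<bullet> \<alpha>}"
    using assms(2) by (force simp: not_less less_imp_le)
qed

context chamber
begin

text \<open>Elements are counted through their inversion sets, which determine them and are exactly
  the sign patterns of generic functionals.\<close>

lemma card_patterns:
  "card {(w, \<Phi>, P) | w. w \<in> weyl \<Phi> \<and> R (inversions P w)}
   = card {I. (\<exists>u. (\<forall>\<beta>\<in>\<Phi>. u \<bullet> \<beta> \<noteq> 0) \<and> I = {\<beta>\<in>P. u \<bullet> \<beta> < 0}) \<and> R I}"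
proof -
  have "{(w, \<Phi>, P) | w. w \<in> weyl \<Phi> \<and> R (inversions P w)} = (\<lambda>w. (w, \<Phi>, P)) ` {w \<in> weyl \<Phi>. R (inversions P w)}" by blast
  then have "card {(w, \<Phi>, P) | w. w \<in> weyl \<Phi> \<and> R (inversions P w)} = card {w \<in> weyl \<Phi>. R (inversions P w)}"
    by (simp add: card_image inj_on_def)
  also have "\<dots> = card (inversions P ` {w \<in> weyl \<Phi>. R (inversions P w)})"
    by (intro card_image[symmetric] inj_onI) (use weyl_unique in blast)
  also have "inversions P ` {w \<in> weyl \<Phi>. R (inversions P w)}
    = {I. (\<exists>u. (\<forall>\<beta>\<in>\<Phi>. u \<bullet> \<beta> \<noteq> 0) \<and> I = {\<beta>\<in>P. u \<bullet> \<beta> < 0}) \<and> R I}" (is "?A = ?B")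
  proof
    show "?A \<subseteq> ?B"
    proof
      fix I assume "I \<in> ?A"
      then obtain w where w: "w \<in> weyl \<Phi>" "R (inversions P w)" "I = inversions P w" by blast
      obtain u where "\<And>\<beta>. \<beta> \<in> \<Phi> \<Longrightarrow> u \<bullet> \<beta> \<noteq> 0" "inversions P w = {\<beta>\<in>P. u \<bullet> \<beta> < 0}" using weyl_functional[OF w(1)] by blast
      then show "I \<in> ?B" using w by blast
    qed
    show "?B \<subseteq> ?A"
    proof
      fix I assume "I \<in> ?B"
      then obtain u where u: "\<forall>\<beta>\<in>\<Phi>. u \<bullet> \<beta> \<noteq> 0" "I = {\<beta>\<in>P. u \<bullet> \<beta> < 0}" "R I" by blast
      then obtain w where "w \<in> weyl \<Phi>" "inversions P w = I" using weyl_exists[of u] by blast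
      then show "I \<in> ?A" using u(3) by blast
    qed
  qed
  finally show ?thesis .
qed

lemma simple_roots_iso:
  assumes "root_iso f \<Phi> \<Phi>" "f ` P = P" "d \<in> D"
  shows "f d \<in> D"
proof -
  have f: "linear f" "inj_on f (span \<Phi>)" using assms(1) by (auto simp: root_iso_def)
  have dP: "d \<in> P" by (rule D_P[OF assms(3)])
  have "f d \<in> f ` P" using dP by (rule imageI)
  then have "f d \<in> P" by (simp only: assms(2))
  moreover have "f d \<noteq> y + z" if yz: "y \<in> P" "z \<in> P" for y z
  proof
    assume e: "f d = y + z"
    have "y \<in> f ` P" "z \<in> f ` P" using yz by (simp_all only: assms(2))
    then obtain y' z' where y': "y' \<in> P" "y = f y'" "z' \<in> P" "z = f z'" by (elim imageE)
    have "f d = f (y' + z')" unfolding linear_add[OF f(1)] e y'(2,4) ..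
    moreover have "d \<in> span \<Phi>" "y' + z' \<in> span \<Phi>"
      using dP y'(1,3) by (simp_all add: P_root span_base span_add)
    ultimately have "d = y' + z'" using inj_onD[OF f(2)] by blast
    then show False using D_indec[OF assms(3) y'(1,3)] by blast
  qed
  ultimately show ?thesis by (auto simp: simple_roots_def)
qed

lemma fixed_simple_roots:
  assumes "linear f" "\<And>d. d \<in> D \<Longrightarrow> f d = d" "I \<subseteq> P"
  shows "f ` I = I"
proof -
  have "f \<beta> = \<beta>" if "\<beta> \<in> P" for \<beta>
  proof -
    have "f (\<Sum>\<delta>\<in>D. (cw \<delta> \<bullet> \<beta>) *\<^sub>R \<delta>) = (\<Sum>\<delta>\<in>D. (cw \<delta> \<bullet> \<beta>) *\<^sub>R \<delta>)"
      using assms(1,2) by (simp add: linear_sum linear_scale)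
    then show ?thesis using P_expand[OF that] by simp
  qed
  then show ?thesis using assms(3) by force
qed

text \<open>In rank two a nonzero dominant functional is positive on all positive roots except
  perhaps one simple root. A pivot would force \<open>J\<close> to have at most one element or to
  miss at most one.\<close>

lemma not_pivotal_rank_2:
  assumes D: "D = {a, b}" "a \<noteq> b" and J: "J \<subseteq> P" "2 \<le> card J" "card J + 2 \<le> card P"
  shows "\<not> pivotal P J"
proof
  assume "pivotal P J"
  then obtain \<omega> where w: "\<forall>\<beta>\<in>P. 0 \<le> \<omega> \<bullet> \<beta>" "\<exists>\<beta>\<in>P. 0 < \<omega> \<bullet> \<beta>"
    "{\<beta>\<in>P. 0 < \<omega> \<bullet> \<beta>} \<subseteq> J \<or> {\<beta>\<in>P. 0 < \<omega> \<bullet> \<beta>} \<inter> J = {}" unfolding pivotal_def by blast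
  obtain d where d: "d \<in> D" "0 < \<omega> \<bullet> d" using P_simple_pos w(2) by blast
  obtain e where e: "D = {d, e}" "d \<noteq> e" using d(1) D by auto
  have eP: "e \<in> P" using D_P e(1) by blast
  have pos: "0 < \<omega> \<bullet> \<beta>" if b: "\<beta> \<in> P" "\<beta> \<noteq> e" for \<beta>
  proof -
    obtain m n :: nat where mn: "\<beta> = real m *\<^sub>R d + real n *\<^sub>R e" using expand2[OF e b(1)] by blast
    have "m \<noteq> 0"
    proof
      assume "m = 0"
      then have "\<beta> = real n *\<^sub>R e" using mn by simp
      then have "real n = 1 \<or> real n = -1" using root_reduced[of e "real n"] P_root eP b(1) by auto
      then show False using \<open>\<beta> = real n *\<^sub>R e\<close> b(2) by auto
    qed
    then have "0 < real m * (\<omega> \<bullet> d)" using d by simp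
    moreover have "0 \<le> real n * (\<omega> \<bullet> e)" using w(1) eP by simp
    ultimately show ?thesis by (simp add: mn inner_add_right)
  qed
  have fJ: "finite J" using J(1) finite_P finite_subset by blast
  from w(3) show False
  proof
    assume "{\<beta>\<in>P. 0 < \<omega> \<bullet> \<beta>} \<subseteq> J"
    then have "P - {e} \<subseteq> J" using pos by blast
    then have "card (P - {e}) \<le> card J" using fJ card_mono by blast
    then show False using J(3) eP finite_P by simp
  next
    assume "{\<beta>\<in>P. 0 < \<omega> \<bullet> \<beta>} \<inter> J = {}"
    then have "J \<subseteq> {e}" using pos J(1) by blast
    then have "card J \<le> card {e}" by (intro card_mono) auto
    then show False using J(2) by simp
  qed
qed

end

section \<open>The patterns in types \<open>A\<^sub>3\<close>, \<open>B\<^sub>2\<close> and \<open>G\<^sub>2\<close>\<close>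

definition comb :: "'b::real_vector \<Rightarrow> 'b \<Rightarrow> 'b \<Rightarrow> real \<times> real \<times> real \<Rightarrow> 'b" where
  "comb p q r t = fst t *\<^sub>R p + fst (snd t) *\<^sub>R q + snd (snd t) *\<^sub>R r"

lemma linear_comb: "linear (comb p q r)"
  by (rule linearI) (simp_all add: comb_def algebra_simps scaleR_add_right)

lemma neq_4: "(1::4) \<noteq> 2" "(1::4) \<noteq> 3" "(1::4) \<noteq> 4" "(2::4) \<noteq> 3" "(2::4) \<noteq> 4" "(3::4) \<noteq> 4"
  "(2::4) \<noteq> 1" "(3::4) \<noteq> 1" "(4::4) \<noteq> 1" "(3::4) \<noteq> 2" "(4::4) \<noteq> 2" "(4::4) \<noteq> 3"
  by simp_all

lemma ev_inner: "ev i \<bullet> ev j = (if i = j then 1 else 0)"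
  by (simp add: inner_axis_axis)

text \<open>Coordinates with respect to the simple roots. In rank 2 the third coordinate is unused; it
  belongs to the vector \<open>ev 4\<close>, which makes the coordinate maps injective.\<close>

definition A3_coord :: "(real \<times> real \<times> real) set" where
  "A3_coord = {(1,0,0), (0,1,0), (0,0,1), (1,1,0), (0,1,1), (1,1,1)}"

definition B2_coord :: "(real \<times> real \<times> real) set" where
  "B2_coord = {(1,0,0), (0,1,0), (1,1,0), (1,2,0)}"

definition G2_coord :: "(real \<times> real \<times> real) set" where
  "G2_coord = {(1,0,0), (0,1,0), (1,1,0), (1,2,0), (1,3,0), (2,3,0)}"

definition a\<^sub>1 :: "real^4" where "a\<^sub>1 = ev 1 - ev 2"
definition a\<^sub>2 :: "real^4" where "a\<^sub>2 = ev 2 - ev 3"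
definition a\<^sub>3 :: "real^4" where "a\<^sub>3 = ev 3 - ev 4"

definition cA :: "real \<times> real \<times> real \<Rightarrow> real^4" where "cA = comb a\<^sub>1 a\<^sub>2 a\<^sub>3"
definition cB :: "real \<times> real \<times> real \<Rightarrow> real^4" where "cB = comb b\<^sub>1 b\<^sub>2 (ev 4)"
definition cG :: "real \<times> real \<times> real \<Rightarrow> real^4" where "cG = comb g\<^sub>1 g\<^sub>2 (ev 4)"

lemma linear_c: "linear cA" "linear cB" "linear cG"
  by (simp_all add: cA_def cB_def cG_def linear_comb)

lemma inj_c: "inj cA" "inj cB" "inj cG"
proof -
  have "t = 0" if "cA t = 0" for t
  proof -
    have "cA t $ 1 = 0" "cA t $ 2 = 0" "cA t $ 4 = 0" using that by simp_all
    then show ?thesis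
      by (cases t) (simp add: cA_def comb_def a\<^sub>1_def a\<^sub>2_def a\<^sub>3_def axis_def zero_prod_def)
  qed
  then show "inj cA" by (simp add: linear_injective_0[OF linear_c(1)])
  have "t = 0" if "cB t = 0" for t
  proof -
    have "cB t $ 1 = 0" "cB t $ 2 = 0" "cB t $ 4 = 0" using that by simp_all
    then show ?thesis
      by (cases t) (simp add: cB_def comb_def b\<^sub>1_def b\<^sub>2_def axis_def zero_prod_def)
  qed
  then show "inj cB" by (simp add: linear_injective_0[OF linear_c(2)])
  have "t = 0" if "cG t = 0" for t
  proof -
    have "cG t $ 1 = 0" "cG t $ 3 = 0" "cG t $ 4 = 0" using that by simp_all
    then show ?thesis
      by (cases t) (simp add: cG_def comb_def g\<^sub>1_def g\<^sub>2_def axis_def zero_prod_def)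
  qed
  then show "inj cG" by (simp add: linear_injective_0[OF linear_c(3)])
qed

lemma cA_inner: "cA (x,y,z) \<bullet> cA (x',y',z') = 2*x*x' + 2*y*y' + 2*z*z' - x*y' - y*x' - y*z' - z*y'"
  by (simp add: cA_def comb_def a\<^sub>1_def a\<^sub>2_def a\<^sub>3_def inner_add_left inner_add_right inner_diff_left inner_diff_right ev_inner)
    (simp add: algebra_simps)

lemma cB_inner: "cB (x,y,z) \<bullet> cB (x',y',z') = 2*x*x' + y*y' + z*z' - x*y' - y*x'"
  by (simp add: cB_def comb_def b\<^sub>1_def b\<^sub>2_def inner_add_left inner_add_right inner_diff_left inner_diff_right ev_inner)
    (simp add: algebra_simps)

lemma cG_inner: "cG (x,y,z) \<bullet> cG (x',y',z') = 6*x*x' + 2*y*y' + z*z' - 3*x*y' - 3*y*x'"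
  by (simp add: cG_def comb_def g\<^sub>1_def g\<^sub>2_def inner_add_left inner_add_right inner_diff_left inner_diff_right ev_inner)
    (simp add: algebra_simps)

definition v4 :: "real \<Rightarrow> real \<Rightarrow> real \<Rightarrow> real^4" where
  "v4 x y z = x *\<^sub>R ev 1 + y *\<^sub>R ev 2 + z *\<^sub>R ev 3"

text \<open>The entries are those of the functional with value \<open>h\<^sub>i\<close> on the \<open>i\<close>-th simple root.\<close>

lemma v4_cA: "v4 (h\<^sub>1 + h\<^sub>2 + h\<^sub>3) (h\<^sub>2 + h\<^sub>3) h\<^sub>3 \<bullet> cA (x,y,z) = h\<^sub>1 * x + h\<^sub>2 * y + h\<^sub>3 * z"
  by (simp add: v4_def cA_def comb_def a\<^sub>1_def a\<^sub>2_def a\<^sub>3_def inner_add_left inner_add_right inner_diff_left inner_diff_right ev_inner)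

lemma v4_cB: "v4 (h\<^sub>1 + h\<^sub>2) h\<^sub>2 0 \<bullet> cB (x,y,z) = h\<^sub>1 * x + h\<^sub>2 * y"
  by (simp add: v4_def cB_def comb_def b\<^sub>1_def b\<^sub>2_def inner_add_left inner_add_right inner_diff_left inner_diff_right ev_inner)

lemma v4_cG: "v4 0 (- h\<^sub>2) (h\<^sub>1 + h\<^sub>2) \<bullet> cG (x,y,z) = h\<^sub>1 * x + h\<^sub>2 * y"
  by (simp add: v4_def cG_def comb_def g\<^sub>1_def g\<^sub>2_def inner_add_left inner_add_right inner_diff_left inner_diff_right ev_inner)

lemma A3_pos_eq: "A3_pos = cA ` A3_coord"
  unfolding A3_pos_def A3_coord_def cA_def comb_def a\<^sub>1_def a\<^sub>2_def a\<^sub>3_def by (simp add: insert_commute)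

lemma B2_pos_eq: "B2_pos = cB ` B2_coord"
  unfolding B2_pos_def B2_coord_def cB_def comb_def by simp

lemma G2_pos_eq: "G2_pos = cG ` G2_coord"
  unfolding G2_pos_def G2_coord_def cG_def comb_def by simp

lemma root_system_A3: "root_system A3_roots"
  unfolding A3_roots_def A3_pos_eq
proof (rule root_system_image[OF linear_c(1) inj_c(1)])
  show "finite A3_coord" "0 \<notin> A3_coord" by (simp_all add: A3_coord_def zero_prod_def)
  have "\<forall>s\<in>A3_coord. \<forall>t\<in>A3_coord. t - (2 * (cA t \<bullet> cA s) / (cA s \<bullet> cA s)) *\<^sub>R s \<in> A3_coord \<union> uminus ` A3_coord"
    unfolding A3_coord_def by (simp only: ball_simps cA_inner scaleR_Pair diff_Pair) simp
  then show "t - (2 * (cA t \<bullet> cA s) / (cA s \<bullet> cA s)) *\<^sub>R s \<in> A3_coord \<union> uminus ` A3_coord"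
    if "s \<in> A3_coord" "t \<in> A3_coord" for s t using that by blast
  have "\<forall>s\<in>A3_coord. \<forall>t\<in>A3_coord. \<forall>k. k *\<^sub>R s = t \<longrightarrow> k = 1 \<or> k = -1"
    unfolding A3_coord_def by (auto simp: zero_prod_def)
  then show "k = 1 \<or> k = -1" if "s \<in> A3_coord" "t \<in> A3_coord" "k *\<^sub>R s = t" for s t k using that by blast
  have "\<forall>s\<in>A3_coord. \<forall>t\<in>A3_coord. 2 * (cA t \<bullet> cA s) / (cA s \<bullet> cA s) \<in> \<int>"
    unfolding A3_coord_def by (simp only: ball_simps cA_inner scaleR_Pair diff_Pair) simp
  then show "2 * (cA t \<bullet> cA s) / (cA s \<bullet> cA s) \<in> \<int>" if "s \<in> A3_coord" "t \<in> A3_coord" for s t using that by blast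
qed

lemma root_system_B2: "root_system B2_roots"
  unfolding B2_roots_def B2_pos_eq
proof (rule root_system_image[OF linear_c(2) inj_c(2)])
  show "finite B2_coord" "0 \<notin> B2_coord" by (simp_all add: B2_coord_def zero_prod_def)
  have "\<forall>s\<in>B2_coord. \<forall>t\<in>B2_coord. t - (2 * (cB t \<bullet> cB s) / (cB s \<bullet> cB s)) *\<^sub>R s \<in> B2_coord \<union> uminus ` B2_coord"
    unfolding B2_coord_def by (simp only: ball_simps cB_inner scaleR_Pair diff_Pair) simp
  then show "t - (2 * (cB t \<bullet> cB s) / (cB s \<bullet> cB s)) *\<^sub>R s \<in> B2_coord \<union> uminus ` B2_coord"
    if "s \<in> B2_coord" "t \<in> B2_coord" for s t using that by blast
  have "\<forall>s\<in>B2_coord. \<forall>t\<in>B2_coord. \<forall>k. k *\<^sub>R s = t \<longrightarrow> k = 1 \<or> k = -1"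
    unfolding B2_coord_def by (auto simp: zero_prod_def)
  then show "k = 1 \<or> k = -1" if "s \<in> B2_coord" "t \<in> B2_coord" "k *\<^sub>R s = t" for s t k using that by blast
  have "\<forall>s\<in>B2_coord. \<forall>t\<in>B2_coord. 2 * (cB t \<bullet> cB s) / (cB s \<bullet> cB s) \<in> \<int>"
    unfolding B2_coord_def by (simp only: ball_simps cB_inner scaleR_Pair diff_Pair) simp
  then show "2 * (cB t \<bullet> cB s) / (cB s \<bullet> cB s) \<in> \<int>" if "s \<in> B2_coord" "t \<in> B2_coord" for s t using that by blast
qed

lemma root_system_G2: "root_system G2_roots"
  unfolding G2_roots_def G2_pos_eq
proof (rule root_system_image[OF linear_c(3) inj_c(3)])
  show "finite G2_coord" "0 \<notin> G2_coord" by (simp_all add: G2_coord_def zero_prod_def)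
  have "\<forall>s\<in>G2_coord. \<forall>t\<in>G2_coord. t - (2 * (cG t \<bullet> cG s) / (cG s \<bullet> cG s)) *\<^sub>R s \<in> G2_coord \<union> uminus ` G2_coord"
    unfolding G2_coord_def by (simp only: ball_simps cG_inner scaleR_Pair diff_Pair) simp
  then show "t - (2 * (cG t \<bullet> cG s) / (cG s \<bullet> cG s)) *\<^sub>R s \<in> G2_coord \<union> uminus ` G2_coord"
    if "s \<in> G2_coord" "t \<in> G2_coord" for s t using that by blast
  have "\<forall>s\<in>G2_coord. \<forall>t\<in>G2_coord. \<forall>k. k *\<^sub>R s = t \<longrightarrow> k = 1 \<or> k = -1"
    unfolding G2_coord_def by (auto simp: zero_prod_def)
  then show "k = 1 \<or> k = -1" if "s \<in> G2_coord" "t \<in> G2_coord" "k *\<^sub>R s = t" for s t k using that by blast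
  have "\<forall>s\<in>G2_coord. \<forall>t\<in>G2_coord. 2 * (cG t \<bullet> cG s) / (cG s \<bullet> cG s) \<in> \<int>"
    unfolding G2_coord_def by (simp only: ball_simps cG_inner scaleR_Pair diff_Pair) simp
  then show "2 * (cG t \<bullet> cG s) / (cG s \<bullet> cG s) \<in> \<int>" if "s \<in> G2_coord" "t \<in> G2_coord" for s t using that by blast
qed

text \<open>The height functionals, with value 1 on each simple root as \<open>simple_rootsI\<close>
  demands. The entries are those of \<open>v4_cA\<close>, \<open>v4_cB\<close> and
  \<open>v4_cG\<close> with all parameters equal to 1.\<close>

abbreviation "vA \<equiv> v4 3 2 1"
abbreviation "vB \<equiv> v4 2 1 0"
abbreviation "vG \<equiv> v4 0 (-1) 2"

lemma vA_cA: "vA \<bullet> cA (x,y,z) = x + y + z" using v4_cA[of 1 1 1] by simp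
lemma vB_cB: "vB \<bullet> cB (x,y,z) = x + y" using v4_cB[of 1 1] by simp
lemma vG_cG: "vG \<bullet> cG (x,y,z) = x + y" using v4_cG[of 1 1] by simp

interpretation A3: chamber A3_roots A3_pos vA
  unfolding A3_roots_def A3_pos_eq
  by (rule chamber_image[OF root_system_A3[unfolded A3_roots_def A3_pos_eq]]) (auto simp: A3_coord_def vA_cA)

interpretation B2: chamber B2_roots B2_pos vB
  unfolding B2_roots_def B2_pos_eq
  by (rule chamber_image[OF root_system_B2[unfolded B2_roots_def B2_pos_eq]]) (auto simp: B2_coord_def vB_cB)

interpretation G2: chamber G2_roots G2_pos vG
  unfolding G2_roots_def G2_pos_eq
  by (rule chamber_image[OF root_system_G2[unfolded G2_roots_def G2_pos_eq]]) (auto simp: G2_coord_def vG_cG)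

lemma decompose_image:
  assumes "linear c" "\<And>t. t \<in> S - T \<Longrightarrow> \<exists>x\<in>S. \<exists>y\<in>S. t = x + y" "\<beta> \<in> c ` S - c ` T"
  shows "\<exists>x\<in>c ` S. \<exists>y\<in>c ` S. \<beta> = x + y"
proof -
  obtain t where t: "t \<in> S" "\<beta> = c t" using assms(3) by blast
  then have "t \<notin> T" using assms(3) by blast
  then obtain x y where "x \<in> S" "y \<in> S" "t = x + y" using assms(2) t by blast
  then show ?thesis using t(2) linear_add[OF assms(1), of x y] by blast
qed

section \<open>Simple roots, rank and irreducibility of the models\<close>

lemma A3_simple: "A3.D = cA ` {(1,0,0), (0,1,0), (0,0,1)}"
proof (rule A3.simple_rootsI)
  show "cA ` {(1,0,0), (0,1,0), (0,0,1)} \<subseteq> A3_pos" unfolding A3_pos_eq A3_coord_def by blast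
  show "vA \<bullet> t = 1" if "t \<in> cA ` {(1,0,0), (0,1,0), (0,0,1)}" for t using that by (auto simp: vA_cA)
  show "1 \<le> vA \<bullet> \<beta>" if "\<beta> \<in> A3_pos" for \<beta> using that unfolding A3_pos_eq A3_coord_def by (auto simp: vA_cA)
  show "\<exists>x\<in>A3_pos. \<exists>y\<in>A3_pos. \<beta> = x + y" if "\<beta> \<in> A3_pos - cA ` {(1,0,0), (0,1,0), (0,0,1)}" for \<beta>
    using that unfolding A3_pos_eq
    by (rule decompose_image[OF linear_c(1), rotated]) (auto simp: A3_coord_def)
qed

lemma B2_simple: "B2.D = cB ` {(1,0,0), (0,1,0)}"
proof (rule B2.simple_rootsI)
  show "cB ` {(1,0,0), (0,1,0)} \<subseteq> B2_pos" unfolding B2_pos_eq B2_coord_def by blast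
  show "vB \<bullet> t = 1" if "t \<in> cB ` {(1,0,0), (0,1,0)}" for t using that by (auto simp: vB_cB)
  show "1 \<le> vB \<bullet> \<beta>" if "\<beta> \<in> B2_pos" for \<beta> using that unfolding B2_pos_eq B2_coord_def by (auto simp: vB_cB)
  show "\<exists>x\<in>B2_pos. \<exists>y\<in>B2_pos. \<beta> = x + y" if "\<beta> \<in> B2_pos - cB ` {(1,0,0), (0,1,0)}" for \<beta>
    using that unfolding B2_pos_eq
    by (rule decompose_image[OF linear_c(2), rotated]) (auto simp: B2_coord_def)
qed

lemma G2_simple: "G2.D = cG ` {(1,0,0), (0,1,0)}"
proof (rule G2.simple_rootsI)
  show "cG ` {(1,0,0), (0,1,0)} \<subseteq> G2_pos" unfolding G2_pos_eq G2_coord_def by blast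
  show "vG \<bullet> t = 1" if "t \<in> cG ` {(1,0,0), (0,1,0)}" for t using that by (auto simp: vG_cG)
  show "1 \<le> vG \<bullet> \<beta>" if "\<beta> \<in> G2_pos" for \<beta> using that unfolding G2_pos_eq G2_coord_def by (auto simp: vG_cG)
  show "\<exists>x\<in>G2_pos. \<exists>y\<in>G2_pos. \<beta> = x + y" if "\<beta> \<in> G2_pos - cG ` {(1,0,0), (0,1,0)}" for \<beta>
    using that unfolding G2_pos_eq
    by (rule decompose_image[OF linear_c(3), rotated]) (auto simp: G2_coord_def)
qed

lemma dim_concrete: "dim A3_roots = 3" "dim B2_roots = 2" "dim G2_roots = 2"
proof -
  have c: "card (c ` X) = card X" if "inj c" for c :: "real \<times> real \<times> real \<Rightarrow> real^4" and X
    using card_image inj_on_subset[OF that subset_UNIV] by blast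
  show "dim A3_roots = 3" "dim B2_roots = 2" "dim G2_roots = 2"
    unfolding A3.dim_roots B2.dim_roots G2.dim_roots A3_simple B2_simple G2_simple
      c[OF inj_c(1)] c[OF inj_c(2)] c[OF inj_c(3)] by simp_all
qed

lemma irreducible_concrete: "irreducible_roots A3_roots" "irreducible_roots B2_roots" "irreducible_roots G2_roots"
proof -
  have e: "irreducible_roots ({x} \<union> {y})" if "x \<bullet> y \<noteq> 0" for x y :: "real^4"
    by (rule irreducible_roots_union[OF irreducible_roots_singleton irreducible_roots_singleton _ _ that]) (use that in auto)
  have "irreducible_roots ({cB (1,0,0)} \<union> {cB (0,1,0)})" by (rule e) (simp add: cB_inner)
  then have "irreducible_roots B2.D" unfolding B2_simple by (simp add: insert_commute)
  then show "irreducible_roots B2_roots"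
    by (rule irreducible_roots_of_spanning) (use B2.D_P B2.P_root B2.span_D B2.zero_not_root span_base in blast)+
  have "irreducible_roots ({cG (1,0,0)} \<union> {cG (0,1,0)})" by (rule e) (simp add: cG_inner)
  then have "irreducible_roots G2.D" unfolding G2_simple by (simp add: insert_commute)
  then show "irreducible_roots G2_roots"
    by (rule irreducible_roots_of_spanning) (use G2.D_P G2.P_root G2.span_D G2.zero_not_root span_base in blast)+
  have nz: "0 \<notin> {cA (1,0,0)} \<union> {cA (0,1,0)} \<union> {cA (0,0,1)}"
    using A3.zero_notin_D[OF subset_refl] unfolding A3_simple by auto
  have "irreducible_roots ({cA (1,0,0)} \<union> {cA (0,1,0)})" by (rule e) (simp add: cA_inner)
  then have "irreducible_roots ({cA (1,0,0)} \<union> {cA (0,1,0)} \<union> {cA (0,0,1)})"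
    by (rule irreducible_roots_union[OF _ irreducible_roots_singleton, of _ "cA (0,1,0)"]) (use nz in \<open>auto simp: cA_inner\<close>)
  then have "irreducible_roots A3.D" unfolding A3_simple by (simp add: insert_commute)
  then show "irreducible_roots A3_roots"
    by (rule irreducible_roots_of_spanning) (use A3.D_P A3.P_root A3.span_D A3.zero_not_root span_base in blast)+
qed

lemma simply_laced_A3: "simply_laced A3_roots"
proof -
  have "x \<bullet> x = 2" if "x \<in> A3_roots" for x
    using that unfolding A3_roots_def A3_pos_eq A3_coord_def by (auto simp: cA_inner)
  then show ?thesis unfolding simply_laced_def norm_eq_sqrt_inner by simp
qed

section \<open>The two permutations of type A3\<close>

lemma refl_ev:
  assumes "i \<noteq> j"
  shows "refl_map (ev i - ev j) x = (\<chi> k. if k = i then x $ j else if k = j then x $ i else x $ k)"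
proof -
  have "x \<bullet> (ev i - ev j) = x $ i - x $ j" by (simp add: inner_diff_right inner_axis)
  moreover have "(ev i - ev j) \<bullet> (ev i - ev j) = 2"
    using assms by (simp add: inner_diff_right inner_diff_left ev_inner)
  ultimately show ?thesis using assms
    unfolding refl_map_def vec_eq_iff by (auto simp: axis_def diff_divide_distrib)
qed

lemma one_line_simps:
  "one_line a b c d 1 = a" "one_line a b c d 2 = b" "one_line a b c d 3 = c" "one_line a b c d 4 = d"
  by (simp_all add: one_line_def neq_4)

lemma inv_one_line:
  "inv (one_line 3 1 4 2) = one_line 2 4 1 3" "inv (one_line 2 4 1 3) = one_line 3 1 4 2"
proof -
  have "\<forall>x. one_line 2 4 1 3 (one_line 3 1 4 2 x) = x" "\<forall>x. one_line 3 1 4 2 (one_line 2 4 1 3 x) = x"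
    unfolding forall_4 one_line_simps by simp_all
  then show "inv (one_line 3 1 4 2) = one_line 2 4 1 3" "inv (one_line 2 4 1 3) = one_line 3 1 4 2"
    by (simp_all add: inv_equality)
qed

text \<open>Both permutations are four-cycles. Each is factored into three transpositions, and a
  transposition is the reflection in a difference of coordinate vectors.\<close>

lemma perm_map_word:
  "perm_map (one_line 3 1 4 2) = refl_word [ev 1 - ev 3, ev 3 - ev 4, ev 2 - ev 4]"
  "perm_map (one_line 2 4 1 3) = refl_word [ev 1 - ev 2, ev 2 - ev 4, ev 3 - ev 4]"
  unfolding perm_map_def inv_one_line refl_word_def fun_eq_iff vec_eq_iff forall_4
  by (simp_all add: refl_ev one_line_simps neq_4)

lemma perm_map_weyl:
  "perm_map (one_line 3 1 4 2) \<in> weyl A3_roots" "perm_map (one_line 2 4 1 3) \<in> weyl A3_roots"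
  unfolding perm_map_word weyl_def
  by (intro imageI, simp add: A3_roots_def A3_pos_def)+

lemma A3_inversions_perm:
  assumes "perm_map \<sigma> \<in> weyl A3_roots"
  shows "inversions A3_pos (perm_map \<sigma>)
    = {\<beta>\<in>A3_pos. 3 * \<beta> $ inv \<sigma> 1 + 2 * \<beta> $ inv \<sigma> 2 + \<beta> $ inv \<sigma> 3 < 0}"
proof -
  obtain as where as: "as \<in> lists A3_roots" "perm_map \<sigma> = refl_word as" using assms by (auto simp: weyl_def)
  have "vA \<bullet> perm_map \<sigma> \<beta> = 3 * \<beta> $ inv \<sigma> 1 + 2 * \<beta> $ inv \<sigma> 2 + \<beta> $ inv \<sigma> 3" for \<beta>
    by (simp add: v4_def inner_add_left inner_axis' perm_map_def)
  then show ?thesis using A3.inversions_word[OF as(1)] by (simp add: as(2)[symmetric])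
qed

lemma cA_nth:
  "cA (x,y,z) $ 1 = x" "cA (x,y,z) $ 2 = y - x" "cA (x,y,z) $ 3 = z - y" "cA (x,y,z) $ 4 = - z"
  by (simp_all add: cA_def comb_def a\<^sub>1_def a\<^sub>2_def a\<^sub>3_def axis_def)

lemma filter_image: "{\<beta> \<in> c ` S. R \<beta>} = c ` {s \<in> S. R (c s)}"
  by blast

lemma A3_inversions:
  "inversions A3_pos (perm_map (one_line 3 1 4 2)) = cA ` {(1,0,0), (0,0,1), (1,1,1)}"
  "inversions A3_pos (perm_map (one_line 2 4 1 3)) = cA ` {(0,1,0), (1,1,0), (0,1,1)}"
proof -
  have "{s \<in> A3_coord. 3 * cA s $ 2 + 2 * cA s $ 4 + cA s $ 1 < 0} = {(1,0,0), (0,0,1), (1,1,1)}"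
    unfolding A3_coord_def by (auto simp: cA_nth)
  then show "inversions A3_pos (perm_map (one_line 3 1 4 2)) = cA ` {(1,0,0), (0,0,1), (1,1,1)}"
    unfolding A3_inversions_perm[OF perm_map_weyl(1)] inv_one_line one_line_simps
    unfolding A3_pos_eq filter_image by simp
  have "{s \<in> A3_coord. 3 * cA s $ 3 + 2 * cA s $ 1 + cA s $ 4 < 0} = {(0,1,0), (1,1,0), (0,1,1)}"
    unfolding A3_coord_def by (auto simp: cA_nth)
  then show "inversions A3_pos (perm_map (one_line 2 4 1 3)) = cA ` {(0,1,0), (1,1,0), (0,1,1)}"
    unfolding A3_inversions_perm[OF perm_map_weyl(2)] inv_one_line one_line_simps
    unfolding A3_pos_eq filter_image by simp
qed

lemma image_c_eq_iff: "cA ` S = cA ` T \<longleftrightarrow> S = T" "cB ` S = cB ` T \<longleftrightarrow> S = T" "cG ` S = cG ` T \<longleftrightarrow> S = T"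
  by (simp_all add: inj_image_eq_iff inj_c)

lemma card_image_c: "card (cA ` S) = card S" "card (cB ` S) = card S" "card (cG ` S) = card S"
  using card_image inj_on_subset[OF _ subset_UNIV] inj_c by blast+

lemma A3_patterns_neq: "A3_3142 \<noteq> A3_2413"
proof
  assume "A3_3142 = A3_2413"
  then have "cA ` {(1,0,0), (0,0,1), (1,1,1)} = cA ` {(0,1,0), (1,1,0), (0,1,1)}"
    unfolding A3_3142_def A3_2413_def A3_inversions[symmetric] by simp
  then have e: "{(1,0,0), (0,0,1), (1,1,1)} = {(0,1,0), (1,1,0), (0 :: real, 1 :: real, 1 :: real)}"
    by (simp only: image_c_eq_iff)
  have "(1,0,0) \<in> {(0,1,0), (1,1,0), (0 :: real, 1 :: real, 1 :: real)}" unfolding e[symmetric] by (rule insertI1)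
  then show False by simp
qed

lemma B2_card: "card B2_pos = 4" and G2_card: "card G2_pos = 6"
  unfolding B2_pos_eq G2_pos_eq card_image_c by (simp_all add: B2_coord_def G2_coord_def)

lemma A3_not_pivotal:
  "\<not> pivotal A3_pos (cA ` {(1,0,0), (0,0,1), (1,1,1)})" "\<not> pivotal A3_pos (cA ` {(0,1,0), (1,1,0), (0,1,1)})"
proof -
  have mem: "cA s \<in> cA ` S \<longleftrightarrow> s \<in> S" for s S using inj_c(1) by (simp add: inj_image_mem_iff)
  have gen: "\<not> pivotal A3_pos (cA ` S)"
    if S: "S = {(1,0,0), (0,0,1), (1,1,1)} \<or> S = {(0,1,0), (1,1,0), (0,1,1)}" for S
  proof
    assume "pivotal A3_pos (cA ` S)"
    then obtain \<omega> where \<omega>: "\<forall>\<beta>\<in>A3_pos. 0 \<le> \<omega> \<bullet> \<beta>" "\<exists>\<beta>\<in>A3_pos. 0 < \<omega> \<bullet> \<beta>"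
      "{\<beta>\<in>A3_pos. 0 < \<omega> \<bullet> \<beta>} \<subseteq> cA ` S \<or> {\<beta>\<in>A3_pos. 0 < \<omega> \<bullet> \<beta>} \<inter> cA ` S = {}"
      unfolding pivotal_def by blast
    have w: "\<forall>t\<in>A3_coord. 0 \<le> \<omega> \<bullet> cA t" "\<exists>t\<in>A3_coord. 0 < \<omega> \<bullet> cA t"
      using \<omega>(1,2) unfolding A3_pos_eq by blast+
    have w3: "(\<forall>t\<in>A3_coord. 0 < \<omega> \<bullet> cA t \<longrightarrow> t \<in> S) \<or> (\<forall>t\<in>A3_coord. 0 < \<omega> \<bullet> cA t \<longrightarrow> t \<notin> S)"
      using \<omega>(3)
    proof
      assume a: "{\<beta>\<in>A3_pos. 0 < \<omega> \<bullet> \<beta>} \<subseteq> cA ` S"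
      have "t \<in> S" if "t \<in> A3_coord" "0 < \<omega> \<bullet> cA t" for t
      proof -
        have "cA t \<in> {\<beta>\<in>A3_pos. 0 < \<omega> \<bullet> \<beta>}" using that by (simp add: A3_pos_eq)
        then show ?thesis using a mem by blast
      qed
      then show ?thesis by blast
    next
      assume a: "{\<beta>\<in>A3_pos. 0 < \<omega> \<bullet> \<beta>} \<inter> cA ` S = {}"
      have "t \<notin> S" if "t \<in> A3_coord" "0 < \<omega> \<bullet> cA t" for t
      proof -
        have "cA t \<in> {\<beta>\<in>A3_pos. 0 < \<omega> \<bullet> \<beta>}" using that by (simp add: A3_pos_eq)
        then show ?thesis using a by blast
      qed
      then show ?thesis by blast
    qed
    define p q r where pqr: "p = \<omega> \<bullet> a\<^sub>1" "q = \<omega> \<bullet> a\<^sub>2" "r = \<omega> \<bullet> a\<^sub>3"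
    have e: "\<omega> \<bullet> cA (x,y,z) = x * p + y * q + z * r" for x y z
      by (simp add: cA_def comb_def inner_add_right pqr)
    have pos: "0 \<le> p" "0 \<le> q" "0 \<le> r"
      using w(1) unfolding A3_coord_def by (simp_all add: e)
    have some: "0 < p \<or> 0 < q \<or> 0 < r"
    proof (rule ccontr)
      assume "\<not> ?thesis"
      then have "p = 0" "q = 0" "r = 0" using pos by simp_all
      then have "\<not> 0 < \<omega> \<bullet> cA t" for t by (cases t) (simp add: e)
      then show False using w(2) by blast
    qed
    \<comment> \<open>\<open>X\<close> and \<open>Y\<close> partition the positive roots, so either
      alternative makes \<omega> nonpositive on one of them. As \<open>p\<close>, \<open>q\<close>,
      \<open>r\<close> are nonnegative and each of the two sets involves all of them, they
      vanish.\<close>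
    define X Y :: "(real \<times> real \<times> real) set" where XY: "X = {(1,0,0), (0,0,1), (1,1,1)}" "Y = {(0,1,0), (1,1,0), (0,1,1)}"
    have sub: "X \<subseteq> A3_coord" "Y \<subseteq> A3_coord" "X \<inter> Y = {}" by (simp_all add: XY A3_coord_def)
    have S': "S = X \<or> S = Y" using S unfolding XY .
    have "\<exists>T. (T = X \<or> T = Y) \<and> (\<forall>t\<in>T. \<omega> \<bullet> cA t \<le> 0)"
      using w3
    proof
      assume 0: "\<forall>t\<in>A3_coord. 0 < \<omega> \<bullet> cA t \<longrightarrow> t \<in> S"
      have neg: "\<omega> \<bullet> cA t \<le> 0" if "t \<in> A3_coord" "t \<notin> S" for t using 0 that not_less by blast
      from S' show ?thesis
      proof
        assume "S = X"
        then have "\<forall>t\<in>Y. \<omega> \<bullet> cA t \<le> 0" using sub by (intro ballI neg) auto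
        then show ?thesis by (intro exI[of _ Y]) simp
      next
        assume "S = Y"
        then have "\<forall>t\<in>X. \<omega> \<bullet> cA t \<le> 0" using sub by (intro ballI neg) auto
        then show ?thesis by (intro exI[of _ X]) simp
      qed
    next
      assume 0: "\<forall>t\<in>A3_coord. 0 < \<omega> \<bullet> cA t \<longrightarrow> t \<notin> S"
      have "S \<subseteq> A3_coord" using S' sub by auto
      then have "\<forall>t\<in>S. \<omega> \<bullet> cA t \<le> 0" using 0 by (auto simp: not_less[symmetric])
      then show ?thesis using S' by (intro exI[of _ S]) simp
    qed
    then obtain T where T: "T = X \<or> T = Y" "\<forall>t\<in>T. \<omega> \<bullet> cA t \<le> 0" by blast
    from T(1) show False
    proof
      assume "T = X"
      then show False using T(2) pos some unfolding XY by (auto simp: e)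
    next
      assume "T = Y"
      then show False using T(2) pos some unfolding XY by (auto simp: e)
    qed
  qed
  then show "\<not> pivotal A3_pos (cA ` {(1,0,0), (0,0,1), (1,1,1)})"
    "\<not> pivotal A3_pos (cA ` {(0,1,0), (1,1,0), (0,1,1)})" by blast+
qed

lemma positive_concrete: "positive_system A3_roots A3_pos" "positive_system B2_roots B2_pos" "positive_system G2_roots G2_pos"
  using A3.generic A3.P_eq B2.generic B2.P_eq G2.generic G2.P_eq unfolding positive_system_def by blast+

lemma min_patterns_cases:
  assumes "q \<in> min_patterns"
  obtains "q = A3_3142" | "q = A3_2413"
    | u where "q = (u, B2_roots, B2_pos)" "u \<in> weyl B2_roots" "card (inversions B2_pos u) = 2"
    | u where "q = (u, G2_roots, G2_pos)" "u \<in> weyl G2_roots" "card (inversions G2_pos u) \<in> {2, 3, 4}"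
  using assms unfolding min_patterns_def B2_patterns_def G2_patterns_def
  by (auto simp: B2.weyl_length_eq G2.weyl_length_eq)

lemma is_pattern_min_patterns: "q \<in> min_patterns \<Longrightarrow> is_pattern q"
  by (erule min_patterns_cases)
    (auto simp: A3_3142_def A3_2413_def perm_map_weyl root_system_A3 root_system_B2 root_system_G2 positive_concrete)

lemma B2_not_pivotal: "card (inversions B2_pos u) = 2 \<Longrightarrow> \<not> pivotal B2_pos (inversions B2_pos u)"
  by (rule B2.not_pivotal_rank_2[of "cB (1,0,0)" "cB (0,1,0)"])
    (use inj_c(2) in \<open>auto simp: B2_simple inversions_def B2_card inj_eq\<close>)

lemma G2_not_pivotal: "card (inversions G2_pos u) \<in> {2, 3, 4} \<Longrightarrow> \<not> pivotal G2_pos (inversions G2_pos u)"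
  by (rule G2.not_pivotal_rank_2[of "cG (1,0,0)" "cG (0,1,0)"])
    (use inj_c(3) in \<open>auto simp: G2_simple inversions_def G2_card inj_eq\<close>)

lemma min_patterns_minimal:
  assumes q: "q \<in> min_patterns"
  shows "minimal_nonseparable q"
  using q
proof (cases rule: min_patterns_cases)
  case 1
  have "is_pattern (perm_map (one_line 3 1 4 2), A3_roots, A3_pos)"
    using is_pattern_min_patterns[OF q] unfolding 1 A3_3142_def .
  then show ?thesis unfolding 1 A3_3142_def
    using A3_not_pivotal dim_concrete irreducible_concrete simply_laced_A3
    by (intro minimal_by_rank) (simp_all only: A3_inversions, simp_all)
next
  case 2
  have "is_pattern (perm_map (one_line 2 4 1 3), A3_roots, A3_pos)"
    using is_pattern_min_patterns[OF q] unfolding 2 A3_2413_def .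
  then show ?thesis unfolding 2 A3_2413_def
    using A3_not_pivotal dim_concrete irreducible_concrete simply_laced_A3
    by (intro minimal_by_rank) (simp_all only: A3_inversions, simp_all)
next
  case (3 u)
  show ?thesis using is_pattern_min_patterns[OF q] unfolding 3(1)
    using B2_not_pivotal[OF 3(3)] dim_concrete irreducible_concrete by (intro minimal_by_rank) blast+
next
  case (4 u)
  show ?thesis using is_pattern_min_patterns[OF q] unfolding 4(1)
    using G2_not_pivotal[OF 4(3)] dim_concrete irreducible_concrete by (intro minimal_by_rank) blast+
qed

text \<open>With the positive roots of a rank-two system in slope order, inversion sets are initial
  or final segments. \<open>B2_mid\<close> and \<open>G2_mid\<close> list the segments that contain
  at least two roots and omit at least two.\<close>

definition B2_mid :: "(real \<times> real \<times> real) set set" where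
  "B2_mid = {{(1,0,0), (1,1,0)}, {(0,1,0), (1,2,0)}}"

definition G2_mid :: "(real \<times> real \<times> real) set set" where
  "G2_mid = {{(1,0,0), (1,1,0)}, {(1,0,0), (1,1,0), (2,3,0)}, {(1,0,0), (1,1,0), (2,3,0), (1,2,0)},
     {(0,1,0), (1,3,0)}, {(0,1,0), (1,3,0), (1,2,0)}, {(0,1,0), (1,3,0), (1,2,0), (2,3,0)}}"

lemma card_B2_mid: "card B2_mid = 2"
  unfolding B2_mid_def by (auto simp: card_insert_if doubleton_eq_iff)

lemma card_G2_mid: "card G2_mid = 6"
proof (rule antisym)
  have "card G2_mid = card (set [{(1,0,0), (1,1,0)}, {(1,0,0), (1,1,0), (2,3,0)}, {(1,0,0), (1,1,0), (2,3,0), (1,2,0)},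
     {(0,1,0), (1,3,0)}, {(0,1,0), (1,3,0), (1,2,0)}, {(0,1,0), (1,3,0), (1,2,0), (2,3,0)} :: (real \<times> real \<times> real) set])"
    unfolding G2_mid_def by simp
  also have "\<dots> \<le> 6" by (rule order_trans[OF card_length]) simp
  finally show "card G2_mid \<le> 6" .
  \<comment> \<open>Size and presence of the long simple root tell the six sets apart.\<close>
  have "(\<lambda>S. (card S, (1,0,0) \<in> S)) ` G2_mid
      = {(2, True), (3, True), (4, True), (2, False), (3, False), (4, False)}"
    unfolding G2_mid_def by (simp add: eval_nat_numeral)
  then have "card ((\<lambda>S. (card S, (1,0,0) \<in> S)) ` G2_mid) = 6" by simp
  moreover have "finite G2_mid" by (simp add: G2_mid_def)
  ultimately show "6 \<le> card G2_mid" using card_image_le by metis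
qed

lemma minimal_min_chamber:
  assumes "chamber \<Phi> P v" "is_pattern (w, \<Phi>, P)" "minimal_nonseparable (w, \<Phi>, P)"
  obtains u where "min_chamber \<Phi> P v u" "inversions P w = {\<beta>\<in>P. u \<bullet> \<beta> < 0}"
proof -
  interpret chamber \<Phi> P v by (rule assms(1))
  have "w \<in> weyl \<Phi>" using assms(2) by simp
  then obtain u where u: "\<And>\<beta>. \<beta> \<in> \<Phi> \<Longrightarrow> u \<bullet> \<beta> \<noteq> 0" "inversions P w = {\<beta>\<in>P. u \<bullet> \<beta> < 0}"
    using weyl_functional by blast
  have "minimal_nonpivotal \<Phi> P {\<beta>\<in>P. u \<bullet> \<beta> < 0}"
    using assms(3) unfolding minimal_nonseparable_iff[OF assms(2)] u(2) .
  then have "min_chamber \<Phi> P v u"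
    by (intro min_chamber.intro signed_chamber.intro signed_chamber_axioms.intro min_chamber_axioms.intro assms(1) u(1))
  then show ?thesis using u(2) that by blast
qed

lemma c_rank_2:
  "cB (x,y,0) = x *\<^sub>R b\<^sub>1 + y *\<^sub>R b\<^sub>2" "cG (x,y,0) = x *\<^sub>R g\<^sub>1 + y *\<^sub>R g\<^sub>2"
  by (simp_all add: cB_def cG_def comb_def)

lemma B2_mid_image:
  "image cB ` B2_mid = {{b\<^sub>1, b\<^sub>1 + b\<^sub>2}, {b\<^sub>2, b\<^sub>1 + 2 *\<^sub>R b\<^sub>2}}"
  by (simp add: B2_mid_def c_rank_2)

lemma G2_mid_image:
  "image cG ` G2_mid = {{g\<^sub>1, g\<^sub>1 + g\<^sub>2}, {g\<^sub>1, g\<^sub>1 + g\<^sub>2, 2 *\<^sub>R g\<^sub>1 + 3 *\<^sub>R g\<^sub>2},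
    {g\<^sub>1, g\<^sub>1 + g\<^sub>2, 2 *\<^sub>R g\<^sub>1 + 3 *\<^sub>R g\<^sub>2, g\<^sub>1 + 2 *\<^sub>R g\<^sub>2}, {g\<^sub>2, g\<^sub>1 + 3 *\<^sub>R g\<^sub>2},
    {g\<^sub>2, g\<^sub>1 + 3 *\<^sub>R g\<^sub>2, g\<^sub>1 + 2 *\<^sub>R g\<^sub>2},
    {g\<^sub>2, g\<^sub>1 + 3 *\<^sub>R g\<^sub>2, g\<^sub>1 + 2 *\<^sub>R g\<^sub>2, 2 *\<^sub>R g\<^sub>1 + 3 *\<^sub>R g\<^sub>2}}"
  by (simp add: G2_mid_def c_rank_2)

lemma B2_mid_card: "J \<in> image cB ` B2_mid \<Longrightarrow> card J = 2"
  by (auto simp only: card_image_c image_iff) (auto simp: B2_mid_def)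

lemma G2_mid_card: "J \<in> image cG ` G2_mid \<Longrightarrow> card J \<in> {2, 3, 4}"
  by (auto simp only: card_image_c image_iff) (auto simp: G2_mid_def)

lemma B2_neq: "b\<^sub>1 \<noteq> b\<^sub>2" and G2_neq: "g\<^sub>1 \<noteq> g\<^sub>2"
proof -
  have "cB (1,0,0) \<noteq> cB (0,1,0)" "cG (1,0,0) \<noteq> cG (0,1,0)" using inj_c by (simp_all add: inj_eq)
  then show "b\<^sub>1 \<noteq> b\<^sub>2" "g\<^sub>1 \<noteq> g\<^sub>2" by (simp_all add: c_rank_2)
qed

text \<open>An element of length two is already known to be minimal, so the classification of
  rank-two inversion sets applies to it; the group need not be enumerated.\<close>

lemma B2_patterns_eq:
  "B2_patterns = {(u, B2_roots, B2_pos) | u. u \<in> weyl B2_roots \<and> inversions B2_pos u \<in> image cB ` B2_mid}"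
proof -
  have "weyl_length B2_pos w = 2 \<longleftrightarrow> inversions B2_pos w \<in> image cB ` B2_mid" if w: "w \<in> weyl B2_roots" for w
  proof
    assume "weyl_length B2_pos w = 2"
    then have "(w, B2_roots, B2_pos) \<in> min_patterns" using w by (auto simp: min_patterns_def B2_patterns_def)
    then obtain u where u: "min_chamber B2_roots B2_pos vB u" "inversions B2_pos w = {\<beta>\<in>B2_pos. u \<bullet> \<beta> < 0}"
      using minimal_min_chamber[OF B2.chamber_axioms is_pattern_min_patterns min_patterns_minimal] by blast
    show "inversions B2_pos w \<in> image cB ` B2_mid"
      unfolding u(2) B2_mid_image
      by (rule min_chamber.rank_2_B2_inversions[OF u(1) _ B2_neq B2_pos_def]) (simp add: B2_simple c_rank_2)
  next
    assume "inversions B2_pos w \<in> image cB ` B2_mid"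
    then show "weyl_length B2_pos w = 2" using B2_mid_card B2.weyl_length_eq[OF w] by simp
  qed
  then show ?thesis unfolding B2_patterns_def by blast
qed

lemma G2_patterns_eq:
  "G2_patterns = {(u, G2_roots, G2_pos) | u. u \<in> weyl G2_roots \<and> inversions G2_pos u \<in> image cG ` G2_mid}"
proof -
  have "weyl_length G2_pos w \<in> {2, 3, 4} \<longleftrightarrow> inversions G2_pos w \<in> image cG ` G2_mid" if w: "w \<in> weyl G2_roots" for w
  proof
    assume "weyl_length G2_pos w \<in> {2, 3, 4}"
    then have "(w, G2_roots, G2_pos) \<in> min_patterns" using w by (auto simp: min_patterns_def G2_patterns_def)
    then obtain u where u: "min_chamber G2_roots G2_pos vG u" "inversions G2_pos w = {\<beta>\<in>G2_pos. u \<bullet> \<beta> < 0}"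
      using minimal_min_chamber[OF G2.chamber_axioms is_pattern_min_patterns min_patterns_minimal] by blast
    show "inversions G2_pos w \<in> image cG ` G2_mid"
      unfolding u(2) G2_mid_image
      by (rule min_chamber.rank_2_G2_inversions[OF u(1) _ G2_neq G2_pos_def]) (simp add: G2_simple c_rank_2)
  next
    assume "inversions G2_pos w \<in> image cG ` G2_mid"
    then show "weyl_length G2_pos w \<in> {2, 3, 4}" using G2_mid_card B2.weyl_length_eq G2.weyl_length_eq[OF w] by simp
  qed
  then show ?thesis unfolding G2_patterns_def by blast
qed

lemma generic_positive:
  assumes "\<Phi> = P \<union> uminus ` P" "\<forall>\<beta>\<in>P. u \<bullet> \<beta> \<noteq> (0::real)"
  shows "\<forall>\<beta>\<in>\<Phi>. u \<bullet> \<beta> \<noteq> 0"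
  using assms by auto

lemma Collect_mem_insert:
  "{t \<in> insert a A. R t} = (if R a then insert a {t \<in> A. R t} else {t \<in> A. R t})"
  by auto

lemma B2_realized:
  assumes "S \<in> B2_mid"
  shows "\<exists>u. (\<forall>\<beta>\<in>B2_roots. u \<bullet> \<beta> \<noteq> 0) \<and> cB ` S = {\<beta>\<in>B2_pos. u \<bullet> \<beta> < 0}"
proof -
  have "\<exists>x y. (\<forall>(m,n,k)\<in>B2_coord. x * m + y * n \<noteq> 0) \<and> S = {t\<in>B2_coord. x * fst t + y * fst (snd t) < 0}"
    using assms unfolding B2_mid_def
  proof (elim insertE emptyE)
    assume "S = {(1,0,0), (1,1,0)}"
    \<comment> \<open>Values of a functional on the simple roots. The ratio of their absolute
      values, 3/2, lies between 1 and 2, so the sign changes between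
      \<open>b\<^sub>1 + b\<^sub>2\<close> and
      \<open>b\<^sub>1 + 2 *\<^sub>R b\<^sub>2\<close>.\<close>
    then show ?thesis by (intro exI[of _ "-3"] exI[of _ 2], unfold B2_coord_def Collect_mem_insert, simp add: insert_commute)
  next
    assume "S = {(0,1,0), (1,2,0)}"
    then show ?thesis by (intro exI[of _ 3] exI[of _ "-2"], unfold B2_coord_def Collect_mem_insert, simp add: insert_commute)
  qed
  then obtain x y where xy: "\<forall>(m,n,k)\<in>B2_coord. x * m + y * n \<noteq> 0" "S = {t\<in>B2_coord. x * fst t + y * fst (snd t) < 0}" by blast
  have e: "v4 (x + y) y 0 \<bullet> cB t = x * fst t + y * fst (snd t)" for t by (cases t) (simp add: v4_cB)
  have "\<forall>\<beta>\<in>B2_pos. v4 (x + y) y 0 \<bullet> \<beta> \<noteq> 0" using xy(1) unfolding B2_pos_eq by (auto simp: e)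
  moreover have "cB ` S = {\<beta>\<in>B2_pos. v4 (x + y) y 0 \<bullet> \<beta> < 0}" unfolding xy(2) B2_pos_eq filter_image e ..
  ultimately show ?thesis using generic_positive[OF B2_roots_def] by blast
qed

lemma G2_realized:
  assumes "S \<in> G2_mid"
  shows "\<exists>u. (\<forall>\<beta>\<in>G2_roots. u \<bullet> \<beta> \<noteq> 0) \<and> cG ` S = {\<beta>\<in>G2_pos. u \<bullet> \<beta> < 0}"
proof -
  have "\<exists>x y. (\<forall>(m,n,k)\<in>G2_coord. x * m + y * n \<noteq> 0) \<and> S = {t\<in>G2_coord. x * fst t + y * fst (snd t) < 0}"
    using assms unfolding G2_mid_def
  proof (elim insertE emptyE)
    assume "S = {(1,0,0), (1,1,0)}"
    \<comment> \<open>The inversion set changes where the ratio of the absolute values passes 1,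
      3/2, 2 or 3. The ratios 4/3, 5/3 and 5/2 sample the three inner gaps, once for each
      orientation.\<close>
    then show ?thesis by (intro exI[of _ "-4"] exI[of _ 3], unfold G2_coord_def Collect_mem_insert, simp add: insert_commute)
  next
    assume "S = {(1,0,0), (1,1,0), (2,3,0)}"
    then show ?thesis by (intro exI[of _ "-5"] exI[of _ 3], unfold G2_coord_def Collect_mem_insert, simp add: insert_commute)
  next
    assume "S = {(1,0,0), (1,1,0), (2,3,0), (1,2,0)}"
    then show ?thesis by (intro exI[of _ "-5"] exI[of _ 2], unfold G2_coord_def Collect_mem_insert, simp add: insert_commute)
  next
    assume "S = {(0,1,0), (1,3,0)}"
    then show ?thesis by (intro exI[of _ 5] exI[of _ "-2"], unfold G2_coord_def Collect_mem_insert, simp add: insert_commute)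
  next
    assume "S = {(0,1,0), (1,3,0), (1,2,0)}"
    then show ?thesis by (intro exI[of _ 5] exI[of _ "-3"], unfold G2_coord_def Collect_mem_insert, simp add: insert_commute)
  next
    assume "S = {(0,1,0), (1,3,0), (1,2,0), (2,3,0)}"
    then show ?thesis by (intro exI[of _ 4] exI[of _ "-3"], unfold G2_coord_def Collect_mem_insert, simp add: insert_commute)
  qed
  then obtain x y where xy: "\<forall>(m,n,k)\<in>G2_coord. x * m + y * n \<noteq> 0" "S = {t\<in>G2_coord. x * fst t + y * fst (snd t) < 0}" by blast
  have e: "v4 0 (- y) (x + y) \<bullet> cG t = x * fst t + y * fst (snd t)" for t by (cases t) (simp add: v4_cG)
  have "\<forall>\<beta>\<in>G2_pos. v4 0 (- y) (x + y) \<bullet> \<beta> \<noteq> 0" using xy(1) unfolding G2_pos_eq by (auto simp: e)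
  moreover have "cG ` S = {\<beta>\<in>G2_pos. v4 0 (- y) (x + y) \<bullet> \<beta> < 0}" unfolding xy(2) G2_pos_eq filter_image e ..
  ultimately show ?thesis using generic_positive[OF G2_roots_def] by blast
qed

lemma card_B2_patterns: "card B2_patterns = 2"
proof -
  have "{I. (\<exists>u. (\<forall>\<beta>\<in>B2_roots. u \<bullet> \<beta> \<noteq> 0) \<and> I = {\<beta>\<in>B2_pos. u \<bullet> \<beta> < 0}) \<and> I \<in> image cB ` B2_mid} = image cB ` B2_mid"
    using B2_realized by blast
  moreover have "card (image cB ` B2_mid) = 2"
    using card_B2_mid by (subst card_image) (auto simp: inj_on_def image_c_eq_iff)
  ultimately show ?thesis unfolding B2_patterns_eq
    using B2.card_patterns[of "\<lambda>I. I \<in> image cB ` B2_mid"] by simp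
qed

lemma card_G2_patterns: "card G2_patterns = 6"
proof -
  have "{I. (\<exists>u. (\<forall>\<beta>\<in>G2_roots. u \<bullet> \<beta> \<noteq> 0) \<and> I = {\<beta>\<in>G2_pos. u \<bullet> \<beta> < 0}) \<and> I \<in> image cG ` G2_mid} = image cG ` G2_mid"
    using G2_realized by blast
  moreover have "card (image cG ` G2_mid) = 6"
    using card_G2_mid by (subst card_image) (auto simp: inj_on_def image_c_eq_iff)
  ultimately show ?thesis unfolding G2_patterns_eq
    using G2.card_patterns[of "\<lambda>I. I \<in> image cG ` G2_mid"] by simp
qed

section \<open>Identifying minimal patterns with the models\<close>

lemma (in chamber) linear_on_simple_roots:
  fixes h :: "'a \<Rightarrow> 'b::euclidean_space"
  obtains f where "linear f" "\<And>d. d \<in> D \<Longrightarrow> f d = h d"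
  using linear_independent_extend[OF D_independent, of h] by blast

lemma minimal_iso_B2:
  assumes p: "is_pattern (w, \<Phi>, P)" and m: "min_chamber \<Phi> P v u" and inv: "inversions P w = {\<beta>\<in>P. u \<bullet> \<beta> < 0}"
    and D: "simple_roots P = {a, b}" "a \<noteq> b" and gram: "a \<bullet> a = 2 * (b \<bullet> b)" "a \<bullet> b = - (b \<bullet> b)"
    and P: "P = {a, b, a + b, a + 2 *\<^sub>R b}"
  shows "\<exists>q\<in>B2_patterns. pattern_iso (w, \<Phi>, P) q"
proof -
  interpret min_chamber \<Phi> P v u by (rule m)
  obtain f :: "'a \<Rightarrow> real^4" where f: "linear f" "\<And>d. d \<in> D \<Longrightarrow> f d = (if d = a then b\<^sub>1 else b\<^sub>2)"
    using linear_on_simple_roots[of "\<lambda>d. if d = a then b\<^sub>1 else b\<^sub>2"] by blast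
  have fab: "f a = b\<^sub>1" "f b = b\<^sub>2" using f(2) D by auto
  have bb: "0 < b \<bullet> b" using D_P[of b] D(1) P_nonzero[of b] by simp
  have g: "b\<^sub>1 \<bullet> b\<^sub>1 = 2" "b\<^sub>1 \<bullet> b\<^sub>2 = -1" "b\<^sub>2 \<bullet> b\<^sub>1 = -1" "b\<^sub>2 \<bullet> b\<^sub>2 = 1"
    using cB_inner[of 1 0 0 1 0 0] cB_inner[of 1 0 0 0 1 0] cB_inner[of 0 1 0 1 0 0] cB_inner[of 0 1 0 0 1 0] by (simp_all add: c_rank_2)
  have fP: "f ` P = B2_pos"
    unfolding P B2_pos_def by (simp add: linear_add[OF f(1)] linear_scale[OF f(1)] fab)
  \<comment> \<open>The model root \<open>b\<^sub>2\<close> has squared norm 1, so dividing by that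
    of \<open>b\<close> matches the scales. In the models of G2 and A3 the image of \<open>b\<close>
    has squared norm 2, hence the numerator 2 there.\<close>
  have "f d \<bullet> f e = (1 / (b \<bullet> b)) * (d \<bullet> e)" if "d \<in> D" "e \<in> D" for d e
    using that bb unfolding D(1) by (auto simp: fab g gram inner_commute[of b a])
  then have iso: "root_iso f \<Phi> B2_roots"
    using bb by (intro root_iso_of_gram[OF f(1) _ _ fP B2_roots_def, of "1 / (b \<bullet> b)"]) auto
  obtain w' where w': "w' \<in> weyl B2_roots" "inversions B2_pos w' = f ` inversions P w"
      "pattern_iso (w, \<Phi>, P) (w', B2_roots, B2_pos)" "is_pattern (w', B2_roots, B2_pos)"
    by (rule root_iso_transport[OF p B2.chamber_axioms iso fP])
  have "inversions P w \<in> {{a, a + b}, {b, a + 2 *\<^sub>R b}}" unfolding inv by (rule rank_2_B2_inversions[OF D P])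
  then have "f ` inversions P w \<in> image f ` {{a, a + b}, {b, a + 2 *\<^sub>R b}}" by (rule imageI)
  also have "image f ` {{a, a + b}, {b, a + 2 *\<^sub>R b}} = image cB ` B2_mid"
    unfolding B2_mid_image by (simp add: linear_add[OF f(1)] linear_scale[OF f(1)] fab)
  finally have "(w', B2_roots, B2_pos) \<in> B2_patterns" unfolding B2_patterns_eq using w' by auto
  then show ?thesis using w'(3) by blast
qed

lemma minimal_iso_G2:
  assumes p: "is_pattern (w, \<Phi>, P)" and m: "min_chamber \<Phi> P v u" and inv: "inversions P w = {\<beta>\<in>P. u \<bullet> \<beta> < 0}"
    and D: "simple_roots P = {a, b}" "a \<noteq> b" and gram: "a \<bullet> a = 3 * (b \<bullet> b)" "2 * (a \<bullet> b) = - 3 * (b \<bullet> b)"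
    and P: "P = {a, b, a + b, a + 2 *\<^sub>R b, a + 3 *\<^sub>R b, 2 *\<^sub>R a + 3 *\<^sub>R b}"
  shows "\<exists>q\<in>G2_patterns. pattern_iso (w, \<Phi>, P) q"
proof -
  interpret min_chamber \<Phi> P v u by (rule m)
  obtain f :: "'a \<Rightarrow> real^4" where f: "linear f" "\<And>d. d \<in> D \<Longrightarrow> f d = (if d = a then g\<^sub>1 else g\<^sub>2)"
    using linear_on_simple_roots[of "\<lambda>d. if d = a then g\<^sub>1 else g\<^sub>2"] by blast
  have fab: "f a = g\<^sub>1" "f b = g\<^sub>2" using f(2) D by auto
  have bb: "0 < b \<bullet> b" using D_P[of b] D(1) P_nonzero[of b] by simp
  have ab: "a \<bullet> b = - 3 * (b \<bullet> b) / 2" using gram(2) by simp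
  have g: "g\<^sub>1 \<bullet> g\<^sub>1 = 6" "g\<^sub>1 \<bullet> g\<^sub>2 = -3" "g\<^sub>2 \<bullet> g\<^sub>1 = -3" "g\<^sub>2 \<bullet> g\<^sub>2 = 2"
    using cG_inner[of 1 0 0 1 0 0] cG_inner[of 1 0 0 0 1 0] cG_inner[of 0 1 0 1 0 0] cG_inner[of 0 1 0 0 1 0] by (simp_all add: c_rank_2)
  have fP: "f ` P = G2_pos"
    unfolding P G2_pos_def by (simp add: linear_add[OF f(1)] linear_scale[OF f(1)] fab)
  have "f d \<bullet> f e = (2 / (b \<bullet> b)) * (d \<bullet> e)" if "d \<in> D" "e \<in> D" for d e
    using that bb unfolding D(1) by (auto simp: fab g gram(1) ab inner_commute[of b a])
  then have iso: "root_iso f \<Phi> G2_roots"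
    using bb by (intro root_iso_of_gram[OF f(1) _ _ fP G2_roots_def, of "2 / (b \<bullet> b)"]) auto
  obtain w' where w': "w' \<in> weyl G2_roots" "inversions G2_pos w' = f ` inversions P w"
      "pattern_iso (w, \<Phi>, P) (w', G2_roots, G2_pos)" "is_pattern (w', G2_roots, G2_pos)"
    by (rule root_iso_transport[OF p G2.chamber_axioms iso fP])
  let ?J = "{{a, a + b}, {a, a + b, 2 *\<^sub>R a + 3 *\<^sub>R b},
    {a, a + b, 2 *\<^sub>R a + 3 *\<^sub>R b, a + 2 *\<^sub>R b}, {b, a + 3 *\<^sub>R b}, {b, a + 3 *\<^sub>R b, a + 2 *\<^sub>R b},
    {b, a + 3 *\<^sub>R b, a + 2 *\<^sub>R b, 2 *\<^sub>R a + 3 *\<^sub>R b}}"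
  have "inversions P w \<in> ?J" unfolding inv by (rule rank_2_G2_inversions[OF D P])
  then have "f ` inversions P w \<in> image f ` ?J" by (rule imageI)
  also have "image f ` ?J = image cG ` G2_mid"
    unfolding G2_mid_image by (simp add: linear_add[OF f(1)] linear_scale[OF f(1)] fab)
  finally have "(w', G2_roots, G2_pos) \<in> G2_patterns" unfolding G2_patterns_eq using w' by auto
  then show ?thesis using w'(3) by blast
qed

lemma minimal_iso_A3:
  assumes p: "is_pattern (w, \<Phi>, P)" and ch: "chamber \<Phi> P v"
    and D: "simple_roots P = {a, b, c}" "a \<noteq> b" "b \<noteq> c" "a \<noteq> c"
    and gram: "a \<bullet> c = 0" "a \<bullet> a = b \<bullet> b" "c \<bullet> c = b \<bullet> b" "2 * (a \<bullet> b) = - (b \<bullet> b)" "2 * (b \<bullet> c) = - (b \<bullet> b)"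
    and P: "P = {a, b, c, a + b, b + c, a + b + c}"
    and inv: "inversions P w \<in> {{a, c, a + b + c}, {b, a + b, b + c}}"
  shows "\<exists>q\<in>{A3_3142, A3_2413}. pattern_iso (w, \<Phi>, P) q"
proof -
  interpret chamber \<Phi> P v by (rule ch)
  obtain f :: "'a \<Rightarrow> real^4" where f: "linear f" "\<And>d. d \<in> D \<Longrightarrow> f d = (if d = a then a\<^sub>1 else if d = b then a\<^sub>2 else a\<^sub>3)"
    using linear_on_simple_roots[of "\<lambda>d. if d = a then a\<^sub>1 else if d = b then a\<^sub>2 else a\<^sub>3"] by blast
  have fab: "f a = a\<^sub>1" "f b = a\<^sub>2" "f c = a\<^sub>3" using f(2) D by auto
  have bb: "0 < b \<bullet> b" using D_P[of b] D(1) P_nonzero[of b] by simp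
  have ab: "a \<bullet> b = - (b \<bullet> b) / 2" "b \<bullet> c = - (b \<bullet> b) / 2" using gram(4,5) by simp_all
  have cA: "cA (x,y,z) = x *\<^sub>R a\<^sub>1 + y *\<^sub>R a\<^sub>2 + z *\<^sub>R a\<^sub>3" for x y z by (simp add: cA_def comb_def)
  have g: "a\<^sub>1 \<bullet> a\<^sub>1 = 2" "a\<^sub>1 \<bullet> a\<^sub>2 = -1" "a\<^sub>2 \<bullet> a\<^sub>1 = -1" "a\<^sub>2 \<bullet> a\<^sub>2 = 2" "a\<^sub>3 \<bullet> a\<^sub>3 = 2"
    "a\<^sub>1 \<bullet> a\<^sub>3 = 0" "a\<^sub>3 \<bullet> a\<^sub>1 = 0" "a\<^sub>2 \<bullet> a\<^sub>3 = -1" "a\<^sub>3 \<bullet> a\<^sub>2 = -1"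
    by (simp_all add: a\<^sub>1_def a\<^sub>2_def a\<^sub>3_def inner_diff_left inner_diff_right ev_inner)
  have fP: "f ` P = A3_pos"
    unfolding P A3_pos_eq A3_coord_def by (simp add: linear_add[OF f(1)] fab cA)
  have "f d \<bullet> f e = (2 / (b \<bullet> b)) * (d \<bullet> e)" if "d \<in> D" "e \<in> D" for d e
    using that bb unfolding D(1)
    by (auto simp: fab g gram(1,2,3) ab inner_commute[of b a] inner_commute[of c a] inner_commute[of c b])
  then have iso: "root_iso f \<Phi> A3_roots"
    using bb by (intro root_iso_of_gram[OF f(1) _ _ fP A3_roots_def, of "2 / (b \<bullet> b)"]) auto
  obtain w' where w': "w' \<in> weyl A3_roots" "inversions A3_pos w' = f ` inversions P w"
      "pattern_iso (w, \<Phi>, P) (w', A3_roots, A3_pos)" "is_pattern (w', A3_roots, A3_pos)"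
    by (rule root_iso_transport[OF p A3.chamber_axioms iso fP])
  from inv consider "inversions P w = {a, c, a + b + c}" | "inversions P w = {b, a + b, b + c}" by blast
  then show ?thesis
  proof cases
    case 1
    then have "inversions A3_pos w' = inversions A3_pos (perm_map (one_line 3 1 4 2))"
      unfolding w'(2) A3_inversions by (simp add: linear_add[OF f(1)] fab cA)
    then have "w' = perm_map (one_line 3 1 4 2)" by (rule A3.weyl_unique[OF w'(1) perm_map_weyl(1)])
    then show ?thesis using w'(3) unfolding A3_3142_def by blast
  next
    case 2
    then have "inversions A3_pos w' = inversions A3_pos (perm_map (one_line 2 4 1 3))"
      unfolding w'(2) A3_inversions by (simp add: linear_add[OF f(1)] fab cA)
    then have "w' = perm_map (one_line 2 4 1 3)" by (rule A3.weyl_unique[OF w'(1) perm_map_weyl(2)])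
    then show ?thesis using w'(3) unfolding A3_2413_def by blast
  qed
qed

lemma minimal_iso_min_patterns:
  assumes m: "minimal_nonseparable p"
  shows "\<exists>q\<in>min_patterns. pattern_iso p q"
proof -
  obtain w \<Phi> P where p: "p = (w, \<Phi>, P)" by (cases p) auto
  have ip: "is_pattern (w, \<Phi>, P)" using m by (simp add: p)
  obtain v where v: "chamber \<Phi> P v" using is_pattern_chamber[OF ip] by blast
  obtain u where u: "min_chamber \<Phi> P v u" "inversions P w = {\<beta>\<in>P. u \<bullet> \<beta> < 0}"
    using minimal_min_chamber[OF v ip] m unfolding p by blast
  interpret min_chamber \<Phi> P v u by (rule u(1))
  from rank_2_or_3 show ?thesis
  proof
    assume "card D = 2"
    then show ?thesis
    proof (cases rule: rank_2)
      case (1 a b)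
      then show ?thesis unfolding p min_patterns_def using minimal_iso_B2[OF ip u 1] by blast
    next
      case (2 a b)
      then show ?thesis unfolding p min_patterns_def using minimal_iso_G2[OF ip u 2] by blast
    qed
  next
    assume "card D = 3"
    then show ?thesis
    proof (cases rule: rank_3)
      case (1 a b c)
      have "inversions P w \<in> {{a, c, a + b + c}, {b, a + b, b + c}}" unfolding u(2) by (rule 1(11))
      then show ?thesis unfolding p min_patterns_def using minimal_iso_A3[OF ip v 1(1-10)] by blast
    qed
  qed
qed

section \<open>The listed patterns are pairwise not isomorphic\<close>

lemma pattern_iso_invariants:
  assumes "pattern_iso (w, \<Phi>, P) (u, \<Psi>, Q)" "P \<subseteq> \<Phi>"
  shows "dim \<Psi> = dim \<Phi>" "card Q = card P"
proof -
  obtain f where f: "linear f" "inj_on f (span \<Phi>)" "f ` \<Phi> = \<Psi>" "f ` P = Q"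
    using assms(1) by (auto simp: pattern_iso_def root_iso_def)
  show "dim \<Psi> = dim \<Phi>" using dim_image_eq[OF f(1,2)] f(3) by simp
  have "inj_on f P" using inj_on_subset[OF f(2)] order_trans[OF assms(2) span_superset] .
  then show "card Q = card P" using card_image[of f P] f(4) by simp
qed

text \<open>An automorphism that preserves \<open>P\<close> permutes the two simple roots. Unequal
  Cartan integers forbid the swap, so both are fixed, and with them every root.\<close>

lemma (in chamber) rank_2_no_automorphism:
  assumes D: "D = {a, b}" "a \<noteq> b" "cartan a b \<noteq> cartan b a" and f: "root_iso f \<Phi> \<Phi>" "f ` P = P" and I: "I \<subseteq> P"
  shows "f ` I = I"
proof -
  have lin: "linear f" "inj_on f (span \<Phi>)" using f(1) by (auto simp: root_iso_def)
  have ab: "a \<in> D" "b \<in> D" using D by auto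
  have root: "a \<in> \<Phi>" "b \<in> \<Phi>" using ab D_P P_root by blast+
  have ne: "f a \<noteq> f b" using inj_onD[OF lin(2)] root span_base D(2) by blast
  have im: "f a \<in> {a, b}" "f b \<in> {a, b}" using simple_roots_iso[OF f] ab unfolding D(1) by blast+
  have "cartan (f a) (f b) = cartan a b" using f(1) root unfolding root_iso_def by blast
  then have "f a = a" "f b = b" using im ne D(3) by auto
  then show ?thesis by (intro fixed_simple_roots[OF lin(1) _ I]) (auto simp: D(1))
qed

lemma cartan_asymmetric: "cartan b\<^sub>1 b\<^sub>2 \<noteq> cartan b\<^sub>2 b\<^sub>1" "cartan g\<^sub>1 g\<^sub>2 \<noteq> cartan g\<^sub>2 g\<^sub>1"
proof -
  have "cartan (cB (1,0,0)) (cB (0,1,0)) \<noteq> cartan (cB (0,1,0)) (cB (1,0,0))"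
    "cartan (cG (1,0,0)) (cG (0,1,0)) \<noteq> cartan (cG (0,1,0)) (cG (1,0,0))"
    by (simp_all add: cartan_def cB_inner cG_inner)
  then show "cartan b\<^sub>1 b\<^sub>2 \<noteq> cartan b\<^sub>2 b\<^sub>1" "cartan g\<^sub>1 g\<^sub>2 \<noteq> cartan g\<^sub>2 g\<^sub>1" by (simp_all add: c_rank_2)
qed

text \<open>An isomorphism that preserves \<open>P\<close> maps simple roots to simple roots
  injectively, but 3142 inverts two of them and 2413 only one.\<close>

lemma A3_patterns_not_iso: "\<not> pattern_iso A3_3142 A3_2413"
proof
  assume "pattern_iso A3_3142 A3_2413"
  then obtain f where f: "root_iso f A3_roots A3_roots" "f ` A3_pos = A3_pos"
    "f ` cA ` {(1,0,0), (0,0,1), (1,1,1)} = cA ` {(0,1,0), (1,1,0), (0,1,1)}"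
    by (auto simp only: pattern_iso_def A3_3142_def A3_2413_def A3_inversions contains_via.simps Int_UNIV_right)
  have key: "f (cA s) = cA (0,1,0)" if s: "s = (1,0,0) \<or> s = (0,0,1)" for s
  proof -
    have "cA s \<in> A3.D" using s unfolding A3_simple by blast
    then have "f (cA s) \<in> A3.D" by (rule A3.simple_roots_iso[OF f(1,2)])
    then have "f (cA s) \<in> cA ` {(1,0,0), (0,1,0), (0,0,1)}" unfolding A3_simple .
    moreover have "f (cA s) \<in> cA ` {(0,1,0), (1,1,0), (0,1,1)}" unfolding f(3)[symmetric] using s by blast
    ultimately show ?thesis by (auto simp: inj_eq[OF inj_c(1)])
  qed
  have "cA (1,0,0) \<in> A3_roots" "cA (0,0,1) \<in> A3_roots" by (auto simp: A3_roots_def A3_pos_eq A3_coord_def)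
  moreover have "f (cA (1,0,0)) = f (cA (0,0,1))" using key by simp
  ultimately have "cA (1,0,0) = cA (0,0,1)"
    using f(1) unfolding root_iso_def by (meson inj_onD span_base)
  then show False by (simp add: inj_eq[OF inj_c(1)])
qed

text \<open>Rank and number of positive roots determine the type. In B2 and G2 the isomorphism fixes
  every root, hence the inversion set, which determines the element; in A3 two different patterns
  would have to be 3142 and 2413.\<close>

lemma min_patterns_iso_imp_eq:
  assumes q: "q \<in> min_patterns" and r: "r \<in> min_patterns" and iso: "pattern_iso q r"
  shows "q = r"
proof -
  have iso': "pattern_iso r q" using pattern_iso_sym[OF is_pattern_min_patterns[OF q] iso] .
  obtain w \<Phi> P where qe: "q = (w, \<Phi>, P)" by (cases q) auto
  obtain u \<Psi> Q where re: "r = (u, \<Psi>, Q)" by (cases r) auto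
  have "P \<subseteq> \<Phi>" using is_pattern_min_patterns[OF q] is_pattern_subset unfolding qe by blast
  note i = pattern_iso_invariants[OF iso[unfolded qe re] this]
  have t: "(X = A3_roots \<and> Y = A3_pos \<and> (z, X, Y) \<in> {A3_3142, A3_2413}) \<or> (X = B2_roots \<and> Y = B2_pos \<and> z \<in> weyl X)
      \<or> (X = G2_roots \<and> Y = G2_pos \<and> z \<in> weyl X)" if "(z, X, Y) \<in> min_patterns" for z X Y
    using that by (cases rule: min_patterns_cases) (auto simp: A3_3142_def A3_2413_def)
  note tq = t[OF q[unfolded qe]] and tr = t[OF r[unfolded re]]
  have same: "\<Psi> = \<Phi> \<and> Q = P"
    using tq tr i dim_concrete B2_card G2_card by (elim disjE conjE) simp_all
  obtain f where f: "root_iso f \<Phi> \<Phi>" "f ` P = P" "f ` inversions P w = inversions P u"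
    using iso same unfolding qe re by (auto simp: pattern_iso_def)
  from tq show ?thesis
  proof (elim disjE conjE)
    assume 0: "\<Phi> = A3_roots" "P = A3_pos" "(w, \<Phi>, P) \<in> {A3_3142, A3_2413}"
    have "dim \<Psi> = 3" using same 0(1) dim_concrete by simp
    then have "r \<in> {A3_3142, A3_2413}" using tr dim_concrete unfolding re by auto
    then show ?thesis using 0(3) iso iso' A3_patterns_not_iso unfolding qe[symmetric] by blast
  next
    assume 0: "\<Phi> = B2_roots" "P = B2_pos" "w \<in> weyl \<Phi>"
    have "f ` inversions B2_pos w = inversions B2_pos w"
      by (rule B2.rank_2_no_automorphism[OF _ B2_neq cartan_asymmetric(1) f(1,2)[unfolded 0(1,2)]])
        (auto simp: B2_simple c_rank_2 inversions_def)
    moreover have "u \<in> weyl B2_roots" using is_pattern_min_patterns[OF r] same 0(1) unfolding re by simp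
    ultimately have "w = u" using f(3) 0 by (intro B2.weyl_unique) simp_all
    then show ?thesis using same unfolding qe re by simp
  next
    assume 0: "\<Phi> = G2_roots" "P = G2_pos" "w \<in> weyl \<Phi>"
    have "f ` inversions G2_pos w = inversions G2_pos w"
      by (rule G2.rank_2_no_automorphism[OF _ G2_neq cartan_asymmetric(2) f(1,2)[unfolded 0(1,2)]])
        (auto simp: G2_simple c_rank_2 inversions_def)
    moreover have "u \<in> weyl G2_roots" using is_pattern_min_patterns[OF r] same 0(1) unfolding re by simp
    ultimately have "w = u" using f(3) 0 by (intro G2.weyl_unique) simp_all
    then show ?thesis using same unfolding qe re by simp
  qed
qed

section \<open>Separability as pattern avoidance\<close>

lemma minimal_iff_min_patterns:
  assumes "is_pattern p"
  shows "minimal_nonseparable p \<longleftrightarrow> (\<exists>q\<in>min_patterns. pattern_iso p q)"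
proof
  assume "\<exists>q\<in>min_patterns. pattern_iso p q"
  then obtain q where q: "q \<in> min_patterns" "pattern_iso p q" by blast
  show "minimal_nonseparable p"
    by (rule minimal_nonseparable_iso[OF is_pattern_min_patterns[OF q(1)] assms
          pattern_iso_sym[OF assms q(2)] min_patterns_minimal[OF q(1)]])
qed (rule minimal_iso_min_patterns)

lemma separable_iff_avoids:
  assumes p: "is_pattern (w, \<Phi>, P)"
  shows "separable (w, \<Phi>, P) \<longleftrightarrow> (\<forall>q\<in>min_patterns. avoids (w, \<Phi>, P) q)"
proof
  assume s: "separable (w, \<Phi>, P)"
  show "\<forall>q\<in>min_patterns. avoids (w, \<Phi>, P) q"
  proof
    fix q assume q: "q \<in> min_patterns"
    have "\<not> separable q" using min_patterns_minimal[OF q] by (cases q) simp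
    then show "avoids (w, \<Phi>, P) q"
      unfolding avoids_def using separable_contains[OF p is_pattern_min_patterns[OF q] s] by blast
  qed
next
  assume av: "\<forall>q\<in>min_patterns. avoids (w, \<Phi>, P) q"
  show "separable (w, \<Phi>, P)"
  proof (rule ccontr)
    assume "\<not> separable (w, \<Phi>, P)"
    then obtain U where U: "subspace U" "minimal_nonseparable (weyl_restrict P w (\<Phi> \<inter> U), \<Phi> \<inter> U, P \<inter> U)"
      using nonseparable_contains_minimal[OF p] by blast
    obtain q where q: "q \<in> min_patterns" "pattern_iso (weyl_restrict P w (\<Phi> \<inter> U), \<Phi> \<inter> U, P \<inter> U) q"
      using minimal_iso_min_patterns[OF U(2)] by blast
    obtain x \<Psi> Q where qe: "q = (x, \<Psi>, Q)" by (cases q) auto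
    \<comment> \<open>Restricting to \<open>U\<close> and then applying an isomorphism is
      containment via \<open>U\<close>, since the restriction has the inversions of \<open>w\<close>
      in \<open>U\<close>.\<close>
    have "contains_via U (w, \<Phi>, P) q"
      using q(2) is_pattern_restrict(2)[OF p U(1)] unfolding qe pattern_iso_def by simp
    then show False using av q(1) U(1) unfolding avoids_def contains_def by blast
  qed
qed

text \<open>Roots of equal length have symmetric Cartan integers, and isomorphisms preserve these,
  so no subsystem matches a system with an asymmetric pair. The simple roots of B2 and G2 form such
  pairs.\<close>

lemma simply_laced_avoids:
  assumes sl: "simply_laced \<Phi>" and \<Psi>: "\<alpha> \<in> \<Psi>" "\<beta> \<in> \<Psi>" "cartan \<alpha> \<beta> \<noteq> cartan \<beta> \<alpha>"
  shows "avoids (w, \<Phi>, P) (x, \<Psi>, Q)"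
proof -
  have False if f: "root_iso f (\<Phi> \<inter> U) \<Psi>" for f U
  proof -
    have "\<alpha> \<in> f ` (\<Phi> \<inter> U)" "\<beta> \<in> f ` (\<Phi> \<inter> U)" using f \<Psi>(1,2) by (simp_all add: root_iso_def)
    then obtain a b where ab: "a \<in> \<Phi> \<inter> U" "b \<in> \<Phi> \<inter> U" "\<alpha> = f a" "\<beta> = f b" by (elim imageE)
    have "norm a = norm b" using sl ab(1,2) by (auto simp: simply_laced_def)
    then have "cartan a b = cartan b a" by (simp add: cartan_def dot_square_norm inner_commute)
    moreover have "cartan (f a) (f b) = cartan a b" "cartan (f b) (f a) = cartan b a"
      using f ab(1,2) unfolding root_iso_def by blast+
    ultimately show False using \<Psi>(3) ab(3,4) by simp
  qed
  then show ?thesis by (auto simp: avoids_def contains_def)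
qed

lemma separable_simply_laced:
  assumes p: "is_pattern (w, \<Phi>, P)" "simply_laced \<Phi>"
  shows "separable (w, \<Phi>, P) \<longleftrightarrow> avoids (w, \<Phi>, P) A3_3142 \<and> avoids (w, \<Phi>, P) A3_2413"
proof -
  have "b\<^sub>1 \<in> B2_roots" "b\<^sub>2 \<in> B2_roots" "g\<^sub>1 \<in> G2_roots" "g\<^sub>2 \<in> G2_roots"
    by (simp_all add: B2_roots_def B2_pos_def G2_roots_def G2_pos_def)
  then have "avoids (w, \<Phi>, P) q" if "q \<in> B2_patterns \<union> G2_patterns" for q
    using that simply_laced_avoids[OF p(2)] cartan_asymmetric unfolding B2_patterns_def G2_patterns_def by blast
  then show ?thesis unfolding separable_iff_avoids[OF p(1)] min_patterns_def by blast
qed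

theorem theorem5p3:
  shows "(\<forall>q\<in>min_patterns. minimal_nonseparable q)
    \<and> (\<forall>p :: 'a::euclidean_space pattern. is_pattern p \<longrightarrow>
          (minimal_nonseparable p \<longleftrightarrow> (\<exists>q\<in>min_patterns. pattern_iso p q)))
    \<and> (\<forall>q\<in>min_patterns. \<forall>r\<in>min_patterns. pattern_iso q r \<longrightarrow> q = r)
    \<and> A3_3142 \<noteq> A3_2413 \<and> card B2_patterns = 2 \<and> card G2_patterns = 6
    \<and> B2_patterns = {(u, B2_roots, B2_pos) | u. u \<in> weyl B2_roots \<and>
          inversions B2_pos u \<in> {{b\<^sub>1, b\<^sub>1 + b\<^sub>2}, {b\<^sub>2, b\<^sub>1 + 2 *\<^sub>R b\<^sub>2}}}
    \<and> (\<forall>w \<Phi> (P :: 'a set). is_pattern (w, \<Phi>, P) \<longrightarrow>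
          (separable (w, \<Phi>, P) \<longleftrightarrow> (\<forall>q\<in>min_patterns. avoids (w, \<Phi>, P) q)))
    \<and> (\<forall>w \<Phi> (P :: 'a set). is_pattern (w, \<Phi>, P) \<and> simply_laced \<Phi> \<longrightarrow>
          (separable (w, \<Phi>, P) \<longleftrightarrow> avoids (w, \<Phi>, P) A3_3142 \<and> avoids (w, \<Phi>, P) A3_2413))"
proof (intro conjI ballI allI impI)
  show "minimal_nonseparable q" if "q \<in> min_patterns" for q by (rule min_patterns_minimal[OF that])
  show "minimal_nonseparable p \<longleftrightarrow> (\<exists>q\<in>min_patterns. pattern_iso p q)" if "is_pattern p" for p :: "'a pattern"
    by (rule minimal_iff_min_patterns[OF that])
  show "q = r" if "q \<in> min_patterns" "r \<in> min_patterns" "pattern_iso q r" for q r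
    by (rule min_patterns_iso_imp_eq[OF that])
  show "separable (w, \<Phi>, P) \<longleftrightarrow> (\<forall>q\<in>min_patterns. avoids (w, \<Phi>, P) q)"
    if "is_pattern (w, \<Phi>, P)" for w \<Phi> and P :: "'a set"
    by (rule separable_iff_avoids[OF that])
  show "separable (w, \<Phi>, P) \<longleftrightarrow> avoids (w, \<Phi>, P) A3_3142 \<and> avoids (w, \<Phi>, P) A3_2413"
    if "is_pattern (w, \<Phi>, P) \<and> simply_laced \<Phi>" for w \<Phi> and P :: "'a set"
    using that separable_simply_laced by blast
qed (rule A3_patterns_neq card_B2_patterns card_G2_patterns B2_patterns_eq[unfolded B2_mid_image])+

end
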